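(* Let $G$ be a locally compact group with the approximation property (AP). Then for any closed left ideal $J$ of $L^1(G)$ we have $\mathrm{Bim}(J^{\perp})=\mathrm{Ran}(J)^{\perp}$.
   Context: On $L^2(G)$ (left Haar measure, modular function $\Delta$), $\lambda(s)\xi(t)=\xi(s^{-1}t)$ and $\rho(s)\xi(t)=\xi(ts)\Delta(s)^{1/2}$; $VN(G)=\lambda(G)''$; $M_f$ is multiplication by $f\in L^\infty(G)$; $\mathcal T(L^2(G))$ is the space of trace class operators, with dual $\mathcal B(L^2(G))$. $A(G)$ is the Fourier algebra (functions $s\mapsto\langle\lambda(s)\xi,\eta\rangle$), with the operator space structure as predual of $VN(G)$. AP: $M_{cb}A(G)$ is the space of $\varphi\in L^\infty(G)$ such that $v\mapsto \varphi v$ is a completely bounded map $A(G)\to A(G)$, with the cb-norm. It is a dual space with predual $Q_{cb}(G)$, the completion of $L^1(G)$ in the norm $\|f\|=\sup\{|\int f\varphi| : \|\varphi\|_{M_{cb}A(G)}\le 1\}$. $G$ has the AP if there is a net $(v_i)$ in $A(G)$ with $v_i\to 1$ in $\sigma(M_{cb}A(G),Q_{cb}(G))$. For $f\in L^1(G)$, $\Theta^r(f)$ is the normal completely bounded map on $\mathcal B(L^2(G))$ given by $\Theta^r(f)(T)=\int_G f(s)\rho(s)T\rho(s^{-1})\,ds$, and $\Theta^r(f)_*:\mathcal T(L^2(G))\to\mathcal T(L^2(G))$ is its pre-adjoint. For a closed left ideal $J$ of the convolution algebra $L^1(G)$, $J^\perp\subseteq L^\infty(G)$ is its annihilator, $$\mathrm{Ran}(J)=\overline{\mathrm{span}\{\Theta^r(f)_*(\omega)\mid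 f\in J,\ \omega\in\mathcal T(L^2(G))\}}^{\|\cdot\|_{\mathcal T(L^2(G))}},$$ $\mathrm{Ran}(J)^\perp\subseteq\mathcal B(L^2(G))$ is its annihilator, and $$\mathrm{Bim}(J^\perp)=\overline{\mathrm{span}\{xM_fy\mid f\in J^\perp,\ x,y\in VN(G)\}}^{w^*}\subseteq\mathcal B(L^2(G)).$$ *)

theory Defs
  imports "HOL-Analysis.Analysis"
begin

section \<open>Complex Hilbert spaces\<close>

class complex_inner = real_inner +
  fixes scaleC :: "complex \<Rightarrow> 'a \<Rightarrow> 'a"  (infixr "*\<^sub>C" 75)
    and cinner :: "'a \<Rightarrow> 'a \<Rightarrow> complex"
  assumes scaleC_add_right: "c *\<^sub>C (x + y) = c *\<^sub>C x + c *\<^sub>C y"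
    and scaleC_add_left: "(c + d) *\<^sub>C x = c *\<^sub>C x + d *\<^sub>C x"
    and scaleC_scaleC: "c *\<^sub>C d *\<^sub>C x = (c * d) *\<^sub>C x"
    and scaleR_scaleC: "r *\<^sub>R x = complex_of_real r *\<^sub>C x"
    and cinner_add_left: "cinner (x + y) z = cinner x z + cinner y z"
    and cinner_scaleC_left: "cinner (c *\<^sub>C x) y = c * cinner x y"
    and cinner_commute: "cinner x y = cnj (cinner y x)"
    and inner_cinner: "inner x y = Re (cinner x y)"

class chilbert_space = complex_inner + complete_space

text \<open>\<open>'h \<Rightarrow>\<^sub>L 'h\<close> consists of the bounded real-linear maps; \<open>bounded_ops\<close> is the algebra of bounded
  complex-linear operators.\<close>

definition bounded_ops :: "('h::chilbert_space \<Rightarrow>\<^sub>L 'h) set"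
  where "bounded_ops = {T. \<forall>c \<xi>. blinfun_apply T (c *\<^sub>C \<xi>) = c *\<^sub>C blinfun_apply T \<xi>}"

definition scale_op :: "complex \<Rightarrow> ('h::chilbert_space \<Rightarrow>\<^sub>L 'h) \<Rightarrow> ('h \<Rightarrow>\<^sub>L 'h)"
  where "scale_op c T = Blinfun (\<lambda>\<xi>. c *\<^sub>C blinfun_apply T \<xi>)"

lemma module_scaleC: "module (scaleC :: complex \<Rightarrow> 'a::complex_inner \<Rightarrow> 'a)"
proof
  show "1 *\<^sub>C x = x" for x :: 'a
    using scaleR_scaleC[of 1 x] by simp
qed (simp_all add: scaleC_add_right scaleC_add_left scaleC_scaleC)

lemma norm_scaleC: "norm (c *\<^sub>C x) = cmod c * norm x" for x :: "'a::complex_inner"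
proof -
  have "cinner (c *\<^sub>C x) (c *\<^sub>C x) = c * cnj (c * cinner x x)"
    by (metis cinner_commute cinner_scaleC_left)
  also have "\<dots> = complex_of_real ((cmod c)\<^sup>2) * cinner x x"
    by (simp add: cinner_commute[of x x, symmetric] complex_norm_square[symmetric] mult.assoc[symmetric] del: of_real_power)
  finally show ?thesis
    by (simp add: norm_eq_sqrt_inner inner_cinner real_sqrt_mult del: of_real_power)
qed

lemma scale_op_apply: "blinfun_apply (scale_op c T) \<xi> = c *\<^sub>C blinfun_apply T \<xi>"
proof -
  have "bounded_linear (\<lambda>x :: 'a. c *\<^sub>C x)"
  proof
    show "c *\<^sub>C (r *\<^sub>R x) = r *\<^sub>R (c *\<^sub>C x)" for r and x :: 'a
      by (simp add: scaleR_scaleC scaleC_scaleC mult.commute)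
    show "\<exists>K. \<forall>x :: 'a. norm (c *\<^sub>C x) \<le> norm x * K"
      by (rule exI[of _ "cmod c"]) (simp add: norm_scaleC mult.commute)
  qed (simp add: scaleC_add_right)
  from bounded_linear_compose[OF this blinfun.bounded_linear_right[of T]]
  show ?thesis unfolding scale_op_def by (simp add: bounded_linear_Blinfun_apply)
qed

lemma module_scale_op: "module (scale_op :: complex \<Rightarrow> ('h::chilbert_space \<Rightarrow>\<^sub>L 'h) \<Rightarrow> _)"
proof
  show "scale_op 1 T = T" for T :: "'h \<Rightarrow>\<^sub>L 'h"
    by (rule blinfun_eqI) (simp add: scale_op_apply module.scale_one[OF module_scaleC])
qed (rule blinfun_eqI, simp add: scale_op_apply blinfun.add_left
      scaleC_add_right scaleC_add_left scaleC_scaleC)+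

abbreviation op_cspan :: "('h::chilbert_space \<Rightarrow>\<^sub>L 'h) set \<Rightarrow> ('h \<Rightarrow>\<^sub>L 'h) set"
  where "op_cspan \<equiv> module.span scale_op"

definition adj_op :: "('h::chilbert_space \<Rightarrow>\<^sub>L 'h) \<Rightarrow> ('h \<Rightarrow>\<^sub>L 'h)"
  where "adj_op T = (THE S. \<forall>\<xi> \<eta>. cinner (blinfun_apply T \<xi>) \<eta> = cinner \<xi> (blinfun_apply S \<eta>))"

definition positive_op :: "('h::chilbert_space \<Rightarrow>\<^sub>L 'h) \<Rightarrow> bool"
  where "positive_op T \<longleftrightarrow> T \<in> bounded_ops \<and> (\<forall>\<xi>. cinner (blinfun_apply T \<xi>) \<xi> \<in> \<real>\<^sub>\<ge>\<^sub>0)"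

definition abs_op :: "('h::chilbert_space \<Rightarrow>\<^sub>L 'h) \<Rightarrow> ('h \<Rightarrow>\<^sub>L 'h)"
  where "abs_op T = (THE P. positive_op P \<and> P o\<^sub>L P = adj_op T o\<^sub>L T)"

definition orthonormal_basis :: "'h::chilbert_space set \<Rightarrow> bool"
  where "orthonormal_basis E \<longleftrightarrow>
    (\<forall>e\<in>E. \<forall>e'\<in>E. cinner e e' = (if e = e' then 1 else 0)) \<and>
    closure (module.span scaleC E) = UNIV"

text \<open>Being of trace class, the trace norm and the trace do not depend on the orthonormal basis;
  they are computed in an arbitrarily chosen one.\<close>

definition some_basis :: "'h::chilbert_space set"
  where "some_basis = (SOME E. orthonormal_basis E)"

definition trace_class :: "('h::chilbert_space \<Rightarrow>\<^sub>L 'h) set"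
  where "trace_class = {\<omega> \<in> bounded_ops.
    (\<lambda>e. Re (cinner (blinfun_apply (abs_op \<omega>) e) e)) summable_on some_basis}"

definition trace_norm :: "('h::chilbert_space \<Rightarrow>\<^sub>L 'h) \<Rightarrow> real"
  where "trace_norm \<omega> = (\<Sum>\<^sub>\<infinity>e\<in>some_basis. Re (cinner (blinfun_apply (abs_op \<omega>) e) e))"

definition op_trace :: "('h::chilbert_space \<Rightarrow>\<^sub>L 'h) \<Rightarrow> complex"
  where "op_trace \<omega> = (\<Sum>\<^sub>\<infinity>e\<in>some_basis. cinner (blinfun_apply \<omega> e) e)"

text \<open>The duality between bounded operators and trace class operators.\<close>

definition trace_pairing :: "('h::chilbert_space \<Rightarrow>\<^sub>L 'h) \<Rightarrow> ('h \<Rightarrow>\<^sub>L 'h) \<Rightarrow> complex"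
  where "trace_pairing T \<omega> = op_trace (T o\<^sub>L \<omega>)"

definition weak_star_ops :: "('h::chilbert_space \<Rightarrow>\<^sub>L 'h) topology"
  where "weak_star_ops = pullback_topology bounded_ops
    (\<lambda>T. \<lambda>\<omega>\<in>trace_class. trace_pairing T \<omega>) (product_topology (\<lambda>_. euclidean) trace_class)"

definition trace_norm_closure :: "('h::chilbert_space \<Rightarrow>\<^sub>L 'h) set \<Rightarrow> ('h \<Rightarrow>\<^sub>L 'h) set"
  where "trace_norm_closure S = {\<tau> \<in> trace_class. \<forall>\<epsilon>>0. \<exists>\<sigma>\<in>S. trace_norm (\<tau> - \<sigma>) < \<epsilon>}"

definition op_annihilator :: "('h::chilbert_space \<Rightarrow>\<^sub>L 'h) set \<Rightarrow> ('h \<Rightarrow>\<^sub>L 'h) set"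
  where "op_annihilator S = {T \<in> bounded_ops. \<forall>\<tau>\<in>S. trace_pairing T \<tau> = 0}"

definition commutant :: "('h::chilbert_space \<Rightarrow>\<^sub>L 'h) set \<Rightarrow> ('h \<Rightarrow>\<^sub>L 'h) set"
  where "commutant S = {T \<in> bounded_ops. \<forall>A\<in>S. T o\<^sub>L A = A o\<^sub>L T}"

text \<open>The norm of a matrix \<open>(a i j)\<close>, \<open>i, j \<in> I\<close>, of operators, acting on the \<open>\<ell>\<^sup>2\<close>-direct sum of
  copies of the space indexed by the finite set \<open>I\<close>.\<close>

definition matrix_norm :: "'i set \<Rightarrow> ('i \<Rightarrow> 'i \<Rightarrow> 'h::real_normed_vector \<Rightarrow> 'h) \<Rightarrow> real"
  where "matrix_norm I a =
    Sup {sqrt (\<Sum>i\<in>I. (norm (\<Sum>j\<in>I. a i j (\<xi> j)))\<^sup>2) | \<xi>. (\<Sum>j\<in>I. (norm (\<xi> j))\<^sup>2) \<le> 1}"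


section \<open>Locally compact groups and the left regular representation\<close>

text \<open>Groups are written additively, as in the library class \<open>topological_group_add\<close>; they are not
  assumed to be commutative. So \<open>- s + t\<close> stands for $s^{-1}t$.

  The class carries the group's left Haar measure with a chosen normalisation. It is a Radon measure
  on the Borel sets: finite on compact sets, outer regular on Borel sets and inner regular on open
  sets. It need not be \<open>\<sigma>\<close>-finite.\<close>

class locally_compact_group = topological_group_add + t2_space +
  fixes haar :: "'a measure"
  assumes locally_compact: "\<exists>U K. open U \<and> compact K \<and> x \<in> U \<and> U \<subseteq> K"
    and haar_borel: "sets haar = sigma_sets UNIV {U. open U}"
    and haar_compact: "compact K \<Longrightarrow> emeasure haar K < \<infinity>"
    and haar_outer_regular: "A \<in> sets haar \<Longrightarrow>
      emeasure haar A = (INF U\<in>{U. open U \<and> A \<subseteq> U}. emeasure haar U)"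
    and haar_inner_regular: "open U \<Longrightarrow>
      emeasure haar U = (SUP K\<in>{K. compact K \<and> K \<subseteq> U}. emeasure haar K)"
    and haar_nonzero: "emeasure haar UNIV \<noteq> 0"
    and haar_left_invariant: "A \<in> sets haar \<Longrightarrow> emeasure haar ((\<lambda>t. s + t) ` A) = emeasure haar A"

lemma locally_compact_space_UNIV:
  "locally_compact_space (euclidean :: 'g::locally_compact_group topology)"
  using locally_compact by (auto simp: locally_compact_space_def)

text \<open>The modular function, normalised by $\mu(As) = \Delta(s)\mu(A)$.\<close>

definition modular :: "'g::locally_compact_group \<Rightarrow> real"
  where "modular s = (THE d. d > 0 \<and>
    (\<forall>A\<in>sets borel. emeasure haar ((\<lambda>t. t + s) ` A) = ennreal d * emeasure haar A))"

lemma sets_haar [measurable_cong, simp]: "sets (haar :: 'g::locally_compact_group measure) = sets borel"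
  by (simp add: haar_borel borel_def)

lemma space_haar [simp]: "space (haar :: 'g::locally_compact_group measure) = UNIV"
  using sets_eq_imp_space_eq[OF sets_haar] by simp

subsection \<open>The Hilbert space \<open>L\<^sup>2(G)\<close>\<close>

definition square_integrable :: "('g::locally_compact_group \<Rightarrow> complex) \<Rightarrow> bool"
  where "square_integrable f \<longleftrightarrow>
    f \<in> borel_measurable borel \<and> integrable haar (\<lambda>t. (cmod (f t))\<^sup>2)"

definition L2_rel :: "('g::locally_compact_group \<Rightarrow> complex) \<Rightarrow> ('g \<Rightarrow> complex) \<Rightarrow> bool"
  where "L2_rel f g \<longleftrightarrow> square_integrable f \<and> square_integrable g \<and> (AE t in haar. f t = g t)"

lemma borel_measurable_cnj [measurable (raw)]:
  "f \<in> borel_measurable M \<Longrightarrow> (\<lambda>x. cnj (f x)) \<in> borel_measurable M"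
  by (rule borel_measurable_continuous_on[OF continuous_on_cnj[OF continuous_on_id]])

lemma square_integrable_measurable [measurable_dest]:
  "square_integrable f \<Longrightarrow> f \<in> borel_measurable borel"
  by (simp add: square_integrable_def)

lemma square_integrable_measurable_haar:
  "square_integrable f \<Longrightarrow> f \<in> borel_measurable haar"
  using measurable_cong_sets[OF sets_haar refl] by (auto simp: square_integrable_def)

lemma square_integrable_zero: "square_integrable (\<lambda>_. 0)"
  by (simp add: square_integrable_def)

quotient_type (overloaded) 'g L2 = "'g::locally_compact_group \<Rightarrow> complex" / partial: L2_rel
proof (rule part_equivpI)
  show "\<exists>x. L2_rel x x"
    by (rule exI[of _ "\<lambda>_. 0"]) (simp add: L2_rel_def square_integrable_zero)
  show "symp L2_rel"
    by (auto simp: symp_def L2_rel_def elim: eventually_mono)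
  show "transp L2_rel"
    unfolding transp_def L2_rel_def by (auto elim: eventually_elim2)
qed

lemma square_integrable_add:
  fixes f g :: "'g::locally_compact_group \<Rightarrow> complex"
  assumes "square_integrable f" "square_integrable g"
  shows "square_integrable (\<lambda>t. f t + g t)"
proof -
  have [measurable]: "f \<in> borel_measurable borel" "g \<in> borel_measurable borel"
    using assms by (auto simp: square_integrable_def)
  have le: "(cmod (f t + g t))\<^sup>2 \<le> 2 * (cmod (f t))\<^sup>2 + 2 * (cmod (g t))\<^sup>2" for t
  proof -
    have "(cmod (f t + g t))\<^sup>2 \<le> (cmod (f t) + cmod (g t))\<^sup>2"
      by (intro power_mono norm_triangle_ineq norm_ge_zero)
    also have "\<dots> \<le> 2 * (cmod (f t))\<^sup>2 + 2 * (cmod (g t))\<^sup>2"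
      using sum_squares_bound[of "cmod (f t)" "cmod (g t)"] by (simp add: power2_sum)
    finally show ?thesis .
  qed
  have "integrable haar (\<lambda>t. 2 * (cmod (f t))\<^sup>2 + 2 * (cmod (g t))\<^sup>2)"
    using assms by (auto simp: square_integrable_def)
  then have "integrable haar (\<lambda>t. (cmod (f t + g t))\<^sup>2)"
    by (rule Bochner_Integration.integrable_bound) (use le in auto)
  then show ?thesis by (auto simp: square_integrable_def)
qed

lemma square_integrable_mult:
  assumes "square_integrable f"
  shows "square_integrable (\<lambda>t. c * f t)"
  using assms by (auto simp: square_integrable_def norm_mult power_mult_distrib)

lemma square_integrable_prod:
  fixes f g :: "'g::locally_compact_group \<Rightarrow> complex"
  assumes "square_integrable f" "square_integrable g"
  shows "integrable haar (\<lambda>t. f t * cnj (g t))"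
proof -
  have [measurable]: "f \<in> borel_measurable borel" "g \<in> borel_measurable borel"
    using assms by (auto simp: square_integrable_def)
  have le: "cmod (f t) * cmod (g t) \<le> (cmod (f t))\<^sup>2 + (cmod (g t))\<^sup>2" for t
    using sum_squares_bound[of "cmod (f t)" "cmod (g t)"]
      mult_nonneg_nonneg[of "cmod (f t)" "cmod (g t)"] by (simp del: mult_nonneg_nonneg)
  have "integrable haar (\<lambda>t. (cmod (f t))\<^sup>2 + (cmod (g t))\<^sup>2)"
    using assms by (auto simp: square_integrable_def)
  then show ?thesis
  proof (rule Bochner_Integration.integrable_bound)
    show "(\<lambda>t. f t * cnj (g t)) \<in> borel_measurable haar" by measurable
  qed (use le in \<open>auto simp: norm_mult\<close>)
qed

instantiation L2 :: (locally_compact_group) complex_inner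
begin

lift_definition zero_L2 :: "'a L2" is "\<lambda>_. 0"
  by (simp add: L2_rel_def square_integrable_zero)

lift_definition plus_L2 :: "'a L2 \<Rightarrow> 'a L2 \<Rightarrow> 'a L2" is "\<lambda>f g t. f t + g t"
  by (auto simp: L2_rel_def intro: square_integrable_add elim: eventually_elim2)

lift_definition scaleC_L2 :: "complex \<Rightarrow> 'a L2 \<Rightarrow> 'a L2" is "\<lambda>c f t. c * f t"
  by (auto simp: L2_rel_def intro: square_integrable_mult elim: eventually_mono)

lift_definition cinner_L2 :: "'a L2 \<Rightarrow> 'a L2 \<Rightarrow> complex"
  is "\<lambda>f g. LINT t|haar. f t * cnj (g t)"
proof -
  fix f f' g g' :: "'a \<Rightarrow> complex"
  assume a: "L2_rel f f'" "L2_rel g g'"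
  have [measurable]: "f \<in> borel_measurable borel" "f' \<in> borel_measurable borel"
    "g \<in> borel_measurable borel" "g' \<in> borel_measurable borel"
    using a by (auto simp: L2_rel_def square_integrable_def)
  have "AE t in haar. f t = f' t" "AE t in haar. g t = g' t"
    using a by (auto simp: L2_rel_def)
  then have "AE t in haar. f t * cnj (g t) = f' t * cnj (g' t)"
    by eventually_elim simp
  then show "(LINT t|haar. f t * cnj (g t)) = (LINT t|haar. f' t * cnj (g' t))"
    by (intro integral_cong_AE) measurable
qed

definition uminus_L2 :: "'a L2 \<Rightarrow> 'a L2" where "- \<xi> = (-1) *\<^sub>C \<xi>" for \<xi> :: "'a L2"
definition minus_L2 :: "'a L2 \<Rightarrow> 'a L2 \<Rightarrow> 'a L2" where "\<xi> - \<eta> = \<xi> + (- \<eta>)" for \<xi> :: "'a L2"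
definition scaleR_L2 :: "real \<Rightarrow> 'a L2 \<Rightarrow> 'a L2" where "r *\<^sub>R \<xi> = complex_of_real r *\<^sub>C \<xi>" for \<xi> :: "'a L2"
definition inner_L2 :: "'a L2 \<Rightarrow> 'a L2 \<Rightarrow> real" where "inner \<xi> \<eta> = Re (cinner \<xi> \<eta>)" for \<xi> :: "'a L2"
definition norm_L2 :: "'a L2 \<Rightarrow> real" where "norm \<xi> = sqrt (inner \<xi> \<xi>)" for \<xi> :: "'a L2"
definition sgn_L2 :: "'a L2 \<Rightarrow> 'a L2" where "sgn \<xi> = inverse (norm \<xi>) *\<^sub>R \<xi>" for \<xi> :: "'a L2"
definition dist_L2 :: "'a L2 \<Rightarrow> 'a L2 \<Rightarrow> real" where "dist \<xi> \<eta> = norm (\<xi> - \<eta>)" for \<xi> :: "'a L2"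
definition uniformity_L2 :: "('a L2 \<times> 'a L2) filter"
  where "uniformity_L2 = (INF e\<in>{0<..}. principal {(x, y). dist x y < e})"
definition open_L2 :: "'a L2 set \<Rightarrow> bool"
  where "open_L2 U \<longleftrightarrow> (\<forall>x\<in>U. eventually (\<lambda>(x', y). x' = x \<longrightarrow> y \<in> U) uniformity)"

instance
proof
  fix x y z :: "'a L2" and c d :: complex and r s :: real
  show add_assoc: "x + y + z = x + (y + z)"
    by transfer (auto simp: L2_rel_def algebra_simps intro!: square_integrable_add)
  show "x + y = y + x"
    by transfer (auto simp: L2_rel_def algebra_simps intro!: square_integrable_add)
  show "0 + x = x"
    by transfer (auto simp: L2_rel_def)
  show "- x + x = 0"
    unfolding uminus_L2_def
    by transfer (auto simp: L2_rel_def square_integrable_zero)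
  show "x - y = x + - y" by (simp add: minus_L2_def)
  show ar: "c *\<^sub>C (x + y) = c *\<^sub>C x + c *\<^sub>C y" for c :: complex and x y :: "'a L2"
    by transfer (auto simp: L2_rel_def algebra_simps intro!: square_integrable_add square_integrable_mult)
  show al: "(c + d) *\<^sub>C x = c *\<^sub>C x + d *\<^sub>C x" for c d :: complex and x :: "'a L2"
    by transfer (auto simp: L2_rel_def algebra_simps intro!: square_integrable_add square_integrable_mult)
  show ss: "c *\<^sub>C d *\<^sub>C x = (c * d) *\<^sub>C x" for c d :: complex and x :: "'a L2"
    by transfer (auto simp: L2_rel_def algebra_simps
        intro!: square_integrable_add square_integrable_mult[of _ "c * d" for c d, unfolded mult.assoc])
  show "r *\<^sub>R x = complex_of_real r *\<^sub>C x" by (simp add: scaleR_L2_def)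
  show "r *\<^sub>R (x + y) = r *\<^sub>R x + r *\<^sub>R y" by (simp add: scaleR_L2_def ar)
  show "(r + s) *\<^sub>R x = r *\<^sub>R x + s *\<^sub>R x" by (simp add: scaleR_L2_def al)
  show "r *\<^sub>R s *\<^sub>R x = (r * s) *\<^sub>R x" by (simp add: scaleR_L2_def ss)
  show "1 *\<^sub>R x = x" unfolding scaleR_L2_def
    by transfer (auto simp: L2_rel_def)
  show "sgn x = inverse (norm x) *\<^sub>R x" by (simp add: sgn_L2_def)
  show "dist x y = norm (x - y)" by (simp add: dist_L2_def)
  show "uniformity = (INF e\<in>{0<..}. principal {(x :: 'a L2, y). dist x y < e})"
    by (simp add: uniformity_L2_def)
  show "open U = (\<forall>x\<in>U. \<forall>\<^sub>F (x', y) in uniformity. x' = x \<longrightarrow> y \<in> U)" for U :: "'a L2 set"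
    by (simp add: open_L2_def)
  show cl: "cinner (x + y) z = cinner x z + cinner y z"
    by transfer (simp add: L2_rel_def algebra_simps square_integrable_prod)
  show cs: "cinner (c *\<^sub>C x) y = c * cinner x y" for c :: complex and x y :: "'a L2"
    by transfer (simp add: L2_rel_def algebra_simps square_integrable_prod)
  show cc: "cinner x y = cnj (cinner y x)"
    by transfer (simp add: Bochner_Integration.integral_cnj[symmetric] mult.commute)
  show "inner x y = Re (cinner x y)" by (simp add: inner_L2_def)
  show "inner x y = inner y x" unfolding inner_L2_def by (subst cc) simp
  show "inner (x + y) z = inner x z + inner y z" by (simp add: inner_L2_def cl)
  show "inner (r *\<^sub>R x) y = r * inner x y" by (simp add: inner_L2_def scaleR_L2_def cs)
  show "norm x = sqrt (inner x x)" by (simp add: norm_L2_def)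
  have sq: "(LINT t|haar. f t * cnj (f t)) = complex_of_real (LINT t|haar. (cmod (f t))\<^sup>2)"
    for f :: "'a \<Rightarrow> complex"
    unfolding complex_norm_square[symmetric] by (rule integral_complex_of_real)
  show "0 \<le> inner x x" unfolding inner_L2_def
    by transfer (simp add: sq)
  show "inner x x = 0 \<longleftrightarrow> x = 0" unfolding inner_L2_def
  proof transfer
    fix f :: "'a \<Rightarrow> complex" assume f: "L2_rel f f"
    have "(LINT t|haar. (cmod (f t))\<^sup>2) = 0 \<longleftrightarrow> (AE t in haar. (cmod (f t))\<^sup>2 = 0)"
    proof (rule integral_nonneg_eq_0_iff_AE)
      show "integrable haar (\<lambda>t. (cmod (f t))\<^sup>2)"
        using f unfolding L2_rel_def square_integrable_def by blast
    qed simp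
    then show "Re (LINT t|haar. f t * cnj (f t)) = 0 \<longleftrightarrow> L2_rel f (\<lambda>_. 0)"
      using f by (simp add: sq L2_rel_def square_integrable_zero)
  qed
qed

end

lemma norm_L2_abs:
  fixes f :: "'g::locally_compact_group \<Rightarrow> complex"
  assumes "square_integrable f"
  shows "norm (abs_L2 f) = sqrt (LINT t|haar. (cmod (f t))\<^sup>2)"
proof -
  have "cinner (abs_L2 f) (abs_L2 f) = (LINT t|haar. f t * cnj (f t))"
    using assms by (intro cinner_L2.abs_eq) (auto simp: L2_rel_def)
  also have "\<dots> = complex_of_real (LINT t|haar. (cmod (f t))\<^sup>2)"
    unfolding complex_norm_square[symmetric] by (rule integral_complex_of_real)
  finally show ?thesis by (simp add: norm_L2_def inner_L2_def)
qed

lemma nn_integral_square_integrable: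
  fixes f :: "'g::locally_compact_group \<Rightarrow> complex"
  assumes "square_integrable f"
  shows "(\<integral>\<^sup>+t. ennreal ((cmod (f t))\<^sup>2) \<partial>haar) = ennreal ((norm (abs_L2 f))\<^sup>2)"
proof -
  have "integrable haar (\<lambda>t. (cmod (f t))\<^sup>2)" using assms by (simp add: square_integrable_def)
  from nn_integral_eq_integral[OF this] show ?thesis by (simp add: norm_L2_abs[OF assms])
qed

lemma abs_L2_add:
  assumes "square_integrable f" "square_integrable g"
  shows "abs_L2 f + abs_L2 g = abs_L2 (\<lambda>t. f t + g t)"
  using assms by (intro plus_L2.abs_eq) (auto simp: L2_rel_def)

lemma abs_L2_scaleC:
  assumes "square_integrable f"
  shows "c *\<^sub>C abs_L2 f = abs_L2 (\<lambda>t. c * f t)"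
  using assms by (intro scaleC_L2.abs_eq) (auto simp: L2_rel_def)

lemma abs_L2_diff:
  assumes "square_integrable f" "square_integrable g"
  shows "abs_L2 f - abs_L2 g = abs_L2 (\<lambda>t. f t - g t)"
  using abs_L2_add[OF assms(1) square_integrable_mult[OF assms(2), of "-1"]]
  by (simp add: minus_L2_def uminus_L2_def abs_L2_scaleC[OF assms(2)])

lemma rep_L2_square_integrable [simp]: "square_integrable (rep_L2 \<xi>)"
  using Quotient_rep_reflp[OF Quotient_L2, of \<xi>] by (simp add: L2_rel_def)

lemma abs_rep_L2 [simp]: "abs_L2 (rep_L2 \<xi>) = \<xi>"
  by (rule Quotient_abs_rep[OF Quotient_L2])

instance L2 :: (locally_compact_group) chilbert_space
proof
  fix X :: "nat \<Rightarrow> 'a L2"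
  assume X: "Cauchy X"
  have "\<exists>N. \<forall>m\<ge>N. \<forall>n\<ge>N. norm (X m - X n) < (1/2)^k" for k
    using X[THEN CauchyD, of "(1/2)^k"] by simp
  then obtain N where N: "\<And>k m n. m \<ge> N k \<Longrightarrow> n \<ge> N k \<Longrightarrow> norm (X m - X n) < (1/2)^k"
    by metis
  define r where "r k = (\<Sum>i\<le>k. N i) + k" for k
  have rN: "r m \<ge> N k" if "m \<ge> k" for m k
    using member_le_sum[of k "{..m}" N] that by (simp add: r_def)
  have rk: "r k \<ge> k" for k by (simp add: r_def)
  define f where "f k = rep_L2 (X (r k))" for k
  have sf [simp]: "square_integrable (f k)" for k by (simp add: f_def)
  have mf [measurable]: "f k \<in> borel_measurable borel" for k
    using sf[of k] by (simp add: square_integrable_def)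
  have af: "abs_L2 (f k) = X (r k)" for k by (simp add: f_def)
  define g where "g k t = f (Suc k) t - f k t" for k t
  have mg [measurable]: "g k \<in> borel_measurable borel" for k unfolding g_def by measurable
  define G where "G n t = complex_of_real (\<Sum>k<n. cmod (g k t))" for n t
  have sg: "square_integrable (\<lambda>t. complex_of_real (cmod (g k t)))"
    and ng: "norm (abs_L2 (\<lambda>t. complex_of_real (cmod (g k t)))) \<le> (1/2)^k" for k
  proof -
    have s: "square_integrable (g k)"
      using square_integrable_add[OF sf[of "Suc k"] square_integrable_mult[OF sf[of k], of "-1"]]
      by (simp add: g_def[abs_def])
    then show s': "square_integrable (\<lambda>t. complex_of_real (cmod (g k t)))"
      by (simp add: square_integrable_def)
    have "norm (abs_L2 (\<lambda>t. complex_of_real (cmod (g k t)))) = norm (abs_L2 (g k))"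
      by (simp add: norm_L2_abs s s')
    also have "abs_L2 (g k) = X (r (Suc k)) - X (r k)"
      by (simp add: g_def[abs_def] abs_L2_diff[symmetric] af)
    also have "norm (X (r (Suc k)) - X (r k)) \<le> (1/2)^k"
      using N[OF rN rN, of k "Suc k" k] by simp
    finally show "norm (abs_L2 (\<lambda>t. complex_of_real (cmod (g k t)))) \<le> (1/2)^k" .
  qed
  have G: "square_integrable (G n) \<and> norm (abs_L2 (G n)) \<le> (\<Sum>k<n. (1/2)^k)" for n
  proof (induction n)
    case 0
    have "norm (abs_L2 (\<lambda>_::'a. 0)) = 0"
      by (simp add: norm_L2_abs square_integrable_zero)
    then show ?case by (simp add: G_def[abs_def] square_integrable_zero)
  next
    case (Suc n)
    have e: "G (Suc n) = (\<lambda>t. G n t + complex_of_real (cmod (g n t)))"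
      by (auto simp: G_def)
    have "norm (abs_L2 (G (Suc n))) \<le> norm (abs_L2 (G n)) + norm (abs_L2 (\<lambda>t. complex_of_real (cmod (g n t))))"
      unfolding e using Suc sg by (subst abs_L2_add[symmetric]) (auto intro: norm_triangle_ineq)
    then show ?case
      using Suc ng[of n] unfolding e by (auto intro: square_integrable_add sg)
  qed
  have G2: "(\<integral>\<^sup>+t. (\<Sum>k<n. ennreal (cmod (g k t)))\<^sup>2 \<partial>haar) \<le> 4" for n
  proof -
    have "(\<Sum>k<n. (1/2)^k) \<le> (\<Sum>k. (1/2::real)^k)"
      by (intro sum_le_suminf) (auto simp: summable_geometric)
    also have "\<dots> = 2" by (simp add: suminf_geometric)
    finally have "norm (abs_L2 (G n)) \<le> 2" using G[of n] by linarith
    then have "(norm (abs_L2 (G n)))\<^sup>2 \<le> 2\<^sup>2" by (intro power_mono) auto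
    moreover have "(\<integral>\<^sup>+t. (\<Sum>k<n. ennreal (cmod (g k t)))\<^sup>2 \<partial>haar) = (\<integral>\<^sup>+t. ennreal ((cmod (G n t))\<^sup>2) \<partial>haar)"
      by (intro nn_integral_cong)
        (simp add: G_def sum_nonneg ennreal_power sum_ennreal abs_of_nonneg del: of_real_sum)
    ultimately show ?thesis
      using nn_integral_square_integrable[of "G n"] G[of n]
      by (metis ennreal_leI ennreal_numeral numeral_Bit0 power2_eq_square mult_2 numeral_times_numeral
          semiring_norm(11) semiring_norm(13) zero_le_numeral four_x_squared)
  qed
  have "(\<integral>\<^sup>+t. (\<Sum>k. ennreal (cmod (g k t)))\<^sup>2 \<partial>haar) \<le> 4"
  proof -
    have sq: "(\<Sum>k. a k)\<^sup>2 = (SUP n. (\<Sum>k<n. a k)\<^sup>2)" for a :: "nat \<Rightarrow> ennreal"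
    proof (rule antisym)
      have "(\<Sum>k<i. a k) * (\<Sum>k<j. a k) \<le> (SUP n. (\<Sum>k<n. a k)\<^sup>2)" for i j
        by (rule SUP_upper2[of "max i j"])
          (auto simp: power2_eq_square intro!: mult_mono sum_mono2)
      then show "(\<Sum>k. a k)\<^sup>2 \<le> (SUP n. (\<Sum>k<n. a k)\<^sup>2)"
        unfolding power2_eq_square suminf_eq_SUP
        by (auto simp: SUP_mult_left_ennreal SUP_mult_right_ennreal intro!: SUP_least)
      show "(SUP n. (\<Sum>k<n. a k)\<^sup>2) \<le> (\<Sum>k. a k)\<^sup>2"
        by (intro SUP_least power_mono sum_le_suminf) auto
    qed
    have "(\<integral>\<^sup>+t. (\<Sum>k. ennreal (cmod (g k t)))\<^sup>2 \<partial>haar)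
        = (\<integral>\<^sup>+t. (SUP n. (\<Sum>k<n. ennreal (cmod (g k t)))\<^sup>2) \<partial>haar)"
      by (simp add: sq)
    also have "\<dots> = (SUP n. (\<integral>\<^sup>+t. (\<Sum>k<n. ennreal (cmod (g k t)))\<^sup>2 \<partial>haar))"
      by (intro nn_integral_monotone_convergence_SUP)
        (auto intro!: incseq_SucI le_funI power_mono ennreal_leI simp del: sum_ennreal)
    also have "\<dots> \<le> 4" using G2 by (intro SUP_least)
    finally show ?thesis .
  qed
  then have "(\<integral>\<^sup>+t. (\<Sum>k. ennreal (cmod (g k t)))\<^sup>2 \<partial>haar) \<noteq> \<infinity>"
    by (auto simp: top_unique)
  then have "AE t in haar. (\<Sum>k. ennreal (cmod (g k t)))\<^sup>2 \<noteq> \<infinity>"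
    by (intro nn_integral_PInf_AE) auto
  then have conv: "AE t in haar. convergent (\<lambda>k. f k t)"
  proof eventually_elim
    case (elim t)
    then have "(\<Sum>k. ennreal (cmod (g k t))) \<noteq> \<infinity>"
      by (auto simp: power2_eq_square ennreal_top_mult)
    then have "summable (\<lambda>k. cmod (g k t))"
      by (intro summable_suminf_not_top) auto
    then have "summable (\<lambda>k. g k t)" by (rule summable_norm_cancel)
    then have "convergent (\<lambda>n. \<Sum>k<n. g k t)" by (simp add: summable_iff_convergent)
    moreover have "(\<Sum>k<n. g k t) = f n t - f 0 t" for n
      using sum_lessThan_telescope[of "\<lambda>k. f k t" n] by (simp add: g_def)
    ultimately have "convergent (\<lambda>n. (f n t - f 0 t) + f 0 t)"
      by (intro convergent_add convergent_const) simp
    then show ?case by simp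
  qed
  define h where "h t = lim (\<lambda>k. f k t)" for t
  have mh [measurable]: "h \<in> borel_measurable borel" unfolding h_def by measurable
  have fat: "(\<integral>\<^sup>+t. ennreal ((cmod (h t - f n t))\<^sup>2) \<partial>haar) \<le> ennreal (((1/2)^n)\<^sup>2)" for n
  proof -
    have "(\<integral>\<^sup>+t. ennreal ((cmod (h t - f n t))\<^sup>2) \<partial>haar)
        = (\<integral>\<^sup>+t. liminf (\<lambda>m. ennreal ((cmod (f m t - f n t))\<^sup>2)) \<partial>haar)"
    proof (rule nn_integral_cong_AE, use conv in eventually_elim)
      case (elim t)
      then have "(\<lambda>m. f m t) \<longlonglongrightarrow> h t" by (simp add: h_def convergent_LIMSEQ_iff)
      then have "(\<lambda>m. ennreal ((cmod (f m t - f n t))\<^sup>2)) \<longlonglongrightarrow> ennreal ((cmod (h t - f n t))\<^sup>2)"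
        by (intro tendsto_intros)
      then show ?case by (rule lim_imp_Liminf[OF sequentially_bot, symmetric])
    qed
    also have "\<dots> \<le> liminf (\<lambda>m. \<integral>\<^sup>+t. ennreal ((cmod (f m t - f n t))\<^sup>2) \<partial>haar)"
      by (rule nn_integral_liminf) measurable
    also have "\<dots> \<le> limsup (\<lambda>m. \<integral>\<^sup>+t. ennreal ((cmod (f m t - f n t))\<^sup>2) \<partial>haar)"
      by (rule Liminf_le_Limsup) simp
    also have "\<dots> \<le> ennreal (((1/2)^n)\<^sup>2)"
    proof (rule Limsup_bounded, rule eventually_sequentiallyI[of n])
      fix m assume m: "n \<le> m"
      have s: "square_integrable (\<lambda>t. f m t - f n t)"
        using square_integrable_add[OF sf[of m] square_integrable_mult[OF sf[of n], of "-1"]] by simp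
      have "norm (X (r m) - X (r n)) \<le> (1/2)^n" using N[OF rN rN, of n m n] m by simp
      then show "(\<integral>\<^sup>+t. ennreal ((cmod (f m t - f n t))\<^sup>2) \<partial>haar) \<le> ennreal (((1/2)^n)\<^sup>2)"
        using nn_integral_square_integrable[OF s]
        by (simp add: abs_L2_diff[symmetric] af ennreal_leI power_mono)
    qed
    finally show ?thesis .
  qed
  have sd: "square_integrable (\<lambda>t. h t - f n t)" for n
    unfolding square_integrable_def
    using fat[of n] by (auto intro!: integrableI_bounded simp: le_less_trans[OF _ ennreal_less_top])
  have sh: "square_integrable h"
    using square_integrable_add[OF sd[of 0] sf[of 0]] by simp
  have lim: "norm (abs_L2 h - X (r n)) \<le> (1/2)^n" for n
  proof -
    have "ennreal ((norm (abs_L2 h - X (r n)))\<^sup>2) \<le> ennreal (((1/2)^n)\<^sup>2)"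
      using nn_integral_square_integrable[OF sd[of n]] fat[of n]
      by (simp add: abs_L2_diff[symmetric] af sh)
    then show ?thesis by (simp add: power2_le_iff_abs_le)
  qed
  show "convergent X"
  proof (rule convergentI, rule LIMSEQ_I)
    fix e :: real assume "0 < e"
    then obtain n where n: "(1/2)^n < e/2"
      using real_arch_pow_inv[of "e/2" "1/2"] by auto
    show "\<exists>no. \<forall>m\<ge>no. norm (X m - abs_L2 h) < e"
    proof (intro exI allI impI)
      fix m assume "N n \<le> m"
      then have "norm (X m - X (r n)) < (1/2)^n" using N rN by simp
      then show "norm (X m - abs_L2 h) < e"
        using lim[of n] n norm_triangle_ineq4[of "X m - X (r n)" "abs_L2 h - X (r n)"] by simp
    qed
  qed
qed

subsection \<open>Regular representations and the group von Neumann algebra\<close>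

text \<open>Left and right translations preserve null sets, so the choice of representatives is immaterial.\<close>

definition left_reg :: "'g::locally_compact_group \<Rightarrow> ('g L2 \<Rightarrow>\<^sub>L 'g L2)"
  where "left_reg s = Blinfun (\<lambda>\<xi>. abs_L2 (\<lambda>t. rep_L2 \<xi> (- s + t)))"

definition right_reg :: "'g::locally_compact_group \<Rightarrow> ('g L2 \<Rightarrow>\<^sub>L 'g L2)"
  where "right_reg s =
    Blinfun (\<lambda>\<xi>. abs_L2 (\<lambda>t. rep_L2 \<xi> (t + s) * complex_of_real (sqrt (modular s))))"

definition VN :: "('g::locally_compact_group L2 \<Rightarrow>\<^sub>L 'g L2) set"
  where "VN = commutant (commutant (range left_reg))"


section \<open>\<open>L\<^sup>1(G)\<close> and \<open>L\<^sup>\<infinity>(G)\<close>\<close>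

text \<open>Elements of \<open>L\<^sup>1(G)\<close> and \<open>L\<^sup>\<infinity>(G)\<close> are represented by Borel functions. As usual for groups
  that are not \<open>\<sigma>\<close>-compact, \<open>L\<^sup>\<infinity>(G)\<close> is taken modulo locally null sets, which makes it the dual
  of \<open>L\<^sup>1(G)\<close>; every class of locally measurable, locally essentially bounded functions contains a
  Borel function.\<close>

definition loc_AE :: "('g::locally_compact_group \<Rightarrow> bool) \<Rightarrow> bool"
  where "loc_AE P \<longleftrightarrow> (\<forall>K. compact K \<longrightarrow> (AE t in haar. t \<in> K \<longrightarrow> P t))"

definition L1 :: "('g::locally_compact_group \<Rightarrow> complex) set"
  where "L1 = {f. integrable haar f}"

definition Linf :: "('g::locally_compact_group \<Rightarrow> complex) set"
  where "Linf = {f \<in> borel_measurable borel. \<exists>C. loc_AE (\<lambda>t. cmod (f t) \<le> C)}"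

definition mult_op :: "('g::locally_compact_group \<Rightarrow> complex) \<Rightarrow> ('g L2 \<Rightarrow>\<^sub>L 'g L2)"
  where "mult_op f = Blinfun (\<lambda>\<xi>. abs_L2 (\<lambda>t. f t * rep_L2 \<xi> t))"

definition convolution ::
    "('g::locally_compact_group \<Rightarrow> complex) \<Rightarrow> ('g \<Rightarrow> complex) \<Rightarrow> ('g \<Rightarrow> complex)"
  where "convolution f g t = (LINT s|haar. f s * g (- s + t))"

text \<open>The last condition, closedness in the \<open>L\<^sup>1\<close>-seminorm, includes that membership depends
  only on the class of a function modulo null functions.\<close>

definition closed_left_ideal :: "('g::locally_compact_group \<Rightarrow> complex) set \<Rightarrow> bool"
  where "closed_left_ideal J \<longleftrightarrow>
    J \<subseteq> L1 \<and>
    (\<lambda>_. 0) \<in> J \<and>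
    (\<forall>f\<in>J. \<forall>g\<in>J. (\<lambda>t. f t + g t) \<in> J) \<and>
    (\<forall>c. \<forall>f\<in>J. (\<lambda>t. c * f t) \<in> J) \<and>
    (\<forall>f\<in>L1. \<forall>g\<in>J. \<forall>h\<in>L1. (AE t in haar. h t = convolution f g t) \<longrightarrow> h \<in> J) \<and>
    (\<forall>f\<in>L1. (\<forall>\<epsilon>>0. \<exists>g\<in>J. (LINT t|haar. cmod (f t - g t)) < \<epsilon>) \<longrightarrow> f \<in> J)"

definition L1_annihilator ::
    "('g::locally_compact_group \<Rightarrow> complex) set \<Rightarrow> ('g \<Rightarrow> complex) set"
  where "L1_annihilator J = {h \<in> Linf. \<forall>f\<in>J. (LINT t|haar. f t * h t) = 0}"


section \<open>The Fourier algebra and the approximation property\<close>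

definition fourier_coeff ::
    "'g::locally_compact_group L2 \<Rightarrow> 'g L2 \<Rightarrow> 'g \<Rightarrow> complex"
  where "fourier_coeff \<xi> \<eta> s = cinner (blinfun_apply (left_reg s) \<xi>) \<eta>"

definition fourier_algebra :: "('g::locally_compact_group \<Rightarrow> complex) set"
  where "fourier_algebra = {fourier_coeff \<xi> \<eta> | \<xi> \<eta>. True}"

text \<open>The duality between \<open>VN\<close> and its predual: $\langle x, u\rangle = \langle x\xi, \eta\rangle$ for
  $u(s) = \langle\lambda(s)\xi, \eta\rangle$.\<close>

definition fourier_pairing ::
    "('g::locally_compact_group L2 \<Rightarrow>\<^sub>L 'g L2) \<Rightarrow> ('g \<Rightarrow> complex) \<Rightarrow> complex"
  where "fourier_pairing x u =
    (THE c. \<exists>\<xi> \<eta>. u = fourier_coeff \<xi> \<eta> \<and> c = cinner (blinfun_apply x \<xi>) \<eta>)"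

text \<open>The norm of $M_n(A(G))$ in the predual operator space structure, where
  $M_n(A(G)) \subseteq CB(VN(G), M_n)$: the completely bounded norm of
  $x \mapsto (\langle x, u_{ij}\rangle)_{ij}$.\<close>

definition fourier_matrix_norm ::
    "nat \<Rightarrow> (nat \<Rightarrow> nat \<Rightarrow> 'g::locally_compact_group \<Rightarrow> complex) \<Rightarrow> real"
  where "fourier_matrix_norm n u =
    Sup {matrix_norm ({..<n} \<times> {..<m})
           (\<lambda>(i, k) (j, l) z. fourier_pairing (x k l) (u i j) * z) | (m::nat) x.
         (\<forall>k<m. \<forall>l<m. x k l \<in> VN) \<and>
         matrix_norm {..<m} (\<lambda>k l. blinfun_apply (x k l)) \<le> 1}"

definition cb_bound ::
    "(('g::locally_compact_group \<Rightarrow> complex) \<Rightarrow> ('g \<Rightarrow> complex)) \<Rightarrow> real \<Rightarrow> bool"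
  where "cb_bound \<Phi> C \<longleftrightarrow> 0 \<le> C \<and>
    (\<forall>n v. (\<forall>i<n. \<forall>j<n. v i j \<in> fourier_algebra) \<longrightarrow>
      fourier_matrix_norm n (\<lambda>i j. \<Phi> (v i j)) \<le> C * fourier_matrix_norm n v)"

text \<open>The class of \<open>\<phi> v\<close> in \<open>L\<^sup>\<infinity>(G)\<close> contains at most one element of \<open>A(G)\<close>, since the elements of
  \<open>A(G)\<close> are continuous.\<close>

definition fourier_mult ::
    "('g::locally_compact_group \<Rightarrow> complex) \<Rightarrow> ('g \<Rightarrow> complex) \<Rightarrow> ('g \<Rightarrow> complex)"
  where "fourier_mult \<phi> v =
    (THE w. w \<in> fourier_algebra \<and> loc_AE (\<lambda>t. w t = \<phi> t * v t))"

definition McbA :: "('g::locally_compact_group \<Rightarrow> complex) set"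
  where "McbA = {\<phi> \<in> Linf.
    (\<forall>v\<in>fourier_algebra. \<exists>w\<in>fourier_algebra. loc_AE (\<lambda>t. w t = \<phi> t * v t)) \<and>
    (\<exists>C. cb_bound (fourier_mult \<phi>) C)}"

definition McbA_norm :: "('g::locally_compact_group \<Rightarrow> complex) \<Rightarrow> real"
  where "McbA_norm \<phi> = Inf {C. cb_bound (fourier_mult \<phi>) C}"

text \<open>The norm of \<open>f \<in> L\<^sup>1(G)\<close> defining \<open>Q\<^sub>c\<^sub>b(G)\<close> is the norm of the functional
  $\varphi \mapsto \int f\varphi$ on the multiplier space, so the completion is realised as the norm
  closure of these functionals in its dual space.\<close>

definition Qcb :: "(('g::locally_compact_group \<Rightarrow> complex) \<Rightarrow> complex) set"
  where "Qcb = {q. \<forall>\<epsilon>>0. \<exists>f\<in>L1. \<forall>\<phi>\<in>McbA.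
    cmod (q \<phi> - (LINT t|haar. f t * \<phi> t)) \<le> \<epsilon> * McbA_norm \<phi>}"

definition weak_star_McbA :: "('g::locally_compact_group \<Rightarrow> complex) topology"
  where "weak_star_McbA = pullback_topology McbA
    (\<lambda>\<phi>. \<lambda>q\<in>Qcb. q \<phi>) (product_topology (\<lambda>_. euclidean) Qcb)"

text \<open>Nets in \<open>A(G)\<close> are rendered by proper filters containing \<open>A(G)\<close>.\<close>

definition approximation_property :: "'g::locally_compact_group itself \<Rightarrow> bool"
  where "approximation_property _ \<longleftrightarrow>
    (\<exists>F :: ('g \<Rightarrow> complex) filter. F \<noteq> bot \<and> (\<forall>\<^sub>F v in F. v \<in> fourier_algebra) \<and>
      limitin weak_star_McbA (\<lambda>v. v) (\<lambda>_. 1) F)"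


section \<open>The operators \<open>\<Theta>\<^sup>r(f)\<close>, and the spaces \<open>Ran(J)\<close> and \<open>Bim(J\<^sup>\<bottom>)\<close>\<close>

text \<open>The integral $\int f(s)\rho(s)T\rho(s^{-1})\,ds$ is understood in the weak operator sense.\<close>

definition Theta ::
    "('g::locally_compact_group \<Rightarrow> complex) \<Rightarrow> ('g L2 \<Rightarrow>\<^sub>L 'g L2) \<Rightarrow> ('g L2 \<Rightarrow>\<^sub>L 'g L2)"
  where "Theta f T = (THE S. \<forall>\<xi> \<eta>. cinner (blinfun_apply S \<xi>) \<eta> =
    (LINT s|haar. f s * cinner (blinfun_apply (right_reg s o\<^sub>L T o\<^sub>L right_reg (- s)) \<xi>) \<eta>))"

definition Theta_pre ::
    "('g::locally_compact_group \<Rightarrow> complex) \<Rightarrow> ('g L2 \<Rightarrow>\<^sub>L 'g L2) \<Rightarrow> ('g L2 \<Rightarrow>\<^sub>L 'g L2)"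
  where "Theta_pre f \<omega> = (THE \<tau>. \<tau> \<in> trace_class \<and>
    (\<forall>T\<in>bounded_ops. trace_pairing T \<tau> = trace_pairing (Theta f T) \<omega>))"

definition Ran :: "('g::locally_compact_group \<Rightarrow> complex) set \<Rightarrow> ('g L2 \<Rightarrow>\<^sub>L 'g L2) set"
  where "Ran J = trace_norm_closure
    (op_cspan {Theta_pre f \<omega> | f \<omega>. f \<in> J \<and> \<omega> \<in> trace_class})"

definition Bim :: "('g::locally_compact_group \<Rightarrow> complex) set \<Rightarrow> ('g L2 \<Rightarrow>\<^sub>L 'g L2) set"
  where "Bim X = weak_star_ops closure_of
    (op_cspan {x o\<^sub>L mult_op f o\<^sub>L y | x f y. f \<in> X \<and> x \<in> VN \<and> y \<in> VN})"

end

theory Submission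
 imports Defs
begin

text \<open>The inclusion of \<open>Bim\<close> is formal: \<open>\<Theta>\<^sup>r(g)\<close> is a \<open>VN(G)\<close>-bimodule map, and it kills
 \<open>M\<^sub>h\<close> for \<open>g\<close> in \<open>J\<close> and \<open>h\<close> in its annihilator because \<open>J\<close> is a left ideal. Conversely, let
 \<open>\<Theta>\<^sup>r(g)(T) = 0\<close> for all \<open>g\<close> in \<open>J\<close>. The functions $h_r(s) = \langle T\rho(s^{-1})\rho(r)a, \rho(s^{-1})b\rangle$
 then annihilate \<open>J\<close>, and $\int \Delta(r)^{-1/2} M_{h_r}\lambda(r)\,dr = \lambda(b)^* T \lambda(a)$ formally, but the
 integral need not converge in the weak* sense. Inserting a completely bounded multiplier as a weight gives a
 bounded operator whose norm is controlled by the cb-norm of the multiplier, so pairing it with a trace class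
 operator is a functional in \<open>Q\<^sub>c\<^sub>b(G)\<close>. If the trace class operator annihilates the bimodule, this
 functional vanishes on \<open>A(G)\<close>, hence at \<open>1\<close> by the AP. Now let \<open>a\<close> and \<open>b\<close> run through an approximate unit.\<close>

text \<open>An arbitrary bounded weight would not give a bounded operator, and the constant weight 1
  need not lie in A(G). Multipliers are admissible because of an absorption principle. Put a second
  copy of \<open>\<lambda>(r)\<close> into another tensor leg and integrate
  \<open>\<Delta>(r)^(-1/2) M_(h_r) \<lambda>(r) \<otimes> \<lambda>(r)\<close>. With the unitary
  \<open>(V k)(t, u) = k(t, t + u)\<close> this is the conjugate by V of
  \<open>S \<otimes> 1\<close>, where \<open>S\<close> is
  \<open>\<lambda>(b)^* T \<lambda>(a)\<close>; so it is a contraction. Its matrix entries over the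
  first leg are the operators \<open>lam (slice p q)\<close> in VN(G), on which a multiplier acts
  with at most its cb-norm. The second leg is removed by coefficients of \<open>\<lambda>\<close>
  that are close to 1 on small sets, glued by a partition of unity. The Haar measure need not be
  sigma-finite and orthonormal bases need not be countable, so exchanges of integrals and sums rest
  on finite approximations that are uniform on compact sets, not on product measures.
  \<open>T\<close> need not depend continuously on conjugation by translations; continuity of the
  functions \<open>h_r\<close> comes from the strong continuity of \<open>\<rho>\<close>.\<close>

abbreviation (input) app where "app \<equiv> blinfun_apply"
abbreviation (input) cor where "cor \<equiv> complex_of_real"
abbreviation (input) cont where "cont f \<equiv> continuous_on UNIV f"
abbreviation (input) haar_integral (binder "LI " 10) where "haar_integral f \<equiv> integral\<^sup>L haar f"

lemmas BI_add = Bochner_Integration.integrable_add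
lemmas BI_bound = Bochner_Integration.integrable_bound
lemmas BI_diff = Bochner_Integration.integrable_diff
lemmas BI_sum = Bochner_Integration.integrable_sum
lemmas Bi_add = Bochner_Integration.integral_add
lemmas Bi_cnj = Bochner_Integration.integral_cnj
lemmas Bi_cong = Bochner_Integration.integral_cong
lemmas Bi_diff = Bochner_Integration.integral_diff
lemmas Bi_mult_left_zero = Bochner_Integration.integral_mult_left_zero
lemmas Bi_mult_right_zero = Bochner_Integration.integral_mult_right_zero
lemmas Bi_sum = Bochner_Integration.integral_sum

interpretation cvec: module "scaleC :: complex => 'a::complex_inner => 'a"
 by (rule module_scaleC)

interpretation cop: module "scale_op :: complex => ('h::chilbert_space \<Rightarrow>\<^sub>L 'h) => ('h \<Rightarrow>\<^sub>L 'h)"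
 by (rule module_scale_op)

section \<open>Complex inner product spaces\<close>

lemma cinner_zero_left [simp]: "cinner 0 x = 0"
 using cinner_scaleC_left[of 0 x x] by simp

lemma cinner_zero_right [simp]: "cinner x 0 = 0"
 using cinner_commute[of x 0] by simp

lemma cinner_add_right: "cinner x (y + z) = cinner x y + cinner x z"
 by (subst (1 2 3) cinner_commute) (simp add: cinner_add_left)

lemma cinner_scaleC_right: "cinner x (c *\<^sub>C y) = cnj c*cinner x y"
 by (subst (1 2) cinner_commute) (simp add: cinner_scaleC_left)

lemma scaleC_minus1: "(-1) *\<^sub>C x = - (x::'a::complex_inner)"
 by simp

lemma cinner_minus_left [simp]: "cinner (- x) y = - cinner x y"
 using cinner_scaleC_left[of "-1" x y] by simp

lemma cinner_minus_right [simp]: "cinner x (- y) = - cinner x y"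
 using cinner_scaleC_right[of x "-1" y] by simp

lemma cinner_diff_left: "cinner (x - y) z = cinner x z - cinner y z"
 using cinner_add_left[of x "- y" z] by simp

lemma cinner_diff_right: "cinner x (y - z) = cinner x y - cinner x z"
 using cinner_add_right[of x y "- z"] by simp

lemma cinner_sum_left: "cinner (sum f A) y = (\<Sum>i\<in>A. cinner (f i) y)"
 by (induction A rule: infinite_finite_induct) (auto simp: cinner_add_left)

lemma cinner_sum_right: "cinner x (sum f A) = (\<Sum>i\<in>A. cinner x (f i))"
 by (induction A rule: infinite_finite_induct) (auto simp: cinner_add_right)

lemma cinner_self: "cinner x x = cor ((norm x)\<^sup>2)"
proof -
 have "cinner x x : \<real>"
  using cinner_commute[of x x] by (simp add: complex_is_Real_iff complex_eq_iff)
 moreover have "Re (cinner x x) = (norm x)\<^sup>2"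
  by (simp add: inner_cinner[symmetric] power2_norm_eq_inner)
 ultimately show ?thesis by (metis of_real_Re)
qed

lemma cinner_self_eq_0 [simp]: "cinner x x = 0 \<longleftrightarrow> x = 0"
 by (simp add: cinner_self del: of_real_power)

lemma Re_cinner_le: "Re (cinner x y) <= norm x*norm y"
 by (simp add: inner_cinner[symmetric] norm_cauchy_schwarz)

lemma cinner_norm_le: "cmod (cinner x y) <= norm x*norm y"
proof (cases "cinner x y = 0")
 case False
 \<comment> \<open>Rotating \<open>x\<close> by the conjugate phase makes the inner product real and
   nonnegative, so that the real Cauchy-Schwarz inequality applies.\<close>
 define c where "c = cnj (sgn (cinner x y))"
 have c: "cmod c = 1" using False by (simp add: c_def norm_sgn)
 have "cinner (c *\<^sub>C x) y = cor (cmod (cinner x y))"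
  using False by (simp add: cinner_scaleC_left c_def sgn_eq complex_norm_square[symmetric] field_simps
    power2_eq_square)
 then have "cmod (cinner x y) = Re (cinner (c *\<^sub>C x) y)" by simp
 also have "\<dots> <= norm (c *\<^sub>C x)*norm y" by (rule Re_cinner_le)
 finally show ?thesis by (simp add: norm_scaleC c)
qed simp

lemma scaleR_scaleC_commute: "c *\<^sub>C (r *\<^sub>R x) = r *\<^sub>R (c *\<^sub>C (x::'a::complex_inner))"
 by (simp add: scaleR_scaleC mult.commute)

interpretation bounded_bilinear_cinner: bounded_bilinear cinner
proof
 show "cinner (r *\<^sub>R x) y = r *\<^sub>R cinner x y" for r and x y :: 'a
  by (simp add: scaleR_scaleC cinner_scaleC_left scaleR_conv_of_real)
 show "cinner x (r *\<^sub>R y) = r *\<^sub>R cinner x y" for r and x y :: 'a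
  by (simp add: scaleR_scaleC cinner_scaleC_right scaleR_conv_of_real)
 show "EX K. ALL x y :: 'a. norm (cinner x y) <= norm x*norm y*K"
  by (rule exI[of _ 1]) (simp add: cinner_norm_le)
qed (simp_all add: cinner_add_left cinner_add_right)

interpretation bounded_bilinear_scaleC: bounded_bilinear "scaleC :: complex => 'a::complex_inner => 'a"
proof
 show "(r *\<^sub>R c) *\<^sub>C x = r *\<^sub>R (c *\<^sub>C x)" for r c and x :: 'a
  by (simp add: scaleR_scaleC scaleR_conv_of_real)
 show "EX K. ALL c. ALL x :: 'a. norm (c *\<^sub>C x) <= norm c*norm x*K"
  by (rule exI[of _ 1]) (simp add: norm_scaleC)
qed (simp_all add: scaleC_add_left scaleC_add_right scaleR_scaleC_commute)

lemmas tendsto_cinner [tendsto_intros] = bounded_bilinear_cinner.tendsto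
lemmas continuous_on_cinner [continuous_intros] = bounded_bilinear_cinner.continuous_on
lemmas tendsto_scaleC [tendsto_intros] = bounded_bilinear_scaleC.tendsto
lemmas continuous_on_scaleC [continuous_intros] = bounded_bilinear_scaleC.continuous_on

lemma cinner_ext: "(!!y. cinner x y = cinner x' y) ==> x = x'"
 by (metis cinner_diff_left cinner_self_eq_0 right_minus_eq)

lemma cinner_ext_right: "(!!y. cinner y x = cinner y x') ==> x = x'"
 by (metis cinner_ext cinner_commute)

lemma norm_eqI_cinner:
 assumes "0 <= C" and "!!y. cmod (cinner x y) <= C*norm y" shows "norm x <= C"
proof (cases "x = 0")
 case False
 have "norm x*norm x <= C*norm x"
  using assms(2)[of x] by (simp add: cinner_self norm_power power2_eq_square norm_mult)
 then show ?thesis using False by simp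
qed (use assms in simp)

section \<open>Closures of subspaces and the Riesz representation theorem\<close>

lemma csubspace_closure:
 assumes "cvec.subspace D" shows "cvec.subspace (closure D)"
proof (rule cvec.subspaceI)
 show "0 : closure D" using assms closure_subset cvec.subspace_0 by blast
next
 fix x y assume "x : closure D" "y : closure D"
 then obtain f g where "!!n. f n : D" "f \<longlonglongrightarrow> x" "!!n. g n : D" "g \<longlonglongrightarrow> y"
  unfolding closure_sequential by blast
 then have "(%n. f n + g n) \<longlonglongrightarrow> x + y" "!!n. f n + g n : D"
  using cvec.subspace_add[OF assms] by (auto intro: tendsto_intros)
 then show "x + y : closure D" unfolding closure_sequential
  by (intro exI[of _ "%n. f n + g n"]) auto
next
 fix x c assume "x : closure D"
 then obtain f where "!!n. f n : D" "f \<longlonglongrightarrow> x"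
  unfolding closure_sequential by blast
 then have "(%n. c *\<^sub>C f n) \<longlonglongrightarrow> c *\<^sub>C x" "!!n. c *\<^sub>C f n : D"
  using cvec.subspace_scale[OF assms] by (auto intro: tendsto_intros)
 then show "c *\<^sub>C x : closure D" unfolding closure_sequential
  by (intro exI[of _ "%n. c *\<^sub>C f n"]) auto
qed

lemma cinner_closure_eq:
 assumes "!!d. d : D ==> cinner d x = cinner d y" "z : closure D"
 shows "cinner z x = cinner z y"
proof -
 obtain f where f: "!!n. f n : D" "f \<longlonglongrightarrow> z"
  using assms(2) unfolding closure_sequential by blast
 have "(%n. cinner (f n) x) \<longlonglongrightarrow> cinner z x" "(%n. cinner (f n) y) \<longlonglongrightarrow> cinner z y"
  using f by (auto intro!: tendsto_intros)
 then show ?thesis using assms(1)[OF f(1)] LIMSEQ_unique by simp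
qed

text \<open>The difference lies in the closure of \<open>D\<close> and is orthogonal to
  \<open>D\<close>, hence to itself. This uniqueness is what makes maps defined through chosen Riesz
  vectors linear.\<close>

lemma riesz_closure_unique:
 assumes D: "cvec.subspace D" and "z : closure D" "w : closure D"
  and "!!d. d : D ==> cinner d z = cinner d w"
 shows "z = w"
proof -
 have "z - w : closure D"
  using cvec.subspace_diff[OF csubspace_closure[OF D]] assms by blast
 then have "cinner (z - w) z = cinner (z - w) w"
  using cinner_closure_eq assms(4) by blast
 then have "cinner (z - w) (z - w) = 0" by (simp add: cinner_diff_right)
 then show ?thesis by simp
qed

lemma norm_plus_sq:
 fixes x y :: "'a::real_inner"
 shows "(norm (x + y))\<^sup>2 = (norm x)\<^sup>2 + (norm y)\<^sup>2 + 2*inner x y"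
 by (simp add: power2_norm_eq_inner inner_add_left inner_add_right inner_commute)

text \<open>The subspace need not be closed; with \<open>f = (\<lambda>d. cinner d x)\<close> this yields the orthogonal
  projection of \<open>x\<close>.\<close>

lemma riesz_subspace:
 fixes D :: "'h::chilbert_space set" and f :: "'h => complex"
 assumes D: "cvec.subspace D"
  and add: "!!x y. x : D ==> y : D ==> f (x + y) = f x + f y"
  and scale: "!!c x. x : D ==> f (c *\<^sub>C x) = c*f x"
  and bound: "!!x. x : D ==> cmod (f x) <= C*norm x"
  and C: "0 <= C"
 shows "EX z:closure D. (ALL d:D. f d = cinner d z) & norm z <= C"
proof -
 \<comment> \<open>If \<open>f\<close> is \<open>cinner _ z\<close>, then
   \<open>J d = |d - z|^2 - |z|^2\<close>, so the Riesz vector is the limit of a minimising sequence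
   of \<open>J\<close>; the parallelogram law makes such a sequence Cauchy.\<close>
 define J where "J d = (norm d)\<^sup>2 - 2*Re (f d)" for d
 have J_ge: "J d >= - (C\<^sup>2)" if "d : D" for d
 proof -
  have "Re (f d) <= C*norm d" using bound[OF that] complex_Re_le_cmod order_trans by blast
  moreover have "0 <= (norm d - C)\<^sup>2" by simp
  ultimately show ?thesis unfolding J_def by (simp add: power2_eq_square algebra_simps)
 qed
 define m where "m = Inf (J ` D)"
 have D0: "0 : D" by (rule cvec.subspace_0[OF D])
 have bdd: "bdd_below (J ` D)" using J_ge by (auto intro!: bdd_belowI[of _ "- (C\<^sup>2)"])
 have m_le: "m <= J d" if "d : D" for d
  unfolding m_def using that bdd by (auto intro: cInf_lower)
 have "EX d:D. J d < m + 1 / Suc n" for n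
 proof -
  have "Inf (J ` D) < m + 1 / Suc n" by (simp add: m_def)
  then show ?thesis using cInf_lessD[of "J ` D"] D0 by auto
 qed
 then obtain d where dD: "!!n. d n : D" and dJ: "!!n. J (d n) < m + 1 / Suc n" by metis
 have est: "(norm (d i - d k))\<^sup>2 <= 2 / Suc i + 2 / Suc k" for i k
 proof -
  define e where "e = (1/2) *\<^sub>R (d i + d k)"
  have eD: "e : D" unfolding e_def scaleR_scaleC
   using cvec.subspace_scale[OF D] cvec.subspace_add[OF D] dD by blast
  have fe: "f e = (f (d i) + f (d k)) / 2"
   unfolding e_def scaleR_scaleC by (simp add: scale add dD cvec.subspace_add[OF D])
  have "(norm (d i - d k))\<^sup>2 = 2*(norm (d i))\<^sup>2 + 2*(norm (d k))\<^sup>2 - 4*(norm e)\<^sup>2"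
   unfolding e_def
   by (simp add: power2_norm_eq_inner inner_diff_left inner_diff_right inner_add_left
     inner_add_right inner_commute algebra_simps)
  also have "\<dots> = 2*J (d i) + 2*J (d k) - 4*J e"
   unfolding J_def fe by (simp add: field_simps)
  also have "\<dots> <= 2 / Suc i + 2 / Suc k"
   using dJ[of i] dJ[of k] m_le[OF eD] by linarith
  finally show ?thesis .
 qed
 have "Cauchy d"
 proof (rule CauchyI)
  fix e :: real assume e: "0 < e"
  obtain N where N: "4 / e\<^sup>2 < real N" using reals_Archimedean2 by blast
  show "EX M. ALL i>=M. ALL k>=M. norm (d i - d k) < e"
  proof (intro exI allI impI)
   fix i k assume ik: "N <= i" "N <= k"
   have Np: "0 < real N" using N e by (smt (verit) divide_pos_pos zero_less_power)
   have "2 / real (Suc j) < 2 / real N" if "N <= j" for j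
    using that Np by (intro divide_strict_left_mono) auto
   from this[OF ik(1)] this[OF ik(2)] have "(norm (d i - d k))\<^sup>2 < 4 / N"
    using est[of i k] by simp
   also have "4 / N < e\<^sup>2" using N e Np by (simp add: field_simps)
   finally show "norm (d i - d k) < e" using e by (simp add: power_less_imp_less_base)
  qed
 qed
 then obtain z where z: "d \<longlonglongrightarrow> z" using Cauchy_convergent convergent_def by blast
 have zD: "z : closure D" using z dD unfolding closure_sequential by blast
 have Re_eq: "Re (f x) = Re (cinner x z)" if x: "x : D" for x
 proof -
  have ge: "0 <= t\<^sup>2*(norm x)\<^sup>2 + 2*t*(inner z x - Re (f x))" for t :: real
  proof -
   have "0 <= 1 / Suc n + (t\<^sup>2*(norm x)\<^sup>2 + 2*t*(inner (d n) x - Re (f x)))" for n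
   proof -
    have D1: "d n + t *\<^sub>R x : D" unfolding scaleR_scaleC
     using cvec.subspace_scale[OF D] cvec.subspace_add[OF D] dD x by blast
    have "J (d n + t *\<^sub>R x) = J (d n) + (t\<^sup>2*(norm x)\<^sup>2 + 2*t*(inner (d n) x - Re (f x)))"
     unfolding J_def norm_plus_sq
     by (simp add: scaleR_scaleC[of t x] add scale dD x cvec.subspace_scale[OF D] norm_scaleC
       power_mult_distrib algebra_simps inner_cinner cinner_scaleC_right)
    then show ?thesis using m_le[OF D1] dJ[of n] by linarith
   qed
   moreover have "(%n. 1 / real (Suc n) + (t\<^sup>2*(norm x)\<^sup>2 + 2*t*(inner (d n) x - Re (f x))))
     \<longlonglongrightarrow> 0 + (t\<^sup>2*(norm x)\<^sup>2 + 2*t*(inner z x - Re (f x)))"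
    using z by (intro tendsto_intros LIMSEQ_Suc[OF lim_1_over_n]) 
   ultimately show ?thesis by (intro LIMSEQ_le_const[where X="%n. 1 / real (Suc n) + (t\<^sup>2*(norm x)\<^sup>2 + 2*t*(inner (d n) x - Re (f x)))"]) auto
  qed
  define g where "g = inner z x - Re (f x)"
  have "g = 0"
  proof (rule ccontr)
   assume g: "g ~= 0"
   \<comment> \<open>Close to the minimiser of the quadratic in \<open>t\<close>; the summand 1
     keeps the denominator positive when \<open>x = 0\<close>.\<close>
   define t where "t = - g / ((norm x)\<^sup>2 + 1)"
   have n1: "(norm x)\<^sup>2 + 1 > 0" by (smt (verit) zero_le_power2)
   have sq: "(- g / N)\<^sup>2*N + 2*(- g / N)*g = - (g\<^sup>2 / N)" if "N > 0" for N :: real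
    using that by (simp add: field_simps power2_eq_square)
   have "t\<^sup>2*(norm x)\<^sup>2 + 2*t*g <= t\<^sup>2*((norm x)\<^sup>2 + 1) + 2*t*g"
    by (simp add: mult_left_mono)
   also have "\<dots> = - (g\<^sup>2 / ((norm x)\<^sup>2 + 1))"
    unfolding t_def by (rule sq[OF n1])
   also have "\<dots> < 0" using g n1 by simp
   finally show False using ge[of t] unfolding g_def by linarith
  qed
  then show ?thesis unfolding g_def by (simp add: inner_commute inner_cinner[symmetric])
 qed
 have eq: "f x = cinner x z" if x: "x : D" for x
 proof (rule complex_eqI)
  show "Re (f x) = Re (cinner x z)" by (rule Re_eq[OF x])
  have "Re (f ((-\<i>) *\<^sub>C x)) = Re (cinner ((-\<i>) *\<^sub>C x) z)"
   by (rule Re_eq[OF cvec.subspace_scale[OF D x]])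
  then show "Im (f x) = Im (cinner x z)"
   by (simp only: scale[OF x] cinner_scaleC_left) simp
 qed
 have "norm z <= C"
 proof (cases "z = 0")
  case False
  have "(%n. C*norm (d n) - Re (cinner (d n) z)) \<longlonglongrightarrow> C*norm z - Re (cinner z z)"
   using z by (intro tendsto_intros)
  moreover have "0 <= C*norm (d n) - Re (cinner (d n) z)" for n
   using bound[OF dD] complex_Re_le_cmod[of "f (d n)"] eq[OF dD] by (smt (verit))
  ultimately have "0 <= C*norm z - Re (cinner z z)"
   by (intro LIMSEQ_le_const) auto
  then have "norm z*norm z <= C*norm z" by (simp add: cinner_self power2_eq_square)
  then show ?thesis using False by simp
 qed (use C in simp)
 with zD eq show ?thesis by blast
qed

section \<open>Bounded operators, sesquilinear forms and adjoints\<close>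

lemma bounded_opsI: "(!!c xi. app T (c *\<^sub>C xi) = c *\<^sub>C app T xi) ==> T : bounded_ops"
 by (simp add: bounded_ops_def)

lemma bounded_ops_scaleC: "T : bounded_ops ==> app T (c *\<^sub>C xi) = c *\<^sub>C app T xi"
 by (simp add: bounded_ops_def)

lemma op_of_linear:
 fixes f :: "'h::chilbert_space => 'h"
 assumes "!!x y. f (x + y) = f x + f y" "!!c x. f (c *\<^sub>C x) = c *\<^sub>C f x"
  and "!!x. norm (f x) <= C*norm x"
 shows "app (Blinfun f) = f" "Blinfun f : bounded_ops" "0 <= C ==> norm (Blinfun f) <= C"
proof -
 have "bounded_linear f"
  using assms by (intro bounded_linear_intro[of _ C]) (auto simp: scaleR_scaleC mult.commute)
 then show f: "app (Blinfun f) = f" by (rule bounded_linear_Blinfun_apply)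
 then show "Blinfun f : bounded_ops" by (simp add: bounded_ops_def assms)
 show "norm (Blinfun f) <= C" if "0 <= C"
  using that assms(3) f by (intro norm_blinfun_bound) auto
qed

lemma op_eqI: "(!!x y. cinner (app S x) y = cinner (app T x) y) ==> S = T"
 by (rule blinfun_eqI) (rule cinner_ext)

lemma op_eqI_dense:
 assumes "closure D = UNIV"
  and "!!x y. x : D ==> y : D ==> cinner (app S x) y = cinner (app T x) y"
 shows "S = T"
proof (rule blinfun_eqI)
 have *: "app S x = app T x" if x: "x : D" for x
 proof (rule cinner_ext_right)
  fix y
  show "cinner y (app S x) = cinner y (app T x)"
   by (rule cinner_closure_eq[of D]) (use assms x in \<open>metis cinner_commute\<close>, use assms in auto)
 qed
 fix x
 obtain f where f: "!!n. f n : D" "f \<longlonglongrightarrow> x"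
  using assms(1) closure_sequential[of x D] by auto
 have "(%n. app S (f n)) \<longlonglongrightarrow> app S x"
  "(%n. app T (f n)) \<longlonglongrightarrow> app T x"
  using f(2) by (auto intro!: tendsto_intros)
 then show "app S x = app T x"
  using *[OF f(1)] LIMSEQ_unique by simp
qed

text \<open>Riesz vectors are taken three times: \<open>Z x\<close> represents the form on the dense
  subspace, \<open>W\<close> is the adjoint of \<open>Z\<close> and already lives on the whole
  space, and \<open>S\<close>, the adjoint of \<open>W\<close>, extends \<open>Z\<close>. Taking the
  adjoint twice replaces an extension by continuity, so a form given on compactly supported
  functions is enough later.\<close>

lemma form_operator:
 fixes D :: "'h::chilbert_space set" and B :: "'h => 'h => complex"
 assumes D: "cvec.subspace D" and dense: "closure D = UNIV"
  and add1: "!!x y z. x : D ==> y : D ==> z : D ==> B (x + y) z = B x z + B y z"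
  and add2: "!!x y z. x : D ==> y : D ==> z : D ==> B x (y + z) = B x y + B x z"
  and scale1: "!!c x y. x : D ==> y : D ==> B (c *\<^sub>C x) y = c*B x y"
  and scale2: "!!c x y. x : D ==> y : D ==> B x (c *\<^sub>C y) = cnj c*B x y"
  and bound: "!!x y. x : D ==> y : D ==> cmod (B x y) <= C*norm x*norm y"
  and C: "0 <= C"
 shows "EX S:bounded_ops. norm S <= C & (ALL x:D. ALL y:D. cinner (app S x) y = B x y)"
proof -
 have "EX z:closure D. (ALL y:D. cnj (B x y) = cinner y z) & norm z <= C*norm x" if x: "x : D" for x
  using D
  by (rule riesz_subspace) (use x C bound[of x] add2 scale2 in \<open>auto simp: mult.assoc mult.commute[of _ "norm x"]\<close>)
 then obtain Z where Z: "!!x y. x : D ==> y : D ==> cnj (B x y) = cinner y (Z x)"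
  and Zn: "!!x. x : D ==> norm (Z x) <= C*norm x" by metis
 have ZB: "cinner (Z x) y = B x y" if "x : D" "y : D" for x y
  using Z[OF that] cinner_commute[of "Z x" y] by (metis complex_cnj_cnj)
 have uniq: "z = w" if "!!y. y : D ==> cinner z y = cinner w y" for z w
  using riesz_closure_unique[OF D, of z w] that dense by (metis UNIV_I cinner_commute)
 have Zadd: "Z (x + y) = Z x + Z y" if "x : D" "y : D" for x y
  by (rule uniq) (simp add: ZB that cvec.subspace_add[OF D] add1 cinner_add_left)
 have Zscale: "Z (c *\<^sub>C x) = c *\<^sub>C Z x" if "x : D" for c x
  by (rule uniq) (simp add: ZB that cvec.subspace_scale[OF D] scale1 cinner_scaleC_left)
 have "EX w:closure D. (ALL x:D. cinner (Z x) y = cinner x w) & norm w <= C*norm y" for y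
 proof (rule riesz_subspace[OF D])
  show "cmod (cinner (Z x) y) <= C*norm y*norm x" if "x : D" for x
   using cinner_norm_le[of "Z x" y] mult_right_mono[OF Zn[OF that], of "norm y"]
   by (simp add: mult_ac)
 qed (use C in \<open>auto simp: Zadd Zscale cinner_add_left cinner_scaleC_left\<close>)
 then obtain W where W: "!!x y. x : D ==> cinner (Z x) y = cinner x (W y)"
  and Wn: "!!y. norm (W y) <= C*norm y" by metis
 have uniq': "z = w" if "!!x. x : D ==> cinner x z = cinner x w" for z w
  using uniq that by (metis cinner_commute)
 have Wadd: "W (x + y) = W x + W y" for x y
  by (rule uniq') (simp add: W[symmetric] cinner_add_right)
 have Wscale: "W (c *\<^sub>C x) = c *\<^sub>C W x" for c x
  by (rule uniq') (simp add: W[symmetric] cinner_scaleC_right)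
 have "EX z:closure UNIV. (ALL y:UNIV. cinner (W y) x = cinner y z) & norm z <= C*norm x" for x
 proof (rule riesz_subspace)
  show "cmod (cinner (W y) x) <= C*norm x*norm y" for y
   using cinner_norm_le[of "W y" x] mult_right_mono[OF Wn[of y], of "norm x"]
   by (simp add: mult_ac)
 qed (use C in \<open>auto simp: Wadd Wscale cinner_add_left cinner_scaleC_left\<close>)
 then obtain S where S: "!!x y. cinner (W y) x = cinner y (S x)"
  and Sn: "!!x. norm (S x) <= C*norm x" by (metis UNIV_I)
 have Sadd: "S (x + y) = S x + S y" for x y
  by (rule cinner_ext_right) (simp add: S[symmetric] cinner_add_right)
 have Sscale: "S (c *\<^sub>C x) = c *\<^sub>C S x" for c x
  by (rule cinner_ext_right) (simp add: S[symmetric] cinner_scaleC_right)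
 note op = op_of_linear[of S C, OF Sadd Sscale Sn]
 have "cinner (S x) y = B x y" if "x : D" "y : D" for x y
  using S[of y x] W[OF that(1), of y] ZB[OF that] by (metis cinner_commute)
 then show ?thesis using op C by (intro bexI[of _ "Blinfun S"]) auto
qed

lemma adj_op_exists:
 assumes T: "T : bounded_ops"
 shows "EX S:bounded_ops. norm S <= norm T &
  (ALL xi eta. cinner (app T xi) eta = cinner xi (app S eta))"
proof -
 have "EX S:bounded_ops. norm S <= norm T &
   (ALL x:UNIV. ALL y:UNIV. cinner (app S x) y = cinner x (app T y))"
 proof (rule form_operator)
  show "cmod (cinner x (app T y)) <= norm T*norm x*norm y" for x y
   using cinner_norm_le[of x "app T y"]
    mult_left_mono[OF norm_blinfun[of T y], of "norm x"] by (simp add: mult_ac)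
 qed (auto simp: cinner_add_left cinner_add_right blinfun.add_right bounded_ops_scaleC[OF T]
   cinner_scaleC_left cinner_scaleC_right)
 then show ?thesis by (metis UNIV_I cinner_commute)
qed

lemma adj_op_eqI:
 assumes "!!xi eta. cinner (app T xi) eta = cinner xi (app S eta)"
 shows "adj_op T = S"
 unfolding adj_op_def
proof (rule the_equality)
 fix S' assume "ALL xi eta. cinner (app T xi) eta = cinner xi (app S' eta)"
 then have "!!xi eta. cinner xi (app S' eta) = cinner xi (app S eta)" using assms by metis
 then show "S' = S" by (intro blinfun_eqI cinner_ext_right)
qed (use assms in blast)

lemma
 assumes "T : bounded_ops"
 shows adj_op_bounded_ops: "adj_op T : bounded_ops"
  and cinner_adj_right: "cinner xi (app (adj_op T) eta) = cinner (app T xi) eta"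
  and cinner_adj_left: "cinner (app (adj_op T) eta) xi = cinner eta (app T xi)"
  and norm_adj_op_le: "norm (adj_op T) <= norm T"
proof -
 obtain S where S: "S : bounded_ops" "norm S <= norm T"
  "!!xi eta. cinner (app T xi) eta = cinner xi (app S eta)"
  using adj_op_exists[OF assms] by blast
 then have "adj_op T = S" by (intro adj_op_eqI) auto
 then show "adj_op T : bounded_ops"
  "cinner xi (app (adj_op T) eta) = cinner (app T xi) eta"
  "cinner (app (adj_op T) eta) xi = cinner eta (app T xi)"
  "norm (adj_op T) <= norm T"
  using S by (simp_all, metis cinner_commute)
qed

lemma bounded_ops_compose: "S : bounded_ops ==> T : bounded_ops ==> S o\<^sub>L T : bounded_ops"
 by (simp add: bounded_ops_def)

lemma bounded_ops_add: "S : bounded_ops ==> T : bounded_ops ==> S + T : bounded_ops"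
 by (simp add: bounded_ops_def blinfun.add_left scaleC_add_right)

lemma bounded_ops_diff: "S : bounded_ops ==> T : bounded_ops ==> S - T : bounded_ops"
 by (simp add: bounded_ops_def blinfun.diff_left cvec.scale_right_diff_distrib)

lemma bounded_ops_scale: "T : bounded_ops ==> scale_op c T : bounded_ops"
 by (simp add: bounded_ops_def scale_op_apply mult.commute)

lemma bounded_ops_scaleR: "T : bounded_ops ==> r *\<^sub>R T : bounded_ops"
 by (simp add: bounded_ops_def blinfun.scaleR_left scaleR_scaleC_commute)

lemma bounded_ops_zero [simp]: "0 : bounded_ops"
 by (simp add: bounded_ops_def)

lemma bounded_ops_id [simp]: "id_blinfun : bounded_ops"
 by (simp add: bounded_ops_def)

lemma bounded_ops_sum: "(!!i. i : A ==> f i : bounded_ops) ==> sum f A : bounded_ops"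
 by (induction A rule: infinite_finite_induct) (auto intro: bounded_ops_add)

instance chilbert_space \<subseteq> banach ..

subsection \<open>Positive operators\<close>

lemma positive_op_symmetric:
 assumes "positive_op P"
 shows "cinner (app P x) y = cinner x (app P y)"
proof -
 define g where "g x y = cinner (app P x) y - cinner x (app P y)" for x y
 have P: "P : bounded_ops" using assms by (simp add: positive_op_def)
 have g0: "g x x = 0" for x
 proof -
  have "cinner (app P x) x : \<real>"
   using assms nonneg_Reals_subset_Reals by (auto simp: positive_op_def)
  then show ?thesis
   unfolding g_def using cinner_commute[of x "app P x"] by (simp add: complex_is_Real_iff complex_eq_iff)
 qed
 \<comment> \<open>Polarisation: \<open>g\<close> vanishes on the diagonal, and evaluating it at
   \<open>x + y\<close> and at \<open>x + \<i> *\<^sub>C y\<close> separates \<open>g x y\<close>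
   from \<open>g y x\<close>.\<close>
 have "g (x + y) (x + y) = g x x + g x y + g y x + g y y"
  unfolding g_def by (simp add: blinfun.add_right cinner_add_left cinner_add_right)
 then have 1: "g x y + g y x = 0" by (simp add: g0)
 have "g (x + \<i> *\<^sub>C y) (x + \<i> *\<^sub>C y) = g x x - \<i>*g x y + \<i>*g y x + g y y"
  unfolding g_def by (simp add: blinfun.add_right cinner_add_left cinner_add_right
    bounded_ops_scaleC[OF P] cinner_scaleC_left cinner_scaleC_right algebra_simps)
 then have 2: "\<i>*(g y x - g x y) = 0" by (simp add: g0 algebra_simps)
 have "g x y = 0" using 1 2 by auto
 then show ?thesis by (simp add: g_def)
qed

lemma positive_op_nonneg: "positive_op P ==> 0 <= Re (cinner (app P x) x)"
 by (auto simp: positive_op_def complex_nonneg_Reals_iff)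

lemma positive_opI:
 assumes "P : bounded_ops" "!!x y. cinner (app P x) y = cinner x (app P y)"
  and "!!x. 0 <= Re (cinner (app P x) x)"
 shows "positive_op P"
proof -
 have "Im (cinner (app P x) x) = 0" for x
  using assms(2)[of x x] cinner_commute[of x "app P x"]
  by (metis Reals_cnj_iff complex_is_Real_iff)
 then show ?thesis using assms by (auto simp: positive_op_def complex_nonneg_Reals_iff)
qed

lemma positive_op_cauchy_schwarz:
 assumes "positive_op P"
 shows "(cmod (cinner (app P x) y))\<^sup>2
  <= Re (cinner (app P x) x)*Re (cinner (app P y) y)"
proof (cases "cinner (app P x) y = 0")
 case False
 have P: "P : bounded_ops" using assms by (simp add: positive_op_def)
 define a where "a = cmod (cinner (app P x) y)"
 define al where "al = Re (cinner (app P x) x)"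
 define \<beta> where "\<beta> = Re (cinner (app P y) y)"
 define c where "c = cnj (sgn (cinner (app P x) y))"
 have cc: "c*cnj c = 1" using False
  by (simp add: c_def sgn_eq complex_norm_square[symmetric] field_simps power2_eq_square)
 have ca: "c*cinner (app P x) y = a"
  using False by (simp add: a_def c_def sgn_eq complex_norm_square[symmetric] field_simps
    power2_eq_square)
 have ca': "cnj c*cinner (app P y) x = a"
 proof -
  have "cinner (app P y) x = cnj (cinner (app P x) y)"
   using positive_op_symmetric[OF assms] cinner_commute by metis
  then show ?thesis using ca by (metis complex_cnj_mult complex_cnj_complex_of_real)
 qed
 \<comment> \<open>Positivity at \<open>c *\<^sub>C x + t *\<^sub>C y\<close>; the rotation by
   \<open>c\<close> makes the cross terms real, so a real quadratic in \<open>t\<close>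
   remains.\<close>
 have q: "0 <= al + 2*t*a + t\<^sup>2*\<beta>" for t :: real
 proof -
  have "cinner (app P (c *\<^sub>C x + cor t *\<^sub>C y)) (c *\<^sub>C x + cor t *\<^sub>C y)
    = (c*cnj c)*cinner (app P x) x + t*(c*cinner (app P x) y)
     + t*(cnj c*cinner (app P y) x) + t\<^sup>2*cinner (app P y) y"
   by (simp add: blinfun.add_right cinner_add_left cinner_add_right
    bounded_ops_scaleC[OF P] cinner_scaleC_left cinner_scaleC_right algebra_simps power2_eq_square)
  also have "Re \<dots> = al + 2*t*a + t\<^sup>2*\<beta>"
   unfolding cc ca ca' al_def \<beta>_def by simp
  finally show ?thesis using positive_op_nonneg[OF assms] by metis
 qed
 have a: "a > 0" using False by (simp add: a_def)
 have \<beta>: "\<beta> >= 0" unfolding \<beta>_def using positive_op_nonneg[OF assms] .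
 have "\<beta> ~= 0"
 proof
  assume "\<beta> = 0"
  \<comment> \<open>For \<open>\<beta> = 0\<close> the quadratic is affine in \<open>t\<close>, and
    at this \<open>t\<close> its value is -1.\<close>
  then show False using q[of "- (al + 1) / (2*a)"] a by (simp add: field_simps)
 qed
 then have "\<beta> > 0" using \<beta> by simp
 then have "a\<^sup>2 <= al*\<beta>"
  using q[of "- a / \<beta>"] by (simp add: field_simps power2_eq_square)
 then show ?thesis by (simp add: a_def al_def \<beta>_def)
qed (use positive_op_nonneg[OF assms] in simp)

lemma positive_op_null:
 assumes "positive_op P" "Re (cinner (app P x) x) <= 0" shows "app P x = 0"
proof -
 have "Re (cinner (app P x) x) = 0" using assms positive_op_nonneg by (metis antisym)
 then have "(cmod (cinner (app P x) (app P x)))\<^sup>2 <= 0"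
  using positive_op_cauchy_schwarz[OF assms(1), of x "app P x"] by simp
 then show ?thesis by simp
qed

lemma symmetric_limit_op:
 assumes lim: "X \<longlonglongrightarrow> Y"
  and X: "!!n. X n : bounded_ops"
  and sym: "!!n x y. cinner (app (X n) x) y = cinner x (app (X n) y)"
 shows "Y : bounded_ops" "cinner (app Y x) y = cinner x (app Y y)"
proof -
 have ap: "(%n. app (X n) x) \<longlonglongrightarrow> app Y x" for x
  using lim by (intro tendsto_intros)
 show "Y : bounded_ops"
 proof (rule bounded_opsI)
  fix c x
  have "(%n. app (X n) (c *\<^sub>C x)) \<longlonglongrightarrow> c *\<^sub>C app Y x"
   unfolding bounded_ops_scaleC[OF X] by (intro tendsto_intros ap)
  then show "app Y (c *\<^sub>C x) = c *\<^sub>C app Y x"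
   using ap LIMSEQ_unique by blast
 qed
 have "(%n. cinner (app (X n) x) y) \<longlonglongrightarrow> cinner (app Y x) y"
  "(%n. cinner (app (X n) x) y) \<longlonglongrightarrow> cinner x (app Y y)"
  by (intro tendsto_intros ap, unfold sym, intro tendsto_intros ap)
 then show "cinner (app Y x) y = cinner x (app Y y)"
  using LIMSEQ_unique by blast
qed

text \<open>The square root of \<open>A = 1 - B\<close> is \<open>1 - Y\<close> for the limit \<open>Y\<close> of the iteration
  \<open>Y \<mapsto> (B + Y\<^sup>2) / 2\<close>, which is dominated by the scalar iteration with \<open>B = 1\<close>.\<close>

lemma positive_contraction_sqrt:
 fixes A :: "'h::chilbert_space \<Rightarrow>\<^sub>L 'h"
 assumes A: "positive_op A" and A1: "norm A <= 1"
 shows "EX S. positive_op S & S o\<^sub>L S = A & (ALL C. C o\<^sub>L A = A o\<^sub>L C --> C o\<^sub>L S = S o\<^sub>L C)"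
proof -
 define B where "B = id_blinfun - A"
 have Ab: "A : bounded_ops" using A by (simp add: positive_op_def)
 have Bb: "B : bounded_ops" unfolding B_def by (intro bounded_ops_diff Ab) simp
 have Bsym: "cinner (app B x) y = cinner x (app B y)" for x y
  using positive_op_symmetric[OF A] by (simp add: B_def blinfun.diff_left cinner_diff_left cinner_diff_right)
 \<comment> \<open>Cauchy-Schwarz for the form of \<open>A\<close> gives
   \<open>|A x|^2 \<le> <A x, x>\<close>, whence \<open>|x - A x|^2 \<le> |x|^2\<close>.\<close>
 have B1: "norm B <= 1"
 proof (rule norm_blinfun_bound)
  fix x
  define a where "a = app A x"
  have "(cmod (cinner a a))\<^sup>2 <= Re (cinner a x)*Re (cinner (app A a) a)"
   unfolding a_def by (rule positive_op_cauchy_schwarz[OF A])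
  also have "Re (cinner (app A a) a) <= norm (app A a)*norm a" by (rule Re_cinner_le)
  also have "\<dots> <= (norm a)\<^sup>2"
  proof -
   have "norm (app A a) <= norm A*norm a" by (rule norm_blinfun)
   also have "\<dots> <= 1*norm a" using A1 by (intro mult_right_mono) auto
   finally show ?thesis by (simp add: power2_eq_square mult_right_mono)
  qed
  finally have "((norm a)\<^sup>2)\<^sup>2 <= Re (cinner a x)*(norm a)\<^sup>2"
   using positive_op_nonneg[OF A, of x] by (simp add: cinner_self a_def mult_left_mono norm_power)
  then have *: "(norm a)\<^sup>2 <= Re (cinner a x)"
   using positive_op_nonneg[OF A, of x] by (cases "a = 0") (auto simp: power2_eq_square)
  have "(norm (x + - a))\<^sup>2 = (norm x)\<^sup>2 + (norm a)\<^sup>2 - 2*Re (cinner a x)"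
   unfolding norm_plus_sq by (simp add: inner_commute[of x] inner_cinner[symmetric])
  also have "\<dots> <= (norm x)\<^sup>2"
   using*positive_op_nonneg[OF A, of x] by (simp add: a_def)
  finally show "norm (app B x) <= 1*norm x"
   by (simp add: B_def a_def blinfun.diff_left power2_le_iff_abs_le)
 qed simp
 define Y where "Y = rec_nat 0 (%_ Z. (1/2) *\<^sub>R (B + (Z o\<^sub>L Z)))"
 define y where "y = rec_nat 0 (%_ z. (1 + z*z) / 2 :: real)"
 have Y0 [simp]: "Y 0 = 0" and YS: "Y (Suc n) = (1/2) *\<^sub>R (B + (Y n o\<^sub>L Y n))" for n
  by (simp_all add: Y_def)
 have y0 [simp]: "y 0 = 0" and yS: "y (Suc n) = (1 + y n*y n) / 2" for n
  by (simp_all add: y_def)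
 have y1: "0 <= y n & y n <= 1" for n
 proof (induction n)
  case (Suc n)
  then have "y n*y n <= 1 * 1" by (intro mult_mono) auto
  then show ?case using Suc by (simp add: yS)
 qed simp
 have Yn: "norm (Y n) <= y n" for n
 proof (induction n)
  case (Suc n)
  have "norm (Y n o\<^sub>L Y n) <= norm (Y n)*norm (Y n)" by (rule norm_blinfun_compose)
  also have "\<dots> <= y n*y n" using Suc y1[of n] by (intro mult_mono) auto
  finally show ?case using B1 norm_triangle_ineq[of B "Y n o\<^sub>L Y n"] unfolding YS yS
   by simp
 qed simp
 have comp_diff: "(P o\<^sub>L P) - (Q o\<^sub>L Q) = (P o\<^sub>L (P - Q)) + ((P - Q) o\<^sub>L Q)" for P Q :: "'h \<Rightarrow>\<^sub>L 'h"
  by (rule blinfun_eqI) (simp add: blinfun.add_left blinfun.diff_left blinfun.diff_right)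
 \<comment> \<open>The increments are dominated by those of the scalar iteration because a
   difference of squares splits as \<open>P (P - Q) + (P - Q) Q\<close>, where every factor is
   dominated by its scalar counterpart.\<close>
 have Yd: "norm (Y (Suc n) - Y n) <= y (Suc n) - y n" for n
 proof (induction n)
  case 0
  then show ?case using B1 by (simp add: YS yS)
 next
  case (Suc n)
  have "Y (Suc (Suc n)) - Y (Suc n)
    = (1/2) *\<^sub>R ((Y (Suc n) o\<^sub>L (Y (Suc n) - Y n)) + ((Y (Suc n) - Y n) o\<^sub>L Y n))"
  proof -
   have "(1/2) *\<^sub>R (B + P) - (1/2) *\<^sub>R (B + Q) = (1/2) *\<^sub>R (P - Q)" for P Q :: "'h \<Rightarrow>\<^sub>L 'h"
    by (simp add: algebra_simps)
   then show ?thesis unfolding comp_diff[symmetric] by (metis YS)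
  qed
  also have "norm \<dots> <= (norm (Y (Suc n) o\<^sub>L (Y (Suc n) - Y n)) + norm ((Y (Suc n) - Y n) o\<^sub>L Y n)) / 2"
   by (simp add: norm_triangle_ineq)
  also have "\<dots> <= (norm (Y (Suc n))*norm (Y (Suc n) - Y n) + norm (Y (Suc n) - Y n)*norm (Y n)) / 2"
   by (intro divide_right_mono add_mono norm_blinfun_compose) simp
  also have "\<dots> <= (y (Suc n)*(y (Suc n) - y n) + (y (Suc n) - y n)*y n) / 2"
   using Suc Yn[of n] Yn[of "Suc n"] y1[of n] y1[of "Suc n"] order_trans[OF norm_ge_zero Suc]
   by (intro divide_right_mono add_mono mult_mono) auto
  also have "\<dots> = y (Suc (Suc n)) - y (Suc n)"
  proof -
   have "(p*(p - q) + (p - q)*q) / 2 = r - p" if "r = (1 + p*p) / 2" "p = (1 + q*q) / 2" for p q r :: real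
   proof -
    have "2*p = 1 + q*q" using that(2) by simp
    moreover have "2*r = 1 + p*p" using that(1) by simp
    moreover have "p*(p - q) + (p - q)*q = p*p - q*q" by (simp add: algebra_simps)
    ultimately have "p*(p - q) + (p - q)*q = 2*(r - p)" by argo
    then show ?thesis by simp
   qed
   then show ?thesis using yS[of "Suc n"] yS[of n] by blast
  qed
  finally show ?case .
 qed
 have Ymn: "norm (Y (n + k) - Y n) <= y (n + k) - y n" for n k
 proof (induction k)
  case (Suc k)
  have "norm (Y (n + Suc k) - Y n) <= norm (Y (Suc (n + k)) - Y (n + k)) + norm (Y (n + k) - Y n)"
   using norm_triangle_ineq[of "Y (Suc (n + k)) - Y (n + k)" "Y (n + k) - Y n"] by simp
  then show ?case using Suc Yd[of "n + k"] by simp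
 qed simp
 have "incseq y"
  by (rule incseq_SucI) (use order_trans[OF norm_ge_zero Yd] in simp)
 then have "convergent y" using y1
  by (metis incseq_convergent convergent_def)
 then have Cy: "Cauchy y" by (rule convergent_Cauchy)
 have "Cauchy Y"
 proof (rule CauchyI')
  fix e :: real assume "e > 0"
  then obtain M where M: "!!m n. m >= M ==> n >= M ==> norm (y m - y n) < e"
   using CauchyD[OF Cy] by blast
  show "EX M. ALL m>=M. ALL n>m. dist (Y m) (Y n) < e"
  proof (intro exI allI impI)
   fix m n assume "M <= m" "m < n"
   then obtain k where "n = m + k" using less_imp_add_positive by blast
   then show "dist (Y m) (Y n) < e"
    using Ymn[of m k] M[of n m] \<open>M <= m\<close> by (simp add: dist_norm norm_minus_commute)
  qed
 qed
 then obtain Z where Z: "Y \<longlonglongrightarrow> Z" using Cauchy_convergent convergent_def by blast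
 have Yb: "Y n : bounded_ops" for n
  by (induction n) (auto simp: YS intro: bounded_ops_scaleR bounded_ops_add bounded_ops_compose Bb)
 have Ysym: "cinner (app (Y n) x) y = cinner x (app (Y n) y)" for n x y
  by (induction n arbitrary: x y)
   (simp_all add: YS blinfun.add_left blinfun.scaleR_left bounded_bilinear_cinner.scaleR_left
    bounded_bilinear_cinner.scaleR_right cinner_add_left cinner_add_right Bsym)
 note Zb = symmetric_limit_op(1)[OF Z Yb Ysym] and Zsym = symmetric_limit_op(2)[OF Z Yb Ysym]
 have "(%n. norm (Y n)) \<longlonglongrightarrow> norm Z" using Z by (rule tendsto_norm)
 then have Z1: "norm Z <= 1"
  by (rule LIMSEQ_le_const2) (use Yn y1 order_trans in blast)
 note comp_tendsto = bounded_bilinear.tendsto[OF bounded_bilinear_blinfun_compose]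
 have "(%n. (1/2) *\<^sub>R (B + (Y n o\<^sub>L Y n))) \<longlonglongrightarrow> (1/2) *\<^sub>R (B + (Z o\<^sub>L Z))"
  by (intro tendsto_intros comp_tendsto Z)
 then have "Z = (1/2) *\<^sub>R (B + (Z o\<^sub>L Z))"
  using LIMSEQ_Suc[OF Z] unfolding YS by (rule LIMSEQ_unique[rotated])
 then have "2 *\<^sub>R Z = B + (Z o\<^sub>L Z)"
  by (metis scaleR_half_double scaleR_2 scaleR_add_right)
 then have ZZ: "Z o\<^sub>L Z = 2 *\<^sub>R Z - B" by simp
 define S where "S = id_blinfun - Z"
 have "S o\<^sub>L S = id_blinfun - 2 *\<^sub>R Z + (Z o\<^sub>L Z)"
  unfolding S_def by (rule blinfun_eqI) (simp add: blinfun.add_left blinfun.diff_left blinfun.diff_right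
    blinfun.scaleR_left scaleR_2)
 then have SS: "S o\<^sub>L S = A" by (simp add: ZZ B_def)
 have "positive_op S"
 proof (rule positive_opI)
  show "S : bounded_ops" unfolding S_def by (intro bounded_ops_diff Zb) simp
  show "cinner (app S x) y = cinner x (app S y)" for x y
   by (simp add: S_def blinfun.diff_left cinner_diff_left cinner_diff_right Zsym)
  fix x
  have "Re (cinner (app Z x) x) <= norm (app Z x)*norm x" by (rule Re_cinner_le)
  also have "\<dots> <= (norm Z*norm x)*norm x" by (intro mult_right_mono norm_blinfun) simp
  also have "\<dots> <= (1*norm x)*norm x" using Z1 by (intro mult_right_mono) auto
  finally show "0 <= Re (cinner (app S x) x)"
   by (simp add: S_def blinfun.diff_left cinner_diff_left cinner_self power2_eq_square)
 qed
 moreover have "C o\<^sub>L S = S o\<^sub>L C" if C: "C o\<^sub>L A = A o\<^sub>L C" for C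
 proof -
  have CB: "C o\<^sub>L B = B o\<^sub>L C"
   unfolding B_def by (rule blinfun_eqI) (use arg_cong[OF C, of app] in
     \<open>simp add: blinfun.diff_left blinfun.diff_right fun_eq_iff\<close>)
  have CY: "C o\<^sub>L Y n = Y n o\<^sub>L C" for n
  proof (induction n)
   case (Suc n)
   have "app C (app B x) = app B (app C x)"
    "app C (app (Y n) x) = app (Y n) (app C x)" for x
    using arg_cong[OF CB, of app] arg_cong[OF Suc, of app] by (simp_all add: fun_eq_iff)
   then show ?case
    by (intro blinfun_eqI) (simp add: YS blinfun.add_left blinfun.add_right blinfun.scaleR_left blinfun.scaleR_right)
  qed (auto intro: blinfun_eqI)
  have "(%n. C o\<^sub>L Y n) \<longlonglongrightarrow> (C o\<^sub>L Z)" "(%n. C o\<^sub>L Y n) \<longlonglongrightarrow> (Z o\<^sub>L C)"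
   by (intro comp_tendsto Z tendsto_const, unfold CY, intro comp_tendsto Z tendsto_const)
  then have "C o\<^sub>L Z = Z o\<^sub>L C" by (rule LIMSEQ_unique)
  then have "app C (app Z x) = app Z (app C x)" for x
   by (metis blinfun_apply_blinfun_compose)
  then show ?thesis
   unfolding S_def by (intro blinfun_eqI) (simp add: blinfun.diff_left blinfun.diff_right)
 qed
 ultimately show ?thesis using SS by blast
qed

text \<open>Scaling reduces this to contractions. The commutation clause serves uniqueness: another
  root of \<open>A\<close> commutes with \<open>A\<close>, hence with \<open>S\<close>, and
  commuting positive roots agree.\<close>

lemma positive_sqrt_exists:
 fixes A :: "'h::chilbert_space \<Rightarrow>\<^sub>L 'h"
 assumes A: "positive_op A"
 shows "EX S. positive_op S & S o\<^sub>L S = A & (ALL C. C o\<^sub>L A = A o\<^sub>L C --> C o\<^sub>L S = S o\<^sub>L C)"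
proof -
 define r where "r = norm A + 1"
 have r: "r > 0" by (simp add: r_def add_nonneg_pos)
 have scale: "positive_op (t *\<^sub>R P)" if "positive_op P" "0 <= t" for t and P :: "'h \<Rightarrow>\<^sub>L 'h"
  using that by (auto simp: positive_op_def bounded_ops_scaleR blinfun.scaleR_left
    bounded_bilinear_cinner.scaleR_left complex_nonneg_Reals_iff)
 have "norm ((1/r) *\<^sub>R A) <= 1"
 proof -
  have "norm ((1/r) *\<^sub>R A) = norm A / r" using r by simp
  also have "\<dots> <= 1" by (rule divide_le_eq_1_pos[OF r, THEN iffD2]) (simp add: r_def)
  finally show ?thesis .
 qed
 then obtain S where S: "positive_op S" "S o\<^sub>L S = (1/r) *\<^sub>R A"
  "!!C. C o\<^sub>L ((1/r) *\<^sub>R A) = ((1/r) *\<^sub>R A) o\<^sub>L C ==> C o\<^sub>L S = S o\<^sub>L C"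
  using positive_contraction_sqrt[of "(1/r) *\<^sub>R A"] scale[OF A, of "1/r"] less_imp_le[of 0 "1/r"] r
  by (metis zero_less_divide_1_iff)
 note comp_scaleR = bounded_bilinear.scaleR_left[OF bounded_bilinear_blinfun_compose]
  bounded_bilinear.scaleR_right[OF bounded_bilinear_blinfun_compose]
 have "(sqrt r *\<^sub>R S) o\<^sub>L (sqrt r *\<^sub>R S) = A"
  using r by (simp add: comp_scaleR S(2))
 moreover have "C o\<^sub>L (sqrt r *\<^sub>R S) = (sqrt r *\<^sub>R S) o\<^sub>L C" if "C o\<^sub>L A = A o\<^sub>L C" for C
 proof -
  have "C o\<^sub>L S = S o\<^sub>L C" by (rule S(3)) (simp add: comp_scaleR that)
  then show ?thesis by (simp add: comp_scaleR)
 qed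
 ultimately show ?thesis
  using scale[OF S(1), of "sqrt r"] r real_sqrt_ge_zero[of r] less_imp_le[of 0 r] by blast
qed

text \<open>For \<open>z = P x - Q x\<close> the vector \<open>P z + Q z\<close> is
  \<open>(P\<^sup>2 - Q\<^sup>2) x = 0\<close>, so both positive forms vanish at \<open>z\<close>
  and \<open>P z = Q z = 0\<close>. Symmetry then moves \<open>P\<close> and \<open>Q\<close> onto
  the second \<open>z\<close> in \<open>cinner z z\<close>.\<close>

lemma positive_sqrt_unique:
 fixes P Q :: "'h::chilbert_space \<Rightarrow>\<^sub>L 'h"
 assumes P: "positive_op P" and Q: "positive_op Q" and eq: "P o\<^sub>L P = Q o\<^sub>L Q"
  and comm: "P o\<^sub>L Q = Q o\<^sub>L P"
 shows "P = Q"
proof (rule blinfun_eqI)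
 fix x
 have PQ: "app P (app Q x) = app Q (app P x)"
  and PP: "app P (app P x) = app Q (app Q x)" for x
  using arg_cong[OF comm, of app] arg_cong[OF eq, of app] by (simp_all add: fun_eq_iff)
 define z where "z = app P x - app Q x"
 have "app P z + app Q z = 0"
  by (simp add: z_def blinfun.diff_right PQ PP)
 then have "cinner (app P z) z + cinner (app Q z) z = 0"
  by (metis cinner_add_left cinner_zero_left)
 then have "Re (cinner (app P z) z) + Re (cinner (app Q z) z) = 0"
  by (metis plus_complex.sel(1) zero_complex.sel(1))
 then have "app P z = 0" "app Q z = 0"
  using positive_op_nonneg[OF P, of z] positive_op_nonneg[OF Q, of z]
  by (auto intro!: positive_op_null P Q)
 then have "cinner z z = 0"
  using positive_op_symmetric[OF P, of x z] positive_op_symmetric[OF Q, of x z]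
  by (subst z_def) (simp add: cinner_diff_left)
 then show "app P x = app Q x" by (simp add: z_def)
qed

lemma abs_op:
 fixes T :: "'h::chilbert_space \<Rightarrow>\<^sub>L 'h"
 assumes T: "T : bounded_ops"
 shows "positive_op (abs_op T)" "abs_op T o\<^sub>L abs_op T = adj_op T o\<^sub>L T"
proof -
 define A where "A = adj_op T o\<^sub>L T"
 have A: "positive_op A"
  by (rule positive_opI)
   (auto simp: A_def cinner_adj_left cinner_adj_right T bounded_ops_compose adj_op_bounded_ops cinner_self)
 obtain S where S: "positive_op S" "S o\<^sub>L S = A" "!!C. C o\<^sub>L A = A o\<^sub>L C ==> C o\<^sub>L S = S o\<^sub>L C"
  using positive_sqrt_exists[OF A] by blast
 have "\<exists>!P. positive_op P & P o\<^sub>L P = A"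
 proof (rule ex1I[of _ S])
  fix P assume P: "positive_op P & P o\<^sub>L P = A"
  then have "P o\<^sub>L A = A o\<^sub>L P" by (intro blinfun_eqI) auto
  then have "P o\<^sub>L S = S o\<^sub>L P" by (rule S(3))
  then show "P = S" using S(1,2) P by (metis positive_sqrt_unique)
 qed (use S(1,2) in simp)
 then have "positive_op (abs_op T) & abs_op T o\<^sub>L abs_op T = A"
  unfolding abs_op_def A_def by (rule theI')
 then show "positive_op (abs_op T)" "abs_op T o\<^sub>L abs_op T = adj_op T o\<^sub>L T"
  by (simp_all add: A_def)
qed

lemma cinner_abs_op:
 assumes T: "T : bounded_ops"
 shows "cinner (app (abs_op T) x) (app (abs_op T) y)
  = cinner (app T x) (app T y)"
proof -
 have "cinner (app (abs_op T) x) (app (abs_op T) y)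
   = cinner (app (abs_op T o\<^sub>L abs_op T) x) y"
  by (simp add: positive_op_symmetric[OF abs_op(1)[OF T]])
 then show ?thesis by (simp add: abs_op(2)[OF T] cinner_adj_left[OF T])
qed

lemma norm_abs_op: "T : bounded_ops ==> norm (app (abs_op T) x) = norm (app T x)"
 using cinner_abs_op[of T x x] by (simp add: norm_eq_sqrt_inner inner_cinner)

text \<open>\<open>V\<close> is the adjoint of the partial isometry
  \<open>|T| x \<mapsto> T x\<close>. It is obtained directly from Riesz vectors lying in the
  closure of the range of \<open>|T|\<close>, and their uniqueness there gives
  \<open>V T = |T|\<close>.\<close>

lemma polar_decomposition:
 fixes T :: "'h::chilbert_space \<Rightarrow>\<^sub>L 'h"
 assumes T: "T : bounded_ops"
 shows "EX V:bounded_ops. norm V <= 1 & V o\<^sub>L T = abs_op T & adj_op V o\<^sub>L abs_op T = T"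
proof -
 let ?A = "abs_op T"
 define D where "D = range (app ?A)"
 have Ab: "?A : bounded_ops" using abs_op(1)[OF T] by (simp add: positive_op_def)
 have D: "cvec.subspace D"
 proof (rule cvec.subspaceI)
  show "0 : D" unfolding D_def by (rule image_eqI[of _ _ 0]) auto
  show "x + y : D" if "x : D" "y : D" for x y
   using that unfolding D_def by (auto simp: blinfun.add_right[symmetric])
  show "c *\<^sub>C x : D" if "x : D" for c x
   using that unfolding D_def by (auto simp: bounded_ops_scaleC[OF Ab, symmetric])
 qed
 \<comment> \<open>The chosen preimage is immaterial, since \<open>abs_op T\<close> and
   \<open>T\<close> have the same kernel.\<close>
 define U where "U d = app T (SOME x. app ?A x = d)" for d
 have UA: "U (app ?A x) = app T x" for x
 proof -
  define x' where "x' = (SOME z. app ?A z = app ?A x)"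
  have "app ?A x' = app ?A x" unfolding x'_def by (rule someI) simp
  then have "norm (app T (x' - x)) = 0"
   using norm_abs_op[OF T, of "x' - x"] by (simp add: blinfun.diff_right)
  then show ?thesis by (simp add: U_def x'_def[symmetric] blinfun.diff_right)
 qed
 have "EX z:closure D. (ALL d:D. cinner (U d) y = cinner d z) & norm z <= norm y" for y
 proof (rule riesz_subspace[OF D])
  show "cinner (U (d + d')) y = cinner (U d) y + cinner (U d') y" if "d : D" "d' : D" for d d'
   using that by (auto simp: D_def blinfun.add_right[symmetric] cinner_add_left[symmetric] UA)
  show "cinner (U (c *\<^sub>C d)) y = c*cinner (U d) y" if "d : D" for c d
   using that by (auto simp: D_def bounded_ops_scaleC[OF Ab, symmetric] UA
     bounded_ops_scaleC[OF T] cinner_scaleC_left)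
  show "cmod (cinner (U d) y) <= norm y*norm d" if "d : D" for d
   using that cinner_norm_le[of "U d" y] norm_abs_op[OF T]
   by (auto simp: D_def UA mult.commute)
 qed simp
 then obtain V where Vc: "!!y. V y : closure D"
  and V: "!!y d. d : D ==> cinner (U d) y = cinner d (V y)"
  and Vn: "!!y. norm (V y) <= norm y" by metis
 have VA: "cinner (app T x) y = cinner (app ?A x) (V y)" for x y
  using V[of "app ?A x" y] by (simp add: D_def UA)
 have Vadd: "V (x + y) = V x + V y" for x y
  by (rule riesz_closure_unique[OF D])
   (auto simp: Vc V[symmetric] cinner_add_right cvec.subspace_add[OF csubspace_closure[OF D]])
 have Vscale: "V (c *\<^sub>C x) = c *\<^sub>C V x" for c x
  by (rule riesz_closure_unique[OF D])
   (auto simp: Vc V[symmetric] cinner_scaleC_right cvec.subspace_scale[OF csubspace_closure[OF D]])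
 note op = op_of_linear[of V 1, OF Vadd Vscale]
 have Vb: "Blinfun V : bounded_ops" and Va: "app (Blinfun V) = V"
  and V1: "norm (Blinfun V) <= 1" using op Vn by auto
 have "V (app T x) = app ?A x" for x
 proof (rule riesz_closure_unique[OF D])
  fix d assume "d : D"
  then obtain z where d: "d = app ?A z" by (auto simp: D_def)
  show "cinner d (V (app T x)) = cinner d (app ?A x)"
   unfolding d VA[symmetric] cinner_abs_op[OF T] ..
 qed (use Vc closure_subset[of D] in \<open>auto simp: D_def\<close>)
 then have "Blinfun V o\<^sub>L T = ?A" by (intro blinfun_eqI) (simp add: Va)
 moreover have "adj_op (Blinfun V) o\<^sub>L ?A = T"
  by (rule op_eqI) (simp add: cinner_adj_left[OF Vb] Va VA)
 ultimately show ?thesis using Vb V1 by blast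
qed

subsection \<open>Orthonormal families\<close>

definition orthonormal :: "'h::complex_inner set => bool"
 where "orthonormal E \<longleftrightarrow> (ALL e:E. ALL e':E. cinner e e' = (if e = e' then 1 else 0))"

lemma orthonormal_basis_iff: "orthonormal_basis E \<longleftrightarrow> orthonormal E & closure (cvec.span E) = UNIV"
 by (simp add: orthonormal_basis_def orthonormal_def)

text \<open>Completing the square in the coefficients. Bessel's inequality and the optimality of the
  Fourier coefficients are both read off from the last sum.\<close>

lemma orthonormal_proj_dist:
 assumes "orthonormal F" "finite F"
 shows "(norm (x - (\<Sum>e\<in>F. c e *\<^sub>C e)))\<^sup>2
  = (norm x)\<^sup>2 - (\<Sum>e\<in>F. (cmod (cinner x e))\<^sup>2) + (\<Sum>e\<in>F. (cmod (cinner x e - c e))\<^sup>2)"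
proof -
 define y where "y = (\<Sum>e\<in>F. c e *\<^sub>C e)"
 have ye: "cinner y e = c e" if "e : F" for e
 proof -
  have "cinner y e = (\<Sum>e'\<in>F. c e'*(if e' = e then 1 else 0))"
   unfolding y_def cinner_sum_left cinner_scaleC_left using assms(1) that
   by (intro sum.cong) (auto simp: orthonormal_def)
  then show ?thesis using that assms(2) by (simp add: sum.delta if_distrib cong: if_cong)
 qed
 have yy: "cinner y y = (\<Sum>e\<in>F. cnj (c e)*c e)"
  by (subst (2) y_def) (simp add: cinner_sum_right cinner_scaleC_right ye)
 have xy: "cinner x y = (\<Sum>e\<in>F. cnj (c e)*cinner x e)"
  by (simp add: y_def cinner_sum_right cinner_scaleC_right)
 have "cor ((norm (x - y))\<^sup>2) = cinner x x - cinner x y - cnj (cinner x y) + cinner y y"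
  unfolding cinner_self[symmetric] by (simp add: cinner_diff_left cinner_diff_right cinner_commute[of y x])
 also have "\<dots> = cor ((norm x)\<^sup>2) + (\<Sum>e\<in>F. - (cnj (c e)*cinner x e)
   - c e*cnj (cinner x e) + cnj (c e)*c e)"
  unfolding yy xy cinner_self[of x] by (simp add: sum.distrib sum_subtractf sum_negf)
 also have "\<dots> = cor ((norm x)\<^sup>2) + (\<Sum>e\<in>F. cor ((cmod (cinner x e - c e))\<^sup>2
   - (cmod (cinner x e))\<^sup>2))"
  by (intro arg_cong2[of _ _ _ _ "(+)"] sum.cong refl)
   (simp add: complex_norm_square algebra_simps del: of_real_power)
 also have "\<dots> = cor ((norm x)\<^sup>2 + (\<Sum>e\<in>F. (cmod (cinner x e - c e))\<^sup>2
   - (cmod (cinner x e))\<^sup>2))" by simp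
 finally have "(norm (x - y))\<^sup>2 = (norm x)\<^sup>2 + (\<Sum>e\<in>F. (cmod (cinner x e - c e))\<^sup>2
   - (cmod (cinner x e))\<^sup>2)" by (simp only: of_real_eq_iff)
 then show ?thesis by (simp add: y_def sum_subtractf)
qed

lemma bessel: "orthonormal F ==> finite F ==> (\<Sum>e\<in>F. (cmod (cinner x e))\<^sup>2) <= (norm x)\<^sup>2"
 using orthonormal_proj_dist[of F x "%e. cinner x e"]
  zero_le_power2[of "norm (x - (\<Sum>e\<in>F. cinner x e *\<^sub>C e))"] by simp

lemma orthonormal_best_approx:
 assumes "orthonormal F" "finite F"
 shows "norm (x - (\<Sum>e\<in>F. cinner x e *\<^sub>C e)) <= norm (x - (\<Sum>e\<in>F. c e *\<^sub>C e))"
proof -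
 have "(norm (x - (\<Sum>e\<in>F. cinner x e *\<^sub>C e)))\<^sup>2 <= (norm (x - (\<Sum>e\<in>F. c e *\<^sub>C e)))\<^sup>2"
  unfolding orthonormal_proj_dist[OF assms] by (simp add: sum_nonneg)
 then show ?thesis by (simp add: power2_le_iff_abs_le)
qed

lemma orthonormal_subset: "orthonormal E ==> F \<subseteq> E ==> orthonormal F"
 unfolding orthonormal_def by blast

lemma orthonormal_basis_exists: "EX E :: 'h::chilbert_space set. orthonormal_basis E"
proof -
 define A where "A = {E :: 'h set. orthonormal E}"
 have "EX M:A. ALL X:A. M \<subseteq> X --> X = M"
 proof (rule subset_Zorn_nonempty)
  show "A ~= {}" by (auto simp: A_def orthonormal_def)
  fix \<C> assume "\<C> ~= {}" and ch: "subset.chain A \<C>"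
  show "\<Union> \<C> : A"
   unfolding A_def orthonormal_def
  proof (intro CollectI ballI)
   fix e e' assume "e : \<Union> \<C>" "e' : \<Union> \<C>"
   then obtain X where "X : \<C>" "e : X" "e' : X"
    using ch by (auto simp: subset.chain_def) blast
   then show "cinner e e' = (if e = e' then 1 else 0)"
    using ch by (auto simp: subset.chain_def A_def orthonormal_def)
  qed
 qed
 then obtain E :: "'h set" where E: "orthonormal E" "!!X. orthonormal X ==> E \<subseteq> X ==> X = E"
  unfolding A_def by blast
 have "closure (cvec.span E) = UNIV"
 proof (rule ccontr)
  assume "closure (cvec.span E) ~= UNIV"
  then obtain x where x: "x ~: closure (cvec.span E)" by auto
  \<comment> \<open>Restricting \<open>cinner _ x\<close> to the span yields the orthogonal
    projection \<open>z\<close> of \<open>x\<close>; normalising \<open>x - z\<close> would then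
    enlarge the maximal family.\<close>
  have "EX z:closure (cvec.span E). (ALL d:cvec.span E. cinner d x = cinner d z) & norm z <= norm x"
   by (rule riesz_subspace)
    (auto simp: cinner_add_left cinner_scaleC_left cinner_norm_le mult.commute[of "norm x"])
  then obtain z where z: "z : closure (cvec.span E)" "!!d. d : cvec.span E ==> cinner d x = cinner d z"
   by blast
  define e where "e = (1 / norm (x - z)) *\<^sub>R (x - z)"
  have "x - z ~= 0" using x z by auto
  then have "norm e = 1" by (simp add: e_def)
  then have ee: "cinner e e = 1" by (simp add: cinner_self)
  have de: "cinner d e = 0" if "d : E" for d
   using z(2)[OF cvec.span_base[OF that]]
   by (simp add: e_def bounded_bilinear_cinner.scaleR_right cinner_diff_right)
  then have ed: "cinner e d = 0" if "d : E" for d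
   using that cinner_commute[of e d] by simp
  have "orthonormal (insert e E)"
   using E(1) ee de ed unfolding orthonormal_def by auto
  then have "e : E" using E(2) by blast
  then show False using de ee by fastforce
 qed
 then show ?thesis using E by (auto simp: orthonormal_basis_iff)
qed

lemma some_basis: "orthonormal_basis some_basis"
 unfolding some_basis_def by (rule someI_ex[OF orthonormal_basis_exists])

lemma orthonormal_basis_approx:
 assumes E: "orthonormal_basis E" and "0 < ep"
 shows "EX F0. finite F0 & F0 \<subseteq> E & (ALL F. finite F & F0 \<subseteq> F & F \<subseteq> E -->
  norm (x - (\<Sum>e\<in>F. cinner x e *\<^sub>C e)) < ep)"
proof -
 have "x : closure (cvec.span E)" using E by (simp add: orthonormal_basis_iff)
 then obtain y where y: "y : cvec.span E" "norm (x - y) < ep"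
  using \<open>0 < ep\<close> by (metis closure_approachable dist_norm norm_minus_commute)
 then obtain F0 c where F0: "finite F0" "F0 \<subseteq> E" "y = (\<Sum>e\<in>F0. c e *\<^sub>C e)"
  unfolding cvec.span_explicit by blast
 have "norm (x - (\<Sum>e\<in>F. cinner x e *\<^sub>C e)) < ep" if F: "finite F" "F0 \<subseteq> F" "F \<subseteq> E" for F
 proof -
  have "orthonormal F" using E F by (auto simp: orthonormal_basis_iff intro: orthonormal_subset)
  then have "norm (x - (\<Sum>e\<in>F. cinner x e *\<^sub>C e))
    <= norm (x - (\<Sum>e\<in>F. (if e : F0 then c e else 0) *\<^sub>C e))"
   using F by (intro orthonormal_best_approx)
  also have "(\<Sum>e\<in>F. (if e : F0 then c e else 0) *\<^sub>C e) = y"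
   unfolding F0(3) using F by (intro sum.mono_neutral_cong_right) auto
  finally show ?thesis using y by simp
 qed
 then show ?thesis using F0 by blast
qed

lemma parseval:
 assumes E: "orthonormal_basis E"
 shows "((%e. cinner x e*cinner e y) has_sum cinner x y) E"
 unfolding has_sum_def tendsto_iff
proof (intro allI impI)
 fix ep :: real assume ep: "0 < ep"
 have ny: "0 < norm y + 1" by (rule add_nonneg_pos) simp_all
 then have "0 < ep / (norm y + 1)" using ep by (rule divide_pos_pos[rotated])
 from orthonormal_basis_approx[OF E this, of x] obtain F0 where F0: "finite F0" "F0 \<subseteq> E"
  "ALL F. finite F & F0 \<subseteq> F & F \<subseteq> E --> norm (x - (\<Sum>e\<in>F. cinner x e *\<^sub>C e)) < ep / (norm y + 1)"
  by (elim exE conjE)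
 show "\<forall>\<^sub>F F in finite_subsets_at_top E. dist (\<Sum>e\<in>F. cinner x e*cinner e y) (cinner x y) < ep"
  unfolding eventually_finite_subsets_at_top
 proof (intro exI[of _ F0] conjI allI impI F0)
  fix F assume F: "finite F & F0 \<subseteq> F & F \<subseteq> E"
  have "dist (\<Sum>e\<in>F. cinner x e*cinner e y) (cinner x y)
    = cmod (cinner (x - (\<Sum>e\<in>F. cinner x e *\<^sub>C e)) y)"
   by (simp add: dist_norm norm_minus_commute cinner_diff_left cinner_sum_left cinner_scaleC_left)
  also have "\<dots> <= norm (x - (\<Sum>e\<in>F. cinner x e *\<^sub>C e))*norm y" by (rule cinner_norm_le)
  also have "\<dots> <= ep / (norm y + 1)*norm y"
   using F0(3)[rule_format, OF F] by (intro mult_right_mono) simp_all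
  also have "\<dots> = ep*(norm y / (norm y + 1))" by simp
  also have "\<dots> < ep * 1" using ep ny by (intro mult_strict_left_mono) (simp_all add: divide_less_eq)
  also have "\<dots> = ep" by simp
  finally show "dist (\<Sum>e\<in>F. cinner x e*cinner e y) (cinner x y) < ep" .
 qed
qed

text \<open>The orthonormal vectors stay in the given subspace; for compactly supported functions
  this keeps their slices compactly supported. The length \<open>n\<close> is left open because
  dependent vectors add nothing.\<close>

lemma gram_schmidt:
 fixes xi :: "'i => 'h::complex_inner"
 assumes "finite I" "!!i. i : I ==> xi i : D" and D: "cvec.subspace D"
 shows "EX (n::nat) e al. (ALL j<n. e j : D) &
  (ALL j<n. ALL k<n. cinner (e j) (e k) = (if j = k then 1 else 0)) &
  (ALL i:I. xi i = (\<Sum>j<n. al i j *\<^sub>C e j))"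
 using assms(1,2)
proof (induction I rule: finite_induct)
 case (insert i I)
 have "EX (n::nat) e al. (ALL j<n. e j : D) &
  (ALL j<n. ALL k<n. cinner (e j) (e k) = (if j = k then 1 else 0)) &
  (ALL i:I. xi i = (\<Sum>j<n. al i j *\<^sub>C e j))"
  by (rule insert.IH) (use insert.prems in simp)
 then obtain n :: nat and e al where h: "ALL j<n. e j : D"
  "ALL j<n. ALL k<n. cinner (e j) (e k) = (if j = k then 1 else 0)"
  "ALL i:I. xi i = (\<Sum>j<n. al i j *\<^sub>C e j)" by blast
 then have D1: "!!j. j < n ==> e j : D"
  and on: "!!j k. j < n ==> k < n ==> cinner (e j) (e k) = (if j = k then 1 else 0)"
  and ex: "!!l. l : I ==> xi l = (\<Sum>j<n. al l j *\<^sub>C e j)" by blast+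
 define p where "p = (\<Sum>j<n. cinner (xi i) (e j) *\<^sub>C e j)"
 define z where "z = xi i - p"
 have zD: "z : D" unfolding z_def p_def using insert.prems
  by (intro cvec.subspace_diff[OF D] cvec.subspace_sum[OF D] cvec.subspace_scale[OF D] D1) auto
 have pe: "cinner p (e k) = cinner (xi i) (e k)" if "k < n" for k
 proof -
  have "cinner p (e k) = (\<Sum>j<n. cinner (xi i) (e j)*(if j = k then 1 else 0))"
   unfolding p_def cinner_sum_left cinner_scaleC_left using on that by (intro sum.cong) auto
  then show ?thesis using that by (simp add: if_distrib cong: if_cong)
 qed
 have ze: "cinner z (e k) = 0" if "k < n" for k using pe[OF that] by (simp add: z_def cinner_diff_left)
 then have ez: "cinner (e k) z = 0" if "k < n" for k using that cinner_commute[of "e k" z] by simp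
 show ?case
 proof (cases "z = 0")
  case True
  then show ?thesis
   using D1 on ex insert.hyps
   by (intro exI[of _ n] exI[of _ e] exI[of _ "al(i := %j. cinner (xi i) (e j))"])
    (auto simp: z_def p_def)
 next
  case False
  define w where "w = (1 / norm z) *\<^sub>R z"
  have w: "w : D" unfolding w_def scaleR_scaleC by (rule cvec.subspace_scale[OF D zD])
  have ww: "cinner w w = 1" using False by (simp add: w_def cinner_self)
  have we: "cinner w (e k) = 0" "cinner (e k) w = 0" if "k < n" for k
   using ze[OF that] ez[OF that]
   by (simp_all add: w_def bounded_bilinear_cinner.scaleR_left bounded_bilinear_cinner.scaleR_right)
  have zw: "z = cor (norm z) *\<^sub>C w"
   using False by (simp add: w_def scaleR_scaleC[symmetric])
  define e' where "e' = e(n := w)"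
  define al' where "al' l j = (if l = i then (if j < n then cinner (xi i) (e j) else cor (norm z))
   else if j < n then al l j else 0)" for l j
  have "xi i = (\<Sum>j<Suc n. al' i j *\<^sub>C e' j)"
   using zw by (simp add: al'_def e'_def z_def p_def algebra_simps)
  moreover have "xi l = (\<Sum>j<Suc n. al' l j *\<^sub>C e' j)" if "l : I" for l
   using ex[OF that] that insert.hyps by (auto simp: al'_def e'_def intro!: sum.cong)
  ultimately show ?thesis
   using D1 on w ww we
   by (intro exI[of _ "Suc n"] exI[of _ e'] exI[of _ al']) (auto simp: e'_def less_Suc_eq)
 qed
qed (rule exI[of _ 0], auto)

subsection \<open>Trace class operators\<close>

text \<open>A nuclear representation of \<open>om\<close> as a sum of rank one operators
  \<open><., eta i> xi i\<close>, read weakly. It replaces the absolute value and the fixed basis in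
  most later arguments on trace class operators.\<close>

definition nuclear :: "'i set => ('i => 'h::chilbert_space) => ('i => 'h) => ('h \<Rightarrow>\<^sub>L 'h) => bool"
 where "nuclear I xi eta om \<longleftrightarrow> om : bounded_ops & (%i. norm (xi i)*norm (eta i)) summable_on I &
  (ALL x y. ((%i. cinner x (eta i)*cinner (xi i) y) has_sum cinner (app om x) y) I)"

lemma orthonormal_sum_mult_le:
 assumes "orthonormal F" "finite F"
 shows "(\<Sum>e\<in>F. cmod (cinner x e)*cmod (cinner y e)) <= norm x*norm y"
proof -
 have L: "L2_set (%e. cmod (cinner z e)) F <= norm z" for z
  unfolding L2_set_def using bessel[OF assms, of z] by (simp add: real_le_lsqrt)
 have "(\<Sum>e\<in>F. \<bar>cmod (cinner x e)\<bar>*\<bar>cmod (cinner y e)\<bar>)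
   <= L2_set (%e. cmod (cinner x e)) F*L2_set (%e. cmod (cinner y e)) F"
  by (rule L2_set_mult_ineq)
 also have "\<dots> <= norm x*norm y" by (intro mult_mono L) (auto simp: L2_set_nonneg)
 finally show ?thesis by simp
qed

lemma some_basis_finite: "F \<subseteq> some_basis ==> orthonormal F"
 using some_basis orthonormal_subset by (auto simp: orthonormal_basis_iff)

lemma basis_mult_summable:
 fixes x y :: "'h::chilbert_space"
 shows "(%e. cmod (cinner x e)*cmod (cinner y e)) summable_on some_basis"
  and "(\<Sum>\<^sub>\<infinity>e\<in>some_basis. cmod (cinner x e)*cmod (cinner y e)) <= norm x*norm y"
proof -
 have le: "(\<Sum>e\<in>F. cmod (cinner x e)*cmod (cinner y e)) <= norm x*norm y"
  if "finite F" "F \<subseteq> some_basis" for F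
  using orthonormal_sum_mult_le[OF some_basis_finite] that by blast
 show s: "(%e. cmod (cinner x e)*cmod (cinner y e)) summable_on some_basis"
  by (rule nonneg_bdd_above_summable_on) (auto intro!: bdd_aboveI[of _ "norm x*norm y"] le)
 show "(\<Sum>\<^sub>\<infinity>e\<in>some_basis. cmod (cinner x e)*cmod (cinner y e)) <= norm x*norm y"
  by (rule infsum_le_finite_sums[OF s le])
qed

text \<open>The family indexed by pairs of an index and a basis vector is absolutely summable, so
  both orders of summation agree: one gives the trace in the fixed basis, the other, by Parseval, an
  expression free of that basis.\<close>

lemma nuclear_pairing:
 fixes T om :: "'h::chilbert_space \<Rightarrow>\<^sub>L 'h"
 assumes n: "nuclear I xi eta om" and T: "T : bounded_ops"
 shows "((%i. cinner (app T (xi i)) (eta i)) has_sum trace_pairing T om) I"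
proof -
 define f where "f = (%(i, e). cinner e (eta i)*cinner (app T (xi i)) e)"
 have s: "(%i. norm T*(norm (xi i)*norm (eta i))) summable_on I"
  using n by (intro summable_on_cmult_right) (simp add: nuclear_def)
 have nf: "norm (f (i, e)) = cmod (cinner (app T (xi i)) e)*cmod (cinner (eta i) e)" for i e
  unfolding f_def using cinner_commute[of e "eta i"] by (simp add: norm_mult mult.commute)
 have abs: "(%p. norm (f p)) summable_on (I \<times> some_basis)"
  unfolding Infinite_Sum.abs_summable_on_Sigma_iff nf
 proof (intro conjI ballI basis_mult_summable(1))
  show "(%i. norm (\<Sum>\<^sub>\<infinity>e\<in>some_basis. cmod (cinner (app T (xi i)) e)*cmod (cinner (eta i) e)))
    summable_on I"
  proof (rule Infinite_Sum.abs_summable_on_comparison_test'[OF s])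
   fix i
   have "(\<Sum>\<^sub>\<infinity>e\<in>some_basis. cmod (cinner (app T (xi i)) e)*cmod (cinner (eta i) e))
     <= norm (app T (xi i))*norm (eta i)" by (rule basis_mult_summable(2))
   also have "\<dots> <= (norm T*norm (xi i))*norm (eta i)"
    by (intro mult_right_mono norm_blinfun) simp
   finally show "norm (\<Sum>\<^sub>\<infinity>e\<in>some_basis. cmod (cinner (app T (xi i)) e)*cmod (cinner (eta i) e))
     <= norm T*(norm (xi i)*norm (eta i))"
    by (simp add: infsum_nonneg mult.assoc)
  qed
 qed
 then have "f summable_on (I \<times> some_basis)" by (rule abs_summable_summable)
 then obtain R where R: "(f has_sum R) (I \<times> some_basis)" by (auto simp: summable_on_def)
 have 1: "((%i. cinner (app T (xi i)) (eta i)) has_sum R) I"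
 proof (rule has_sum_SigmaD[OF R])
  show "((%e. f (i, e)) has_sum cinner (app T (xi i)) (eta i)) some_basis" for i
   using parseval[OF some_basis, of "app T (xi i)" "eta i"] by (simp add: f_def mult.commute)
 qed
 have "((%(e, i). f (i, e)) has_sum R) (some_basis \<times> I)" using R by (subst (asm) has_sum_swap)
 then have "((%e. cinner (app (T o\<^sub>L om) e) e) has_sum R) some_basis"
 proof (rule has_sum_SigmaD)
  fix e
  have "((%i. cinner e (eta i)*cinner (xi i) (app (adj_op T) e))
    has_sum cinner (app om e) (app (adj_op T) e)) I"
   using n by (simp add: nuclear_def)
  then show "((%i. case (e, i) of (e, i) => f (i, e)) has_sum cinner (app (T o\<^sub>L om) e) e) I"
   by (simp add: f_def cinner_adj_right[OF T])
 qed
 then have "trace_pairing T om = R"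
  unfolding trace_pairing_def op_trace_def by (rule infsumI)
 then show ?thesis using 1 by simp
qed

lemma nuclear_compose:
 assumes n: "nuclear I xi eta om" and V: "V : bounded_ops"
 shows "nuclear I (%i. app V (xi i)) eta (V o\<^sub>L om)"
 unfolding nuclear_def
proof (intro conjI allI)
 show "V o\<^sub>L om : bounded_ops" using n V by (simp add: nuclear_def bounded_ops_compose)
 have s: "(%i. norm V*(norm (xi i)*norm (eta i))) summable_on I"
  using n by (intro summable_on_cmult_right) (simp add: nuclear_def)
 have "norm (norm (app V (xi i))*norm (eta i)) <= norm V*(norm (xi i)*norm (eta i))" for i
  using mult_right_mono[OF norm_blinfun[of V "xi i"], of "norm (eta i)"] by (simp add: mult.assoc)
 from Infinite_Sum.abs_summable_on_comparison_test'[OF s this]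
 show "(%i. norm (app V (xi i))*norm (eta i)) summable_on I" by simp
 fix x y
 have "((%i. cinner x (eta i)*cinner (xi i) (app (adj_op V) y))
   has_sum cinner (app om x) (app (adj_op V) y)) I"
  using n by (simp add: nuclear_def)
 then show "((%i. cinner x (eta i)*cinner (app V (xi i)) y)
   has_sum cinner (app (V o\<^sub>L om) x) y) I"
  by (simp add: cinner_adj_right[OF V])
qed

lemma has_sum_finite_sum:
 fixes f :: "'i => 'e => 'a::{topological_comm_monoid_add}"
 assumes "finite F" "!!e. e : F ==> ((%i. f i e) has_sum S e) I"
 shows "((%i. \<Sum>e\<in>F. f i e) has_sum (\<Sum>e\<in>F. S e)) I"
 using assms by (induction F rule: finite_induct) (auto intro: has_sum_add)

lemma nuclear_trace_sum_le:
 assumes n: "nuclear I xi eta om" and F: "finite F" "F \<subseteq> some_basis"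
  and V: "V : bounded_ops" "norm V <= 1"
 shows "cmod (\<Sum>e\<in>F. cinner (app (V o\<^sub>L om) e) e) <= (\<Sum>\<^sub>\<infinity>i\<in>I. norm (xi i)*norm (eta i))"
proof -
 let ?g = "%i. \<Sum>e\<in>F. cinner e (eta i)*cinner (app V (xi i)) e"
 have "((%i. cinner e (eta i)*cinner (app V (xi i)) e)
   has_sum cinner (app (V o\<^sub>L om) e) e) I" for e
  using nuclear_compose[OF n V(1)] by (simp add: nuclear_def)
 then have hs: "(?g has_sum (\<Sum>e\<in>F. cinner (app (V o\<^sub>L om) e) e)) I"
  by (intro has_sum_finite_sum F)
 have s: "(%i. norm (xi i)*norm (eta i)) summable_on I" using n by (simp add: nuclear_def)
 have le: "cmod (?g i) <= norm (xi i)*norm (eta i)" for i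
 proof -
  have "cmod (?g i) <= (\<Sum>e\<in>F. cmod (cinner (app V (xi i)) e)*cmod (cinner (eta i) e))"
   by (rule sum_norm_le) (metis cinner_commute complex_mod_cnj mult.commute norm_mult order_refl)
  also have "\<dots> <= norm (app V (xi i))*norm (eta i)"
   using F by (intro orthonormal_sum_mult_le some_basis_finite)
  also have "\<dots> <= norm (xi i)*norm (eta i)"
  proof (rule mult_right_mono)
   have "norm (app V (xi i)) <= norm V*norm (xi i)" by (rule norm_blinfun)
   also have "\<dots> <= 1*norm (xi i)" using V by (intro mult_right_mono) auto
   finally show "norm (app V (xi i)) <= norm (xi i)" by simp
  qed simp
  finally show ?thesis .
 qed
 have abs: "(%i. norm (?g i)) summable_on I" by (rule Infinite_Sum.abs_summable_on_comparison_test'[OF s le])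
 have "cmod (\<Sum>e\<in>F. cinner (app (V o\<^sub>L om) e) e) = cmod (infsum ?g I)"
  using infsumI[OF hs] by simp
 also have "\<dots> <= (\<Sum>\<^sub>\<infinity>i\<in>I. cmod (?g i))" by (rule norm_infsum_bound[OF abs])
 also have "\<dots> <= (\<Sum>\<^sub>\<infinity>i\<in>I. norm (xi i)*norm (eta i))" by (rule infsum_mono[OF abs s le])
 finally show ?thesis .
qed

text \<open>The polar decomposition writes \<open>abs_op ta\<close> as \<open>V ta\<close> with a
  contraction \<open>V\<close>, so the partial sums that define the trace norm are among those
  bounded by \<open>C\<close>.\<close>

lemma trace_class_criterion:
 fixes ta :: "'h::chilbert_space \<Rightarrow>\<^sub>L 'h"
 assumes ta: "ta : bounded_ops"
  and bound: "!!V F. V : bounded_ops ==> norm V <= 1 ==> finite F ==> F \<subseteq> some_basis ==>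
   cmod (\<Sum>e\<in>F. cinner (app (V o\<^sub>L ta) e) e) <= C"
 shows "ta : trace_class" "trace_norm ta <= C"
proof -
 obtain V where V: "V : bounded_ops" "norm V <= 1" "V o\<^sub>L ta = abs_op ta"
  using polar_decomposition[OF ta] by blast
 have pos: "0 <= Re (cinner (app (abs_op ta) e) e)" for e
  using positive_op_nonneg[OF abs_op(1)[OF ta]] .
 have le: "(\<Sum>e\<in>F. Re (cinner (app (abs_op ta) e) e)) <= C" if "finite F" "F \<subseteq> some_basis" for F
  using bound[OF V(1,2) that] complex_Re_le_cmod[of "\<Sum>e\<in>F. cinner (app (V o\<^sub>L ta) e) e"]
  unfolding V(3) Re_sum by linarith
 have s: "(%e. Re (cinner (app (abs_op ta) e) e)) summable_on some_basis"
  by (rule nonneg_bdd_above_summable_on) (auto intro!: bdd_aboveI[of _ C] le pos)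
 then show "ta : trace_class" using ta by (simp add: trace_class_def)
 show "trace_norm ta <= C"
  unfolding trace_norm_def by (rule infsum_le_finite_sums[OF s le])
qed

lemma nuclear_trace_class:
 assumes "nuclear I xi eta om"
 shows "om : trace_class" "trace_norm om <= (\<Sum>\<^sub>\<infinity>i\<in>I. norm (xi i)*norm (eta i))"
 using trace_class_criterion[OF _ nuclear_trace_sum_le[OF assms]] assms
 by (auto simp: nuclear_def)

lemma trace_class_bounded: "om : trace_class ==> om : bounded_ops"
 by (simp add: trace_class_def)

text \<open>Factor \<open>om\<close> as \<open>adj_op V\<close> times \<open>S\<close> times
  \<open>S\<close>, with \<open>S\<close> the root of \<open>abs_op om\<close>, and insert the basis
  between the two roots. The products of norms are then at most \<open>|S e|^2\<close>, the diagonal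
  entries of \<open>abs_op om\<close>.\<close>

lemma trace_class_nuclear:
 fixes om :: "'h::chilbert_space \<Rightarrow>\<^sub>L 'h"
 assumes om: "om : trace_class"
 shows "EX xi eta. nuclear (some_basis :: 'h set) xi eta om &
  (\<Sum>\<^sub>\<infinity>e\<in>some_basis. norm (xi e)*norm (eta e)) <= trace_norm om"
proof -
 have omb: "om : bounded_ops" using om by (rule trace_class_bounded)
 obtain V where V: "V : bounded_ops" "norm V <= 1" "adj_op V o\<^sub>L abs_op om = om"
  using polar_decomposition[OF omb] by blast
 obtain S where S: "positive_op S" "S o\<^sub>L S = abs_op om"
  using positive_sqrt_exists[OF abs_op(1)[OF omb]] by blast
 note Ssym = positive_op_symmetric[OF S(1)]
 define xi where "xi e = app (adj_op V) (app S e)" for e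
 have SS: "app (abs_op om) x = app S (app S x)" for x
  by (simp add: S(2)[symmetric])
 have nS: "(norm (app S e))\<^sup>2 = Re (cinner (app (abs_op om) e) e)" for e
  by (simp add: SS Ssym cinner_self)
 have nxi: "norm (xi e) <= norm (app S e)" for e
 proof -
  have "norm (xi e) <= norm (adj_op V)*norm (app S e)" unfolding xi_def by (rule norm_blinfun)
  also have "\<dots> <= 1*norm (app S e)"
   using norm_adj_op_le[OF V(1)] V(2) by (intro mult_right_mono) auto
  finally show ?thesis by simp
 qed
 have le: "norm (norm (xi e)*norm (app S e)) <= Re (cinner (app (abs_op om) e) e)" for e
  unfolding nS[symmetric] using mult_right_mono[OF nxi[of e], of "norm (app S e)"]
  by (simp add: power2_eq_square)
 have tc: "(%e. Re (cinner (app (abs_op om) e) e)) summable_on some_basis"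
  using om by (simp add: trace_class_def)
 have s: "(%e. norm (xi e)*norm (app S e)) summable_on some_basis"
  using Infinite_Sum.abs_summable_on_comparison_test'[OF tc le] by simp
 have "nuclear (some_basis :: 'h set) xi (app S) om"
  unfolding nuclear_def
 proof (intro conjI allI omb s)
  fix x y
  have "cinner (app om x) y = cinner (app (adj_op V) (app (abs_op om) x)) y"
   by (subst V(3)[symmetric]) simp
  also have "\<dots> = cinner (app S x) (app S (app V y))"
   by (simp add: cinner_adj_left[OF V(1)] SS Ssym)
  finally have eq: "cinner (app om x) y = cinner (app S x) (app S (app V y))" .
  have "((%e. cinner (app S x) e*cinner e (app S (app V y)))
    has_sum cinner (app om x) y) some_basis"
   unfolding eq by (rule parseval[OF some_basis])
  then show "((%e. cinner x (app S e)*cinner (xi e) y)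
    has_sum cinner (app om x) y) some_basis"
   by (simp add: xi_def cinner_adj_left[OF V(1)] Ssym)
 qed
 moreover have "(\<Sum>\<^sub>\<infinity>e\<in>some_basis. norm (xi e)*norm (app S e)) <= trace_norm om"
  unfolding trace_norm_def by (rule infsum_mono[OF s tc]) (use le in simp)
 ultimately show ?thesis by (intro exI[of _ xi] exI[of _ "app S"] conjI)
qed

lemma nuclear_form_summable:
 assumes "(%i. norm (xi i)*norm (eta i)) summable_on I"
 shows "(%i. norm (cinner x (eta i)*cinner (xi i) y)) summable_on I"
  and "cmod (\<Sum>\<^sub>\<infinity>i\<in>I. cinner x (eta i)*cinner (xi i) y)
   <= (\<Sum>\<^sub>\<infinity>i\<in>I. norm (xi i)*norm (eta i))*norm x*norm y"
proof -
 have s: "(%i. (norm (xi i)*norm (eta i))*(norm x*norm y)) summable_on I"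
  by (intro summable_on_cmult_left assms)
 have le: "norm (cinner x (eta i)*cinner (xi i) y) <= (norm (xi i)*norm (eta i))*(norm x*norm y)" for i
  using mult_mono[OF cinner_norm_le[of x "eta i"] cinner_norm_le[of "xi i" y]]
  by (simp add: norm_mult mult_ac)
 show a: "(%i. norm (cinner x (eta i)*cinner (xi i) y)) summable_on I"
  by (rule Infinite_Sum.abs_summable_on_comparison_test'[OF s le])
 have "cmod (\<Sum>\<^sub>\<infinity>i\<in>I. cinner x (eta i)*cinner (xi i) y) <= (\<Sum>\<^sub>\<infinity>i\<in>I. norm (cinner x (eta i)*cinner (xi i) y))"
  by (rule norm_infsum_bound[OF a])
 also have "\<dots> <= (\<Sum>\<^sub>\<infinity>i\<in>I. (norm (xi i)*norm (eta i))*(norm x*norm y))"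
  by (rule infsum_mono[OF a s le])
 also have "\<dots> = (\<Sum>\<^sub>\<infinity>i\<in>I. norm (xi i)*norm (eta i))*(norm x*norm y)"
  by (rule infsum_cmult_left) (use assms in simp)
 finally show "cmod (\<Sum>\<^sub>\<infinity>i\<in>I. cinner x (eta i)*cinner (xi i) y)
   <= (\<Sum>\<^sub>\<infinity>i\<in>I. norm (xi i)*norm (eta i))*norm x*norm y" by (simp add: mult.assoc)
qed

lemma nuclear_exists:
 fixes xi eta :: "'i => 'h::chilbert_space"
 assumes s: "(%i. norm (xi i)*norm (eta i)) summable_on I"
 shows "EX om. nuclear I xi eta om"
proof -
 define B where "B x y = (\<Sum>\<^sub>\<infinity>i\<in>I. cinner x (eta i)*cinner (xi i) y)" for x y
 note su = abs_summable_summable[OF nuclear_form_summable(1)[OF s]]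
 have "EX om:bounded_ops. norm om <= (\<Sum>\<^sub>\<infinity>i\<in>I. norm (xi i)*norm (eta i)) &
  (ALL x:UNIV. ALL y:UNIV. cinner (app om x) y = B x y)"
 proof (rule form_operator)
  show "B (x + y) z = B x z + B y z" for x y z
   unfolding B_def by (simp add: cinner_add_left distrib_right infsum_add su)
  show "B x (y + z) = B x y + B x z" for x y z
   unfolding B_def by (simp add: cinner_add_right distrib_left infsum_add su)
  show "B (c *\<^sub>C x) y = c*B x y" for c x y
   unfolding B_def by (simp add: cinner_scaleC_left mult.assoc infsum_cmult_right su)
  show "B x (c *\<^sub>C y) = cnj c*B x y" for c x y
   unfolding B_def by (simp add: cinner_scaleC_right mult.left_commute[of _ "cnj c"] infsum_cmult_right su)
  show "cmod (B x y) <= (\<Sum>\<^sub>\<infinity>i\<in>I. norm (xi i)*norm (eta i))*norm x*norm y" for x y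
   unfolding B_def by (rule nuclear_form_summable(2)[OF s])
  show "0 <= (\<Sum>\<^sub>\<infinity>i\<in>I. norm (xi i)*norm (eta i))" by (rule infsum_nonneg) simp
 qed simp_all
 then obtain om where "om : bounded_ops" "!!x y. cinner (app om x) y = B x y" by blast
 then have "nuclear I xi eta om"
  unfolding nuclear_def B_def using s su by (simp add: has_sum_infsum)
 then show ?thesis by blast
qed

lemma nuclear_scale:
 assumes "nuclear I xi eta om" shows "nuclear I (%i. c *\<^sub>C xi i) eta (scale_op c om)"
 unfolding nuclear_def
proof (intro conjI allI)
 show "scale_op c om : bounded_ops" using assms by (simp add: nuclear_def bounded_ops_scale)
 show "(%i. norm (c *\<^sub>C xi i)*norm (eta i)) summable_on I"
  unfolding norm_scaleC mult.assoc using assms by (intro summable_on_cmult_right) (simp add: nuclear_def)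
 fix x y
 have "((%i. c*(cinner x (eta i)*cinner (xi i) y)) has_sum c*cinner (app om x) y) I"
  using assms by (intro has_sum_cmult_right) (simp add: nuclear_def)
 then show "((%i. cinner x (eta i)*cinner (c *\<^sub>C xi i) y) has_sum cinner (app (scale_op c om) x) y) I"
  by (simp add: cinner_scaleC_left scale_op_apply mult.left_commute)
qed

lemma trace_norm_nonneg: "om : bounded_ops ==> 0 <= trace_norm om"
 unfolding trace_norm_def by (rule infsum_nonneg) (rule positive_op_nonneg[OF abs_op(1)])

lemma trace_pairing_le:
 fixes om :: "'h::chilbert_space \<Rightarrow>\<^sub>L 'h"
 assumes om: "om : trace_class" and T: "T : bounded_ops"
 shows "cmod (trace_pairing T om) <= norm T*trace_norm om"
proof -
 obtain xi eta where n: "nuclear (some_basis :: 'h set) xi eta om"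
  and le: "(\<Sum>\<^sub>\<infinity>e\<in>some_basis. norm (xi e)*norm (eta e)) <= trace_norm om"
  using trace_class_nuclear[OF om] by blast
 let ?f = "%i. cinner (app T (xi i)) (eta i)"
 have s: "(%i. norm (xi i)*norm (eta i)) summable_on some_basis" using n by (simp add: nuclear_def)
 then have s': "(%i. norm T*(norm (xi i)*norm (eta i))) summable_on some_basis"
  by (rule summable_on_cmult_right)
 have b: "norm (?f i) <= norm T*(norm (xi i)*norm (eta i))" for i
  using order_trans[OF cinner_norm_le mult_right_mono[OF norm_blinfun norm_ge_zero]]
  by (simp add: mult.assoc)
 have abs: "(%i. norm (?f i)) summable_on some_basis" by (rule Infinite_Sum.abs_summable_on_comparison_test'[OF s' b])
 have "cmod (trace_pairing T om) = cmod (infsum ?f some_basis)"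
  using infsumI[OF nuclear_pairing[OF n T]] by simp
 also have "\<dots> <= (\<Sum>\<^sub>\<infinity>i\<in>some_basis. norm (?f i))" by (rule norm_infsum_bound[OF abs])
 also have "\<dots> <= (\<Sum>\<^sub>\<infinity>i\<in>some_basis. norm T*(norm (xi i)*norm (eta i)))"
  by (rule infsum_mono[OF abs s' b])
 also have "\<dots> = norm T*(\<Sum>\<^sub>\<infinity>i\<in>some_basis. norm (xi i)*norm (eta i))"
  by (rule infsum_cmult_right) (use s in simp)
 also have "\<dots> <= norm T*trace_norm om" by (intro mult_left_mono le) simp
 finally show ?thesis .
qed

text \<open>Nuclear representations of the summands, concatenated over
  \<open>K \<times> some_basis\<close>, represent the sum. This circumvents the failure of
  \<open>|S + T| \<le> |S| + |T|\<close> for operators and contains the triangle inequality for the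
  trace norm.\<close>

lemma trace_class_infsum:
 fixes om :: "'j => 'h::chilbert_space \<Rightarrow>\<^sub>L 'h"
 assumes tc: "!!j. j : K ==> om j : trace_class"
  and s: "(%j. trace_norm (om j)) summable_on K"
  and Om: "Om : bounded_ops"
  and hs: "!!x y. ((%j. cinner (app (om j) x) y) has_sum cinner (app Om x) y) K"
 shows "Om : trace_class" "trace_norm Om <= (\<Sum>\<^sub>\<infinity>j\<in>K. trace_norm (om j))"
  "!!T. T : bounded_ops ==> ((%j. trace_pairing T (om j)) has_sum trace_pairing T Om) K"
proof -
 have "ALL j:K. EX xi eta. nuclear (some_basis :: 'h set) xi eta (om j) &
  (\<Sum>\<^sub>\<infinity>e\<in>some_basis. norm (xi e)*norm (eta e)) <= trace_norm (om j)"
  using trace_class_nuclear tc by blast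
 then obtain xi eta where n: "!!j. j : K ==> nuclear (some_basis :: 'h set) (xi j) (eta j) (om j)"
  and le: "!!j. j : K ==> (\<Sum>\<^sub>\<infinity>e\<in>some_basis. norm (xi j e)*norm (eta j e)) <= trace_norm (om j)"
  by metis
 define X where "X = (%(j, e). xi j e)"
 define Y where "Y = (%(j, e). eta j e)"
 have inner: "(%e. norm (xi j e)*norm (eta j e)) summable_on some_basis" if "j : K" for j
  using n[OF that] by (simp add: nuclear_def)
 have s2: "(%j. \<Sum>\<^sub>\<infinity>e\<in>some_basis. norm (xi j e)*norm (eta j e)) summable_on K"
 proof -
  have "norm (\<Sum>\<^sub>\<infinity>e\<in>some_basis. norm (xi j e)*norm (eta j e)) <= trace_norm (om j)" if "j : K" for j
   using le[OF that] by (simp add: infsum_nonneg)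
  from Infinite_Sum.abs_summable_on_comparison_test'[OF s this] show ?thesis by (simp add: infsum_nonneg)
 qed
 have "(%p. norm (norm (X p)*norm (Y p))) summable_on (K \<times> some_basis)"
  unfolding Infinite_Sum.abs_summable_on_Sigma_iff X_def Y_def using inner s2
  by (auto simp: infsum_nonneg)
 then have sXY: "(%p. norm (X p)*norm (Y p)) summable_on (K \<times> some_basis)"
  by simp
 have N: "nuclear (K \<times> some_basis) X Y Om"
  unfolding nuclear_def
 proof (intro conjI allI Om sXY)
  fix x y
  show "((%i. cinner x (Y i)*cinner (X i) y) has_sum cinner (app Om x) y) (K \<times> some_basis)"
  proof (rule has_sum_SigmaI[OF _ hs])
   show "((%e. cinner x (Y (j, e))*cinner (X (j, e)) y) has_sum cinner (app (om j) x) y) some_basis"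
    if "j : K" for j
    using n[OF that] by (simp add: nuclear_def X_def Y_def)
   show "(%i. cinner x (Y i)*cinner (X i) y) summable_on K \<times> some_basis"
    by (rule abs_summable_summable[OF nuclear_form_summable(1)[OF sXY]])
  qed
 qed
 show "Om : trace_class" by (rule nuclear_trace_class(1)[OF N])
 have "trace_norm Om <= (\<Sum>\<^sub>\<infinity>p\<in>K \<times> some_basis. norm (X p)*norm (Y p))"
  by (rule nuclear_trace_class(2)[OF N])
 also have "\<dots> = (\<Sum>\<^sub>\<infinity>j\<in>K. \<Sum>\<^sub>\<infinity>e\<in>some_basis. norm (X (j, e))*norm (Y (j, e)))"
  by (rule infsum_Sigma_banach[OF sXY, symmetric])
 also have "\<dots> <= (\<Sum>\<^sub>\<infinity>j\<in>K. trace_norm (om j))"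
  by (rule infsum_mono) (use s2 s le in \<open>auto simp: X_def Y_def\<close>)
 finally show "trace_norm Om <= (\<Sum>\<^sub>\<infinity>j\<in>K. trace_norm (om j))" .
 show "((%j. trace_pairing T (om j)) has_sum trace_pairing T Om) K" if T: "T : bounded_ops" for T
 proof (rule has_sum_SigmaD[OF nuclear_pairing[OF N T]])
  show "((%e. cinner (app T (X (j, e))) (Y (j, e))) has_sum trace_pairing T (om j)) some_basis"
   if "j : K" for j
   using nuclear_pairing[OF n[OF that] T] by (simp add: X_def Y_def)
 qed
qed

lemma trace_class_sum:
 fixes om :: "'j => 'h::chilbert_space \<Rightarrow>\<^sub>L 'h"
 assumes "finite K" and tc: "!!j. j : K ==> om j : trace_class"
 shows "sum om K : trace_class" "trace_norm (sum om K) <= (\<Sum>j\<in>K. trace_norm (om j))"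
  "T : bounded_ops ==> trace_pairing T (sum om K) = (\<Sum>j\<in>K. trace_pairing T (om j))"
proof -
 have Om: "sum om K : bounded_ops" by (intro bounded_ops_sum trace_class_bounded tc)
 have s: "(%j. trace_norm (om j)) summable_on K" using assms(1) by (rule summable_on_finite)
 have hs: "((%j. cinner (app (om j) x) y) has_sum cinner (app (sum om K) x) y) K" for x y
  by (rule has_sum_finiteI[OF assms(1)]) (simp add: blinfun.sum_left cinner_sum_left)
 note * = trace_class_infsum[OF tc s Om hs]
 show "sum om K : trace_class" using *(1) by blast
 show "trace_norm (sum om K) <= (\<Sum>j\<in>K. trace_norm (om j))" using *(2) assms(1) by simp
 show "trace_pairing T (sum om K) = (\<Sum>j\<in>K. trace_pairing T (om j))" if "T : bounded_ops"
  using infsumI[OF *(3)[OF _ that]] assms(1) by simp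
qed

lemma trace_class_scale:
 fixes om :: "'h::chilbert_space \<Rightarrow>\<^sub>L 'h"
 assumes "om : trace_class"
 shows "scale_op c om : trace_class"
  and "T : bounded_ops ==> trace_pairing T (scale_op c om) = c*trace_pairing T om"
proof -
 obtain xi eta where n: "nuclear (some_basis :: 'h set) xi eta om" using trace_class_nuclear[OF assms] by blast
 show "scale_op c om : trace_class" by (rule nuclear_trace_class(1)[OF nuclear_scale[OF n]])
 assume T: "T : bounded_ops"
 have "((%i. c*cinner (app T (xi i)) (eta i)) has_sum c*trace_pairing T om) some_basis"
  by (intro has_sum_cmult_right nuclear_pairing[OF n T])
 then show "trace_pairing T (scale_op c om) = c*trace_pairing T om"
  using nuclear_pairing[OF nuclear_scale[OF n] T, of c]
  by (simp add: bounded_ops_scaleC[OF T] cinner_scaleC_left has_sum_unique)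
qed

lemma trace_class_add:
 assumes "om : trace_class" "om' : trace_class"
 shows "om + om' : trace_class"
  and "T : bounded_ops ==> trace_pairing T (om + om') = trace_pairing T om + trace_pairing T om'"
 using trace_class_sum(1,3)[of "UNIV :: bool set" "%b. if b then om else om'"] assms
 by (simp_all add: UNIV_bool add.commute)

lemma scale_op_minus1: "scale_op (-1) T = - T"
 by (rule blinfun_eqI) (simp add: scale_op_apply blinfun.minus_left)

lemma trace_class_diff:
 assumes "om : trace_class" "om' : trace_class"
 shows "om - om' : trace_class"
  and "T : bounded_ops ==> trace_pairing T (om - om') = trace_pairing T om - trace_pairing T om'"
 using trace_class_add[OF assms(1) trace_class_scale(1)[OF assms(2), of "-1"]]
  trace_class_scale(2)[OF assms(2), of T "-1"]
 by (simp_all add: scale_op_minus1)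

lemma rank_one_nuclear: "EX om. nuclear {()} (%_. a) (%_. b) om"
 by (rule nuclear_exists) simp

lemma rank_one:
 "EX om:trace_class. ALL T:bounded_ops. trace_pairing T om = cinner (app T a) b"
proof -
 obtain om where n: "nuclear {()} (%_. a) (%_. b) om" using rank_one_nuclear by blast
 have "trace_pairing T om = cinner (app T a) b" if "T : bounded_ops" for T
  using infsumI[OF nuclear_pairing[OF n that]] by simp
 then show ?thesis using nuclear_trace_class(1)[OF n] by blast
qed

lemma trace_class_zero:
 fixes T :: "'h::chilbert_space \<Rightarrow>\<^sub>L 'h"
 shows "(0 :: 'h \<Rightarrow>\<^sub>L 'h) : trace_class" "trace_norm (0 :: 'h \<Rightarrow>\<^sub>L 'h) = 0"
  "T : bounded_ops ==> trace_pairing T 0 = 0"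
 using trace_class_sum[of "{}" "%_. 0 :: 'h \<Rightarrow>\<^sub>L 'h"] trace_norm_nonneg[of "0 :: 'h \<Rightarrow>\<^sub>L 'h"] by simp_all

lemma trace_class_eqI:
 fixes om om' :: "'h::chilbert_space \<Rightarrow>\<^sub>L 'h"
 assumes "om : trace_class" "om' : trace_class"
  and eq: "!!T. T : bounded_ops ==> trace_pairing T om = trace_pairing T om'"
 shows "om = om'"
proof (rule op_eqI)
 fix x y :: 'h
 obtain R where R: "nuclear {()} (%_. x) (%_. y) R" using rank_one_nuclear by blast
 have Rb: "R : bounded_ops" and Ra: "cinner (app R a) b = cinner a y*cinner x b" for a b
  using R by (auto simp: nuclear_def dest!: spec2[of _ a b] infsumI)
 have "trace_pairing R om = cinner (app om x) y" if w: "om : trace_class" for om :: "'h \<Rightarrow>\<^sub>L 'h"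
 proof -
  obtain xi eta where n: "nuclear (some_basis :: 'h set) xi eta om" using trace_class_nuclear[OF w] by blast
  have "((%i. cinner (xi i) y*cinner x (eta i)) has_sum trace_pairing R om) some_basis"
   using nuclear_pairing[OF n Rb] by (simp add: Ra)
  moreover have "((%i. cinner x (eta i)*cinner (xi i) y) has_sum cinner (app om x) y) some_basis"
   using n by (simp add: nuclear_def)
  ultimately show ?thesis by (simp add: mult.commute has_sum_unique)
 qed
 then show "cinner (app om x) y = cinner (app om' x) y"
  using assms eq[OF Rb] by simp
qed

lemma op_eq_0I_pairing:
 assumes "T : bounded_ops" "!!om. om : trace_class ==> trace_pairing T om = 0" shows "T = 0"
proof (rule op_eqI)
 fix x y
 obtain om where "om : trace_class" "trace_pairing T om = cinner (app T x) y"
  using rank_one[of x y] assms(1) by blast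
 then show "cinner (app T x) y = cinner (app 0 x) y" using assms(2) by simp
qed

lemma trace_pairing_add_left:
 fixes om :: "'h::chilbert_space \<Rightarrow>\<^sub>L 'h"
 assumes "om : trace_class" "S : bounded_ops" "T : bounded_ops"
 shows "trace_pairing (S + T) om = trace_pairing S om + trace_pairing T om"
proof -
 obtain xi eta where n: "nuclear (some_basis :: 'h set) xi eta om" using trace_class_nuclear[OF assms(1)] by blast
 show ?thesis
  using has_sum_add[OF nuclear_pairing[OF n assms(2)] nuclear_pairing[OF n assms(3)]]
   nuclear_pairing[OF n bounded_ops_add[OF assms(2,3)]]
  by (simp add: blinfun.add_left cinner_add_left has_sum_unique)
qed

lemma trace_pairing_scale_left:
 fixes om :: "'h::chilbert_space \<Rightarrow>\<^sub>L 'h"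
 assumes "om : trace_class" "T : bounded_ops"
 shows "trace_pairing (scale_op c T) om = c*trace_pairing T om"
proof -
 obtain xi eta where n: "nuclear (some_basis :: 'h set) xi eta om" using trace_class_nuclear[OF assms(1)] by blast
 show ?thesis
  using has_sum_cmult_right[OF nuclear_pairing[OF n assms(2)], of c]
   nuclear_pairing[OF n bounded_ops_scale[OF assms(2)], of c]
  by (simp add: scale_op_apply cinner_scaleC_left has_sum_unique)
qed

text \<open>The error is uniform in \<open>T\<close> relative to \<open>norm T\<close>, and the
  vectors lie in a prescribed dense set. This is the device for moving weakly defined operator
  integrals past the trace pairing.\<close>

lemma trace_class_finite_approx:
 fixes om :: "'h::chilbert_space \<Rightarrow>\<^sub>L 'h"
 assumes om: "om : trace_class" and dense: "closure D = UNIV" and ep: "0 < ep"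
 shows "EX (F :: 'h set) xi eta. finite F & (ALL i:F. xi i : D & eta i : D) &
  (ALL T:bounded_ops. cmod (trace_pairing T om - (\<Sum>i\<in>F. cinner (app T (xi i)) (eta i))) <= ep*norm T)"
proof -
 obtain xi eta where n: "nuclear (some_basis :: 'h set) xi eta om" using trace_class_nuclear[OF om] by blast
 let ?n = "%i. norm (xi i)*norm (eta i)"
 have s: "?n summable_on some_basis" using n by (simp add: nuclear_def)
 have "\<forall>\<^sub>F F in finite_subsets_at_top some_basis. dist (sum ?n F) (infsum ?n some_basis) < ep/2"
  using has_sum_infsum[OF s] half_gt_zero[OF ep] unfolding has_sum_def tendsto_iff by blast
 then obtain F where F: "finite F" "F \<subseteq> some_basis" "dist (sum ?n F) (infsum ?n some_basis) < ep/2"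
  unfolding eventually_finite_subsets_at_top by blast
 have tail: "cmod (trace_pairing T om - (\<Sum>i\<in>F. cinner (app T (xi i)) (eta i))) <= ep/2*norm T"
  if T: "T : bounded_ops" for T
 proof -
  let ?f = "%i. cinner (app T (xi i)) (eta i)"
  have sT: "(%i. norm T*?n i) summable_on A" if "A \<subseteq> some_basis" for A
   using summable_on_subset_banach[OF s that] by (rule summable_on_cmult_right)
  have b: "norm (?f i) <= norm T*?n i" for i
   using order_trans[OF cinner_norm_le mult_right_mono[OF norm_blinfun norm_ge_zero]]
   by (simp add: mult.assoc)
  have abs: "(%i. norm (?f i)) summable_on A" if "A \<subseteq> some_basis" for A
   by (rule Infinite_Sum.abs_summable_on_comparison_test'[OF sT[OF that] b])
  have "trace_pairing T om - sum ?f F = infsum ?f (some_basis - F)"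
   using infsum_Diff[of ?f some_basis F] abs_summable_summable[OF abs] F
    infsumI[OF nuclear_pairing[OF n T]] by simp
  also have "cmod \<dots> <= (\<Sum>\<^sub>\<infinity>i\<in>some_basis - F. norm (?f i))" by (rule norm_infsum_bound[OF abs]) auto
  also have "\<dots> <= (\<Sum>\<^sub>\<infinity>i\<in>some_basis - F. norm T*?n i)"
   by (rule infsum_mono) (use abs sT b in auto)
  also have "\<dots> = norm T*(\<Sum>\<^sub>\<infinity>i\<in>some_basis - F. ?n i)"
   by (rule infsum_cmult_right) (use summable_on_subset_banach[OF s] in auto)
  also have "(\<Sum>\<^sub>\<infinity>i\<in>some_basis - F. ?n i) = infsum ?n some_basis - sum ?n F"
   using infsum_Diff[of ?n some_basis F] s F by simp
  also have "norm T*\<dots> <= norm T*(ep/2)"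
   using F(3) by (intro mult_left_mono) (unfold dist_real_def, linarith, simp)
  finally show ?thesis by (simp add: mult.commute)
 qed
 \<comment> \<open>Each of the \<open>card F\<close> replacements of vectors may cost
   \<open>ep / (2*N)\<close>; the summand 1 keeps \<open>N\<close> positive for empty
   \<open>F\<close>.\<close>
 define N where "N = real (card F) + 1"
 have N: "N > 0" by (simp add: N_def)
 have "EX x y. x : D & y : D & norm (xi i - x)*norm (eta i) + norm x*norm (eta i - y) <= ep / (2*N)" for i
 proof -
  \<comment> \<open>As \<open>dl \<le> 1\<close>, \<open>norm x\<close> is at most
    \<open>norm (xi i) + 1\<close>; the error is then at most \<open>dl\<close> times the sum in the
    denominator, that is \<open>ep / (2*N)\<close>.\<close>
  define dl where "dl = min 1 (ep / (2*N) / (norm (xi i) + norm (eta i) + 1))"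
  have p: "norm (xi i) + norm (eta i) + 1 > 0" by (intro add_nonneg_pos add_nonneg_nonneg) simp_all
  have dl: "dl > 0" "dl <= 1" unfolding dl_def using p ep N by simp_all
  have dl2: "dl*(norm (xi i) + norm (eta i) + 1) <= ep / (2*N)"
   using p unfolding dl_def pos_le_divide_eq[OF p, symmetric] by simp
  obtain x where x: "x : D" "norm (xi i - x) < dl"
   using dense closure_approachable[of "xi i" D] dl(1) by (auto simp: dist_norm norm_minus_commute)
  obtain y where y: "y : D" "norm (eta i - y) < dl"
   using dense closure_approachable[of "eta i" D] dl(1) by (auto simp: dist_norm norm_minus_commute)
  have "norm x <= norm (xi i) + 1" using x dl(2) norm_triangle_ineq2[of x "xi i"]
   by (simp add: norm_minus_commute)
  then have "norm (xi i - x)*norm (eta i) + norm x*norm (eta i - y) <= dl*norm (eta i) + (norm (xi i) + 1)*dl"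
   using x y by (intro add_mono mult_mono) (use dl in \<open>auto intro: add_nonneg_nonneg\<close>)
  also have "\<dots> = dl*(norm (xi i) + norm (eta i) + 1)" by (simp add: algebra_simps)
  finally show ?thesis using x y dl2 by (intro exI[of _ x] exI[of _ y]) auto
 qed
 then obtain X Y where XY: "!!i. X i : D" "!!i. Y i : D"
  "!!i. norm (xi i - X i)*norm (eta i) + norm (X i)*norm (eta i - Y i) <= ep / (2*N)" by metis
 have "cmod (trace_pairing T om - (\<Sum>i\<in>F. cinner (app T (X i)) (Y i))) <= ep*norm T"
  if T: "T : bounded_ops" for T
 proof -
  have "cmod (cinner (app T (xi i)) (eta i) - cinner (app T (X i)) (Y i))
    <= norm T*(ep / (2*N))" for i
  proof -
   have "cinner (app T (xi i)) (eta i) - cinner (app T (X i)) (Y i)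
     = cinner (app T (xi i - X i)) (eta i) + cinner (app T (X i)) (eta i - Y i)"
    by (simp add: blinfun.diff_right cinner_diff_left cinner_diff_right)
   also have "cmod \<dots> <= norm (app T (xi i - X i))*norm (eta i) + norm (app T (X i))*norm (eta i - Y i)"
    by (intro order_trans[OF norm_triangle_ineq] add_mono cinner_norm_le)
   also have "\<dots> <= (norm T*norm (xi i - X i))*norm (eta i) + (norm T*norm (X i))*norm (eta i - Y i)"
    by (intro add_mono mult_right_mono norm_blinfun) simp_all
   also have "\<dots> = norm T*(norm (xi i - X i)*norm (eta i) + norm (X i)*norm (eta i - Y i))"
    by (simp add: algebra_simps)
   also have "\<dots> <= norm T*(ep / (2*N))" by (intro mult_left_mono XY) simp
   finally show ?thesis .
  qed
  then have "cmod (\<Sum>i\<in>F. cinner (app T (xi i)) (eta i) - cinner (app T (X i)) (Y i))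
    <= (\<Sum>i\<in>F. norm T*(ep / (2*N)))" by (intro sum_norm_le)
  also have "\<dots> = norm T*(ep/2*(real (card F) / N))" by simp
  also have "\<dots> <= norm T*(ep/2 * 1)"
   using ep N by (intro mult_left_mono) (simp_all add: N_def)
  finally have 1: "cmod ((\<Sum>i\<in>F. cinner (app T (xi i)) (eta i)) - (\<Sum>i\<in>F. cinner (app T (X i)) (Y i)))
    <= ep/2*norm T" by (simp add: sum_subtractf mult.commute)
  have "cmod (trace_pairing T om - (\<Sum>i\<in>F. cinner (app T (X i)) (Y i)))
   <= ep/2*norm T + ep/2*norm T"
   using norm_triangle_mono[OF tail[OF T] 1] by simp
  then show ?thesis by simp
 qed
 then show ?thesis by (intro exI[of _ F] exI[of _ X] exI[of _ Y] conjI ballI F(1) XY(1,2))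
qed

subsection \<open>The weak* closure of a subspace\<close>

text \<open>Induction on the number of functionals: restrict to the kernel of \<open>f k\<close>,
  then correct by a multiple of \<open>f k\<close> read off from one vector on which it does not
  vanish.\<close>

lemma functional_in_span:
 fixes f :: "'i => ('h::chilbert_space \<Rightarrow>\<^sub>L 'h) => complex"
 assumes "finite F" "cop.subspace S"
  and "!!i s t. i : F ==> s : S ==> t : S ==> f i (s + t) = f i s + f i t"
  and "!!i c s. i : F ==> s : S ==> f i (scale_op c s) = c*f i s"
  and "!!s t. s : S ==> t : S ==> g (s + t) = g s + g t"
  and "!!c s. s : S ==> g (scale_op c s) = c*g s"
  and "!!s. s : S ==> (ALL i:F. f i s = 0) ==> g s = 0"
 shows "EX c. ALL s:S. g s = (\<Sum>i\<in>F. c i*f i s)"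
 using assms
proof (induction F arbitrary: S g rule: finite_induct)
 case empty
 then show ?case by auto
next
 case (insert k F)
 define S1 where "S1 = {s:S. f k s = 0}"
 note S = \<open>cop.subspace S\<close> and fadd = insert.prems(2) and fscale = insert.prems(3)
  and gadd = insert.prems(4) and gscale = insert.prems(5) and ker = insert.prems(6)
 have fk0: "f k 0 = 0" using fscale[of k 0 0] cop.subspace_0[OF S] by simp
 have S1: "cop.subspace S1"
  by (rule cop.subspaceI)
   (auto simp: S1_def fk0 fadd fscale cop.subspace_0[OF S] cop.subspace_add[OF S] cop.subspace_scale[OF S])
 have "EX c. ALL s:S1. g s = (\<Sum>i\<in>F. c i*f i s)"
  by (rule insert.IH[OF S1]) (auto simp: S1_def fadd fscale gadd gscale intro: ker)
 then obtain c where c: "!!s. s : S1 ==> g s = (\<Sum>i\<in>F. c i*f i s)" by blast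
 define h where "h s = g s - (\<Sum>i\<in>F. c i*f i s)" for s
 have hadd: "h (s + t) = h s + h t" if "s : S" "t : S" for s t
  using that by (simp add: h_def gadd fadd distrib_left sum.distrib)
 have hscale: "h (scale_op a s) = a*h s" if "s : S" for a s
  using that by (simp add: h_def gscale fscale right_diff_distrib sum_distrib_left mult.left_commute)
 have h0: "h s = 0" if "s : S1" for s using c[OF that] by (simp add: h_def)
 show ?case
 proof (cases "EX s:S. f k s ~= 0")
  case False
  then have "S1 = S" by (auto simp: S1_def)
  then show ?thesis using c False insert.hyps
   by (intro exI[of _ c]) simp
 next
  case True
  then obtain s0 where s0: "s0 : S" "f k s0 ~= 0" by blast
  have "g s = (\<Sum>i\<in>insert k F. (c(k := h s0 / f k s0)) i*f i s)" if s: "s : S" for s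
  proof -
   define t where "t = s + scale_op (- (f k s / f k s0)) s0"
   have ts: "scale_op (- (f k s / f k s0)) s0 : S" by (rule cop.subspace_scale[OF S s0(1)])
   have "t : S" unfolding t_def by (rule cop.subspace_add[OF S s ts])
   moreover have "f k t = 0"
    unfolding t_def using s0 by (subst fadd[OF insertI1 s ts]) (simp add: fscale[OF insertI1 s0(1)] del: cop.scale_minus_left)
   ultimately have "t : S1" by (simp add: S1_def)
   then have "h s = (f k s / f k s0)*h s0"
    using h0[of t] hadd[OF s ts] hscale[OF s0(1)] by (simp add: t_def del: cop.scale_minus_left)
   moreover have "g s = (\<Sum>i\<in>F. c i*f i s) + h s" by (simp add: h_def)
   ultimately have "g s = (\<Sum>i\<in>F. c i*f i s) + h s0 / f k s0*f k s" by simp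
   moreover have "(\<Sum>i\<in>F. (c(k := h s0 / f k s0)) i*f i s) = (\<Sum>i\<in>F. c i*f i s)"
    using insert.hyps by (intro sum.cong) auto
   ultimately show ?thesis using insert.hyps by simp
  qed
  then show ?thesis by blast
 qed
qed

text \<open>The only obstruction to prescribing finitely many values is a linear relation among the
  functionals. In the inductive step either \<open>f k\<close> can be adjusted without changing the
  others, or it lies in their span, and the relation with coefficient \<open>-1\<close> at
  \<open>k\<close> already forces the right value.\<close>

lemma functional_interpolation:
 fixes f :: "'i => ('h::chilbert_space \<Rightarrow>\<^sub>L 'h) => complex"
 assumes "finite F" "cop.subspace S"
  and "!!i s t. i : F ==> s : S ==> t : S ==> f i (s + t) = f i s + f i t"
  and "!!i c s. i : F ==> s : S ==> f i (scale_op c s) = c*f i s"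
  and "!!c. (!!s. s : S ==> (\<Sum>i\<in>F. c i*f i s) = 0) ==> (\<Sum>i\<in>F. c i * v i) = 0"
 shows "EX s:S. ALL i:F. f i s = v i"
 using assms
proof (induction F rule: finite_induct)
 case empty
 then show ?case using cop.subspace_0 by blast
next
 case (insert k F)
 note S = \<open>cop.subspace S\<close> and fadd = insert.prems(2) and fscale = insert.prems(3) and ann = insert.prems(4)
 have "EX s:S. ALL i:F. f i s = v i"
 proof (rule insert.IH[OF S])
  fix c assume c: "!!s. s : S ==> (\<Sum>i\<in>F. c i*f i s) = 0"
  have *: "(\<Sum>i\<in>F. (c(k := 0)) i*w i) = (\<Sum>i\<in>F. c i*w i)" for w
   using insert.hyps by (intro sum.cong) auto
  show "(\<Sum>i\<in>F. c i * v i) = 0"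
   using ann[of "c(k := 0)"] c insert.hyps by (simp add: * del: fun_upd_apply) simp
 qed (auto simp: fadd fscale)
 then obtain s1 where s1: "s1 : S" "!!i. i : F ==> f i s1 = v i" by blast
 show ?case
 proof (cases "EX s0:S. (ALL i:F. f i s0 = 0) & f k s0 ~= 0")
  case True
  then obtain s0 where s0: "s0 : S" "!!i. i : F ==> f i s0 = 0" "f k s0 ~= 0" by blast
  define a where "a = (v k - f k s1) / f k s0"
  have as: "scale_op a s0 : S" by (rule cop.subspace_scale[OF S s0(1)])
  show ?thesis
   using s1 s0 as
   by (intro bexI[of _ "s1 + scale_op a s0"]) (auto simp: fadd fscale a_def cop.subspace_add[OF S])
 next
  case False
  have "EX c. ALL s:S. f k s = (\<Sum>i\<in>F. c i*f i s)"
   by (rule functional_in_span[OF insert.hyps(1) S]) (use False in \<open>auto simp: fadd fscale\<close>)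
  then obtain c where c: "!!s. s : S ==> f k s = (\<Sum>i\<in>F. c i*f i s)" by blast
  have *: "(\<Sum>i\<in>F. (c(k := -1)) i*w i) = (\<Sum>i\<in>F. c i*w i)" for w
   using insert.hyps by (intro sum.cong) auto
  have "(\<Sum>i\<in>insert k F. (c(k := -1)) i * v i) = 0"
   by (rule ann) (use c insert.hyps in \<open>simp add: * del: fun_upd_apply\<close>, simp)
  then have "v k = (\<Sum>i\<in>F. c i * v i)"
   using insert.hyps by (simp add: * del: fun_upd_apply) simp
  also have "\<dots> = f k s1" using c[OF s1(1)] s1(2) by simp
  finally show ?thesis using s1 by (intro bexI[of _ s1]) auto
 qed
qed

text \<open>The bipolar theorem for subspaces. A basic weak-star neighbourhood restricts finitely
  many trace pairings, and these can be matched exactly inside \<open>S\<close>: a linear relation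
  among them on \<open>S\<close> amounts to a trace class operator annihilating \<open>S\<close>,
  which by assumption annihilates \<open>T\<close> too.\<close>

lemma weak_star_closure_subspace:
 fixes S :: "('h::chilbert_space \<Rightarrow>\<^sub>L 'h) set"
 assumes S: "cop.subspace S" "S \<subseteq> bounded_ops"
 shows "weak_star_ops closure_of S = {T:bounded_ops. ALL om:trace_class.
  (ALL s:S. trace_pairing s om = 0) --> trace_pairing T om = 0}"
proof (intro set_eqI iffI)
 let ?p = "%T :: 'h \<Rightarrow>\<^sub>L 'h. \<lambda>om\<in>trace_class. trace_pairing T om"
 let ?P = "product_topology (%_. euclidean :: complex topology) (trace_class :: ('h \<Rightarrow>\<^sub>L 'h) set)"
 have top: "topspace (weak_star_ops :: ('h \<Rightarrow>\<^sub>L 'h) topology) = bounded_ops"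
  unfolding weak_star_ops_def topspace_pullback_topology by auto
 {
  fix T assume T: "T : weak_star_ops closure_of S"
  then have Tb: "T : bounded_ops" using closure_of_subset_topspace[of weak_star_ops S] top by blast
  have "trace_pairing T om = 0" if om: "om : trace_class" "ALL s:S. trace_pairing s om = 0" for om
  proof (rule ccontr)
   assume nz: "trace_pairing T om ~= 0"
   define U where "U = {g : topspace ?P. g om : - {0}}"
   have "openin ?P U" unfolding U_def
    by (rule openin_continuous_map_preimage[OF continuous_map_product_projection[OF om(1)]]) auto
   then have "openin weak_star_ops (?p -` U \<inter> bounded_ops)"
    unfolding weak_star_ops_def openin_pullback_topology by blast
   moreover have "T : ?p -` U \<inter> bounded_ops" using Tb nz om(1) by (auto simp: U_def)
   ultimately obtain s where "s : S" "s : ?p -` U"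
    using T[unfolded in_closure_of, THEN conjunct2, rule_format, of "?p -` U \<inter> bounded_ops"] by blast
   then show False using om by (auto simp: U_def)
  qed
  then show "T : {T:bounded_ops. ALL om:trace_class.
   (ALL s:S. trace_pairing s om = 0) --> trace_pairing T om = 0}" using Tb by blast
 next
  fix T assume "T : {T:bounded_ops. ALL om:trace_class.
   (ALL s:S. trace_pairing s om = 0) --> trace_pairing T om = 0}"
  then have Tb: "T : bounded_ops"
   and ann: "!!om. om : trace_class ==> (!!s. s : S ==> trace_pairing s om = 0) ==> trace_pairing T om = 0"
   by auto
  show "T : weak_star_ops closure_of S"
   unfolding in_closure_of top
  proof (intro conjI allI impI Tb)
   fix W assume "T : W & openin weak_star_ops W"
   then obtain U where TW: "T : W" and U: "openin ?P U" "W = ?p -` U \<inter> bounded_ops"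
    unfolding weak_star_ops_def openin_pullback_topology by blast
   have "?p T : U" using TW U by auto
   then obtain Y where fin: "finite {om : trace_class. Y om ~= topspace (euclidean :: complex topology)}"
    and Y: "?p T : Pi\<^sub>E trace_class Y" "Pi\<^sub>E trace_class Y \<subseteq> U"
    using U(1) unfolding openin_product_topology_alt by blast
   define F where "F = {om : trace_class. Y om ~= UNIV}"
   have F: "finite F" "F \<subseteq> trace_class" using fin by (auto simp: F_def)
   have "EX s:S. ALL om:F. trace_pairing s om = trace_pairing T om"
   proof (rule functional_interpolation[OF F(1) S(1)])
    fix c assume c: "!!s. s : S ==> (\<Sum>om\<in>F. c om*trace_pairing s om) = 0"
    define om0 where "om0 = (\<Sum>om\<in>F. scale_op (c om) om)"
    have tc: "scale_op (c om) om : trace_class" if "om : F" for om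
     using that F trace_class_scale(1) by blast
    have p: "trace_pairing R om0 = (\<Sum>om\<in>F. c om*trace_pairing R om)" if "R : bounded_ops" for R
     unfolding om0_def
     using F that by (subst trace_class_sum(3)[OF F(1) tc that]) (auto simp: trace_class_scale(2) intro!: sum.cong)
    have "om0 : trace_class" unfolding om0_def by (rule trace_class_sum(1)[OF F(1) tc])
    then show "(\<Sum>om\<in>F. c om*trace_pairing T om) = 0"
     using ann[of om0] p[of T] p S(2) c Tb by (metis subsetD)
   qed (use F S in \<open>auto intro!: trace_pairing_add_left trace_pairing_scale_left\<close>)
   then obtain s where s: "s : S" "!!om. om : F ==> trace_pairing s om = trace_pairing T om" by blast
   have "?p s : Pi\<^sub>E trace_class Y"
   proof (rule PiE_I)
    fix om :: "'h \<Rightarrow>\<^sub>L 'h" assume om: "om : trace_class"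
    have "trace_pairing T om : Y om" using Y(1) om by (auto simp: PiE_def Pi_def)
    then show "?p s om : Y om" using s(2)[of om] om by (cases "om : F") (auto simp: F_def)
   qed auto
   then show "EX y. y : S & y : W" using s(1) S(2) Y(2) U(2) by blast
  qed
 }
qed

section \<open>Integration on locally compact groups\<close>

subsection \<open>Continuous functions of compact support\<close>

definition Cc :: "('g::locally_compact_group => complex) set"
 where "Cc = {f. cont f & (EX K. compact K & (ALL x. x ~: K --> f x = 0))}"

lemma measurable_haar_iff: "f : borel_measurable haar \<longleftrightarrow> f : borel_measurable borel"
 unfolding measurable_cong_sets[OF sets_haar refl] ..

lemma measurable_haar_haar: "f : measurable haar haar \<longleftrightarrow> f : borel_measurable borel"
 unfolding measurable_cong_sets[OF sets_haar sets_haar] ..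

lemma CcI: "cont f ==> compact K ==> (!!x. x ~: K ==> f x = 0) ==> f : Cc"
 by (auto simp: Cc_def)

lemma CcE:
 assumes "f : Cc"
 obtains K where "cont f" "compact K" "!!x. x ~: K ==> f x = 0"
 using assms by (auto simp: Cc_def)

lemma Cc_continuous: "f : Cc ==> cont f"
 by (auto simp: Cc_def)

lemma cont_comp:
 "cont f ==> cont g ==> cont (%x. f (g x))"
 by (rule continuous_on_compose2[of UNIV f]) auto

lemma continuous_borel [measurable_dest]:
 fixes f :: "'g::topological_space => 'b::topological_space"
 shows "cont f ==> f : borel_measurable borel"
 by (rule borel_measurable_continuous_onI)

lemma Cc_measurable: "f : Cc ==> f : borel_measurable borel"
 by (intro continuous_borel Cc_continuous)

lemma Cc_bounded: assumes "f : Cc" shows "EX B>=0. ALL x. cmod (f x) <= B"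
proof -
 obtain K where K: "cont f" "compact K" "!!x. x ~: K ==> f x = 0" using assms by (rule CcE) blast
 have "compact (f ` K)" by (intro compact_continuous_image K continuous_on_subset[OF K(1)]) simp
 then have "bounded (f ` K)" by (rule compact_imp_bounded)
 then obtain B where B: "!!x. x : K ==> cmod (f x) <= B"
  by (auto simp: bounded_iff)
 show ?thesis
 proof (intro exI[of _ "max 0 B"] conjI allI)
  show "cmod (f x) <= max 0 B" for x
   using B[of x] K(3)[of x] by (cases "x : K") (simp_all add: le_max_iff_disj)
 qed simp
qed

lemma compact_borel [measurable]: "compact (K :: 'g::t2_space set) ==> K : sets borel"
 by (intro borel_closed compact_imp_closed)

lemma Cc_integrable: assumes "f : Cc" shows "integrable haar f"
proof -
 obtain K where K: "cont f" "compact K" "!!x. x ~: K ==> f x = 0" using assms by (rule CcE) blast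
 obtain B where "!!x. cmod (f x) <= B" using Cc_bounded[OF assms] by blast
 then show ?thesis
  using K haar_compact[OF K(2)] Cc_measurable[OF assms]
  by (intro integrableI_bounded_set[of K haar f B])
   (auto intro: compact_borel simp: measurable_haar_iff)
qed

lemma Cc_zero [simp]: "(%_. 0) : Cc"
 by (rule CcI[of _ "{}"]) auto

lemma Cc_add: assumes "f : Cc" "g : Cc" shows "(%x. f x + g x) : Cc"
proof -
 obtain K where K: "cont f" "compact K" "!!x. x ~: K ==> f x = 0" using assms(1) by (rule CcE) blast
 obtain L where L: "cont g" "compact L" "!!x. x ~: L ==> g x = 0" using assms(2) by (rule CcE) blast
 show ?thesis
  by (rule CcI[of _ "K \<union> L"]) (use K L in \<open>auto intro!: continuous_intros compact_Un\<close>)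
qed

lemma Cc_mult_left:
 assumes "f : Cc" "cont h" shows "(%x. h x*f x) : Cc"
proof -
 obtain K where K: "cont f" "compact K" "!!x. x ~: K ==> f x = 0" using assms(1) by (rule CcE) blast
 show ?thesis by (rule CcI[of _ K]) (use K assms in \<open>auto intro!: continuous_intros\<close>)
qed

lemma Cc_mult_right: "f : Cc ==> cont h ==> (%x. f x*h x) : Cc"
 using Cc_mult_left[of f h] by (simp add: mult.commute)

lemma Cc_scale: "f : Cc ==> (%x. c*f x) : Cc"
 by (rule Cc_mult_left) auto

lemma Cc_diff: "f : Cc ==> g : Cc ==> (%x. f x - g x) : Cc"
 using Cc_add[of f "%x. (-1)*g x"] Cc_scale[of g "-1"] by simp

lemma Cc_sum: "(!!i. i : I ==> f i : Cc) ==> (%x. \<Sum>i\<in>I. f i x) : Cc"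
 by (induction I rule: infinite_finite_induct) (auto intro: Cc_add)

lemma Cc_comp_norm:
 assumes "f : Cc" "cont h" "h 0 = 0" shows "(%x. h (f x)) : Cc"
proof -
 obtain K where K: "cont f" "compact K" "!!x. x ~: K ==> f x = 0" using assms(1) by (rule CcE) blast
 show ?thesis by (rule CcI[of _ K, OF cont_comp[OF assms(2) K(1)]]) (use K assms in simp_all)
qed

lemma Cc_cnj: "f : Cc ==> (%x. cnj (f x)) : Cc"
 by (rule Cc_comp_norm) (auto intro!: continuous_intros)

lemma Cc_cmod: "f : Cc ==> (%x. cor (cmod (f x))) : Cc"
 by (rule Cc_comp_norm[where h="%z. cor (cmod z)"]) (auto intro!: continuous_intros)

lemma Cc_compose:
 assumes "f : Cc" "cont sg" "cont sg'" "!!x. sg' (sg x) = x"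
 shows "(%x. f (sg x)) : Cc"
proof -
 obtain K where K: "cont f" "compact K" "!!x. x ~: K ==> f x = 0" using assms(1) by (rule CcE) blast
 have "f (sg x) = 0" if "x ~: sg' ` K" for x
 proof -
  have "sg x ~: K" using that assms(4)[of x] image_eqI[of x sg' "sg x" K] by metis
  then show ?thesis by (rule K(3))
 qed
 then show ?thesis
  by (intro CcI[of _ "sg' ` K"] cont_comp[OF K(1) assms(2)]
    compact_continuous_image[OF continuous_on_subset[OF assms(3)] K(2)]) simp_all
qed

lemma Cc_translate_left: "f : Cc ==> (%x. f (s + x)) : Cc"
 by (rule Cc_compose[where sg'="%x. - s + x"]) (auto intro!: continuous_intros simp: add.assoc[symmetric])

lemma Cc_translate_right: "f : Cc ==> (%x. f (x + s)) : Cc"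
 by (rule Cc_compose[where sg'="%x. x + - s"]) (auto intro!: continuous_intros simp: add.assoc simp del: add_uminus_conv_diff)

lemma Cc_inverse: "f : Cc ==> (%x. f (- x)) : Cc"
 by (rule Cc_compose[where sg'=uminus]) (auto intro!: continuous_intros)

lemma bump_function:
 fixes K U :: "'g::locally_compact_group set"
 assumes K: "compact K" and U: "open U" "K \<subseteq> U"
 shows "EX h :: 'g => real. cont h & (ALL x. 0 <= h x & h x <= 1) & (ALL x:K. h x = 1) &
  (ALL x. x ~: U --> h x = 0) & (EX L. compact L & (ALL x. x ~: L --> h x = 0))"
proof -
 have H: "Hausdorff_space (euclidean :: 'g topology)"
  unfolding Hausdorff_space_def using hausdorff by (fastforce simp: disjnt_def)
 have lc: "locally_compact_space (euclidean :: 'g topology)" by (rule locally_compact_space_UNIV)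
 have cr: "completely_regular_space (euclidean :: 'g topology)"
  using lc H locally_compact_regular_imp_completely_regular_space by blast
 \<comment> \<open>Cutting down to a relatively compact \<open>V\<close> gives the Urysohn function
   compact support.\<close>
 obtain V L where V: "open V" "compact L" "K \<subseteq> V" "V \<subseteq> L"
  using lc K locally_compact_space_compact_closed_compact[of "euclidean :: 'g topology"] H
  by (auto simp: open_openin[symmetric] closed_closedin[symmetric])
 have cl: "closedin euclidean (- (V \<inter> U))" using V(1) U(1) using closed_Compl[OF open_Int] by (simp del: Compl_Int)
 have dj: "disjnt K (- (V \<inter> U))" using V(3) U(2) by (auto simp: disjnt_def)
 have Kc: "compactin euclidean K" using K by simp
 obtain f :: "'g => real" where f: "continuous_map euclidean (subtopology euclidean {0..1}) f"
  "f ` K \<subseteq> {1}" "f ` (- (V \<inter> U)) \<subseteq> {0}"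
  by (rule Urysohn_completely_regular_compact_closed[OF zero_le_one cr Kc cl dj])
 have fc: "cont f" and "!!x. f x : {0..1}"
  using f(1) by (auto simp: continuous_map_in_subtopology)
 have "f x = 0" if "x ~: V \<inter> U" for x using f(3) that by blast
 then have fU: "f x = 0" if "x ~: U" for x using that by blast
 have fL: "f x = 0" if "x ~: L" for x using \<open>!!x. x ~: V \<inter> U ==> f x = 0\<close> V(4) that by blast
 have fK: "f x = 1" if "x : K" for x using f(2) that by blast
 have f01: "0 <= f x & f x <= 1" for x using \<open>!!x. f x : {0..1}\<close>[of x] by simp
 show ?thesis
 proof (intro exI[of _ f] conjI)
  show "EX L. compact L & (ALL x. x ~: L --> f x = 0)" using V(2) fL by blast
  show "ALL x. x ~: U --> f x = 0" using fU by blast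
  show "ALL x:K. f x = 1" using fK by blast
  show "ALL x. 0 <= f x & f x <= 1" using f01 by blast
 qed (rule fc)
qed

subsection \<open>Exchanging integrals of continuous functions\<close>

lemma integrable_mult_continuous:
 fixes g k :: "'g::locally_compact_group => complex"
 assumes g: "integrable haar g" and B: "compact B" "!!t. t ~: B ==> g t = 0"
  and k: "k : borel_measurable borel" "!!t. t : B ==> cmod (k t) <= C"
 shows "integrable haar (%t. g t*k t)" "cmod (LI t. g t*k t) <= C*(LI t. cmod (g t))"
proof -
 have gm: "g : borel_measurable borel" using borel_measurable_integrable[OF g] by (simp add: measurable_haar_iff)
 have le: "cmod (g t*k t) <= C*cmod (g t)" for t
  using k(2)[of t] B(2)[of t] by (cases "t : B") (auto simp: norm_mult mult.commute[of C] intro: mult_left_mono)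
 have i: "integrable haar (%t. C*cmod (g t))" using g by simp
 show gk: "integrable haar (%t. g t*k t)"
 proof (rule BI_bound[OF i])
  show "(%t. g t*k t) : borel_measurable haar" using gm k(1) by (simp add: measurable_haar_iff)
  show "AE t in haar. cmod (g t*k t) <= norm (C*cmod (g t))"
   unfolding real_norm_def by (intro AE_I2 order_trans[OF le abs_ge_self])
 qed
 have "cmod (LI t. g t*k t) <= (LI t. cmod (g t*k t))" by (rule integral_norm_bound)
 also have "\<dots> <= (LI t. C*cmod (g t))" by (rule integral_mono) (use gk i le in auto)
 finally show "cmod (LI t. g t*k t) <= C*(LI t. cmod (g t))" by simp
qed

lemma uniform_on_compact:
 fixes k :: "'p::topological_space => 'g::topological_space => complex"
 assumes k: "cont (%(s, t). k s t)" and B: "compact B" and e: "0 < e"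
 shows "EX U. open U & s0 : U & (ALL s:U. ALL t:B. cmod (k s t - k s0 t) <= e)"
proof -
 have "continuous_on (UNIV \<times> B) (%(s, t). k s t)" by (rule continuous_on_subset[OF k]) simp
 from continuous_on_prod_compactE[OF this B UNIV_I e, of s0]
 have "EX X. s0 : X & open X & (ALL x:X \<inter> UNIV. ALL t:B.
   dist ((%(s, t). k s t) (x, t)) ((%(s, t). k s t) (s0, t)) <= e)" by metis
 then show ?thesis by (simp only: Int_UNIV_right case_prod_conv dist_norm) blast
qed

lemma continuous_section:
 "cont (%(s, t). k s t) ==> cont (%t. k s t)"
 by (drule cont_comp[where g="%t. (s, t)"]) (auto intro!: continuous_intros)

lemma continuous_section':
 "cont (%(s, t). k s t) ==> cont (%s. k s t)"
 by (drule cont_comp[where g="%s. (s, t)"]) (auto intro!: continuous_intros)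

lemma bounded_on_compact:
 fixes h :: "'g::topological_space => complex"
 assumes "cont h" "compact B"
 shows "EX C. ALL t:B. cmod (h t) <= C"
proof -
 have "compact (h ` B)" by (rule compact_continuous_image[OF continuous_on_subset[OF assms(1)] assms(2)]) simp
 then have "bounded (h ` B)" by (rule compact_imp_bounded)
 then show ?thesis by (auto simp: bounded_iff)
qed

lemma integrable_kernel:
 fixes g :: "'g::locally_compact_group => complex"
 assumes g: "integrable haar g" and B: "compact B" "!!t. t ~: B ==> g t = 0"
  and k: "cont k"
 shows "integrable haar (%t. g t*k t)"
proof -
 obtain C where "!!t. t : B ==> cmod (k t) <= C" using bounded_on_compact[OF k B(1)] by blast
 from integrable_mult_continuous(1)[OF g B continuous_borel[OF k] this] show ?thesis .
qed

lemma continuous_param_integral: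
 fixes g :: "'g::locally_compact_group => complex" and k :: "'p::topological_space => 'g => complex"
 assumes k: "cont (%(s, t). k s t)"
  and g: "integrable haar g" and B: "compact B" "!!t. t ~: B ==> g t = 0"
 shows "cont (%s. LI t. g t*k s t)"
 unfolding continuous_on_def
proof (intro ballI)
 fix s0 :: 'p
 define N where "N = (LI t. cmod (g t))"
 have N: "0 <= N" unfolding N_def by (rule integral_nonneg_AE) simp
 have ig: "integrable haar (%t. g t*k s t)" for s
  by (rule integrable_kernel[OF g B continuous_section[OF k]])
 show "((%s. LI t. g t*k s t) \<longlongrightarrow> (LI t. g t*k s0 t)) (at s0 within UNIV)"
  unfolding tendsto_iff
 proof (intro allI impI)
  fix e :: real assume e: "0 < e"
  then have "0 < e / (N + 1)" using N by simp
  from uniform_on_compact[OF k B(1) this, of s0] obtain U where U: "open U" "s0 : U"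
   and Uk: "ALL s:U. ALL t:B. cmod (k s t - k s0 t) <= e / (N + 1)" by auto
  have "dist (LI t. g t*k s t) (LI t. g t*k s0 t) < e" if "s : U" for s
  proof -
   have "(LI t. g t*k s t) - (LI t. g t*k s0 t) = (LI t. g t*(k s t - k s0 t))"
    by (simp add: right_diff_distrib ig)
   also have "cmod \<dots> <= e / (N + 1)*(LI t. cmod (g t))"
   proof (rule integrable_mult_continuous(2)[OF g B])
    show "(%t. k s t - k s0 t) : borel_measurable borel"
     by (intro continuous_borel continuous_intros continuous_section[OF k])
    show "cmod (k s t - k s0 t) <= e / (N + 1)" if "t : B" for t using Uk \<open>s : U\<close> that by simp
   qed
   also have "\<dots> < e"
   proof -
    have "N / (N + 1) < 1" using N by simp
    then have "e*(N / (N + 1)) < e * 1" using e by (intro mult_strict_left_mono)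
    then show ?thesis by (simp add: N_def)
   qed
   finally show ?thesis by (simp add: dist_norm)
  qed
  then show "\<forall>\<^sub>F s in at s0 within UNIV. dist (LI t. g t*k s t) (LI t. g t*k s0 t) < e"
   unfolding eventually_at_topological using U by blast
 qed
qed

text \<open>A measurable choice, for each covered point, of one of finitely many open sets
  containing it. It turns a uniform approximation on patches into a kernel with finitely many
  measurable pieces.\<close>

lemma finite_selection:
 fixes U :: "'a => 'g::topological_space set"
 assumes "finite P" "P ~= {}" "!!p. p : P ==> open (U p)"
 shows "EX sg. (ALL p. {s. sg s = p} : sets borel) & (ALL s. sg s : P) & (ALL s:(\<Union>p\<in>P. U p). s : U (sg s))"
 using assms
proof (induction P rule: finite_ne_induct)
 case (singleton x)
 have "{s :: 'g. x = p} : sets borel" for p by (cases "x = p") auto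
 then show ?case by (intro exI[of _ "%_. x"]) auto
next
 case (insert x F)
 then obtain sg where sg: "!!p. {s. sg s = p} : sets borel" "!!s. sg s : F"
  "!!s. s : (\<Union>p\<in>F. U p) ==> s : U (sg s)" by (metis insertCI)
 define ta where "ta s = (if s : U x then x else sg s)" for s
 have Ux: "U x : sets borel" using insert.prems by (intro borel_open) simp
 have "{s. ta s = p} = (if x = p then U x \<union> {s. sg s = p} else {s. sg s = p} - U x)" for p
  by (auto simp: ta_def)
 then have "{s. ta s = p} : sets borel" for p
  using sets.Un[OF Ux sg(1)[of p]] sets.Diff[OF sg(1)[of p] Ux] by (cases "x = p") simp_all
 moreover have "ta s : insert x F" for s using sg(2) by (simp add: ta_def)
 moreover have "s : U (ta s)" if "s : (\<Union>p\<in>insert x F. U p)" for s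
  using that sg(3)[of s] by (auto simp: ta_def)
 ultimately show ?case by blast
qed

lemma measurable_finite_range:
 fixes c :: "'a => complex" and sg :: "'g::topological_space => 'a"
 assumes sg: "finite P" "!!s. sg s : P" "!!p. {s. sg s = p} : sets borel"
 shows "(%s. c (sg s)) : borel_measurable borel"
proof -
 have "(%s. c (sg s)) = (%s. \<Sum>p\<in>P. c p*indicator {s. sg s = p} s)"
 proof
  fix s
  have "(\<Sum>p\<in>P. c p*indicator {s. sg s = p} s) = (\<Sum>p\<in>P. if p = sg s then c p else 0)"
   by (rule sum.cong) (auto simp: indicator_def)
  then show "c (sg s) = (\<Sum>p\<in>P. c p*indicator {s. sg s = p} s)" using sg(1,2) by simp
 qed
 also have "\<dots> : borel_measurable borel"
  using sg(3) by (intro borel_measurable_sum borel_measurable_times borel_measurable_indicator) auto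
 finally show ?thesis .
qed

lemma integral_finite_range:
 fixes f :: "'g::locally_compact_group => complex" and c :: "'a => complex"
 assumes f: "integrable haar f" and sg: "finite P" "!!s. sg s : P" "!!p. {s. sg s = p} : sets borel"
 shows "integrable haar (%s. f s*c (sg s))"
  "(LI s. f s*c (sg s)) = (\<Sum>p\<in>P. c p*(LI s. f s*indicator {s. sg s = p} s))"
proof -
 have eq: "f s*c (sg s) = (\<Sum>p\<in>P. c p*(f s*indicator {s. sg s = p} s))" for s
 proof -
  have "(\<Sum>p\<in>P. c p*(f s*indicator {s. sg s = p} s)) = (\<Sum>p\<in>P. if p = sg s then c p*f s else 0)"
   by (rule sum.cong) (auto simp: indicator_def)
  then show ?thesis using sg(1,2) by simp
 qed
 have i: "integrable haar (%s. f s*indicator {s. sg s = p} s)" for p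
  using integrable_mult_indicator[OF _ f, of "{s. sg s = p}"] sg(3)
  by (simp add: scaleR_conv_of_real of_real_indicator mult.commute)
 show "integrable haar (%s. f s*c (sg s))" unfolding eq using i by auto
 show "(LI s. f s*c (sg s)) = (\<Sum>p\<in>P. c p*(LI s. f s*indicator {s. sg s = p} s))"
  unfolding eq using i by (subst Bi_sum) auto
qed

text \<open>The measure need not be \<open>\<sigma>\<close>-finite and the product Borel sets need not be generated by
  rectangles, so Fubini's theorem for products is replaced by approximating the kernel uniformly by one
  that takes finitely many values in the first variable.\<close>

lemma fubini_kernel:
 fixes f g :: "'g::locally_compact_group => complex" and k :: "'g => 'g => complex"
 assumes k: "cont (%(s, t). k s t)"
  and f: "integrable haar f" and A: "compact A" "!!s. s ~: A ==> f s = 0"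
  and g: "integrable haar g" and B: "compact B" "!!t. t ~: B ==> g t = 0"
 shows "(LI s. f s*(LI t. g t*k s t)) = (LI t. g t*(LI s. f s*k s t))"
proof (cases "A = {}")
 case True
 then show ?thesis using A(2) by simp
next
 case False
 define Nf where "Nf = (LI t. cmod (f t))"
 define Ng where "Ng = (LI t. cmod (g t))"
 have N: "0 <= Nf" "0 <= Ng" unfolding Nf_def Ng_def by (auto intro!: integral_nonneg_AE)
 define L where "L = (LI s. f s*(LI t. g t*k s t))"
 define R where "R = (LI t. g t*(LI s. f s*k s t))"
 have k': "cont (%(t, s). k s t)"
 proof -
  have "cont (%p :: 'g \<times> 'g. (snd p, fst p))" by (intro continuous_intros)
  from cont_comp[OF k this] show ?thesis by (simp add: case_prod_unfold)
 qed
 \<comment> \<open>Both iterated integrals are close to the same finite sum, obtained by freezing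
   the first variable at finitely many points of \<open>A\<close>; for that sum the exchange is mere
   linearity.\<close>
 have est: "cmod (L - R) <= 2*(Nf*Ng)*e" if e: "0 < e" for e
 proof -
  have "EX U. open U & s : U & (ALL s':U. ALL t:B. cmod (k s' t - k s t) <= e)" for s
   by (rule uniform_on_compact[OF k B(1) e])
  then obtain U where U: "!!s. open (U s)" "!!s. s : U s"
   "!!s s' t. s' : U s ==> t : B ==> cmod (k s' t - k s t) <= e" by metis
  obtain P where P: "P \<subseteq> A" "finite P" "A \<subseteq> (\<Union>p\<in>P. U p)"
   using compactE_image[OF A(1), of A U] U by blast
  then have "P ~= {}" using False by auto
  from finite_selection[OF P(2) this, of U] U(1)
  have "EX sg. (ALL p. {s. sg s = p} : sets borel) & (ALL s. sg s : P) & (ALL s:(\<Union>p\<in>P. U p). s : U (sg s))"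
   by simp
  then obtain sg where sg': "ALL p. {s. sg s = p} : sets borel" "ALL s. sg s : P"
   "ALL s:(\<Union>p\<in>P. U p). s : U (sg s)" by (elim exE conjE)
  have sg: "{s. sg s = p} : sets borel" "sg s : P" "s : (\<Union>p\<in>P. U p) ==> s : U (sg s)" for p s
   by (rule sg'(1)[rule_format], rule sg'(2)[rule_format], erule sg'(3)[rule_format])
  have close: "cmod (k s t - k (sg s) t) <= e" if "s : A" "t : B" for s t
   by (rule U(3)[OF sg(3)[OF subsetD[OF P(3) that(1)]] that(2)])
  define c where "c p = (LI t. g t*k p t)" for p
  define m where "m p = (LI s. f s*indicator {s. sg s = p} s)" for p
  have cc: "cont c" unfolding c_def by (rule continuous_param_integral[OF k g B])
  have ig: "integrable haar (%t. g t*k s t)" for s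
   by (rule integrable_kernel[OF g B continuous_section[OF k]])
  have jf: "integrable haar (%s. f s*k s t)" for t
   by (rule integrable_kernel[OF f A continuous_section'[OF k]])
  have L1: "cmod (L - (\<Sum>p\<in>P. c p*m p)) <= e*Ng*Nf"
  proof -
   have 1: "integrable haar (%s. f s*c s)" by (rule integrable_kernel[OF f A cc])
   note 2 = integral_finite_range[OF f P(2) sg(2) sg(1), of c]
   have "L - (\<Sum>p\<in>P. c p*m p) = (LI s. f s*(c s - c (sg s)))"
    unfolding L_def m_def 2(2)[symmetric] c_def[symmetric] right_diff_distrib
    using 1 2(1) by (subst Bi_diff) auto
   also have "cmod \<dots> <= e*Ng*(LI s. cmod (f s))"
   proof (rule integrable_mult_continuous(2)[OF f A])
    show "(%s. c s - c (sg s)) : borel_measurable borel"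
     by (intro borel_measurable_diff continuous_borel[OF cc] measurable_finite_range[OF P(2) sg(2) sg(1)])
    fix s assume s: "s : A"
    have "c s - c (sg s) = (LI t. g t*(k s t - k (sg s) t))"
     unfolding c_def by (simp add: right_diff_distrib ig)
    also have "cmod \<dots> <= e*Ng" unfolding Ng_def
     by (rule integrable_mult_continuous(2)[OF g B])
      (auto intro!: continuous_borel continuous_intros continuous_section[OF k] close s)
    finally show "cmod (c s - c (sg s)) <= e*Ng" .
   qed
   finally show ?thesis by (simp add: Nf_def)
  qed
  have R1: "cmod (R - (\<Sum>p\<in>P. c p*m p)) <= e*Nf*Ng"
  proof -
   define d where "d t = (LI s. f s*k s t)" for t
   have dc: "cont d" unfolding d_def by (rule continuous_param_integral[OF k' f A])
   define d' where "d' t = (\<Sum>p\<in>P. k p t*m p)" for t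
   have d'c: "cont d'" unfolding d'_def
    by (intro continuous_intros continuous_section[OF k])
   have 1: "integrable haar (%t. g t*d t)" by (rule integrable_kernel[OF g B dc])
   have 2: "integrable haar (%t. g t*d' t)" by (rule integrable_kernel[OF g B d'c])
   have "(LI t. g t*d' t) = (LI t. (\<Sum>p\<in>P. (g t*k p t)*m p))"
    unfolding d'_def by (simp add: sum_distrib_left mult.assoc)
   also have "\<dots> = (\<Sum>p\<in>P. c p*m p)"
    unfolding c_def using ig by (subst Bi_sum) auto
   finally have "R - (\<Sum>p\<in>P. c p*m p) = (LI t. g t*(d t - d' t))"
    unfolding R_def d_def[symmetric] right_diff_distrib
    using 1 2 by (subst Bi_diff) auto
   also have "cmod \<dots> <= e*Nf*(LI t. cmod (g t))"
   proof (rule integrable_mult_continuous(2)[OF g B])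
    show "(%t. d t - d' t) : borel_measurable borel" by (intro continuous_borel continuous_intros dc d'c)
    fix t assume t: "t : B"
    note 3 = integral_finite_range[OF f P(2) sg(2) sg(1), of "%p. k p t"]
    have "d t - d' t = (LI s. f s*(k s t - k (sg s) t))"
     unfolding d_def d'_def m_def 3(2)[symmetric] right_diff_distrib
     using jf 3(1) by (subst Bi_diff) auto
    also have "cmod \<dots> <= e*Nf" unfolding Nf_def
    proof (rule integrable_mult_continuous(2)[OF f A])
     show "(%s. k s t - k (sg s) t) : borel_measurable borel"
      by (intro borel_measurable_diff continuous_borel[OF continuous_section'[OF k]]
        measurable_finite_range[OF P(2) sg(2) sg(1), of "%p. k p t"])
    qed (simp_all add: close t)
    finally show "cmod (d t - d' t) <= e*Nf" .
   qed
   finally show ?thesis by (simp add: Ng_def)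
  qed
  have "cmod (L - R) <= cmod (L - (\<Sum>p\<in>P. c p*m p)) + cmod (R - (\<Sum>p\<in>P. c p*m p))"
   using norm_triangle_ineq4[of "L - (\<Sum>p\<in>P. c p*m p)" "R - (\<Sum>p\<in>P. c p*m p)"] by simp
  also have "\<dots> <= e*Ng*Nf + e*Nf*Ng" by (rule add_mono[OF L1 R1])
  also have "\<dots> = 2*(Nf*Ng)*e" by (simp add: algebra_simps)
  finally show ?thesis .
 qed
 have "cmod (L - R) <= 0"
 proof (rule field_le_epsilon)
  fix e :: real assume e: "0 < e"
  have p: "0 < 2*(Nf*Ng) + 1" using N by (simp add: add_nonneg_pos)
  have "cmod (L - R) <= 2*(Nf*Ng)*(e / (2*(Nf*Ng) + 1))" by (rule est) (use e p in simp)
  also have "\<dots> = e*(2*(Nf*Ng) / (2*(Nf*Ng) + 1))" by simp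
  also have "\<dots> <= e * 1" using e p by (intro mult_left_mono) (auto simp: divide_le_eq_1)
  finally show "cmod (L - R) <= 0 + e" by simp
 qed
 then show ?thesis by (simp add: L_def R_def)
qed

lemma integrable_indicator_compact:
 "compact K ==> integrable haar (indicator K :: 'g::locally_compact_group => complex)"
proof -
 assume "compact K"
 then have "integrable haar (indicator K :: 'g => real)"
  using haar_compact compact_borel by (intro integrable_real_indicator) auto
 then have "integrable haar (%x. cor (indicator K x))" by (rule integrable_of_real)
 then show "integrable haar (indicator K :: 'g => complex)" by (simp add: of_real_indicator)
qed

text \<open>For a kernel that itself vanishes off \<open>A \<times> B\<close>, the indicators of
  \<open>A\<close> and \<open>B\<close> serve as the two integrable factors.\<close>

lemma fubini_compact_support:
 fixes k :: "'g::locally_compact_group => 'g => complex"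
 assumes k: "cont (%(s, t). k s t)" and AB: "compact A" "compact B"
  and supp: "!!s t. s ~: A \<or> t ~: B ==> k s t = 0"
 shows "(LI s. LI t. k s t) = (LI t. LI s. k s t)"
proof -
 have 1: "indicator B t*k s t = k s t" "indicator A s*k s t = k s t" for s t
  using supp[of s t] by (auto simp: indicator_def)
 have 2: "indicator A s*(LI t. k s t) = (LI t. k s t)" for s
 proof (cases "s : A")
  case False
  then have "k s = (%_. 0)" using supp by blast
  then show ?thesis by simp
 qed simp
 have 3: "indicator B t*(LI s. k s t) = (LI s. k s t)" for t
 proof (cases "t : B")
  case False
  then have "(%s. k s t) = (%_. 0)" using supp by blast
  then show ?thesis by simp
 qed simp
 show ?thesis
  using fubini_kernel[OF k integrable_indicator_compact[OF AB(1)] AB(1) _ integrable_indicator_compact[OF AB(2)] AB(2)]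
  by (simp add: 1 2 3)
qed

lemma continuous_integral_compact_support:
 fixes k :: "'p::topological_space => 'g::locally_compact_group => complex"
 assumes k: "cont (%(s, t). k s t)" and B: "compact B"
  and supp: "!!s t. t ~: B ==> k s t = 0"
 shows "cont (%s. LI t. k s t)"
proof -
 have 1: "indicator B t*k s t = k s t" for s t
  using supp[of t s] by (auto simp: indicator_def)
 show ?thesis
  using continuous_param_integral[OF k integrable_indicator_compact[OF B] B] by (simp add: 1)
qed

subsection \<open>Invariance and the modular function\<close>

lemma translate_measurable [measurable]:
 fixes s :: "'g::locally_compact_group"
 shows "(%t. s + t) : borel_measurable borel" "(%t. t + s) : borel_measurable borel"
 by (auto intro!: continuous_borel continuous_intros)

lemma translate_image_left: "(%t. s + t) ` U = (%t. - s + t) -` U" for s :: "'a::group_add"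
proof (intro set_eqI iffI)
 fix x assume "x : (%t. s + t) ` U"
 then show "x : (%t. - s + t) -` U" by (auto simp: add.assoc[symmetric])
next
 fix x assume "x : (%t. - s + t) -` U"
 then have "- s + x : U" by simp
 moreover have "x = s + (- s + x)" by (simp add: add.assoc[symmetric])
 ultimately show "x : (%t. s + t) ` U" by (rule image_eqI[rotated])
qed

lemma translate_image_right: "(%t. t + s) ` U = (%t. t - s) -` U" for s :: "'a::group_add"
proof (intro set_eqI iffI)
 fix x assume "x : (%t. t - s) -` U"
 then have "x - s : U" by simp
 moreover have "x = (x - s) + s" by simp
 ultimately show "x : (%t. t + s) ` U" by (rule image_eqI[rotated])
qed auto

lemma distr_haar_left: "distr haar haar (%t. s + t) = (haar :: 'g::locally_compact_group measure)"
proof (rule measure_eqI)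
 fix A assume "A : sets (distr haar haar (%t. s + t :: 'g))"
 then have A: "A : sets haar" by simp
 have "emeasure (distr haar haar (%t. s + t)) A = emeasure haar ((%t. s + t) -` A \<inter> space haar)"
  by (rule emeasure_distr) (use A in \<open>simp_all add: measurable_haar_haar\<close>)
 also have "(%t. s + t) -` A \<inter> space haar = (%t. - s + t) ` A"
  by (simp add: translate_image_left)
 finally show "emeasure (distr haar haar (%t. s + t)) A = emeasure haar A"
  using haar_left_invariant[OF A] by simp
qed simp

lemma integral_haar_left:
 fixes f :: "'g::locally_compact_group => 'b::{banach, second_countable_topology}"
 assumes "f : borel_measurable borel"
 shows "(LI t. f (s + t)) = (LI t. f t)"
  "integrable haar (%t. f (s + t)) \<longleftrightarrow> integrable haar f"
proof -
 have m: "(%t. s + t) : measurable haar haar" by (simp add: measurable_haar_haar)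
 show "(LI t. f (s + t)) = (LI t. f t)"
  using integral_distr[OF m, of f] assms by (simp add: distr_haar_left measurable_haar_iff)
 show "integrable haar (%t. f (s + t)) \<longleftrightarrow> integrable haar f"
  using integrable_distr_eq[OF m, of f] assms by (simp add: distr_haar_left measurable_haar_iff)
qed

text \<open>Finitely many left translates of a nonempty open set cover any given compact set. If the
  open set were null, so would be all compact sets and, by inner regularity, the whole
  group.\<close>

lemma haar_open_pos:
 fixes U :: "'g::locally_compact_group set"
 assumes U: "open U" "U ~= {}" shows "emeasure haar U > 0"
proof (rule ccontr)
 assume "\<not> emeasure haar U > 0"
 then have U0: "emeasure haar U = 0" by simp
 obtain u where u: "u : U" using U by blast
 have "emeasure haar K = 0" if K: "compact K" for K :: "'g set"
 proof -
  define V where "V x = (%t. x - u + t) ` U" for x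
  have Vv: "V x = (%t. - (x - u) + t) -` U" for x
   unfolding V_def by (rule translate_image_left)
  have Vo: "open (V x)" for x unfolding Vv
   by (intro open_vimage U continuous_intros)
  have "x : V x" for x unfolding V_def using u by (intro image_eqI[of _ _ u]) simp_all
  then have "K \<subseteq> (\<Union>x\<in>K. V x)" by (rule UN_I[THEN subsetI, rotated])
  from compactE_image[OF K Vo this] obtain P where P: "P \<subseteq> K" "finite P" "K \<subseteq> (\<Union>x\<in>P. V x)" .
  have V0: "emeasure haar (V x) = 0" for x
   unfolding V_def using haar_left_invariant[of U "x - u"] U U0 by simp
  have "emeasure haar K <= emeasure haar (\<Union>x\<in>P. V x)"
   using P Vo by (intro emeasure_mono) auto
  also have "\<dots> <= (\<Sum>x\<in>P. emeasure haar (V x))"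
   using P Vo by (intro emeasure_subadditive_finite) auto
  finally show ?thesis by (simp add: V0)
 qed
 then have "emeasure haar (UNIV :: 'g set) = 0"
  using haar_inner_regular[of "UNIV :: 'g set"] by (auto intro!: SUP_eq_const simp: SUP_constant bot_ennreal)
 then show False using haar_nonzero[where 'a='g] by simp
qed

lemma continuous_AE_eq_0:
 fixes f :: "'g::locally_compact_group => 'b::{t1_space, zero}"
 assumes f: "cont f" and ae: "AE t in haar. f t = 0"
 shows "f t = 0"
proof (rule ccontr)
 assume "f t ~= 0"
 define U where "U = f -` (- {0})"
 have U: "open U" unfolding U_def by (rule open_vimage[OF _ f]) auto
 have "emeasure haar U = 0"
 proof -
  have "AE t in haar. t ~: U" using ae by eventually_elim (simp add: U_def)
  then show ?thesis using U by (simp add: AE_iff_measurable[of U haar] )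
 qed
 then show False using haar_open_pos[OF U] \<open>f t ~= 0\<close> by (auto simp: U_def)
qed

lemma Cc_integral_sq_0:
 fixes f :: "'g::locally_compact_group => complex"
 assumes f: "f : Cc" and 0: "(LI t. f t*cnj (f t)) = 0"
 shows "f t = 0"
proof -
 have eq: "f t*cnj (f t) = cor ((cmod (f t))\<^sup>2)" for t by (rule complex_norm_square[symmetric])
 have i: "integrable haar (%t. cor ((cmod (f t))\<^sup>2))"
  unfolding eq[symmetric] by (intro Cc_integrable Cc_mult_right f continuous_intros Cc_continuous)
 then have i': "integrable haar (%t. (cmod (f t))\<^sup>2)" by (simp only: complex_of_real_integrable_eq)
 have "cor (LI t. (cmod (f t))\<^sup>2) = 0"
  using 0 unfolding eq by (metis integral_complex_of_real)
 then have "AE t in haar. (cmod (f t))\<^sup>2 = 0"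
  using integral_nonneg_eq_0_iff_AE[OF i'] by simp
 then have "AE t in haar. f t = 0" by eventually_elim simp
 then show ?thesis by (rule continuous_AE_eq_0[OF Cc_continuous[OF f]])
qed

lemma Cc_unit:
 fixes U :: "'g::locally_compact_group set"
 assumes U: "open U" "0 : U"
 shows "EX h :: 'g => real. (%x. cor (h x)) : Cc & (ALL x. 0 <= h x) & (ALL x. x ~: U --> h x = 0) &
  (LI t. h t) = 1 & cont h"
proof -
 obtain f :: "'g => real" and L where f: "cont f" "!!x. 0 <= f x" "f 0 = 1" "!!x. x ~: U ==> f x = 0"
  and L: "compact L" "!!x. x ~: L ==> f x = 0"
  using bump_function[of "{0}" U] U by auto
 have fc: "(%x. cor (f x)) : Cc" by (rule CcI[of _ L]) (auto intro!: continuous_intros f L)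
 then have fi: "integrable haar f" using Cc_integrable[OF fc] by (simp only: complex_of_real_integrable_eq)
 define I where "I = (LI t. f t)"
 have "I ~= 0"
 proof
  assume "I = 0"
  then have "AE t in haar. f t = 0" unfolding I_def using integral_nonneg_eq_0_iff_AE[OF fi] f(2) by simp
  then show False using continuous_AE_eq_0[OF f(1), of 0] f(3) by simp
 qed
 moreover have "0 <= I" unfolding I_def using f(2) by (intro integral_nonneg_AE) simp
 ultimately have I: "0 < I" by simp
 show ?thesis
 proof (intro exI[of _ "%x. f x / I"] conjI allI impI)
  show "(%x. cor (f x / I)) : Cc" using Cc_scale[OF fc, of "1 / I"] by simp
  show "(LI t. f t / I) = 1" using I by (simp add: I_def)
  show "cont (%x. f x / I)" using I by (intro continuous_intros f) auto
 qed (use f I in auto)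
qed

lemma compact_plus:
 fixes K L :: "'g::topological_monoid_add set"
 assumes "compact K" "compact L" shows "compact ((%(x, y). x + y) ` (K \<times> L))"
 by (intro compact_continuous_image compact_Times assms)
  (auto simp: case_prod_unfold intro!: continuous_intros)

lemma plus_image_mem: "x : K ==> y : L ==> x + y : (%(x, y). x + y) ` (K \<times> L)"
 by (rule image_eqI[of _ _ "(x, y)"]) auto

lemma compact_uminus: "compact K ==> compact (uminus ` (K :: 'g::topological_group_add set))"
 by (intro compact_continuous_image) (auto intro!: continuous_intros)

text \<open>Uniqueness of Haar measure, for functionals given by a change of variables in the Haar integral.\<close>

lemma haar_functional_unique:
 fixes sg sg' :: "'g::locally_compact_group => 'g" and ka :: "'g => complex"
 assumes sg: "cont sg" "cont sg'" "!!x. sg' (sg x) = x"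
  and ka: "cont ka"
  and inv: "!!F s. F : Cc ==> (LI t. F (s + sg t)*ka t) = (LI t. F (sg t)*ka t)"
  and f1: "f1 : Cc" and f2: "f2 : Cc"
 shows "(LI t. f2 t)*(LI t. f1 (sg t)*ka t) = (LI t. f1 t)*(LI t. f2 (sg t)*ka t)"
proof -
 define \<nu> where "\<nu> F = (LI t. F (sg t)*ka t)" for F
 \<comment> \<open>The functional applied to right translates of \<open>f\<close>; at
   \<open>s = 0\<close> it is the quantity in the claim.\<close>
 define ph where "ph f s = (LI t. f (sg t + s)*ka t)" for f s
 have phCc: "(%s. h s*ph f s) : Cc" if f: "f : Cc" and h: "h : Cc" for f h
 proof -
  obtain K where K: "cont f" "compact K" "!!x. x ~: K ==> f x = 0" using f by (rule CcE) blast
  obtain L where L: "cont h" "compact L" "!!x. x ~: L ==> h x = 0" using h by (rule CcE) blast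
  define B where "B = sg' ` ((%(x, y). x + y) ` (K \<times> uminus ` L))"
  have B: "compact B" unfolding B_def
   by (rule compact_continuous_image[OF continuous_on_subset[OF sg(2)] compact_plus[OF K(2) compact_uminus[OF L(2)]]]) simp
  have "h s*(f (sg t + s)*ka t) = 0" if t: "t ~: B" for s t
  proof (rule ccontr)
   assume "h s*(f (sg t + s)*ka t) ~= 0"
   then have "s : L" "sg t + s : K" using K(3) L(3) by auto
   then have "(sg t + s) + (- s) : (%(x, y). x + y) ` (K \<times> uminus ` L)" by (intro plus_image_mem imageI)
   then have "sg' (sg t) : B" unfolding B_def by (intro imageI) (simp add: add.assoc del: add_uminus_conv_diff)
   then show False using t sg(3) by simp
  qed
  then have "cont (%s. LI t. h s*(f (sg t + s)*ka t))"
   by (intro continuous_integral_compact_support[OF _ B])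
    (auto simp: case_prod_unfold intro!: continuous_intros cont_comp[OF K(1)]
     cont_comp[OF L(1)] cont_comp[OF sg(1)] cont_comp[OF ka])
  then have "cont (%s. h s*ph f s)" by (simp add: ph_def)
  then show ?thesis by (rule CcI[OF _ L(2)]) (simp add: L(3))
 qed
 \<comment> \<open>Insert the invariance of the functional, exchange the integrals, substitute
   \<open>sg t + s\<close> for \<open>s\<close>, and exchange back. Thus the right-hand side depends
   on \<open>f\<close> only through the Haar integral of \<open>f\<close>.\<close>
 have key: "(LI t. f t)*\<nu> g = (LI s. g (- s)*ph f s)" if f: "f : Cc" and g: "g : Cc" for f g
 proof -
  obtain K where K: "cont f" "compact K" "!!x. x ~: K ==> f x = 0" using f by (rule CcE) blast
  obtain L where L: "cont g" "compact L" "!!x. x ~: L ==> g x = 0" using g by (rule CcE) blast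
  define B where "B = sg' ` ((%(x, y). x + y) ` (K \<times> L))"
  have B: "compact B" unfolding B_def
   by (rule compact_continuous_image[OF continuous_on_subset[OF sg(2)] compact_plus[OF K(2) L(2)]]) simp
  have tB: "t : B" if "x : K" "y : L" "x + y = sg t" for x y t
  proof -
   have "sg' (x + y) : B" unfolding B_def using that by (intro imageI plus_image_mem)
   then show ?thesis using that(3) sg(3) by simp
  qed
  note ci = continuous_intros cont_comp[OF K(1)] cont_comp[OF L(1)]
   cont_comp[OF sg(1)] cont_comp[OF ka]
  have "(LI t. f t)*\<nu> g = (LI s. f s*\<nu> g)" by simp
  also have "\<dots> = (LI s. LI t. f s*(g (- s + sg t)*ka t))"
   by (simp add: \<nu>_def inv[OF g])
  also have "\<dots> = (LI t. LI s. f s*(g (- s + sg t)*ka t))"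
  proof (rule fubini_compact_support[OF _ K(2) B])
   show "cont (%(s, t). f s*(g (- s + sg t)*ka t))"
    unfolding case_prod_unfold by (intro ci)
   fix s t assume st: "s ~: K \<or> t ~: B"
   show "f s*(g (- s + sg t)*ka t) = 0"
   proof (rule ccontr)
    assume "f s*(g (- s + sg t)*ka t) ~= 0"
    then have "s : K" "- s + sg t : L" using K(3) L(3) by auto
    then show False using st tB[of s "- s + sg t" t] by (simp add: add.assoc[symmetric])
   qed
  qed
  also have "\<dots> = (LI t. LI s. g (- s)*(f (sg t + s)*ka t))"
  proof (rule Bi_cong[OF refl])
   fix t
   have "(LI s. f s*(g (- s + sg t)*ka t)) = (LI s. f (sg t + s)*(g (- (sg t + s) + sg t)*ka t))"
    by (rule integral_haar_left(1)[symmetric], rule continuous_borel) (intro ci)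
   then show "(LI s. f s*(g (- s + sg t)*ka t)) = (LI s. g (- s)*(f (sg t + s)*ka t))"
    by (simp add: minus_add add.assoc mult_ac)
  qed
  also have "\<dots> = (LI s. LI t. g (- s)*(f (sg t + s)*ka t))"
  proof (rule fubini_compact_support[OF _ B compact_uminus[OF L(2)]])
   show "cont (%(t, s). g (- s)*(f (sg t + s)*ka t))"
    unfolding case_prod_unfold by (intro ci)
   fix t s assume st: "t ~: B \<or> s ~: uminus ` L"
   show "g (- s)*(f (sg t + s)*ka t) = 0"
   proof (rule ccontr)
    assume "g (- s)*(f (sg t + s)*ka t) ~= 0"
    then have *: "- s : L" "sg t + s : K" using K(3) L(3) by auto
    then have "s : uminus ` L" by (intro image_eqI[of _ _ "- s"]) auto
    moreover have "t : B" using tB[OF *(2,1)] by (simp add: add.assoc del: add_uminus_conv_diff)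
    ultimately show False using st by blast
   qed
  qed
  also have "\<dots> = (LI s. g (- s)*ph f s)" by (simp add: ph_def)
  finally show ?thesis .
 qed
 define I where "I f = (LI t. f t :: complex)" for f :: "'g => complex"
 define \<psi> where "\<psi> s = I f2*ph f1 s - I f1*ph f2 s" for s
 have \<psi>0: "(LI s. h s*\<psi> s) = 0" if h: "h : Cc" for h
 proof -
  define g where "g s = h (- s)" for s
  have g: "g : Cc" unfolding g_def by (rule Cc_inverse[OF h])
  have 1: "integrable haar (%s. h s*ph f s)" if "f : Cc" for f by (rule Cc_integrable[OF phCc[OF that h]])
  have "(LI s. h s*\<psi> s) = (LI s. I f2*(h s*ph f1 s) - I f1*(h s*ph f2 s))"
   unfolding \<psi>_def by (simp add: right_diff_distrib mult.left_commute)
  also have "\<dots> = I f2*(LI s. h s*ph f1 s) - I f1*(LI s. h s*ph f2 s)"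
   using 1 f1 f2 by (subst Bi_diff) auto
  also have "(LI s. h s*ph f1 s) = I f1*\<nu> g" using key[OF f1 g] by (simp add: g_def I_def)
  also have "(LI s. h s*ph f2 s) = I f2*\<nu> g" using key[OF f2 g] by (simp add: g_def I_def)
  also have "I f2*(I f1*\<nu> g) - I f1*(I f2*\<nu> g) = 0" by simp
  finally show ?thesis .
 qed
 obtain bb :: "'g => complex" where bb: "bb : Cc" "bb 0 ~= 0"
 proof -
  obtain h :: "'g => real" and L where "cont h" "ALL x:{0}. h x = 1" "compact L" "ALL x. x ~: L --> h x = 0"
   using bump_function[of "{0::'g}" UNIV] by auto
  then show ?thesis
   by (intro that[of "%x. cor (h x)"] CcI[of _ L]) (auto intro!: continuous_intros)
 qed
 \<comment> \<open>Continuity of \<open>\<psi>\<close> is at hand only after multiplication by a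
   function in \<open>Cc\<close>, so \<open>\<psi>\<close> is tested with \<open>bb\<close> times
   the conjugate of \<open>bb s*\<psi> s\<close>.\<close>
 define w where "w s = bb s*\<psi> s" for s
 have w: "w : Cc"
  using Cc_diff[OF Cc_scale[OF phCc[OF f1 bb(1)], of "I f2"] Cc_scale[OF phCc[OF f2 bb(1)], of "I f1"]]
  by (simp add: w_def[abs_def] \<psi>_def right_diff_distrib mult.left_commute)
 have "(%s. bb s*cnj (w s)) : Cc"
  by (intro Cc_mult_right[OF bb(1)] Cc_continuous Cc_cnj w)
 from \<psi>0[OF this] have "(LI s. w s*cnj (w s)) = 0" by (simp add: w_def mult_ac)
 then have "w 0 = 0" using Cc_integral_sq_0[OF w] by blast
 then have "\<psi> 0 = 0" using bb(2) by (simp add: w_def)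
 then show ?thesis by (simp add: \<psi>_def ph_def I_def)
qed

lemma Cc_unit_exists:
 "EX h :: 'g::locally_compact_group => real. (%x. cor (h x)) : Cc & (ALL x. 0 <= h x) & (LI t. h t) = 1 & cont h"
 using Cc_unit[of UNIV] by auto

definition haar_unit :: "'g::locally_compact_group => real" where
 "haar_unit = (SOME h. (%x. cor (h x)) : Cc & (ALL x. 0 <= h x) &
  (LI t. h t) = 1 & cont h)"

lemma haar_unit:
 shows "(%x :: 'g::locally_compact_group. cor (haar_unit x)) : Cc" "0 <= haar_unit (x :: 'g)"
  "(LI t. haar_unit (t :: 'g)) = 1" "cont (haar_unit :: 'g => real)"
proof -
 have "(%x :: 'g. cor (haar_unit x)) : Cc & (ALL x :: 'g. 0 <= haar_unit x) &
  (LI t. haar_unit (t :: 'g)) = 1 & cont (haar_unit :: 'g => real)"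
  unfolding haar_unit_def by (rule someI_ex[OF Cc_unit_exists])
 then show "(%x :: 'g. cor (haar_unit x)) : Cc" "0 <= haar_unit (x :: 'g)"
  "(LI t. haar_unit (t :: 'g)) = 1" "cont (haar_unit :: 'g => real)" by blast+
qed

text \<open>The number \<open>1 / \<Delta>(s)\<close>, read off from one fixed test function.
  \<open>modular\<close> is a definite description over all Borel sets, and the existence of its
  value is deduced from this factor.\<close>

definition right_factor :: "'g::locally_compact_group => real" where
 "right_factor s = (LI t. haar_unit (t + s))"

lemma integral_real_Cc_right: 
 fixes F :: "'g::locally_compact_group => complex"
 shows right_factor_integral: "F : Cc ==> (LI t. F (t + s)) = cor (right_factor s)*(LI t. F t)"
  and right_factor_pos: "0 < right_factor (s :: 'g)"
  and right_factor_continuous: "cont (right_factor :: 'g => real)"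
proof -
 define h :: "'g => real" where "h = haar_unit"
 have h: "(%x. cor (h x)) : Cc" "!!x. 0 <= h x" "(LI t. h t) = 1" "cont h"
  using haar_unit unfolding h_def by blast+
 have rf: "right_factor s = (LI t. h (t + s))" for s :: 'g unfolding right_factor_def h_def ..
 have rfc: "cor (right_factor s) = (LI t. cor (h (t + s)))" for s :: 'g
  unfolding rf integral_complex_of_real ..
 show main: "(LI t. F (t + s)) = cor (right_factor s)*(LI t. F t)"
  if F: "F : Cc" for F and s :: 'g
 proof -
  have "(LI t. cor (h t))*(LI t. F (t + s) * 1)
    = (LI t. F t)*(LI t. cor (h (t + s)) * 1)"
  proof (rule haar_functional_unique[where sg'="%t. t + - s"])
   fix F :: "'g => complex" and r assume "F : Cc"
   then have "(%t. F (t + s)) : borel_measurable borel" by (intro Cc_measurable Cc_translate_right)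
   from integral_haar_left(1)[OF this, of r]
   show "(LI t. F (r + (t + s)) * 1) = (LI t. F (t + s) * 1)" by (simp add: add.assoc)
  qed (use F h in \<open>auto intro!: continuous_intros\<close>)
  moreover have "(LI t. cor (h t)) = 1" by (simp add: integral_complex_of_real h(3))
  ultimately show ?thesis by (simp add: rfc mult.commute)
 qed
 show "0 < right_factor s"
 proof -
  have i: "integrable haar (%t. h (t + s))"
   using Cc_integrable[OF Cc_translate_right[OF h(1), of s]] by (simp only: complex_of_real_integrable_eq)
  have "right_factor s ~= 0"
  proof
   assume "right_factor s = 0"
   then have "AE t in haar. h (t + s) = 0" unfolding rf using integral_nonneg_eq_0_iff_AE[OF i] h(2) by simp
   then have "h (t + s) = 0" for t
    by (rule continuous_AE_eq_0[rotated]) (intro cont_comp[OF h(4)] continuous_intros)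
   then have "h t = 0" for t by (metis diff_add_cancel)
   then show False using h(3) by simp
  qed
  moreover have "0 <= right_factor s" unfolding rf using h(2) by (intro integral_nonneg_AE) simp
  ultimately show ?thesis by simp
 qed
 obtain L where L: "compact L" "!!x. x ~: L ==> cor (h x) = 0" using h(1) by (rule CcE) blast
 obtain bb where bb: "(%x. cor (bb x)) : Cc" "!!x::'g. 0 <= bb x" "(LI t. bb t) = 1"
  "cont bb" using Cc_unit_exists by blast
 show "cont (right_factor :: 'g => real)"
 proof -
  have "cont (%s :: 'g. cor (right_factor s))"
   unfolding continuous_on_eq_continuous_at[OF open_UNIV] 
  proof
   fix s0 :: 'g
   \<comment> \<open>The support of \<open>t \<mapsto> h (t + s)\<close> moves with
     \<open>s\<close>. A bump at \<open>s0\<close> confines it to a compact set, and dividing by the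
     bump near \<open>s0\<close> recovers continuity there.\<close>
   obtain b :: "'g => real" and B where b: "cont b" "ALL x:{s0}. b x = 1"
    and B: "compact B" "ALL x. x ~: B --> b x = 0"
    using bump_function[of "{s0}" UNIV] by auto
   define S where "S = (%(x, y). x + y) ` (L \<times> uminus ` B)"
   have S: "compact S" unfolding S_def by (intro compact_plus L(1) compact_uminus B(1))
   have "cor (b s)*cor (h (t + s)) = 0" if t: "t ~: S" for s t
   proof (rule ccontr)
    assume "cor (b s)*cor (h (t + s)) ~= 0"
    then have "s : B" "t + s : L" using B(2) L(2)[of "t + s"] by auto
    then have "(t + s) + (- s) : S" unfolding S_def by (intro plus_image_mem imageI)
    then show False using t by (simp add: add.assoc del: add_uminus_conv_diff)
   qed
   then have "cont (%s. LI t. cor (b s)*cor (h (t + s)))"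
    by (intro continuous_integral_compact_support[OF _ S])
     (auto simp: case_prod_unfold intro!: continuous_intros cont_comp[OF h(4)]
      cont_comp[OF b(1)])
   then have c: "cont (%s. cor (b s)*cor (right_factor s))"
    by (simp add: rfc)
   have bc: "isCont (%s. cor (b s)) s0"
    using b(1) by (simp add: continuous_on_eq_continuous_at continuous_of_real)
   have "isCont (%s. cor (b s)*cor (right_factor s) / cor (b s)) s0"
    using c b(2) bc by (intro isCont_divide) (simp_all add: continuous_on_eq_continuous_at)
   moreover have "\<forall>\<^sub>F s in nhds s0. cor (b s)*cor (right_factor s) / cor (b s)
     = cor (right_factor s)"
   proof -
    have "open (b -` (- {0}))" by (rule open_vimage[OF _ b(1)]) auto
    then have "\<forall>\<^sub>F s in nhds s0. s : b -` (- {0})" using b(2) by (intro eventually_nhds_in_open) auto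
    then show ?thesis by eventually_elim simp
   qed
   ultimately show "isCont (%s. cor (right_factor s)) s0"
    using isCont_cong by fastforce
  qed
  from continuous_on_Re[OF this] show ?thesis by simp
 qed
qed

lemma right_factor_add: "right_factor (s + r :: 'g::locally_compact_group) = right_factor s*right_factor r"
proof -
 obtain h :: "'g => real" where h: "(%x. cor (h x)) : Cc" "(LI t. h t) = 1"
  using Cc_unit_exists by blast
 let ?h = "%x. cor (h x)"
 have 1: "(LI t. ?h t) = 1" by (simp add: integral_complex_of_real h(2))
 have "cor (right_factor (s + r)) = (LI t. ?h (t + (s + r)))"
  using right_factor_integral[OF h(1), of "s + r"] 1 by simp
 also have "\<dots> = (LI t. (%x. ?h (x + r)) (t + s))" by (simp add: add.assoc)
 also have "\<dots> = cor (right_factor s)*(LI t. ?h (t + r))"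
  by (rule right_factor_integral[OF Cc_translate_right[OF h(1)]])
 also have "\<dots> = cor (right_factor s*right_factor r)"
  using right_factor_integral[OF h(1), of r] 1 by simp
 finally show ?thesis by (simp only: of_real_eq_iff)
qed

lemma right_factor_zero [simp]: "right_factor (0 :: 'g::locally_compact_group) = 1"
 using right_factor_add[of "0::'g" 0] right_factor_pos[of "0::'g"] by simp

lemma right_factor_minus: "right_factor s*right_factor (- s :: 'g::locally_compact_group) = 1"
 using right_factor_add[of s "- s"] by simp

lemma right_translate_sets: "A : sets borel ==> (%t. t + s) ` A : sets (borel :: 'g::locally_compact_group measure)"
proof -
 assume A: "A : sets borel"
 have "(%t :: 'g. t - s) : borel_measurable borel" by (intro continuous_borel continuous_intros)
 from measurable_sets[OF this A] show ?thesis by (simp add: translate_image_right)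
qed

text \<open>The scaling law passes from functions to sets: a compact part of the translated open set
  is majorised by a translated bump function, and inner regularity exhausts the open set.\<close>

lemma emeasure_right_open_le:
 fixes U :: "'g::locally_compact_group set"
 assumes U: "open U"
 shows "emeasure haar ((%t. t + s) ` U) <= ennreal (right_factor (- s))*emeasure haar U"
proof -
 have oU: "open ((%t. t + s) ` U)" unfolding translate_image_right
  by (intro open_vimage U continuous_intros)
 have "emeasure haar K <= ennreal (right_factor (- s))*emeasure haar U"
  if K: "compact K" "K \<subseteq> (%t. t + s) ` U" for K
 proof -
  define K' where "K' = (%t. t - s) ` K"
  have K': "compact K'" unfolding K'_def by (intro compact_continuous_image K continuous_intros)
  have "K' \<subseteq> U" unfolding K'_def using K(2) by auto
  from bump_function[OF K' U this] obtain h :: "'g => real" and L where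
   h: "cont h" "ALL x. 0 <= h x & h x <= 1" "ALL x:K'. h x = 1" "ALL x. x ~: U --> h x = 0"
   and L: "compact L" "ALL x. x ~: L --> h x = 0" by (elim exE conjE)
  have hc: "(%x. cor (h x)) : Cc"
   by (rule CcI[of _ L]) (use h L in \<open>auto intro!: continuous_intros\<close>)
  have hi: "integrable haar h" using Cc_integrable[OF hc] by (simp only: complex_of_real_integrable_eq)
  have hi': "integrable haar (%t. h (t + - s))"
   using Cc_integrable[OF Cc_translate_right[OF hc, of "- s"]] by (simp only: complex_of_real_integrable_eq)
  have "cor (LI t. h (t + - s)) = cor (right_factor (- s)*(LI t. h t))"
   using right_factor_integral[OF hc, of "- s"] by (simp add: integral_complex_of_real)
  then have eq: "(LI t. h (t + - s)) = right_factor (- s)*(LI t. h t)" by (simp only: of_real_eq_iff)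
  have Kb: "K : sets haar" using K(1) by (simp add: compact_borel)
  have "emeasure haar K = (\<integral>\<^sup>+t. indicator K t \<partial>haar)" using Kb by simp
  also have "\<dots> <= (\<integral>\<^sup>+t. ennreal (h (t + - s)) \<partial>haar)"
  proof (rule nn_integral_mono)
   show "indicator K t <= ennreal (h (t + - s))" for t
    using h(3) by (auto simp: indicator_def K'_def)
  qed
  also have "\<dots> = ennreal (LI t. h (t + - s))"
   by (rule nn_integral_eq_integral[OF hi']) (use h(2) in auto)
  also have "\<dots> = ennreal (right_factor (- s))*ennreal (LI t. h t)"
   unfolding eq using right_factor_pos[of "- s"] by (intro ennreal_mult') simp
  also have "ennreal (LI t. h t) = (\<integral>\<^sup>+t. ennreal (h t) \<partial>haar)"
   by (rule nn_integral_eq_integral[OF hi, symmetric]) (use h(2) in auto)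
  also have "\<dots> <= (\<integral>\<^sup>+t. indicator U t \<partial>haar)"
   by (rule nn_integral_mono) (use h(2,4) in \<open>auto simp: indicator_def ennreal_le_1\<close>)
  also have "\<dots> = emeasure haar U" using U by simp
  finally show ?thesis by (simp add: mult_left_mono)
 qed
 then show ?thesis unfolding haar_inner_regular[OF oU] by (auto intro!: SUP_least)
qed

lemma emeasure_right_le:
 fixes A :: "'g::locally_compact_group set"
 assumes A: "A : sets borel"
 shows "emeasure haar ((%t. t + s) ` A) <= ennreal (right_factor (- s))*emeasure haar A"
proof -
 have rr: "ennreal (right_factor s)*ennreal (right_factor (- s)) = 1" for s :: 'g
  using right_factor_pos[of s] right_factor_pos[of "- s"] right_factor_minus[of s]
  by (simp add: ennreal_mult[symmetric])
 have "ennreal (right_factor s)*emeasure haar ((%t. t + s) ` A) <= emeasure haar U"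
  if U: "open U" "A \<subseteq> U" for U
 proof -
  have "emeasure haar ((%t. t + s) ` A) <= emeasure haar ((%t. t + s) ` U)"
   using U right_translate_sets[of U s] by (intro emeasure_mono) auto
  also have "\<dots> <= ennreal (right_factor (- s))*emeasure haar U" by (rule emeasure_right_open_le[OF U(1)])
  finally have "ennreal (right_factor s)*emeasure haar ((%t. t + s) ` A)
   <= ennreal (right_factor s)*(ennreal (right_factor (- s))*emeasure haar U)" by (rule mult_left_mono) simp
  then show ?thesis by (simp add: mult.assoc[symmetric] rr)
 qed
 then have "ennreal (right_factor s)*emeasure haar ((%t. t + s) ` A) <= emeasure haar A"
  unfolding haar_outer_regular[OF A[folded sets_haar]] by (auto intro!: INF_greatest)
 then have "ennreal (right_factor (- s))*(ennreal (right_factor s)*emeasure haar ((%t. t + s) ` A))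
  <= ennreal (right_factor (- s))*emeasure haar A" by (rule mult_left_mono) simp
 then show ?thesis using rr[of "- s"] by (simp add: mult.assoc[symmetric])
qed

text \<open>The inequality for the inverse translation gives the reverse one, since the factors of
  \<open>s\<close> and \<open>- s\<close> multiply to 1.\<close>

lemma emeasure_right:
 fixes A :: "'g::locally_compact_group set"
 assumes A: "A : sets borel"
 shows "emeasure haar ((%t. t + s) ` A) = ennreal (right_factor (- s))*emeasure haar A"
proof (rule antisym[OF emeasure_right_le[OF A]])
 have "(%t. t + - s) ` ((%t. t + s) ` A) = A" by (auto simp: image_image)
 then have "emeasure haar A <= ennreal (right_factor s)*emeasure haar ((%t. t + s) ` A)"
  using emeasure_right_le[OF right_translate_sets[OF A, of s], of "- s"] by simp
 then have "ennreal (right_factor (- s))*emeasure haar A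
   <= ennreal (right_factor (- s))*(ennreal (right_factor s)*emeasure haar ((%t. t + s) ` A))"
  by (rule mult_left_mono) simp
 also have "\<dots> = emeasure haar ((%t. t + s) ` A)"
  using right_factor_pos[of s] right_factor_pos[of "- s"] right_factor_minus[of s]
  by (simp add: mult.assoc[symmetric] ennreal_mult[symmetric] mult.commute)
 finally show "ennreal (right_factor (- s))*emeasure haar A <= emeasure haar ((%t. t + s) ` A)" .
qed

text \<open>Uniqueness of the factor is tested on a compact neighbourhood of 0, whose measure is
  finite and nonzero.\<close>

lemma modular_eq: "modular s = right_factor (- s :: 'g::locally_compact_group)"
 unfolding modular_def
proof (rule the_equality)
 show "0 < right_factor (- s) & (ALL A:sets borel. emeasure haar ((%t. t + s) ` A) = ennreal (right_factor (- s))*emeasure haar A)"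
  using right_factor_pos emeasure_right by blast
 fix d assume d: "0 < d & (ALL A:sets borel. emeasure haar ((%t. t + s) ` A) = ennreal d*emeasure haar A)"
 obtain U K where UK: "open U" "compact K" "(0::'g) : U" "U \<subseteq> K" using locally_compact[of 0] by blast
 have Kb: "K : sets borel" using UK by (simp add: compact_borel)
 have "0 < emeasure haar U" using UK by (intro haar_open_pos) auto
 also have "\<dots> <= emeasure haar K" using UK Kb by (intro emeasure_mono) auto
 finally have p: "0 < emeasure haar K" .
 have f: "emeasure haar K < \<infinity>" by (rule haar_compact[OF UK(2)])
 define m where "m = measure haar K"
 have Km: "emeasure haar K = ennreal m" unfolding m_def using f by (intro emeasure_eq_ennreal_measure) auto
 have m: "0 < m" using p unfolding Km by (simp add: ennreal_less_zero_iff)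
 have "ennreal d*emeasure haar K = ennreal (right_factor (- s))*emeasure haar K"
  using d Kb emeasure_right[OF Kb, of s] by metis
 then have "ennreal (d*m) = ennreal (right_factor (- s)*m)"
  unfolding Km using d m right_factor_pos[of "- s"] by (simp add: ennreal_mult)
 then have "d*m = right_factor (- s)*m"
  using d m right_factor_pos[of "- s"] by (subst (asm) ennreal_inj) (auto intro: mult_nonneg_nonneg)
 then show "d = right_factor (- s)" using m by simp
qed

lemma modular_pos [simp]: "0 < modular (s :: 'g::locally_compact_group)"
 by (simp add: modular_eq right_factor_pos)

lemma modular_nonneg [simp]: "0 <= modular (s :: 'g::locally_compact_group)"
 by (rule less_imp_le[OF modular_pos])

lemma modular_neq_0 [simp]: "modular (s :: 'g::locally_compact_group) ~= 0"
 by (rule less_imp_neq[OF modular_pos, symmetric])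

lemma modular_add: "modular (s + r :: 'g::locally_compact_group) = modular s*modular r"
 by (simp add: modular_eq minus_add right_factor_add[of "- r" "- s"] del: add_uminus_conv_diff)

lemma modular_zero [simp]: "modular (0 :: 'g::locally_compact_group) = 1"
 by (simp add: modular_eq)

lemma modular_minus: "modular (- s :: 'g::locally_compact_group) = 1 / modular s"
 using modular_add[of s "- s"] by (simp add: field_simps)

lemma right_factor_modular: "right_factor (s :: 'g::locally_compact_group) = 1 / modular s"
 using modular_minus[of s] by (simp add: modular_eq)

lemma modular_continuous: "cont (modular :: 'g::locally_compact_group => real)"
proof -
 have "cont (%s :: 'g. right_factor (- s))"
  by (rule cont_comp[OF right_factor_continuous]) (intro continuous_intros)
 then show ?thesis by (simp add: modular_eq[abs_def])
qed

lemma distr_haar_right: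
 fixes s :: "'g::locally_compact_group"
 shows "distr haar haar (%t. t + s) = density haar (%_. ennreal (1 / modular s))"
proof (rule measure_eqI)
 fix A assume "A : sets (distr haar haar (%t. t + s :: 'g))"
 then have A: "A : sets borel" by simp
 have "emeasure (distr haar haar (%t. t + s)) A = emeasure haar ((%t. t + s) -` A \<inter> space haar)"
  by (rule emeasure_distr) (use A in \<open>simp_all add: measurable_haar_haar\<close>)
 also have "(%t. t + s) -` A \<inter> space haar = (%t. t + - s) ` A"
  unfolding translate_image_right by (simp add: diff_conv_add_uminus del: add_uminus_conv_diff)
 also have "emeasure haar \<dots> = ennreal (1 / modular s)*emeasure haar A"
  using emeasure_right[OF A, of "- s"] by (simp add: right_factor_modular del: add_uminus_conv_diff)
 also have "\<dots> = emeasure (density haar (%_. ennreal (1 / modular s))) A"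
  using A by (simp add: emeasure_density nn_integral_cmult_indicator)
 finally show "emeasure (distr haar haar (%t. t + s)) A = emeasure (density haar (%_. ennreal (1 / modular s))) A" .
qed simp

lemma integral_haar_right:
 fixes f :: "'g::locally_compact_group => 'b::{banach, second_countable_topology}"
 assumes f: "f : borel_measurable borel"
 shows "(LI t. f (t + s)) = (1 / modular s) *\<^sub>R (LI t. f t)"
  "integrable haar (%t. f (t + s)) \<longleftrightarrow> integrable haar f"
proof -
 have m: "(%t. t + s) : measurable haar haar" by (simp add: measurable_haar_haar)
 have f': "f : borel_measurable haar" using f by (simp add: measurable_haar_iff)
 have "(LI t. f (t + s)) = (LINT t|density haar (%_. ennreal (1 / modular s)). f t)"
  using integral_distr[OF m, of f] f' by (simp add: distr_haar_right)
 also have "\<dots> = (1 / modular s) *\<^sub>R (LI t. f t)"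
  using f' by (subst integral_density) auto
 finally show "(LI t. f (t + s)) = (1 / modular s) *\<^sub>R (LI t. f t)" .
 have "integrable haar (%t. f (t + s)) \<longleftrightarrow> integrable haar (%t. (1 / modular s) *\<^sub>R f t)"
  using integrable_distr_eq[OF m, of f] f' by (simp add: distr_haar_right integrable_density)
 also have "\<dots> \<longleftrightarrow> integrable haar f"
 proof
  assume "integrable haar (%t. (1 / modular s) *\<^sub>R f t)"
  then have "integrable haar (%t. modular s *\<^sub>R ((1 / modular s) *\<^sub>R f t))" by (rule integrable_scaleR_right)
  then show "integrable haar f" by simp
 qed (rule integrable_scaleR_right)
 finally show "integrable haar (%t. f (t + s)) \<longleftrightarrow> integrable haar f" .
qed

text \<open>Uniqueness of Haar measure gives the identity up to a constant \<open>c\<close>. The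
  transformation is an involution, so \<open>c*c = 1\<close>, and positivity leaves
  \<open>c = 1\<close>.\<close>

lemma integral_haar_inverse:
 fixes F :: "'g::locally_compact_group => complex"
 assumes F: "F : Cc"
 shows "(LI t. F (- t)*cor (modular (- t))) = (LI t. F t)"
proof -
 define ka where "ka t = cor (modular (- t :: 'g))" for t
 have ka: "cont ka" unfolding ka_def
  by (intro continuous_on_of_real cont_comp[OF modular_continuous] continuous_intros)
 obtain h :: "'g => real" where h: "(%x. cor (h x)) : Cc" "!!x. 0 <= h x" "(LI t. h t) = 1"
  using Cc_unit_exists by blast
 let ?h = "%x. cor (h x)"
 have h1: "(LI t. ?h t) = 1" by (simp add: integral_complex_of_real h(3))
 define c where "c = (LI t. ?h (- t)*ka t)"
 have unique: "(LI t. F (- t)*ka t) = c*(LI t. F t)" if F: "F : Cc" for F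
 proof -
  have "(LI t. ?h t)*(LI t. F (- t)*ka t) = (LI t. F t)*(LI t. ?h (- t)*ka t)"
  proof (rule haar_functional_unique[where sg'=uminus])
   fix F :: "'g => complex" and s assume F: "F : Cc"
   define G where "G t = F (s + - t)*ka t" for t
   have G: "G : borel_measurable borel" unfolding G_def
    by (intro continuous_borel continuous_intros cont_comp[OF Cc_continuous[OF F]] ka)
   have "G (t + s) = ka s*(F (- t)*ka t)" for t
    by (simp add: G_def ka_def minus_add add.assoc[symmetric] modular_add del: add_uminus_conv_diff)
   then have "(LI t. G (t + s)) = ka s*(LI t. F (- t)*ka t)" by simp
   moreover have "(LI t. G (t + s)) = ka s*(LI t. G t)"
    by (simp add: integral_haar_right(1)[OF G] ka_def modular_minus scaleR_conv_of_real)
   moreover have "ka s ~= 0" by (simp add: ka_def)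
   ultimately show "(LI t. F (s + - t)*ka t) = (LI t. F (- t)*ka t)"
    by (simp add: G_def)
  qed (use F h ka in \<open>auto intro!: continuous_intros\<close>)
  then show ?thesis unfolding h1 c_def by (simp add: mult.commute)
 qed
 have "(%t. ?h (- t)*ka t) : Cc" by (rule Cc_mult_right[OF Cc_inverse[OF h(1)] ka])
 from unique[OF this] have "(LI t. ?h t*(ka (- t)*ka t)) = c*c"
  by (simp add: c_def mult.assoc)
 moreover have "ka (- t)*ka t = 1" for t by (simp add: ka_def modular_minus)
 ultimately have cc: "c*c = 1" using h1 by simp
 have "c = cor (LI t. h (- t)*modular (- t))"
  unfolding c_def ka_def by (simp add: integral_complex_of_real[symmetric])
 moreover have "0 <= (LI t. h (- t)*modular (- t))"
  using h(2) by (intro integral_nonneg_AE) (auto intro: mult_nonneg_nonneg)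
 ultimately obtain r where r: "c = cor r" "0 <= r" by blast
 then have "cor (r*r) = cor 1" using cc by simp
 then have "r*r = 1" by (simp only: of_real_eq_iff)
 then have "r = 1" using r(2) by (simp add: square_eq_1_iff)
 then show ?thesis using unique[OF F] r by (simp add: ka_def)
qed

subsection \<open>Density of the continuous functions of compact support\<close>

lemma Cc_L1_dense:
 fixes f :: "'g::locally_compact_group => complex"
 assumes f: "integrable haar f" and e: "0 < e"
 shows "EX g:Cc. (LI t. cmod (f t - g t)) < e"
 using f e
proof (induction arbitrary: e rule: integrable_induct)
 case (base A c)
 \<comment> \<open>Outer regularity of \<open>A\<close> and inner regularity of \<open>U\<close>
   each contribute at most \<open>e'\<close> to the measure of the set of errors, and
   \<open>2*e'*cmod c < e\<close>.\<close>
 define e' where "e' = e / (2*(cmod c + 1))"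
 have c1: "0 < cmod c + 1" by (simp add: add_nonneg_pos)
 have e': "0 < e'" using base c1 by (simp add: e'_def)
 have Ab: "A : sets haar" using base by simp
 have finA: "emeasure haar A = ennreal (measure haar A)" using base(2) by (intro emeasure_eq_ennreal_measure) auto
 have "emeasure haar A < ennreal (measure haar A + e')"
  unfolding finA using e' by (intro ennreal_lessI) (auto intro: add_nonneg_pos)
 then obtain U where U: "open U" "A \<subseteq> U" "emeasure haar U < ennreal (measure haar A + e')"
  unfolding haar_outer_regular[OF Ab] INF_less_iff by auto
 have Ufin: "emeasure haar U < \<infinity>" using U(3) by (auto intro: less_trans simp: less_top)
 have Ub: "U : sets haar" using U(1) by simp
 have finU: "emeasure haar U = ennreal (measure haar U)" using Ufin by (intro emeasure_eq_ennreal_measure) auto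
 have "EX K. compact K & K \<subseteq> U & measure haar U - e' < measure haar K"
 proof (cases "measure haar U < e'")
  case True
  then show ?thesis by (intro exI[of _ "{}"]) auto
 next
  case False
  have "ennreal (measure haar U - e') < emeasure haar U"
   unfolding finU using False e' by (intro ennreal_lessI) auto
  then obtain K where K: "compact K" "K \<subseteq> U" "ennreal (measure haar U - e') < emeasure haar K"
   using haar_inner_regular[OF U(1)] by (auto simp: less_SUP_iff)
  have "emeasure haar K = ennreal (measure haar K)"
   using haar_compact[OF K(1)] by (intro emeasure_eq_ennreal_measure) auto
  then show ?thesis using K False by (intro exI[of _ K]) (auto simp: ennreal_less_iff)
 qed
 then obtain K where K: "compact K" "K \<subseteq> U" "measure haar U - e' < measure haar K" by blast
 have Kb: "K : sets haar" using K(1) by (simp add: compact_borel)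
 obtain h :: "'g => real" and L where h: "cont h" "ALL x. 0 <= h x & h x <= 1" "ALL x:K. h x = 1" "ALL x. x ~: U --> h x = 0"
  and L: "compact L" "ALL x. x ~: L --> h x = 0"
  using bump_function[OF K(1) U(1) K(2)] by (elim exE conjE)
 have hc: "(%x. cor (h x)) : Cc"
  by (rule CcI[of _ L]) (use h L in \<open>auto intro!: continuous_intros\<close>)
 define g where "g x = cor (h x)*c" for x
 have g: "g : Cc" unfolding g_def by (intro Cc_mult_right hc continuous_intros)
 have mA: "measure haar U - measure haar A < e'"
  using U(3) unfolding finU by (simp add: ennreal_less_iff)
 have mK: "measure haar U - measure haar K < e'" using K(3) by simp
 have iA: "integrable haar (indicator A :: _ => real)" "integrable haar (indicator U :: _ => real)"
  "integrable haar (indicator K :: _ => real)"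
  using base Ab Ub Kb Ufin haar_compact[OF K(1)] by (auto intro!: integrable_real_indicator)
 have le: "cmod (indicator A x *\<^sub>R c - g x) <= ((indicator U x - indicator A x) + (indicator U x - indicator K x))*cmod c" for x
 proof -
  have "\<bar>indicator A x - h x\<bar> <= (indicator U x - indicator A x) + (indicator U x - indicator K x)"
   using U(2) K(2) h(3,4) h(2)[rule_format, of x] by (auto simp: indicator_def abs_if)
  moreover have "indicator A x *\<^sub>R c - g x = cor (indicator A x - h x)*c"
   by (simp add: g_def scaleR_conv_of_real left_diff_distrib)
  ultimately show ?thesis by (simp only: norm_mult norm_of_real) (intro mult_right_mono, simp_all)
 qed
 have "(LI x. cmod (indicator A x *\<^sub>R c - g x))
   <= (LI x. ((indicator U x - indicator A x) + (indicator U x - indicator K x))*cmod c)"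
 proof (rule integral_mono)
  have "integrable haar (%x. indicator A x *\<^sub>R c :: complex)" using iA(1) by (rule integrable_scaleR_left)
  then show "integrable haar (%x. cmod (indicator A x *\<^sub>R c - g x))"
   using Cc_integrable[OF g] by (intro integrable_norm BI_diff)
  show "integrable haar (%x. ((indicator U x - indicator A x) + (indicator U x - indicator K x))*cmod c)"
   using iA by (intro integrable_mult_left BI_add BI_diff)
 qed (rule le)
 also have "\<dots> = ((measure haar U - measure haar A) + (measure haar U - measure haar K))*cmod c"
  using iA Ab Ub Kb by simp
 also have "\<dots> <= (2*e')*cmod c" using mA mK by (intro mult_right_mono) auto
 also have "\<dots> = e*(cmod c / (cmod c + 1))"
 proof -
  have "2*(e / (2*x))*y = e*(y / x)" for x y :: real by simp
  then show ?thesis unfolding e'_def .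
 qed
 also have "\<dots> < e * 1" using base(3) c1 by (intro mult_strict_left_mono) (simp_all add: divide_less_eq)
 finally show ?case using g by auto
next
 case (add f1 f2)
 have "0 < e / 2" using add by simp
 then obtain g1 g2 where g: "g1 : Cc" "(LI t. cmod (f1 t - g1 t)) < e/2"
  "g2 : Cc" "(LI t. cmod (f2 t - g2 t)) < e/2" using add.IH by metis
 note i = BI_diff[OF add.hyps(1) Cc_integrable[OF g(1)]]
  BI_diff[OF add.hyps(2) Cc_integrable[OF g(3)]]
 have "(LI t. cmod ((f1 t + f2 t) - (g1 t + g2 t))) <= (LI t. cmod (f1 t - g1 t) + cmod (f2 t - g2 t))"
 proof (rule integral_mono)
  have "integrable haar (%t. (f1 t - g1 t) + (f2 t - g2 t))" using i by (rule BI_add)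
  then show "integrable haar (%t. cmod ((f1 t + f2 t) - (g1 t + g2 t)))"
   by (simp add: algebra_simps)
  show "integrable haar (%t. cmod (f1 t - g1 t) + cmod (f2 t - g2 t))"
   using i by (intro BI_add integrable_norm)
  show "cmod ((f1 t + f2 t) - (g1 t + g2 t)) <= cmod (f1 t - g1 t) + cmod (f2 t - g2 t)" for t
   using norm_triangle_ineq[of "f1 t - g1 t" "f2 t - g2 t"] by (simp add: algebra_simps)
 qed
 also have "\<dots> = (LI t. cmod (f1 t - g1 t)) + (LI t. cmod (f2 t - g2 t))"
  using i by (intro Bi_add integrable_norm)
 also have "\<dots> < e" using g by simp
 finally show ?case using Cc_add[OF g(1,3)] by auto
next
 case (lim f s)
 have "(%i. LI t. cmod (f t - s i t)) \<longlonglongrightarrow> (LI t. cmod (f t - f t))"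
 proof (rule integral_dominated_convergence[where w="%t. 3*cmod (f t)"])
  have fm: "f : borel_measurable haar" and sm: "s i : borel_measurable haar" for i
   using lim.hyps by (auto intro: borel_measurable_integrable)
  show "(%t. cmod (f t - f t)) : borel_measurable haar" by simp
  show "(%t. cmod (f t - s i t)) : borel_measurable haar" for i
   using fm sm[of i] by simp
  show "integrable haar (%t. 3*cmod (f t))" using lim.hyps by (intro integrable_mult_right integrable_norm)
  show "AE t in haar. (%i. cmod (f t - s i t)) \<longlonglongrightarrow> cmod (f t - f t)"
   using lim.hyps by (intro AE_I2 tendsto_intros) simp
  show "AE t in haar. norm (cmod (f t - s i t)) <= 3*cmod (f t)" for i
  proof (rule AE_I2)
   fix t :: 'g
   have "cmod (s i t) <= 2*cmod (f t)" using lim.hyps(3) by simp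
   then show "norm (cmod (f t - s i t)) <= 3*cmod (f t)"
    using norm_triangle_ineq4[of "f t" "s i t"] by simp
  qed
 qed
 then have l: "(%i. LI t. cmod (f t - s i t)) \<longlonglongrightarrow> 0" by simp
 have "0 < e/2" using lim.prems by simp
 from order_tendstoD(2)[OF l this] obtain i where i: "(LI t. cmod (f t - s i t)) < e/2"
  by (auto simp: eventually_sequentially)
 obtain g where g: "g : Cc" "(LI t. cmod (s i t - g t)) < e/2" using lim.IH[of "e/2" i] \<open>0 < e/2\<close> by blast
 note ii = BI_diff[OF lim.hyps(4) lim.hyps(1)[of i]]
  BI_diff[OF lim.hyps(1)[of i] Cc_integrable[OF g(1)]]
 have "(LI t. cmod (f t - g t)) <= (LI t. cmod (f t - s i t) + cmod (s i t - g t))"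
 proof (rule integral_mono)
  show "integrable haar (%t. cmod (f t - g t))"
   by (intro integrable_norm BI_diff lim.hyps(4) Cc_integrable[OF g(1)])
  show "integrable haar (%t. cmod (f t - s i t) + cmod (s i t - g t))"
   using ii by (intro BI_add integrable_norm)
  show "cmod (f t - g t) <= cmod (f t - s i t) + cmod (s i t - g t)" for t
   using norm_triangle_ineq[of "f t - s i t" "s i t - g t"] by simp
 qed
 also have "\<dots> = (LI t. cmod (f t - s i t)) + (LI t. cmod (s i t - g t))"
  using ii by (intro Bi_add integrable_norm)
 also have "\<dots> < e" using i g by simp
 finally show ?case using g by auto
qed

lemma Cc_square_integrable: "f : Cc ==> square_integrable f"
proof -
 assume f: "f : Cc"
 have "(%t. f t*cnj (f t)) : Cc" by (intro Cc_mult_right f continuous_intros Cc_continuous)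
 then have "integrable haar (%t. cor ((cmod (f t))\<^sup>2))"
  unfolding complex_norm_square by (rule Cc_integrable)
 then have "integrable haar (%t. (cmod (f t))\<^sup>2)" by (simp only: complex_of_real_integrable_eq)
 then show ?thesis using Cc_measurable[OF f] by (simp add: square_integrable_def)
qed

lemma square_integrable_diff:
 "square_integrable f ==> square_integrable g ==> square_integrable (%t. f t - g t)"
 using square_integrable_add[of f "%t. (-1)*g t"] square_integrable_mult[of g "-1"] by simp

text \<open>The radial retraction onto the disc of radius \<open>n\<close>. It is continuous and
  fixes 0, so composing with it preserves \<open>Cc\<close>.\<close>

definition clip :: "real => complex => complex"
 where "clip n z = cor (n / max n (cmod z))*z"

lemma clip:
 assumes n: "0 < n"
 shows "cmod (clip n z) <= n" "cmod z <= n ==> clip n z = z" "cont (clip n)" "clip n 0 = 0"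
proof -
 have m: "0 < max n (cmod z)" using n by simp
 show "cmod z <= n ==> clip n z = z" using n by (simp add: clip_def max_def)
 have "cmod (clip n z) = n / max n (cmod z)*cmod z" using n by (simp add: clip_def norm_mult norm_divide del: of_real_divide)
 also have "\<dots> <= n / max n (cmod z)*max n (cmod z)" using n by (intro mult_left_mono) auto
 also have "\<dots> = n" using m by (simp only: times_divide_eq_left nonzero_mult_div_cancel_right[OF less_imp_neq[symmetric]])
 finally show "cmod (clip n z) <= n" .
 have nz: "max n (cmod z) ~= 0" for z using less_max_iff_disj[of 0 n "cmod z"] n by auto
 show "cont (clip n)"
  unfolding clip_def[abs_def] by (intro continuous_intros) (simp add: nz)
 show "clip n 0 = 0" by (simp add: clip_def)
qed

text \<open>Reduction to density in \<open>L\<^sup>1\<close>: a truncation of \<open>f\<close> is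
  approximated in the \<open>L\<^sup>1\<close> norm and the approximant is clipped to the same
  bound; the squared error is then at most a constant times the \<open>L\<^sup>1\<close>
  error.\<close>

lemma Cc_L2_approx:
 fixes xi :: "'g::locally_compact_group L2"
 assumes e: "0 < e"
 shows "EX g:Cc. norm (xi - abs_L2 g) < e"
proof -
 define f where "f = rep_L2 xi"
 have f: "square_integrable f" by (simp add: f_def)
 have fm [measurable]: "f : borel_measurable borel" using f by (simp add: square_integrable_def)
 \<comment> \<open>The upper cutoff makes \<open>F n\<close> bounded, the lower one makes it
   integrable: where \<open>cmod (f t)\<close> is at least \<open>1 / N\<close>, it is at most
   \<open>N*(cmod (f t))\<^sup>2\<close>.\<close>
 define F where "F n t = (if 1 / real (Suc n) <= cmod (f t) & cmod (f t) <= real (Suc n) then f t else 0)" for n t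
 have Fm [measurable]: "F n : borel_measurable borel" for n unfolding F_def by measurable
 have Fle: "cmod (F n t) <= cmod (f t)" for n t by (simp add: F_def)
 have fi: "integrable haar (%t. (cmod (f t))\<^sup>2)" using f by (simp add: square_integrable_def)
 have Fs: "square_integrable (F n)" for n
  unfolding square_integrable_def
 proof (intro conjI Fm)
  show "integrable haar (%t. (cmod (F n t))\<^sup>2)"
   by (rule BI_bound[OF fi])
    (auto simp: measurable_haar_iff Fle intro!: power_mono)
 qed
 have lim: "(%n. LI t. (cmod (f t - F n t))\<^sup>2) \<longlonglongrightarrow> (LINT t|(haar :: 'g measure). 0)"
 proof (rule integral_dominated_convergence[where w="%t. 4*(cmod (f t))\<^sup>2"])
  show "integrable haar (%t. 4*(cmod (f t))\<^sup>2)" using fi by simp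
  show "AE t in haar. norm ((cmod (f t - F n t))\<^sup>2) <= 4*(cmod (f t))\<^sup>2" for n
  proof (rule AE_I2)
   fix t
   have "cmod (f t - F n t) <= 2*cmod (f t)" using norm_triangle_ineq4[of "f t" "F n t"] Fle[of n t] by simp
   then have "(cmod (f t - F n t))\<^sup>2 <= (2*cmod (f t))\<^sup>2" by (intro power_mono) auto
   then show "norm ((cmod (f t - F n t))\<^sup>2) <= 4*(cmod (f t))\<^sup>2" by (simp add: power_mult_distrib)
  qed
  show "AE t in haar. (%n. (cmod (f t - F n t))\<^sup>2) \<longlonglongrightarrow> 0"
  proof (rule AE_I2)
   fix t
   show "(%n. (cmod (f t - F n t))\<^sup>2) \<longlonglongrightarrow> 0"
   proof (cases "f t = 0")
    case False
    then obtain N1 where N1: "1 / real (Suc N1) < cmod (f t)"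
     using reals_Archimedean[of "cmod (f t)"] by (auto simp: inverse_eq_divide)
    obtain N2 where N2: "cmod (f t) <= real N2" using real_arch_simple by blast
    have "F n t = f t" if "n >= max N1 N2" for n
    proof -
     have "1 / real (Suc n) <= 1 / real (Suc N1)" using that by (intro divide_left_mono) auto
     moreover have "real N2 <= real (Suc n)" using that by simp
     ultimately show ?thesis using N1 N2 unfolding F_def by simp
    qed
    then have "\<forall>\<^sub>F n in sequentially. (cmod (f t - F n t))\<^sup>2 = 0"
     by (intro eventually_sequentiallyI[of "max N1 N2"]) simp
    then show ?thesis by (rule tendsto_eventually)
   qed (simp add: F_def)
  qed
 qed (simp_all add: measurable_haar_iff)
 then have "(%n. LI t. (cmod (f t - F n t))\<^sup>2) \<longlonglongrightarrow> 0" by simp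
 from order_tendstoD(2)[OF this, of "(e/4)\<^sup>2"] e
 obtain n where n: "(LI t. (cmod (f t - F n t))\<^sup>2) < (e/4)\<^sup>2" by (auto simp: eventually_sequentially)
 define N where "N = real (Suc n)"
 have N: "0 < N" by (simp add: N_def)
 have FN: "cmod (F n t) <= N" for t by (simp add: F_def N_def)
 have Fi: "integrable haar (F n)"
 proof (rule BI_bound[where f="%t. N*(cmod (f t))\<^sup>2"])
  show "integrable haar (%t. N*(cmod (f t))\<^sup>2)" using fi by simp
  show "AE t in haar. cmod (F n t) <= norm (N*(cmod (f t))\<^sup>2)"
  proof (rule AE_I2)
   fix t
   show "cmod (F n t) <= norm (N*(cmod (f t))\<^sup>2)"
   proof (cases "1 / N <= cmod (f t)")
    case True
    then have "1 <= N*cmod (f t)" using N by (simp add: field_simps)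
    then have "1*cmod (f t) <= (N*cmod (f t))*cmod (f t)" by (intro mult_right_mono) auto
    then show ?thesis using Fle[of n t] N by (simp add: power2_eq_square mult.assoc)
   qed (simp add: F_def N_def)
  qed
 qed (simp add: measurable_haar_iff)
 \<comment> \<open>Chosen so that \<open>4*N*d = 2*(e/4)\<^sup>2\<close>; together with the
   truncation error this leaves a total below \<open>3*e/4\<close>.\<close>
 define d where "d = (e/4)\<^sup>2 / (2*N)"
 have d: "0 < d" using e N by (simp add: d_def)
 obtain g0 where g0: "g0 : Cc" "(LI t. cmod (F n t - g0 t)) < d" using Cc_L1_dense[OF Fi d] by blast
 define g where "g t = clip N (g0 t)" for t
 have g: "g : Cc" unfolding g_def by (rule Cc_comp_norm[OF g0(1) clip(3,4)[OF N]])
 have gN: "cmod (g t) <= N" for t unfolding g_def by (rule clip(1)[OF N])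
 have clip_le: "cmod (F n t - g t) <= 2*cmod (F n t - g0 t)" for t
 proof -
  have "cmod (g0 t - g t) <= cmod (F n t - g0 t)"
  proof (cases "cmod (g0 t) <= N")
   case True
   then show ?thesis by (simp add: g_def clip(2)[OF N])
  next
   case False
   then have "g0 t - g t = cor (1 - N / cmod (g0 t))*g0 t"
    using N by (simp add: g_def clip_def max_def left_diff_distrib)
   moreover have "0 <= 1 - N / cmod (g0 t)" using False N by (simp add: divide_le_eq)
   ultimately have "cmod (g0 t - g t) = (1 - N / cmod (g0 t))*cmod (g0 t)"
    by (simp only: norm_mult norm_of_real abs_of_nonneg)
   also have "\<dots> = cmod (g0 t) - N"
   proof -
    have "g0 t ~= 0" using False N by auto
    then show ?thesis by (simp add: left_diff_distrib)
   qed
   also have "\<dots> <= cmod (F n t - g0 t)" using FN[of t] norm_triangle_ineq2[of "g0 t" "F n t"] by (simp add: norm_minus_commute)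
   finally show ?thesis .
  qed
  then show ?thesis using norm_triangle_ineq[of "F n t - g0 t" "g0 t - g t"] by simp
 qed
 have "(LI t. (cmod (F n t - g t))\<^sup>2) <= (LI t. 4*N*cmod (F n t - g0 t))"
 proof (rule integral_mono)
  show "integrable haar (%t. (cmod (F n t - g t))\<^sup>2)"
   using square_integrable_diff[OF Fs Cc_square_integrable[OF g]] by (simp add: square_integrable_def)
  show "integrable haar (%t. 4*N*cmod (F n t - g0 t))"
   using BI_diff[OF Fi Cc_integrable[OF g0(1)]] by simp
  show "(cmod (F n t - g t))\<^sup>2 <= 4*N*cmod (F n t - g0 t)" for t
  proof -
   have "cmod (F n t - g t) <= 2*N" using norm_triangle_ineq4[of "F n t" "g t"] FN[of t] gN[of t] by simp
   then have "cmod (F n t - g t)*cmod (F n t - g t) <= (2*N)*(2*cmod (F n t - g0 t))"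
    using clip_le[of t] N by (intro mult_mono) auto
   then show ?thesis by (simp add: power2_eq_square)
  qed
 qed
 also have "\<dots> = 4*N*(LI t. cmod (F n t - g0 t))" by simp
 also have "\<dots> <= 4*N*d" using g0(2) N by (intro mult_left_mono) auto
 also have "\<dots> = 2*(e/4)\<^sup>2" using N by (simp add: d_def)
 finally have "(LI t. (cmod (F n t - g t))\<^sup>2) <= 2*(e/4)\<^sup>2" .
 then have 1: "norm (abs_L2 (F n) - abs_L2 g) <= sqrt 2*(e/4)"
  using real_sqrt_le_mono[of "LI t. (cmod (F n t - g t))\<^sup>2" "2*(e/4)\<^sup>2"] e
  by (simp add: abs_L2_diff[OF Fs Cc_square_integrable[OF g]] norm_L2_abs
    square_integrable_diff[OF Fs Cc_square_integrable[OF g]] real_sqrt_mult)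
 have 2: "norm (abs_L2 f - abs_L2 (F n)) < e/4"
  using real_sqrt_less_mono[OF n] e
  by (simp add: abs_L2_diff[OF f Fs] norm_L2_abs square_integrable_diff[OF f Fs])
 have "sqrt 2 <= 2" using real_sqrt_le_mono[of 2 4] by simp
 then have "sqrt 2*(e/4) <= 2*(e/4)" using e by (intro mult_right_mono) auto
 then have "norm (abs_L2 f - abs_L2 g) < e/4 + 2*(e/4)"
  using 1 2 norm_triangle_ineq[of "abs_L2 f - abs_L2 (F n)" "abs_L2 (F n) - abs_L2 g"]
  by (simp add: mult.commute[of "sqrt 2"])
 then have "norm (xi - abs_L2 g) < e" using e by (simp add: f_def)
 then show ?thesis using g by blast
qed

subsection \<open>Operators on \<open>L\<^sup>2(G)\<close> given by maps of functions\<close>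

lemma cinner_abs_L2:
 fixes f g :: "'g::locally_compact_group => complex"
 assumes "square_integrable f" "square_integrable g"
 shows "cinner (abs_L2 f) (abs_L2 g) = (LI t. f t*cnj (g t))"
 using assms by (intro cinner_L2.abs_eq) (auto simp: L2_rel_def)

text \<open>A linear map of functions that is bounded in the \<open>L\<^sup>2\<close> seminorm sends
  null functions to null functions, so it descends to classes whatever representatives
  \<open>rep_L2\<close> picks. Translations and multiplications arise in this way.\<close>

lemma L2_operator:
 fixes U :: "('g::locally_compact_group => complex) => ('g => complex)"
 assumes add: "!!f g. U (%t. f t + g t) = (%t. U f t + U g t)"
  and scale: "!!c f. U (%t. c*f t) = (%t. c*U f t)"
  and sq: "!!f. square_integrable f ==> square_integrable (U f)"
  and bound: "!!f. square_integrable f ==> norm (abs_L2 (U f)) <= C*norm (abs_L2 f)"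
  and C: "0 <= C"
 shows "Blinfun (%xi. abs_L2 (U (rep_L2 xi))) : bounded_ops"
  "square_integrable f ==> app (Blinfun (%xi. abs_L2 (U (rep_L2 xi)))) (abs_L2 f) = abs_L2 (U f)"
  "norm (Blinfun (%xi. abs_L2 (U (rep_L2 xi)))) <= C"
proof -
 let ?W = "%xi. abs_L2 (U (rep_L2 xi))"
 have W: "?W (abs_L2 f) = abs_L2 (U f)" if f: "square_integrable f" for f
 proof -
  define d where "d t = rep_L2 (abs_L2 f) t + (-1)*f t" for t
  have d: "square_integrable d" unfolding d_def
   by (intro square_integrable_add square_integrable_mult f) simp
  have "abs_L2 d = abs_L2 (rep_L2 (abs_L2 f)) - abs_L2 f"
   using abs_L2_diff[of "rep_L2 (abs_L2 f)" f] f by (simp add: d_def[abs_def])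
  then have d0: "norm (abs_L2 d) = 0" by simp
  have "U d = (%t. U (rep_L2 (abs_L2 f)) t + (-1)*U f t)"
   unfolding d_def[abs_def] add scale ..
  then have "?W (abs_L2 f) - abs_L2 (U f) = abs_L2 (U d)"
   using abs_L2_diff[OF sq sq, of "rep_L2 (abs_L2 f)" f] f by simp
  moreover have "norm (abs_L2 (U d)) <= 0" using bound[OF d] d0 by simp
  ultimately show ?thesis by simp
 qed
 have Wadd: "?W (xi + eta) = ?W xi + ?W eta" for xi eta
 proof -
  have "xi + eta = abs_L2 (%t. rep_L2 xi t + rep_L2 eta t)"
   using abs_L2_add[of "rep_L2 xi" "rep_L2 eta"] by simp
  then have "?W (xi + eta) = abs_L2 (U (%t. rep_L2 xi t + rep_L2 eta t))"
   using W[OF square_integrable_add[of "rep_L2 xi" "rep_L2 eta"]] by simp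
  then show ?thesis using abs_L2_add[OF sq sq, of "rep_L2 xi" "rep_L2 eta"] by (simp add: add)
 qed
 have Wscale: "?W (c *\<^sub>C xi) = c *\<^sub>C ?W xi" for c xi
 proof -
  have "c *\<^sub>C xi = abs_L2 (%t. c*rep_L2 xi t)"
   using abs_L2_scaleC[of "rep_L2 xi" c] by simp
  then have "?W (c *\<^sub>C xi) = abs_L2 (U (%t. c*rep_L2 xi t))"
   using W[OF square_integrable_mult[of "rep_L2 xi" c]] by simp
  then show ?thesis using abs_L2_scaleC[OF sq, of "rep_L2 xi" c] by (simp add: scale)
 qed
 have Wn: "norm (?W xi) <= C*norm xi" for xi using bound[of "rep_L2 xi"] by simp
 note op = op_of_linear[of ?W C, OF Wadd Wscale Wn]
 show "Blinfun ?W : bounded_ops" by (rule op(2))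
 show "norm (Blinfun ?W) <= C" by (rule op(3)[OF C])
 show "app (Blinfun ?W) (abs_L2 f) = abs_L2 (U f)" if "square_integrable f"
  unfolding op(1) by (rule W[OF that])
qed

lemma left_translate_square_integrable:
 fixes f :: "'g::locally_compact_group => complex"
 assumes f: "square_integrable f"
 shows "square_integrable (%t. f (- s + t))" "norm (abs_L2 (%t. f (- s + t))) = norm (abs_L2 f)"
proof -
 have fm: "f : borel_measurable borel" and fi: "integrable haar (%t. (cmod (f t))\<^sup>2)"
  using f by (auto simp: square_integrable_def)
 have m: "(%t. (cmod (f t))\<^sup>2) : borel_measurable borel" using fm by measurable
 have tm: "(%t. f (- s + t)) : borel_measurable borel"
  by (rule measurable_compose[OF translate_measurable(1) fm])
 show sq: "square_integrable (%t. f (- s + t))"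
  using tm integral_haar_left(2)[OF m, of "- s"] fi by (simp add: square_integrable_def)
 show "norm (abs_L2 (%t. f (- s + t))) = norm (abs_L2 f)"
  using integral_haar_left(1)[OF m, of "- s"] by (simp add: norm_L2_abs sq f)
qed

lemma right_translate_square_integrable:
 fixes f :: "'g::locally_compact_group => complex"
 assumes f: "square_integrable f"
 shows "square_integrable (%t. f (t + s)*cor (sqrt (modular s)))"
  "norm (abs_L2 (%t. f (t + s)*cor (sqrt (modular s)))) = norm (abs_L2 f)"
proof -
 have fm: "f : borel_measurable borel" and fi: "integrable haar (%t. (cmod (f t))\<^sup>2)"
  using f by (auto simp: square_integrable_def)
 have m: "(%t. (cmod (f t))\<^sup>2) : borel_measurable borel" using fm by measurable
 have tm: "(%t. f (t + s)) : borel_measurable borel"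
  by (rule measurable_compose[OF translate_measurable(2) fm])
 have eq: "(cmod (f (t + s)*cor (sqrt (modular s))))\<^sup>2 = modular s*(cmod (f (t + s)))\<^sup>2" for t
  by (simp add: norm_mult power_mult_distrib mult.commute)
 show sq: "square_integrable (%t. f (t + s)*cor (sqrt (modular s)))"
  unfolding square_integrable_def eq using tm integral_haar_right(2)[OF m, of s] fi by auto
 show "norm (abs_L2 (%t. f (t + s)*cor (sqrt (modular s)))) = norm (abs_L2 f)"
  unfolding norm_L2_abs[OF sq] norm_L2_abs[OF f] eq using integral_haar_right(1)[OF m, of s] by simp
qed

lemma
 fixes s :: "'g::locally_compact_group"
 shows left_reg_bounded [simp]: "left_reg s : bounded_ops"
  and left_reg_abs: "square_integrable f ==> app (left_reg s) (abs_L2 f) = abs_L2 (%t. f (- s + t))"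
 using L2_operator[of "%f t. f (- s + t)" 1] left_translate_square_integrable[of _ s]
 unfolding left_reg_def by auto

lemma
 fixes s :: "'g::locally_compact_group"
 shows right_reg_bounded [simp]: "right_reg s : bounded_ops"
  and right_reg_abs: "square_integrable f ==>
   app (right_reg s) (abs_L2 f) = abs_L2 (%t. f (t + s)*cor (sqrt (modular s)))"
 using L2_operator[of "%f t. f (t + s)*cor (sqrt (modular s))" 1]
  right_translate_square_integrable[of _ s]
 unfolding right_reg_def by (auto simp: distrib_right mult.assoc)

lemma L2_cases: obtains f where "square_integrable f" "(xi :: 'g::locally_compact_group L2) = abs_L2 f"
 using abs_rep_L2[of xi] rep_L2_square_integrable[of xi] by metis

lemma left_reg_norm [simp]: "norm (app (left_reg s) xi) = norm xi"
 by (rule L2_cases[of xi]) (simp add: left_reg_abs left_translate_square_integrable)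

lemma right_reg_norm [simp]: "norm (app (right_reg s) xi) = norm xi"
 by (rule L2_cases[of xi]) (simp add: right_reg_abs right_translate_square_integrable)

lemma left_reg_zero [simp]: "app (left_reg 0) xi = xi"
 by (rule L2_cases[of xi]) (simp add: left_reg_abs)

lemma right_reg_zero [simp]: "app (right_reg 0) xi = xi"
 by (rule L2_cases[of xi]) (simp add: right_reg_abs)

lemma left_reg_add: "app (left_reg (s + r)) xi = app (left_reg s) (app (left_reg r) xi)"
 by (rule L2_cases[of xi])
  (simp add: left_reg_abs left_translate_square_integrable minus_add add.assoc del: add_uminus_conv_diff)

lemma right_reg_add: "app (right_reg (s + r)) xi = app (right_reg s) (app (right_reg r) xi)"
 by (rule L2_cases[of xi])
  (simp add: right_reg_abs right_translate_square_integrable add.assoc modular_add real_sqrt_mult mult_ac)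

lemma left_right_reg_commute:
 "app (left_reg s) (app (right_reg r) xi) = app (right_reg r) (app (left_reg s) xi)"
 by (rule L2_cases[of xi])
  (simp add: left_reg_abs right_reg_abs right_translate_square_integrable left_translate_square_integrable add.assoc)

lemma isometry_cinner:
 fixes T :: "'h::chilbert_space \<Rightarrow>\<^sub>L 'h"
 assumes T: "T : bounded_ops" and iso: "!!x. norm (app T x) = norm x"
 shows "cinner (app T x) (app T y) = cinner x y"
proof -
 have "inner (app T x) (app T y) = inner x y" for x y
  using iso[of "x + y"] iso[of x] iso[of y]
  unfolding dot_norm by (simp add: blinfun.add_right[symmetric])
 then have re: "Re (cinner (app T x) (app T y)) = Re (cinner x y)" for x y
  by (simp add: inner_cinner)
 have "Re (cinner (app T (\<i> *\<^sub>C x)) (app T y)) = Re (cinner (\<i> *\<^sub>C x) y)" by (rule re)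
 then have "Im (cinner (app T x) (app T y)) = Im (cinner x y)"
  by (simp add: bounded_ops_scaleC[OF T] cinner_scaleC_left)
 then show ?thesis using re by (simp add: complex_eq_iff)
qed

lemma left_reg_cinner: "cinner (app (left_reg s) x) y = cinner x (app (left_reg (- s)) y)"
 using isometry_cinner[OF left_reg_bounded[of s] left_reg_norm, of x "app (left_reg (- s)) y"]
 by (simp add: left_reg_add[symmetric])

lemma right_reg_cinner: "cinner (app (right_reg s) x) y = cinner x (app (right_reg (- s)) y)"
 using isometry_cinner[OF right_reg_bounded[of s] right_reg_norm, of x "app (right_reg (- s)) y"]
 by (simp add: right_reg_add[symmetric])

definition Cc_L2 :: "'g::locally_compact_group L2 set" where "Cc_L2 = abs_L2 ` Cc"

lemma Cc_L2_subspace: "cvec.subspace (Cc_L2 :: 'g::locally_compact_group L2 set)"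
proof (rule cvec.subspaceI)
 show "0 : (Cc_L2 :: 'g L2 set)" unfolding Cc_L2_def
  by (rule image_eqI[of _ _ "%_. 0"]) (simp_all add: zero_L2_def)
 show "x + y : Cc_L2" if "x : Cc_L2" "y : Cc_L2" for x y :: "'g L2"
  using that unfolding Cc_L2_def by (auto simp: abs_L2_add Cc_square_integrable intro!: imageI Cc_add)
 show "c *\<^sub>C x : Cc_L2" if "x : Cc_L2" for x :: "'g L2" and c
  using that unfolding Cc_L2_def by (auto simp: abs_L2_scaleC Cc_square_integrable intro!: imageI Cc_scale)
qed

lemma Cc_L2_dense: "closure (Cc_L2 :: 'g::locally_compact_group L2 set) = UNIV"
proof -
 have "xi : closure Cc_L2" for xi :: "'g L2"
  unfolding closure_approachable
 proof (intro allI impI)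
  fix e :: real assume "0 < e"
  then obtain g where "g : Cc" "norm (xi - abs_L2 g) < e" using Cc_L2_approx by blast
  then show "EX y:Cc_L2. dist y xi < e"
   unfolding Cc_L2_def by (intro bexI[of _ "abs_L2 g"]) (auto simp: dist_norm norm_minus_commute)
 qed
 then show ?thesis by auto
qed

subsection \<open>Strong continuity of the regular representations\<close>

text \<open>For isometries weak continuity implies strong continuity, because
  \<open>|U s f - U s0 f|^2 = 2 |f|^2 - 2 Re <U s f, U s0 f>\<close>. Invariance of
  \<open>Cc_L2\<close> makes \<open>U s0 f\<close> an admissible test vector, and density extends
  the result to all vectors.\<close>

lemma strongly_continuous:
 fixes U :: "'p::topological_space => 'g::locally_compact_group L2 \<Rightarrow>\<^sub>L 'g L2"
 assumes iso: "!!s x. norm (app (U s) x) = norm x"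
  and inv: "!!s f. f : Cc ==> app (U s) (abs_L2 f) : Cc_L2"
  and weak: "!!f g. f : Cc ==> g : Cc ==> cont (%s. cinner (app (U s) (abs_L2 f)) (abs_L2 g))"
 shows "cont (%s. app (U s) xi)"
 unfolding continuous_on_def
proof
 fix s0 :: 'p
 have tends: "((%s. app (U s) (abs_L2 f)) \<longlongrightarrow> app (U s0) (abs_L2 f)) (at s0 within UNIV)"
  if f: "f : Cc" for f
 proof -
  obtain g where g: "g : Cc" "app (U s0) (abs_L2 f) = abs_L2 g"
   using inv[OF f, of s0] unfolding Cc_L2_def by blast
  have "((%s. cinner (app (U s) (abs_L2 f)) (abs_L2 g)) \<longlongrightarrow> cinner (app (U s0) (abs_L2 f)) (abs_L2 g)) (at s0 within UNIV)"
   using weak[OF f g(1)] unfolding continuous_on_def by blast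
  then have "((%s. 2*(norm (abs_L2 f))\<^sup>2 - 2*Re (cinner (app (U s) (abs_L2 f)) (abs_L2 g)))
    \<longlongrightarrow> 2*(norm (abs_L2 f))\<^sup>2 - 2*Re (cinner (app (U s0) (abs_L2 f)) (abs_L2 g))) (at s0 within UNIV)"
   by (intro tendsto_diff tendsto_mult tendsto_const tendsto_Re)
  moreover have "2*(norm (abs_L2 f))\<^sup>2 - 2*Re (cinner (app (U s) (abs_L2 f)) (abs_L2 g))
    = (norm (app (U s) (abs_L2 f) - app (U s0) (abs_L2 f)))\<^sup>2" for s
  proof -
   have "(norm (app (U s) (abs_L2 f) - abs_L2 g))\<^sup>2
     = (norm (app (U s) (abs_L2 f)))\<^sup>2 + (norm (abs_L2 g))\<^sup>2 - 2*Re (cinner (app (U s) (abs_L2 f)) (abs_L2 g))"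
    using norm_plus_sq[of "app (U s) (abs_L2 f)" "- abs_L2 g"] by (simp add: inner_cinner)
   moreover have "norm (abs_L2 g) = norm (abs_L2 f)" using iso[of s0 "abs_L2 f"] g(2) by simp
   ultimately show ?thesis using g(2) iso by simp
  qed
  ultimately have "((%s. (norm (app (U s) (abs_L2 f) - app (U s0) (abs_L2 f)))\<^sup>2) \<longlongrightarrow> 0) (at s0 within UNIV)"
   by simp
  then have "((%s. norm (app (U s) (abs_L2 f) - app (U s0) (abs_L2 f))) \<longlongrightarrow> 0) (at s0 within UNIV)"
   using tendsto_real_sqrt[of _ 0] by fastforce
  then show ?thesis using Lim_null tendsto_norm_zero_iff by blast
 qed
 show "((%s. app (U s) xi) \<longlongrightarrow> app (U s0) xi) (at s0 within UNIV)"
  unfolding tendsto_iff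
 proof (intro allI impI)
  fix e :: real assume e: "0 < e"
  then obtain f where f: "f : Cc" "norm (xi - abs_L2 f) < e/3" using Cc_L2_approx[of "e/3" xi] by auto
  have near: "norm (app (U s) xi - app (U s) (abs_L2 f)) < e/3" for s
   using f(2) iso[of s "xi - abs_L2 f"] by (simp add: blinfun.diff_right)
  have "\<forall>\<^sub>F s in at s0 within UNIV. dist (app (U s) (abs_L2 f)) (app (U s0) (abs_L2 f)) < e/3"
   using tendstoD[OF tends[OF f(1)], of "e/3"] e by simp
  then show "\<forall>\<^sub>F s in at s0 within UNIV. dist (app (U s) xi) (app (U s0) xi) < e"
  proof eventually_elim
   case (elim s)
   have "app (U s) xi - app (U s0) xi = (app (U s) xi - app (U s) (abs_L2 f))
    + (app (U s) (abs_L2 f) - app (U s0) (abs_L2 f))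
    - (app (U s0) xi - app (U s0) (abs_L2 f))" by simp
   also have "norm \<dots> <= norm (app (U s) xi - app (U s) (abs_L2 f))
    + norm (app (U s) (abs_L2 f) - app (U s0) (abs_L2 f))
    + norm (app (U s0) xi - app (U s0) (abs_L2 f))"
    by (intro order_trans[OF norm_triangle_ineq4] add_right_mono norm_triangle_ineq)
   finally show ?case using near[of s] near[of s0] elim by (simp add: dist_norm)
  qed
 qed
qed

lemma left_reg_Cc: "f : Cc ==> app (left_reg s) (abs_L2 f) = abs_L2 (%t. f (- s + t))"
 by (rule left_reg_abs[OF Cc_square_integrable])

lemma right_reg_Cc: "f : Cc ==>
  app (right_reg s) (abs_L2 f) = abs_L2 (%t. f (t + s)*cor (sqrt (modular s)))"
 by (rule right_reg_abs[OF Cc_square_integrable])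

lemma Cc_right_translate_scaled: "f : Cc ==> (%t. f (t + s)*cor c) : Cc"
 by (intro Cc_mult_right Cc_translate_right continuous_intros)

lemma cinner_Cc: "f : Cc ==> g : Cc ==> cinner (abs_L2 f) (abs_L2 g) = (LI t. f t*cnj (g t))"
 by (intro cinner_abs_L2 Cc_square_integrable)

lemma left_reg_continuous: "cont (%s. app (left_reg s) (xi :: 'g::locally_compact_group L2))"
proof (rule strongly_continuous)
 fix f g :: "'g => complex" assume f: "f : Cc" and g: "g : Cc"
 show "app (left_reg s) (abs_L2 f) : Cc_L2" for s
  unfolding left_reg_Cc[OF f] Cc_L2_def by (intro imageI Cc_translate_left f)
 obtain L where L: "cont g" "compact L" "!!x. x ~: L ==> g x = 0" using g by (rule CcE) blast
 have "cont (%s. LI t. f (- s + t)*cnj (g t))"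
 proof (rule continuous_integral_compact_support[OF _ L(2)])
  show "cont (%(s, t). f (- s + t)*cnj (g t))"
   unfolding case_prod_unfold
   by (intro continuous_intros cont_comp[OF Cc_continuous[OF f]] cont_comp[OF L(1)])
 qed (simp add: L(3))
 then show "cont (%s. cinner (app (left_reg s) (abs_L2 f)) (abs_L2 g))"
  by (simp add: left_reg_Cc[OF f] cinner_Cc[OF Cc_translate_left[OF f] g])
qed simp

lemma right_reg_continuous: "cont (%s. app (right_reg s) (xi :: 'g::locally_compact_group L2))"
proof (rule strongly_continuous)
 fix f g :: "'g => complex" assume f: "f : Cc" and g: "g : Cc"
 show "app (right_reg s) (abs_L2 f) : Cc_L2" for s
  unfolding right_reg_Cc[OF f] Cc_L2_def by (intro imageI Cc_right_translate_scaled f)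
 obtain L where L: "cont g" "compact L" "!!x. x ~: L ==> g x = 0" using g by (rule CcE) blast
 have "cont (%s. LI t. f (t + s)*cor (sqrt (modular s))*cnj (g t))"
 proof (rule continuous_integral_compact_support[OF _ L(2)])
  show "cont (%(s, t). f (t + s)*cor (sqrt (modular s))*cnj (g t))"
   unfolding case_prod_unfold
   by (intro continuous_intros cont_comp[OF Cc_continuous[OF f]] cont_comp[OF L(1)]
     cont_comp[OF modular_continuous])
 qed (simp add: L(3))
 then show "cont (%s. cinner (app (right_reg s) (abs_L2 f)) (abs_L2 g))"
  by (simp add: right_reg_Cc[OF f] cinner_Cc[OF Cc_right_translate_scaled[OF f] g])
qed simp

lemma continuous_blinfun_apply: "continuous_on S f ==> continuous_on S (%x. app T (f x))"
 by (rule bounded_linear.continuous_on[OF blinfun.bounded_linear_right])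

subsection \<open>Multiplication operators\<close>

text \<open>A set of finite measure lies in an open set of finite measure, which countably many
  compact sets exhaust up to a null set.\<close>

lemma loc_AE_finite:
 fixes A :: "'g::locally_compact_group set"
 assumes P: "loc_AE P" and A: "A : sets borel" "emeasure haar A < \<infinity>"
 shows "AE t in haar. t : A --> P t"
proof -
 obtain U where U: "open U" "A \<subseteq> U" "emeasure haar U < \<infinity>"
  using A(2) unfolding haar_outer_regular[OF A(1)[folded sets_haar]] INF_less_iff by auto
 have finU: "emeasure haar U = ennreal (measure haar U)" using U by (intro emeasure_eq_ennreal_measure) auto
 have "EX K. compact K & K \<subseteq> U & measure haar U - 1 / Suc n < measure haar K" for n
 proof (cases "measure haar U - 1 / Suc n < 0")
  case True
  then show ?thesis by (intro exI[of _ "{}"]) auto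
 next
  case False
  have "ennreal (measure haar U - 1 / Suc n) < emeasure haar U"
   unfolding finU using False by (intro ennreal_lessI) (auto simp: not_less intro: order.strict_trans2[of 0 "1 / (1 + real n)"])
  then obtain K where K: "compact K" "K \<subseteq> U" "ennreal (measure haar U - 1 / Suc n) < emeasure haar K"
   using haar_inner_regular[OF U(1)] by (auto simp: less_SUP_iff)
  have "emeasure haar K = ennreal (measure haar K)"
   using haar_compact[OF K(1)] by (intro emeasure_eq_ennreal_measure) auto
  then show ?thesis using K False by (intro exI[of _ K]) (auto simp: ennreal_less_iff)
 qed
 then obtain K where K: "!!n. compact (K n)" "!!n. K n \<subseteq> U" "!!n. measure haar U - 1 / Suc n < measure haar (K n)" by metis
 define N where "N = U - (\<Union>n. K n)"
 have Kb: "K n : sets haar" for n using K(1) by (simp add: compact_borel)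
 have Nb: "N : sets haar" unfolding N_def using U(1) Kb by (intro sets.Diff sets.countable_UN) auto
 have "measure haar N <= 0"
 proof (rule field_le_epsilon)
  fix e :: real assume "0 < e"
  then obtain n where n: "1 / real (Suc n) < e" using reals_Archimedean by (auto simp: inverse_eq_divide)
  have "measure haar N <= measure haar (U - K n)"
   using U K(2) Kb Nb by (intro measure_mono_fmeasurable) (auto simp: N_def fmeasurable_def intro: le_less_trans[OF emeasure_mono])
  also have "\<dots> = measure haar U - measure haar (K n)"
   using U K Kb by (intro measure_Diff) auto
  also have "\<dots> <= 0 + e" using K(3)[of n] n by simp
  finally show "measure haar N <= 0 + e" .
 qed
 then have m0: "measure haar N = 0" using measure_nonneg[of haar N] by linarith
 have "emeasure haar N <= emeasure haar U" using U(1) by (intro emeasure_mono) (auto simp: N_def)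
 then have "emeasure haar N = ennreal (measure haar N)"
  using U(3) by (intro emeasure_eq_ennreal_measure) (auto simp: top_unique)
 then have "N : null_sets haar" using m0 Nb by auto
 then have 1: "AE t in haar. t ~: N" by (rule AE_not_in)
 have "AE t in haar. ALL n. t : K n --> P t"
  unfolding AE_all_countable using P K(1) by (auto simp: loc_AE_def)
 with 1 show ?thesis
 proof eventually_elim
  case (elim t)
  then show ?case using U(2) by (auto simp: N_def)
 qed
qed

text \<open>The set where an integrable function is nonzero is a countable union of sets of finite
  measure, so a property that holds locally almost everywhere holds almost everywhere on it. This
  reconciles the two notions of null set behind \<open>L1\<close> and \<open>Linf\<close>.\<close>

lemma loc_AE_support:
 fixes g :: "'g::locally_compact_group => 'b::{banach, second_countable_topology}"
 assumes P: "loc_AE P" and g: "integrable haar g"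
 shows "AE t in haar. g t ~= 0 --> P t"
proof -
 have gm: "g : borel_measurable borel" using borel_measurable_integrable[OF g] by (simp add: measurable_haar_iff)
 define A where "A n = {t. 1 / real (Suc n) <= norm (g t)}" for n
 have Am: "A n : sets borel" for n
  unfolding A_def using gm by measurable
 have "emeasure haar (A n) < \<infinity>" for n
 proof -
  have iff: "1 <= ennreal (real (Suc n))*ennreal (norm (g t)) \<longleftrightarrow> 1 / real (Suc n) <= norm (g t)" for t
  proof -
   have "ennreal (real (Suc n))*ennreal (norm (g t)) = ennreal (real (Suc n)*norm (g t))"
    by (rule ennreal_mult[symmetric]) simp_all
   moreover have "ennreal 1 <= ennreal (real (Suc n)*norm (g t)) \<longleftrightarrow> 1 <= real (Suc n)*norm (g t)"
    by (subst ennreal_le_iff2) simp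
   moreover have "1 <= real (Suc n)*norm (g t) \<longleftrightarrow> 1 / real (Suc n) <= norm (g t)"
    by (simp add: divide_le_eq mult.commute del: of_nat_Suc)
   ultimately show ?thesis by simp
  qed
  have "A n = {t:UNIV. 1 <= ennreal (real (Suc n))*ennreal (norm (g t))}"
   unfolding A_def iff by simp
  also have "emeasure haar \<dots> <= ennreal (real (Suc n))*(\<integral>\<^sup>+t. ennreal (norm (g t))*indicator UNIV t \<partial>haar)"
   using gm by (intro nn_integral_Markov_inequality) (auto simp: measurable_haar_iff)
  also have "\<dots> < \<infinity>" using g unfolding integrable_iff_bounded by (auto simp: ennreal_mult_less_top)
  finally show ?thesis .
 qed
 then have "AE t in haar. ALL n. t : A n --> P t"
  unfolding AE_all_countable using loc_AE_finite[OF P Am] by blast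
 then show ?thesis
 proof eventually_elim
  case (elim t)
  show ?case
  proof
   assume "g t ~= 0"
   then obtain n where "1 / real (Suc n) < norm (g t)"
    using reals_Archimedean[of "norm (g t)"] by (auto simp: inverse_eq_divide)
   then have "t : A n" by (simp add: A_def)
   then show "P t" using elim by blast
  qed
 qed
qed

lemma Linf_bound:
 assumes "h : Linf" shows "EX C>=0. loc_AE (%t. cmod (h t) <= C)"
proof -
 obtain C where C: "loc_AE (%t. cmod (h t) <= C)" using assms by (auto simp: Linf_def)
 have "loc_AE (%t. cmod (h t) <= max 0 C)"
  unfolding loc_AE_def
 proof (intro allI impI)
  fix K :: "'a set" assume "compact K"
  then have "AE t in haar. t : K --> cmod (h t) <= C" using C by (simp add: loc_AE_def)
  then show "AE t in haar. t : K --> cmod (h t) <= max 0 C" by eventually_elim auto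
 qed
 then show ?thesis by (intro exI[of _ "max 0 C"]) simp
qed

lemma Linf_mult_L1:
 fixes g h :: "'g::locally_compact_group => complex"
 assumes g: "integrable haar g" and h: "h : borel_measurable borel" "loc_AE (%t. cmod (h t) <= C)"
 shows "integrable haar (%t. g t*h t)" "cmod (LI t. g t*h t) <= C*(LI t. cmod (g t))"
proof -
 have gm: "g : borel_measurable borel" using borel_measurable_integrable[OF g] by (simp add: measurable_haar_iff)
 have ae: "AE t in haar. cmod (g t*h t) <= C*cmod (g t)"
  using loc_AE_support[OF h(2) g]
 proof eventually_elim
  case (elim t)
  then show ?case by (cases "g t = 0") (simp_all add: norm_mult mult.commute[of C] mult_left_mono)
 qed
 have i: "integrable haar (%t. C*cmod (g t))" using g by simp
 show gh: "integrable haar (%t. g t*h t)"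
 proof (rule BI_bound[OF i])
  show "(%t. g t*h t) : borel_measurable haar" using gm h(1) by (simp add: measurable_haar_iff)
  show "AE t in haar. cmod (g t*h t) <= norm (C*cmod (g t))"
   using ae
  proof eventually_elim
   case (elim t)
   then show ?case unfolding real_norm_def by (rule order_trans[OF _ abs_ge_self])
  qed
 qed
 have "cmod (LI t. g t*h t) <= (LI t. cmod (g t*h t))" by (rule integral_norm_bound)
 also have "\<dots> <= (LI t. C*cmod (g t))" by (rule integral_mono_AE) (use gh i ae in auto)
 finally show "cmod (LI t. g t*h t) <= C*(LI t. cmod (g t))" by simp
qed

lemma mult_square_integrable:
 fixes f h :: "'g::locally_compact_group => complex"
 assumes f: "square_integrable f" and h: "h : borel_measurable borel" "loc_AE (%t. cmod (h t) <= C)" "0 <= C"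
 shows "square_integrable (%t. h t*f t)" "norm (abs_L2 (%t. h t*f t)) <= C*norm (abs_L2 f)"
proof -
 have fm: "f : borel_measurable borel" and fi: "integrable haar (%t. (cmod (f t))\<^sup>2)"
  using f by (auto simp: square_integrable_def)
 have hfm: "(%t. h t*f t) : borel_measurable borel" using fm h(1) by simp
 have ae: "AE t in haar. (cmod (h t*f t))\<^sup>2 <= C\<^sup>2*(cmod (f t))\<^sup>2"
  using loc_AE_support[OF h(2) fi]
 proof eventually_elim
  case (elim t)
  show ?case
  proof (cases "f t = 0")
   case False
   then have "cmod (h t) <= C" using elim by simp
   then have "(cmod (h t))\<^sup>2 <= C\<^sup>2" by (intro power_mono) auto
   then show ?thesis by (simp add: norm_mult power_mult_distrib mult_right_mono)
  qed simp
 qed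
 have i: "integrable haar (%t. C\<^sup>2*(cmod (f t))\<^sup>2)" using fi by simp
 have j: "integrable haar (%t. (cmod (h t*f t))\<^sup>2)"
 proof (rule BI_bound[OF i])
  show "(%t. (cmod (h t*f t))\<^sup>2) : borel_measurable haar" using hfm by (simp add: measurable_haar_iff)
  show "AE t in haar. norm ((cmod (h t*f t))\<^sup>2) <= norm (C\<^sup>2*(cmod (f t))\<^sup>2)" using ae by eventually_elim simp
 qed
 show sq: "square_integrable (%t. h t*f t)" using hfm j by (simp add: square_integrable_def)
 have "(LI t. (cmod (h t*f t))\<^sup>2) <= (LI t. C\<^sup>2*(cmod (f t))\<^sup>2)"
  by (rule integral_mono_AE[OF j i ae])
 then have "sqrt (LI t. (cmod (h t*f t))\<^sup>2) <= sqrt (C\<^sup>2*(LI t. (cmod (f t))\<^sup>2))"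
  by (intro real_sqrt_le_mono) simp
 then show "norm (abs_L2 (%t. h t*f t)) <= C*norm (abs_L2 f)"
  using h(3) by (simp add: norm_L2_abs sq f real_sqrt_mult)
qed

lemma mult_op_Linf:
 fixes h :: "'g::locally_compact_group => complex"
 assumes h: "h : borel_measurable borel" "loc_AE (%t. cmod (h t) <= C)" "0 <= C"
 shows "mult_op h : bounded_ops" "norm (mult_op h) <= C"
  "square_integrable f ==> app (mult_op h) (abs_L2 f) = abs_L2 (%t. h t*f t)"
 using L2_operator[of "%f t. h t*f t" C] mult_square_integrable[OF _ h] h(3)
 unfolding mult_op_def by (auto simp: distrib_left mult.left_commute)

lemma mult_op_bounded_ops: "h : Linf ==> mult_op h : bounded_ops"
 using Linf_bound[of h] mult_op_Linf(1)[of h] by (auto simp: Linf_def)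

subsection \<open>The maps \<open>\<Theta>\<^sup>r(f)\<close> and their pre-adjoints\<close>

lemma integrable_mult_bounded:
 fixes f k :: "'g::locally_compact_group => complex"
 assumes f: "integrable haar f" and k: "cont k" "!!t. cmod (k t) <= C"
 shows "integrable haar (%t. f t*k t)" "cmod (LI t. f t*k t) <= C*(LI t. cmod (f t))"
 using Linf_mult_L1[OF f continuous_borel[OF k(1)], of C] k(2) by (auto simp: loc_AE_def)

lemma conj_right_reg:
 "cinner (app (right_reg s o\<^sub>L T o\<^sub>L right_reg (- s)) xi) eta
  = cinner (app T (app (right_reg (- s)) xi)) (app (right_reg (- s)) eta)"
 by (simp add: right_reg_cinner)

lemma right_coeff_continuous:
 "cont (%s. cinner (app T (app (right_reg (- s)) xi)) (app (right_reg (- s)) (eta :: 'g::locally_compact_group L2)))"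
 by (intro continuous_on_cinner continuous_blinfun_apply cont_comp[OF right_reg_continuous] continuous_intros)

lemma right_coeff_bound:
 "cmod (cinner (app T (app (right_reg s) xi)) (app (right_reg r) eta)) <= norm T*norm xi*norm eta"
proof -
 have "cmod (cinner (app T (app (right_reg s) xi)) (app (right_reg r) eta))
   <= norm (app T (app (right_reg s) xi))*norm eta"
  using cinner_norm_le[of "app T (app (right_reg s) xi)" "app (right_reg r) eta"] by simp
 also have "\<dots> <= norm T*norm xi*norm eta"
  using norm_blinfun[of T "app (right_reg s) xi"] by (intro mult_right_mono) auto
 finally show ?thesis .
qed

lemma Theta:
 fixes f :: "'g::locally_compact_group => complex"
 assumes f: "f : L1" and T: "T : bounded_ops"
 shows "Theta f T : bounded_ops"
  "cinner (app (Theta f T) xi) eta = (LI s. f s *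
   cinner (app T (app (right_reg (- s)) xi)) (app (right_reg (- s)) eta))"
proof -
 define B where "B xi eta = (LI s. f s *
   cinner (app T (app (right_reg (- s)) xi)) (app (right_reg (- s)) eta))" for xi eta
 have fi: "integrable haar f" using f by (simp add: L1_def)
 note i = integrable_mult_bounded[OF fi right_coeff_continuous right_coeff_bound, of T]
 have N: "0 <= (LI t. cmod (f t))" by (rule integral_nonneg_AE) simp
 have "EX S:bounded_ops. norm S <= norm T*(LI t. cmod (f t)) &
  (ALL xi:UNIV. ALL eta:UNIV. cinner (app S xi) eta = B xi eta)"
 proof (rule form_operator)
  show "B (x + y) z = B x z + B y z" for x y z
   unfolding B_def by (simp add: blinfun.add_right cinner_add_left distrib_left i)
  show "B x (y + z) = B x y + B x z" for x y z
   unfolding B_def by (simp add: blinfun.add_right cinner_add_right distrib_left i)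
  show "B (c *\<^sub>C x) y = c*B x y" for c x y
   unfolding B_def by (simp add: bounded_ops_scaleC T cinner_scaleC_left mult.left_commute[of _ c])
  show "B x (c *\<^sub>C y) = cnj c*B x y" for c x y
   unfolding B_def by (simp add: bounded_ops_scaleC cinner_scaleC_right mult.left_commute[of _ "cnj c"])
  show "cmod (B x y) <= norm T*(LI t. cmod (f t))*norm x*norm y" for x y
   unfolding B_def using i(2)[of x y] by (simp add: mult_ac)
  show "0 <= norm T*(LI t. cmod (f t))" using N by simp
 qed simp_all
 then obtain S where S: "S : bounded_ops" "!!xi eta. cinner (app S xi) eta = B xi eta" by blast
 have "Theta f T = S"
  unfolding Theta_def conj_right_reg B_def[symmetric]
  by (rule the_equality) (use S in \<open>auto intro: op_eqI\<close>)
 then show "Theta f T : bounded_ops"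
  "cinner (app (Theta f T) xi) eta = (LI s. f s *
   cinner (app T (app (right_reg (- s)) xi)) (app (right_reg (- s)) eta))"
  using S by (simp_all add: B_def)
qed

text \<open>A finite index set that works for a finite net of \<open>W\<close> works on all of
  \<open>W\<close>, with the bound enlarged by the mesh: the optimal coefficients of a point do at
  least as well as those of a nearby net point.\<close>

lemma basis_approx_compact:
 fixes W :: "'h::chilbert_space set"
 assumes W: "compact W" and E: "orthonormal_basis E" and e: "0 < e"
 shows "EX F0. finite F0 & F0 \<subseteq> E & (ALL F w. finite F & F0 \<subseteq> F & F \<subseteq> E & w : W -->
  norm (w - (\<Sum>e\<in>F. cinner w e *\<^sub>C e)) < e)"
proof -
 have e2: "0 < e/2" using e by simp
 have "ALL w. EX F0. finite F0 & F0 \<subseteq> E & (ALL F. finite F & F0 \<subseteq> F & F \<subseteq> E -->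
   norm (w - (\<Sum>e\<in>F. cinner w e *\<^sub>C e)) < e/2)"
  using orthonormal_basis_approx[OF E e2] by blast
 then obtain G where G: "!!w. finite (G w)" "!!w. G w \<subseteq> E"
  "!!w F. finite F & G w \<subseteq> F & F \<subseteq> E ==> norm (w - (\<Sum>e\<in>F. cinner w e *\<^sub>C e)) < e/2"
  by metis
 have "W \<subseteq> (\<Union>w\<in>W. ball w (e/2))" using e2 by auto
 from compactE_image[OF W open_ball this] obtain P where P: "P \<subseteq> W" "finite P" "W \<subseteq> (\<Union>w\<in>P. ball w (e/2))" .
 have "norm (w - (\<Sum>e\<in>F. cinner w e *\<^sub>C e)) < e"
  if F: "finite F" "(\<Union>w\<in>P. G w) \<subseteq> F" "F \<subseteq> E" and w: "w : W" for F w
 proof -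
  obtain p where p: "p : P" "norm (p - w) < e/2" using P(3) w by (auto simp: dist_norm)
  have oF: "orthonormal F" using E F(3) by (auto simp: orthonormal_basis_iff intro: orthonormal_subset)
  have "norm (w - (\<Sum>e\<in>F. cinner w e *\<^sub>C e)) <= norm (w - (\<Sum>e\<in>F. cinner p e *\<^sub>C e))"
   by (rule orthonormal_best_approx[OF oF F(1)])
  also have "\<dots> <= norm (w - p) + norm (p - (\<Sum>e\<in>F. cinner p e *\<^sub>C e))"
   using norm_triangle_ineq[of "w - p" "p - (\<Sum>e\<in>F. cinner p e *\<^sub>C e)"] by simp
  also have "norm (p - (\<Sum>e\<in>F. cinner p e *\<^sub>C e)) < e/2"
   using F p(1) by (intro G(3)) auto
  finally show ?thesis using p(2) by (simp add: norm_minus_commute)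
 qed
 moreover have "(\<Union>w\<in>P. G w) \<subseteq> E" using G(2) by blast
 moreover have "finite (\<Union>w\<in>P. G w)" using P(2) G(1) by blast
 ultimately show ?thesis by (intro exI[of _ "\<Union>w\<in>P. G w"] conjI allI impI) simp_all
qed

text \<open>The pre-adjoint of a rank one operator is the weak integral over \<open>s\<close> of
  \<open>f s\<close> times the rank one operators built from \<open>u s\<close> and
  \<open>w s\<close>. Identifying its trace pairing means exchanging an integral with a sum over a
  possibly uncountable basis, where dominated convergence along sequences does not apply.\<close>

lemma Theta_pre_rank_one:
 fixes f :: "'g::locally_compact_group => complex"
 assumes f: "f : L1"
 shows "EX ta:trace_class. trace_norm ta <= (LI t. cmod (f t))*(norm x*norm y) &
  (ALL T:bounded_ops. trace_pairing T ta = cinner (app (Theta f T) x) y)"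
proof -
 define u where "u s = app (right_reg (- s)) x" for s
 define w where "w s = app (right_reg (- s)) y" for s
 have nu: "norm (u s) = norm x" and nw: "norm (w s) = norm y" for s by (simp_all add: u_def w_def)
 have uc: "cont u" unfolding u_def
  by (intro cont_comp[OF right_reg_continuous] continuous_intros)
 have wc: "cont w" unfolding w_def
  by (intro cont_comp[OF right_reg_continuous] continuous_intros)
 have fi: "integrable haar f" using f by (simp add: L1_def)
 define N where "N = (LI t. cmod (f t))"
 have N: "0 <= N" unfolding N_def by (rule integral_nonneg_AE) simp
 have kc: "cont (%s. cinner a (w s)*cinner (app T (u s)) b)" for a b T
  by (intro continuous_intros continuous_on_cinner uc wc continuous_blinfun_apply)
 have kb: "cmod (cinner a (w s)*cinner (app T (u s)) b) <= (norm T*norm x*norm y)*norm a*norm b" for a b T s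
 proof -
  have "cmod (cinner a (w s)*cinner (app T (u s)) b) <= (norm a*norm (w s))*(norm (app T (u s))*norm b)"
   unfolding norm_mult by (intro mult_mono cinner_norm_le) auto
  also have "\<dots> <= (norm a*norm (w s))*((norm T*norm (u s))*norm b)"
   by (intro mult_left_mono mult_right_mono norm_blinfun) auto
  finally show ?thesis by (simp add: nu nw mult_ac)
 qed
 note i = integrable_mult_bounded[OF fi kc kb]
 define B where "B a b = (LI s. f s*(cinner a (w s)*cinner (app id_blinfun (u s)) b))" for a b
 have "EX ta:bounded_ops. norm ta <= norm x*norm y*N & (ALL a:UNIV. ALL b:UNIV. cinner (app ta a) b = B a b)"
 proof (rule form_operator)
  show "B (a + a') b = B a b + B a' b" for a a' b
   unfolding B_def by (simp add: cinner_add_left distrib_left distrib_right i[of _ id_blinfun, simplified])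
  show "B a (b + b') = B a b + B a b'" for a b b'
   unfolding B_def by (simp add: cinner_add_right distrib_left distrib_right i[of _ id_blinfun, simplified])
  show "B (c *\<^sub>C a) b = c*B a b" for c a b
   unfolding B_def by (simp add: cinner_scaleC_left mult.assoc mult.left_commute[of _ c])
  show "B a (c *\<^sub>C b) = cnj c*B a b" for c a b
   unfolding B_def by (simp add: cinner_scaleC_right mult.left_commute[of _ "cnj c"])
  show "cmod (B a b) <= norm x*norm y*N*norm a*norm b" for a b
  proof -
   have "norm (id_blinfun :: 'g L2 \<Rightarrow>\<^sub>L 'g L2) <= 1" by (rule norm_blinfun_bound) auto
   then have "norm (id_blinfun :: 'g L2 \<Rightarrow>\<^sub>L 'g L2)*(norm x*norm y*norm a*norm b*N) <= 1*(norm x*norm y*norm a*norm b*N)"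
    using N by (intro mult_right_mono) auto
   then show ?thesis using i(2)[of a id_blinfun b] unfolding B_def N_def by (simp add: mult_ac)
  qed
  show "0 <= norm x*norm y*N" using N by simp
 qed simp_all
 then obtain ta where ta: "ta : bounded_ops" "!!a b. cinner (app ta a) b = B a b" by blast
 have TB: "cinner (app (T o\<^sub>L ta) a) b = (LI s. f s*(cinner a (w s)*cinner (app T (u s)) b))"
  if T: "T : bounded_ops" for T a b
  using ta(2)[of a "app (adj_op T) b"] by (simp add: cinner_adj_right[OF T] B_def)
 have crit: "cmod (\<Sum>e\<in>F. cinner (app (V o\<^sub>L ta) e) e) <= N*(norm x*norm y)"
  if V: "V : bounded_ops" "norm V <= 1" and F: "finite F" "F \<subseteq> some_basis" for V F
 proof -
  define q where "q s = (\<Sum>e\<in>F. cinner e (w s)*cinner (app V (u s)) e)" for s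
  have qc: "cont q" unfolding q_def by (intro continuous_on_sum kc)
  have qb: "cmod (q s) <= norm x*norm y" for s
  proof -
   have "cmod (q s) <= (\<Sum>e\<in>F. cmod (cinner (app V (u s)) e)*cmod (cinner (w s) e))"
    unfolding q_def by (rule sum_norm_le) (metis cinner_commute complex_mod_cnj mult.commute norm_mult order_refl)
   also have "\<dots> <= norm (app V (u s))*norm (w s)"
    using F by (intro orthonormal_sum_mult_le some_basis_finite)
   also have "\<dots> <= (1*norm (u s))*norm (w s)"
    using V(2) by (intro mult_right_mono order_trans[OF norm_blinfun] mult_right_mono) auto
   finally show ?thesis by (simp add: nu nw)
  qed
  have "(\<Sum>e\<in>F. cinner (app (V o\<^sub>L ta) e) e) = (LI s. f s*q s)"
   unfolding TB[OF V(1)] q_def sum_distrib_left using i(1)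
   by (subst Bi_sum) auto
  also have "cmod \<dots> <= norm x*norm y*N" unfolding N_def by (rule integrable_mult_bounded(2)[OF fi qc qb])
  finally show ?thesis by (simp add: mult.commute)
 qed
 have tc: "ta : trace_class" "trace_norm ta <= N*(norm x*norm y)"
  using trace_class_criterion[OF ta(1) crit] by auto
 have "trace_pairing T ta = cinner (app (Theta f T) x) y" if T: "T : bounded_ops" for T
 proof -
  define R where "R = cinner (app (Theta f T) x) y"
  have R: "R = (LI s. f s*cinner (app T (u s)) (w s))"
   unfolding R_def Theta(2)[OF f T] u_def w_def ..
  have "((%e. cinner (app (T o\<^sub>L ta) e) e) has_sum R) some_basis"
   unfolding has_sum_def tendsto_iff
  proof (intro allI impI)
   fix e0 :: real assume e0: "0 < e0"
   define C where "C = norm T*norm x*norm y"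
   have C: "0 <= C" by (simp add: C_def)
   define d where "d = e0 / (2*(C + 1))"
   have d: "0 < d" using e0 C by (simp add: d_def)
   \<comment> \<open>Up to \<open>d\<close> in the \<open>L\<^sup>1\<close> norm the density has
     compact support \<open>K\<close>; on the compact image of \<open>K\<close> under
     \<open>w\<close> the basis expansions converge uniformly. The constants \<open>d\<close> and
     \<open>e1\<close> allot about half of \<open>e0\<close> to each of the two errors.\<close>
   obtain g where g: "g : Cc" "(LI t. cmod (f t - g t)) < d" using Cc_L1_dense[OF fi d] by blast
   obtain K where K: "cont g" "compact K" "!!t. t ~: K ==> g t = 0" using g(1) by (rule CcE) blast
   have gi: "integrable haar g" by (rule Cc_integrable[OF g(1)])
   define M where "M = (LI t. cmod (g t))"
   have M: "0 <= M" unfolding M_def by (rule integral_nonneg_AE) simp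
   define e1 where "e1 = e0 / (2*(norm T*norm x*M + 1))"
   have p1: "0 < norm T*norm x*M + 1" using M by (intro add_nonneg_pos mult_nonneg_nonneg) auto
   have e1: "0 < e1" using e0 p1 by (simp add: e1_def)
   have Wc: "compact (w ` K)" by (rule compact_continuous_image[OF continuous_on_subset[OF wc] K(2)]) simp
   obtain F0 where F0: "finite F0" "F0 \<subseteq> some_basis" and F0': "ALL F v. finite F & F0 \<subseteq> F & F \<subseteq> some_basis & v : w ` K -->
     norm (v - (\<Sum>e\<in>F. cinner v e *\<^sub>C e)) < e1"
    using basis_approx_compact[OF Wc some_basis e1] by (elim exE conjE)
   have "dist (\<Sum>e\<in>F. cinner (app (T o\<^sub>L ta) e) e) R < e0"
    if F: "finite F" "F0 \<subseteq> F" "F \<subseteq> some_basis" for F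
   proof -
    define q where "q s = cinner (app T (u s)) (w s - (\<Sum>e\<in>F. cinner (w s) e *\<^sub>C e))" for s
    have oF: "orthonormal F" by (rule some_basis_finite[OF F(3)])
    have qc: "cont q" unfolding q_def
     by (intro continuous_intros continuous_on_cinner continuous_on_scaleC continuous_blinfun_apply uc wc)
    have q1: "cmod (q s) <= norm T*norm x*norm (w s - (\<Sum>e\<in>F. cinner (w s) e *\<^sub>C e))" for s
    proof -
     have "cmod (q s) <= norm (app T (u s))*norm (w s - (\<Sum>e\<in>F. cinner (w s) e *\<^sub>C e))"
      unfolding q_def by (rule cinner_norm_le)
     also have "\<dots> <= (norm T*norm (u s))*norm (w s - (\<Sum>e\<in>F. cinner (w s) e *\<^sub>C e))"
      by (intro mult_right_mono norm_blinfun) simp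
     finally show ?thesis by (simp add: nu)
    qed
    have qb: "cmod (q s) <= C" for s
    proof -
     have "norm (w s - (\<Sum>e\<in>F. cinner (w s) e *\<^sub>C e)) <= norm (w s - (\<Sum>e\<in>F. 0 *\<^sub>C e))"
      by (rule orthonormal_best_approx[OF oF F(1)])
     also have "\<dots> = norm y" by (simp add: nw)
     finally show ?thesis unfolding C_def by (intro order_trans[OF q1] mult_left_mono) auto
    qed
    have qK: "cmod (q s) <= norm T*norm x*e1" if "s : K" for s
    proof -
     have "norm (w s - (\<Sum>e\<in>F. cinner (w s) e *\<^sub>C e)) <= e1"
      using F0'[rule_format, of F "w s"] F that by simp
     then show ?thesis by (intro order_trans[OF q1] mult_left_mono) auto
    qed
    have wsum: "cinner (app T (u s)) (\<Sum>e\<in>F. cinner (w s) e *\<^sub>C e)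
      = (\<Sum>e\<in>F. cinner e (w s)*cinner (app T (u s)) e)" for s
     unfolding cinner_sum_right cinner_scaleC_right by (intro sum.cong refl) (metis cinner_commute)
    have Ri: "integrable haar (%s. f s*cinner (app T (u s)) (w s))"
     unfolding u_def w_def by (rule integrable_mult_bounded(1)[OF fi right_coeff_continuous right_coeff_bound])
    have "(\<Sum>e\<in>F. cinner (app (T o\<^sub>L ta) e) e)
      = (LI s. f s*cinner (app T (u s)) (\<Sum>e\<in>F. cinner (w s) e *\<^sub>C e))"
     unfolding TB[OF T] wsum sum_distrib_left using i(1)
     by (subst Bi_sum) auto
    moreover have "integrable haar (%s. f s*cinner (app T (u s)) (\<Sum>e\<in>F. cinner (w s) e *\<^sub>C e))"
     unfolding wsum sum_distrib_left using i(1) by (intro BI_sum)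
    ultimately have "R - (\<Sum>e\<in>F. cinner (app (T o\<^sub>L ta) e) e) = (LI s. f s*q s)"
     unfolding R q_def cinner_diff_right right_diff_distrib using Ri
     by (subst Bi_diff) auto
    also have "\<dots> = (LI s. g s*q s) + (LI s. (f s - g s)*q s)"
     using integrable_mult_bounded(1)[OF gi qc qb] integrable_mult_bounded(1)[OF BI_diff[OF fi gi] qc qb]
     by (subst Bi_add[symmetric]) (auto simp: algebra_simps)
    also have "cmod \<dots> <= cmod (LI s. g s*q s) + cmod (LI s. (f s - g s)*q s)"
     by (rule norm_triangle_ineq)
    also have "cmod (LI s. g s*q s) <= norm T*norm x*e1*M"
     unfolding M_def by (rule integrable_mult_continuous(2)[OF gi K(2,3) continuous_borel[OF qc] qK])
    also have "cmod (LI s. (f s - g s)*q s) <= C*(LI t. cmod (f t - g t))"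
     by (rule integrable_mult_bounded(2)[OF BI_diff[OF fi gi] qc qb])
    also have "C*(LI t. cmod (f t - g t)) <= C*d" using g(2) C by (intro mult_left_mono) auto
    also have "norm T*norm x*e1*M + C*d < e0"
    proof -
     have "norm T*norm x*e1*M = e0/2*(norm T*norm x*M / (norm T*norm x*M + 1))"
      by (simp add: e1_def)
     also have "\<dots> < e0/2 * 1" using e0 p1 by (intro mult_strict_left_mono) (simp_all add: divide_less_eq)
     finally have a: "norm T*norm x*e1*M < e0/2" by simp
     have "C*d = e0/2*(C / (C + 1))" by (simp add: d_def)
     also have "\<dots> <= e0/2 * 1" using e0 C by (intro mult_left_mono) (simp_all add: divide_le_eq)
     finally show ?thesis using a by simp
    qed
    finally show ?thesis by (simp add: dist_norm norm_minus_commute)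
   qed
   then show "\<forall>\<^sub>F F in finite_subsets_at_top some_basis. dist (\<Sum>e\<in>F. cinner (app (T o\<^sub>L ta) e) e) R < e0"
    unfolding eventually_finite_subsets_at_top using F0 by (intro exI[of _ F0] conjI allI impI) blast+
  qed
  then show ?thesis unfolding trace_pairing_def op_trace_def R_def[symmetric] by (rule infsumI)
 qed
 then show ?thesis using tc unfolding N_def by (intro bexI[of _ ta] conjI ballI)
qed

lemma trace_class_infsum_exists:
 fixes om :: "'j => 'h::chilbert_space \<Rightarrow>\<^sub>L 'h"
 assumes tc: "!!j. j : K ==> om j : trace_class" and s: "(%j. trace_norm (om j)) summable_on K"
 shows "EX Om:trace_class. ALL T:bounded_ops. ((%j. trace_pairing T (om j)) has_sum trace_pairing T Om) K"
proof -
 have b: "cmod (cinner (app (om j) x) y) <= trace_norm (om j)*(norm x*norm y)" if j: "j : K" for j x y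
 proof -
  obtain xi eta where n: "nuclear (some_basis :: 'h set) xi eta (om j)"
   and le: "(\<Sum>\<^sub>\<infinity>e\<in>some_basis. norm (xi e)*norm (eta e)) <= trace_norm (om j)"
   using trace_class_nuclear[OF tc[OF j]] by blast
  have s: "(%i. norm (xi i)*norm (eta i)) summable_on some_basis" using n by (simp add: nuclear_def)
  have "((%i. cinner x (eta i)*cinner (xi i) y) has_sum cinner (app (om j) x) y) some_basis"
   using n by (simp add: nuclear_def)
  from infsumI[OF this] have "cmod (cinner (app (om j) x) y) <= (\<Sum>\<^sub>\<infinity>i\<in>some_basis. norm (xi i)*norm (eta i))*norm x*norm y"
   using nuclear_form_summable(2)[OF s, of x y] by simp
  also have "\<dots> <= trace_norm (om j)*norm x*norm y" using le by (intro mult_right_mono) auto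
  finally show ?thesis by (simp add: mult.assoc)
 qed
 define B where "B x y = (\<Sum>\<^sub>\<infinity>j\<in>K. cinner (app (om j) x) y)" for x y
 have sb: "(%j. trace_norm (om j)*(norm x*norm y)) summable_on K" for x y :: 'h
  by (intro summable_on_cmult_left s)
 have abs: "(%j. norm (cinner (app (om j) x) y)) summable_on K" for x y
  by (rule Infinite_Sum.abs_summable_on_comparison_test'[OF sb b])
 note su = abs_summable_summable[OF abs]
 have "EX Om:bounded_ops. norm Om <= (\<Sum>\<^sub>\<infinity>j\<in>K. trace_norm (om j)) &
  (ALL x:UNIV. ALL y:UNIV. cinner (app Om x) y = B x y)"
 proof (rule form_operator)
  show "B (x + y) z = B x z + B y z" for x y z
   unfolding B_def by (simp add: blinfun.add_right cinner_add_left infsum_add su)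
  show "B x (y + z) = B x y + B x z" for x y z
   unfolding B_def by (simp add: cinner_add_right infsum_add su)
  show "B (c *\<^sub>C x) y = c*B x y" for c x y
  proof -
   have "B (c *\<^sub>C x) y = (\<Sum>\<^sub>\<infinity>j\<in>K. c*cinner (app (om j) x) y)"
    unfolding B_def by (rule infsum_cong) (simp add: bounded_ops_scaleC[OF trace_class_bounded[OF tc]] cinner_scaleC_left)
   then show ?thesis by (simp add: B_def infsum_cmult_right su)
  qed
  show "B x (c *\<^sub>C y) = cnj c*B x y" for c x y
   unfolding B_def by (simp add: cinner_scaleC_right infsum_cmult_right su)
  show "cmod (B x y) <= (\<Sum>\<^sub>\<infinity>j\<in>K. trace_norm (om j))*norm x*norm y" for x y
  proof -
   have "cmod (B x y) <= (\<Sum>\<^sub>\<infinity>j\<in>K. norm (cinner (app (om j) x) y))"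
    unfolding B_def by (rule norm_infsum_bound[OF abs])
   also have "\<dots> <= (\<Sum>\<^sub>\<infinity>j\<in>K. trace_norm (om j)*(norm x*norm y))" by (rule infsum_mono[OF abs sb b])
   also have "\<dots> = (\<Sum>\<^sub>\<infinity>j\<in>K. trace_norm (om j))*(norm x*norm y)"
    by (rule infsum_cmult_left) (use s in simp)
   finally show ?thesis by (simp add: mult.assoc)
  qed
  show "0 <= (\<Sum>\<^sub>\<infinity>j\<in>K. trace_norm (om j))"
   by (rule infsum_nonneg) (rule trace_norm_nonneg[OF trace_class_bounded[OF tc]])
 qed simp_all
 then obtain Om where Om: "Om : bounded_ops" "!!x y. cinner (app Om x) y = B x y" by blast
 have hs: "((%j. cinner (app (om j) x) y) has_sum cinner (app Om x) y) K" for x y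
  unfolding Om(2) B_def by (rule has_sum_infsum[OF su])
 from trace_class_infsum[OF tc s Om(1) hs] show ?thesis by blast
qed

text \<open>The rank one case is summed along a nuclear representation of \<open>om\<close>; the
  trace norms of the pieces are dominated by the summable products of norms.\<close>

lemma Theta_pre:
 fixes f :: "'g::locally_compact_group => complex"
 assumes f: "f : L1" and om: "om : trace_class"
 shows "Theta_pre f om : trace_class"
  "T : bounded_ops ==> trace_pairing T (Theta_pre f om) = trace_pairing (Theta f T) om"
proof -
 obtain xi eta where n: "nuclear (some_basis :: 'g L2 set) xi eta om" using trace_class_nuclear[OF om] by blast
 define N where "N = (LI t. cmod (f t))"
 have "ALL e. EX ta. ta : trace_class & trace_norm ta <= N*(norm (xi e)*norm (eta e)) &
  (ALL T:bounded_ops. trace_pairing T ta = cinner (app (Theta f T) (xi e)) (eta e))"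
  using Theta_pre_rank_one[OF f] unfolding N_def by blast
 then obtain ta where ta: "!!e. ta e : trace_class" "!!e. trace_norm (ta e) <= N*(norm (xi e)*norm (eta e))"
  "!!e T. T : bounded_ops ==> trace_pairing T (ta e) = cinner (app (Theta f T) (xi e)) (eta e)" by metis
 have s: "(%e. N*(norm (xi e)*norm (eta e))) summable_on some_basis"
  using n by (intro summable_on_cmult_right) (simp add: nuclear_def)
 have b: "norm (trace_norm (ta e)) <= N*(norm (xi e)*norm (eta e))" for e
  using ta(2)[of e] trace_norm_nonneg[OF trace_class_bounded[OF ta(1)[of e]]] by simp
 have s': "(%e. trace_norm (ta e)) summable_on some_basis"
  using abs_summable_summable[OF Infinite_Sum.abs_summable_on_comparison_test'[OF s b]] .
 obtain Om where Om: "Om : trace_class" "!!T. T : bounded_ops ==> ((%e. trace_pairing T (ta e)) has_sum trace_pairing T Om) some_basis"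
  using trace_class_infsum_exists[OF ta(1) s'] by blast
 have OmT: "trace_pairing T Om = trace_pairing (Theta f T) om" if T: "T : bounded_ops" for T
  using has_sum_unique[OF Om(2)[OF T, unfolded ta(3)[OF T]] nuclear_pairing[OF n Theta(1)[OF f T]]] .
 have "Theta_pre f om = Om"
  unfolding Theta_pre_def
 proof (rule the_equality)
  show "Om : trace_class & (ALL T:bounded_ops. trace_pairing T Om = trace_pairing (Theta f T) om)"
   using Om(1) OmT by blast
  fix sg assume "sg : trace_class & (ALL T:bounded_ops. trace_pairing T sg = trace_pairing (Theta f T) om)"
  then show "sg = Om" using Om(1) OmT by (intro trace_class_eqI) auto
 qed
 then show "Theta_pre f om : trace_class"
  "T : bounded_ops ==> trace_pairing T (Theta_pre f om) = trace_pairing (Theta f T) om"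
  using Om(1) OmT by simp_all
qed

text \<open>The pairing with \<open>T\<close> is linear and continuous in the trace norm, so neither
  span nor closure changes the annihilator; on the generators it is the pairing of
  \<open>Theta f T\<close> with arbitrary trace class operators.\<close>

lemma op_annihilator_Ran:
 fixes J :: "('g::locally_compact_group => complex) set"
 assumes J: "J \<subseteq> L1"
 shows "op_annihilator (Ran J) = {T:bounded_ops. ALL g:J. Theta g T = 0}"
proof (intro set_eqI iffI)
 let ?G = "{Theta_pre f om | f om. f : J & om : trace_class}"
 have span_tc: "op_cspan ?G \<subseteq> trace_class"
 proof (rule cop.span_minimal)
  show "?G \<subseteq> trace_class" using Theta_pre(1) J by blast
  show "cop.subspace trace_class"
   by (rule cop.subspaceI) (auto intro: trace_class_zero trace_class_add trace_class_scale)
 qed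
 fix T :: "'g L2 \<Rightarrow>\<^sub>L 'g L2"
 {
  assume T: "T : op_annihilator (Ran J)"
  then have Tb: "T : bounded_ops" by (simp add: op_annihilator_def)
  have "Theta g T = 0" if g: "g : J" for g
  proof (rule op_eq_0I_pairing)
   have gL: "g : L1" using g J by blast
   show "Theta g T : bounded_ops" by (rule Theta(1)[OF gL Tb])
   fix om :: "'g L2 \<Rightarrow>\<^sub>L 'g L2" assume om: "om : trace_class"
   have "Theta_pre g om : op_cspan ?G" using g om by (intro cop.span_base) blast
   then have "Theta_pre g om : Ran J"
    unfolding Ran_def trace_norm_closure_def using span_tc trace_class_zero(2)[where 'h="'g L2"]
    by (auto intro!: bexI[of _ "Theta_pre g om"])
   then show "trace_pairing (Theta g T) om = 0"
    using T Theta_pre(2)[OF gL om Tb] by (simp add: op_annihilator_def)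
  qed
  then show "T : {T:bounded_ops. ALL g:J. Theta g T = 0}" using Tb by blast
 next
  assume T: "T : {T:bounded_ops. ALL g:J. Theta g T = 0}"
  then have Tb: "T : bounded_ops" by simp
  have sub: "cop.subspace {sg:trace_class. trace_pairing T sg = 0}"
   by (rule cop.subspaceI)
    (auto simp: trace_class_zero trace_class_add trace_class_scale Tb)
  have zero: "trace_pairing 0 om = 0" if "om : trace_class" for om :: "'g L2 \<Rightarrow>\<^sub>L 'g L2"
   using trace_pairing_scale_left[OF that Tb, of 0] by simp
  have "op_cspan ?G \<subseteq> {sg:trace_class. trace_pairing T sg = 0}"
   using T J by (intro cop.span_minimal[OF _ sub]) (auto simp: Theta_pre subset_iff zero)
  then have ann: "sg : trace_class" "trace_pairing T sg = 0" if "sg : op_cspan ?G" for sg using that by auto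
  have "trace_pairing T ta = 0" if ta: "ta : Ran J" for ta
  proof -
   have tat: "ta : trace_class" and tac: "!!ep. 0 < ep ==> EX sg:op_cspan ?G. trace_norm (ta - sg) < ep"
    using ta by (auto simp: Ran_def trace_norm_closure_def)
   have "cmod (trace_pairing T ta) <= 0"
   proof (rule field_le_epsilon)
    fix e :: real assume e: "0 < e"
    then have "0 < e / (norm T + 1)" by (intro divide_pos_pos add_nonneg_pos) auto
    then obtain sg where sg: "sg : op_cspan ?G" "trace_norm (ta - sg) < e / (norm T + 1)" using tac by blast
    have "trace_pairing T ta = trace_pairing T (ta - sg)"
     using trace_class_diff(2)[OF tat ann(1)[OF sg(1)] Tb] ann(2)[OF sg(1)] by simp
    then have "cmod (trace_pairing T ta) <= norm T*trace_norm (ta - sg)"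
     using trace_pairing_le[OF trace_class_diff(1)[OF tat ann(1)[OF sg(1)]] Tb] by simp
    also have "\<dots> <= norm T*(e / (norm T + 1))" using sg(2) by (intro mult_left_mono) auto
    also have "\<dots> = e*(norm T / (norm T + 1))" by simp
    also have "\<dots> <= e * 1" using e by (intro mult_left_mono) (auto simp: divide_le_eq add_nonneg_pos)
    finally show "cmod (trace_pairing T ta) <= 0 + e" by simp
   qed
   then show ?thesis by simp
  qed
  then show "T : op_annihilator (Ran J)" using Tb by (simp add: op_annihilator_def)
 }
qed

subsection \<open>Convolution\<close>

text \<open>The third form, obtained by translating and inverting the variable, has the shape of the
  coefficients of a multiplication operator conjugated by right translations.\<close>

lemma convolution_Cc:
 fixes F g :: "'g::locally_compact_group => complex"
 assumes F: "F : Cc" and g: "g : Cc"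
 shows "convolution F g : Cc" "(LI t. convolution F g t) = (LI t. F t)*(LI t. g t)"
  "convolution F g t = (LI s. g s*(F (t + - s)*cor (modular (- s))))"
proof -
 obtain K where K: "cont F" "compact K" "!!x. x ~: K ==> F x = 0" using F by (rule CcE) blast
 obtain L where L: "cont g" "compact L" "!!x. x ~: L ==> g x = 0" using g by (rule CcE) blast
 define B where "B = (%(x, y). x + y) ` (K \<times> L)"
 have B: "compact B" unfolding B_def by (rule compact_plus[OF K(2) L(2)])
 note ci = continuous_intros cont_comp[OF K(1)] cont_comp[OF L(1)]
 have kc: "cont (%(t, s). F s*g (- s + t))" unfolding case_prod_unfold by (intro ci)
 have kc': "cont (%(s, t). F s*g (- s + t))" unfolding case_prod_unfold by (intro ci)
 have supp: "F s*g (- s + t) = 0" if "t ~: B" for s t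
 proof (rule ccontr)
  assume "F s*g (- s + t) ~= 0"
  then have "s : K" "- s + t : L" using K(3) L(3) by auto
  then have "s + (- s + t) : B" unfolding B_def by (rule plus_image_mem)
  then show False using that by (simp add: add.assoc[symmetric])
 qed
 have "cont (%t. LI s. F s*g (- s + t))"
  by (rule continuous_integral_compact_support[OF kc K(2)]) (simp add: K(3))
 then have "cont (convolution F g)" by (simp add: convolution_def[abs_def])
 then show "convolution F g : Cc"
  by (rule CcI[OF _ B]) (simp add: convolution_def supp)
 have "(LI t. convolution F g t) = (LI s. LI t. F s*g (- s + t))"
  unfolding convolution_def
  by (rule fubini_compact_support[OF kc B K(2)]) (use supp K(3) in auto)
 also have "\<dots> = (LI s. F s*(LI t. g t))"
  using integral_haar_left(1)[OF Cc_measurable[OF g]] by simp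
 finally show "(LI t. convolution F g t) = (LI t. F t)*(LI t. g t)" by simp
 define Ph where "Ph s = g (- s)*F (t + s)" for s
 have Ph: "Ph : Cc" unfolding Ph_def by (intro Cc_mult_right Cc_inverse g ci)
 have "convolution F g t = (LI s. F (t + s)*g (- (t + s) + t))"
  unfolding convolution_def
  by (rule integral_haar_left(1)[symmetric], rule continuous_borel) (intro ci)
 also have "\<dots> = (LI s. Ph s)" by (simp add: Ph_def minus_add add.assoc mult.commute)
 also have "\<dots> = (LI s. Ph (- s)*cor (modular (- s)))"
  by (rule integral_haar_inverse[OF Ph, symmetric])
 finally show "convolution F g t = (LI s. g s*(F (t + - s)*cor (modular (- s))))"
  by (simp add: Ph_def mult.assoc)
qed

lemma convolution_cmod_le:
 fixes F g :: "'g::locally_compact_group => complex"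
 assumes F: "F : Cc" and g: "g : Cc"
 shows "cmod (convolution F g t) <= (LI s. cmod (F s*g (- s + t)))"
  "integrable haar (%t. LI s. cmod (F s*g (- s + t)))"
  "(LI t. LI s. cmod (F s*g (- s + t))) = (LI t. cmod (F t))*(LI t. cmod (g t))"
proof -
 show "cmod (convolution F g t) <= (LI s. cmod (F s*g (- s + t)))"
  unfolding convolution_def by (rule integral_norm_bound)
 define F' where "F' t = cor (cmod (F t))" for t
 define g' where "g' t = cor (cmod (g t))" for t
 have Fg: "F' : Cc" "g' : Cc" unfolding F'_def g'_def by (intro Cc_cmod F g)+
 have c: "convolution F' g' t = cor (LI s. cmod (F s*g (- s + t)))" for t
  unfolding convolution_def F'_def g'_def by (simp add: integral_complex_of_real[symmetric] norm_mult)
 show "integrable haar (%t. LI s. cmod (F s*g (- s + t)))"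
  using Cc_integrable[OF convolution_Cc(1)[OF Fg]] unfolding c complex_of_real_integrable_eq .
 have "cor (LI t. LI s. cmod (F s*g (- s + t)))
   = cor ((LI t. cmod (F t))*(LI t. cmod (g t)))"
  using convolution_Cc(2)[OF Fg] unfolding c by (simp add: integral_complex_of_real F'_def g'_def)
 then show "(LI t. LI s. cmod (F s*g (- s + t))) = (LI t. cmod (F t))*(LI t. cmod (g t))"
  by (simp only: of_real_eq_iff)
qed

lemma AE_summable_norm:
 fixes f :: "nat => 'a => 'b::{banach, second_countable_topology}"
 assumes i: "!!n. integrable M (f n)" and s: "summable (%n. LINT x|M. norm (f n x))"
 shows "AE x in M. summable (%n. norm (f n x))"
proof -
 have "(\<integral>\<^sup>+x. (\<Sum>n. ennreal (norm (f n x))) \<partial>M) = (\<Sum>n. \<integral>\<^sup>+x. ennreal (norm (f n x)) \<partial>M)"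
  using i by (intro nn_integral_suminf) auto
 also have "\<dots> = (\<Sum>n. ennreal (LINT x|M. norm (f n x)))"
  using i by (intro suminf_cong nn_integral_eq_integral integrable_norm) auto
 also have "\<dots> < \<infinity>"
  using s by (subst suminf_ennreal2) (auto intro!: integral_nonneg_AE)
 finally have "AE x in M. (\<Sum>n. ennreal (norm (f n x))) ~= \<infinity>"
  using i by (intro nn_integral_PInf_AE) auto
 then show ?thesis
  by eventually_elim (rule summable_suminf_not_top, auto)
qed

text \<open>Telescoped approximations of rate \<open>(1/2)^n\<close>. The resulting series converges
  absolutely in \<open>L\<^sup>1\<close> and therefore also pointwise almost everywhere.\<close>

lemma Cc_L1_series:
 fixes g :: "'g::locally_compact_group => complex"
 assumes g: "integrable haar g"
 shows "EX G. (ALL n. G n : Cc) & summable (%n. LI t. cmod (G n t)) &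
  (%N. LI t. cmod (g t - (\<Sum>n<N. G n t))) \<longlonglongrightarrow> 0"
proof -
 have "EX u:Cc. (LI t. cmod (g t - u t)) < (1/2)^n" for n :: nat
  by (rule Cc_L1_dense[OF g]) simp
 then obtain u where u: "!!n. u n : Cc" "!!n. (LI t. cmod (g t - u n t)) < (1/2)^n" by metis
 \<comment> \<open>Shifted by one so as to start at 0; the partial sums of the differences are then
   exactly \<open>v N\<close>.\<close>
 define v where "v n = (case n of 0 => (%_. 0) | Suc k => u k)" for n
 have v: "v n : Cc" for n by (cases n) (auto simp: v_def u)
 define G where "G n t = v (Suc n) t - v n t" for n t
 have G: "G n : Cc" for n unfolding G_def[abs_def] by (intro Cc_diff v)
 have Gs: "(\<Sum>n<N. G n t) = v N t" for N t
 proof -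
  have "(\<Sum>n<N. v (Suc n) t - v n t) = v N t - v 0 t" by (rule sum_lessThan_telescope)
  moreover have "v 0 t = 0" by (simp add: v_def)
  ultimately show ?thesis by (simp add: G_def)
 qed
 have gu: "integrable haar (%t. g t - u n t)" for n
  by (intro BI_diff g Cc_integrable u)
 have le: "(LI t. cmod (G (Suc n) t)) <= 2*(1/2)^n" for n
 proof -
  have "(LI t. cmod (G (Suc n) t)) <= (LI t. cmod (g t - u (Suc n) t) + cmod (g t - u n t))"
  proof (rule integral_mono)
   show "integrable haar (%t. cmod (G (Suc n) t))" by (intro integrable_norm Cc_integrable G)
   show "integrable haar (%t. cmod (g t - u (Suc n) t) + cmod (g t - u n t))"
    by (intro BI_add integrable_norm gu)
   show "cmod (G (Suc n) t) <= cmod (g t - u (Suc n) t) + cmod (g t - u n t)" for t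
    using norm_triangle_ineq4[of "g t - u n t" "g t - u (Suc n) t"] by (simp add: G_def v_def add.commute)
  qed
  also have "\<dots> = (LI t. cmod (g t - u (Suc n) t)) + (LI t. cmod (g t - u n t))"
   by (intro Bi_add integrable_norm gu)
  also have "\<dots> <= (1/2)^(Suc n) + (1/2)^n" using u(2)[of "Suc n"] u(2)[of n] by linarith
  also have "\<dots> <= 2*(1/2)^n" by simp
  finally show ?thesis .
 qed
 have "summable (%n. 2*(1/2::real)^n)" by (intro summable_mult summable_geometric) simp
 then have "summable (%n. LI t. cmod (G (Suc n) t))"
  by (rule summable_comparison_test'[where N=0]) (use le in \<open>simp add: integral_nonneg_AE\<close>)
 then have s: "summable (%n. LI t. cmod (G n t))"
  using summable_Suc_iff[of "%n. LI t. cmod (G n t)"] by blast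
 have "(%n. LI t. cmod (g t - u n t)) \<longlonglongrightarrow> 0"
 proof (rule tendsto_sandwich[of "%_. 0" _ _ "%n. (1/2)^n"])
  show "(%n. (1/2::real)^n) \<longlonglongrightarrow> 0" by (rule LIMSEQ_power_zero) simp
  show "\<forall>\<^sub>F n in sequentially. (LI t. cmod (g t - u n t)) <= (1/2)^n"
   using u(2) less_imp_le by (intro always_eventually allI) blast
 qed (auto intro!: always_eventually integral_nonneg_AE)
 then have "(%N. LI t. cmod (g t - (\<Sum>n<Suc N. G n t))) \<longlonglongrightarrow> 0"
  unfolding Gs by (simp add: v_def)
 then have "(%N. LI t. cmod (g t - (\<Sum>n<N. G n t))) \<longlonglongrightarrow> 0" by (rule LIMSEQ_imp_Suc)
 then show ?thesis using G s by blast
qed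

lemma integral_L1_limit:
 fixes g h :: "'g::locally_compact_group => complex"
 assumes g: "integrable haar g" and G: "!!n. G n : Cc"
  and lim: "(%N. LI t. cmod (g t - (\<Sum>n<N. G n t))) \<longlonglongrightarrow> 0"
  and h: "h : borel_measurable borel" "loc_AE (%t. cmod (h t) <= C)"
 shows "(%n. LI t. G n t*h t) sums (LI t. g t*h t)"
proof -
 have Gi: "integrable haar (%t. G n t*h t)" for n by (rule Linf_mult_L1(1)[OF Cc_integrable[OF G] h])
 have gi: "integrable haar (%t. g t*h t)" by (rule Linf_mult_L1(1)[OF g h])
 have le: "cmod ((\<Sum>n<N. LI t. G n t*h t) - (LI t. g t*h t)) <= C*(LI t. cmod (g t - (\<Sum>n<N. G n t)))" for N
 proof -
  have i: "integrable haar (%t. g t - (\<Sum>n<N. G n t))"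
   by (intro BI_diff g Cc_integrable Cc_sum G)
  have "(LI t. g t*h t) - (\<Sum>n<N. LI t. G n t*h t) = (LI t. g t*h t - (\<Sum>n<N. G n t*h t))"
   using Gi gi by (subst Bi_diff) auto
  also have "\<dots> = (LI t. (g t - (\<Sum>n<N. G n t))*h t)"
   by (simp add: left_diff_distrib sum_distrib_right)
  finally have "(LI t. g t*h t) - (\<Sum>n<N. LI t. G n t*h t) = (LI t. (g t - (\<Sum>n<N. G n t))*h t)" .
  then show ?thesis using Linf_mult_L1(2)[OF i h] by (simp add: norm_minus_commute)
 qed
 have lim0: "(%N. C*(LI t. cmod (g t - (\<Sum>n<N. G n t)))) \<longlonglongrightarrow> 0"
  using tendsto_mult_right_zero[OF lim] .
 have "(%N. (\<Sum>n<N. LI t. G n t*h t) - (LI t. g t*h t)) \<longlonglongrightarrow> 0"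
  by (rule Lim_null_comparison[OF always_eventually[OF allI[OF le]] lim0])
 then show ?thesis unfolding sums_def by (rule LIM_zero_cancel)
qed

lemma loc_AE_UNIV: "(!!t. P t) ==> loc_AE P"
 by (simp add: loc_AE_def)

text \<open>Replacing \<open>g\<close> by a representative that is the sum of a series of continuous functions makes its
  convolution with \<open>F\<close> accessible by Fubini's theorem for continuous functions.\<close>

lemma left_ideal_convolution:
 fixes J :: "('g::locally_compact_group => complex) set"
 assumes J: "closed_left_ideal J" and g: "g : J" and F: "F : Cc"
  and G: "!!n. G n : Cc" and s: "summable (%n. LI t. cmod (G n t))"
  and lim: "(%N. LI t. cmod (g t - (\<Sum>n<N. G n t))) \<longlonglongrightarrow> 0"
  and h: "h : borel_measurable borel" "loc_AE (%t. cmod (h t) <= C)" "0 <= C"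
 shows "EX H:J. (%n. LI t. convolution F (G n) t*h t) sums (LI t. H t*h t)"
proof -
 have gi: "integrable haar g" using J g by (auto simp: closed_left_ideal_def L1_def)
 have Gi: "integrable haar (G n)" for n by (rule Cc_integrable[OF G])
 have Gm [measurable]: "G n : borel_measurable borel" for n by (rule Cc_measurable[OF G])
 \<comment> \<open>The value 0 at points where the series does not converge absolutely makes
   \<open>g'\<close> Borel. Its \<open>L\<^sup>1\<close> distance to \<open>g\<close> is 0, so it
   belongs to \<open>J\<close> by closedness.\<close>
 define g' where "g' t = (if summable (%n. cmod (G n t)) then (\<Sum>n. G n t) else 0)" for t
 have "summable (%n. cmod (G n t)) \<longleftrightarrow> (\<Sum>n. ennreal (cmod (G n t))) ~= top" for t
 proof
  assume "summable (%n. cmod (G n t))"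
  then have "(\<Sum>n. ennreal (cmod (G n t))) = ennreal (\<Sum>n. cmod (G n t))" by (intro suminf_ennreal2 norm_ge_zero)
  then show "(\<Sum>n. ennreal (cmod (G n t))) ~= top" by simp
 next
  assume "(\<Sum>n. ennreal (cmod (G n t))) ~= top"
  then show "summable (%n. cmod (G n t))" by (intro summable_suminf_not_top norm_ge_zero)
 qed
 then have g'_eq: "g' = (%t. if (\<Sum>n. ennreal (cmod (G n t))) ~= top then (\<Sum>n. G n t) else 0)"
  by (intro ext) (simp only: g'_def)
 have m1: "(%t. \<Sum>n. ennreal (cmod (G n t))) : borel_measurable borel"
  by (rule borel_measurable_suminf_order, rule measurable_compose[OF measurable_compose[OF Gm borel_measurable_norm] measurable_ennreal])
 have m2: "{x::ennreal. x ~= top} : sets borel" by (rule borel_open, simp add: open_Collect_neq continuous_on_id continuous_on_const) 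
 have m3: "{t : space borel. (\<Sum>n. ennreal (cmod (G n t))) ~= top} : sets borel"
  using measurable_sets[OF m1 m2] by (simp only: vimage_def space_borel Int_UNIV_right mem_Collect_eq UNIV_I simp_thms)
 have g'm: "g' : borel_measurable borel" unfolding g'_eq
  by (rule measurable_If[OF borel_measurable_suminf[OF Gm] borel_measurable_const m3])
 have ae: "AE t in haar. summable (%n. cmod (G n t))" by (rule AE_summable_norm[OF Gi s])
 have sumi: "integrable haar (%t. \<Sum>n. G n t)" by (rule integrable_suminf[OF Gi ae s])
 have g'i: "integrable haar g'"
 proof (rule integrable_cong_AE_imp[OF sumi])
  show "g' : borel_measurable haar" using g'm by (simp add: measurable_haar_iff)
  show "AE t in haar. (\<Sum>n. G n t) = g' t" using ae by eventually_elim (simp add: g'_def)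
 qed
 have tail: "(%N. \<Sum>n. LI t. cmod (G (n + N) t)) \<longlonglongrightarrow> 0"
  by (rule suminf_exist_split2[OF s])
 have g'lim: "(LI t. cmod (g' t - (\<Sum>n<N. G n t))) <= (\<Sum>n. LI t. cmod (G (n + N) t))" for N
 proof -
  have s': "summable (%n. LI t. cmod (G (n + N) t))" using s by (rule summable_ignore_initial_segment)
  have ae': "AE t in haar. summable (%n. norm (cmod (G (n + N) t)))"
   using ae unfolding real_norm_def abs_norm_cancel by eventually_elim (rule summable_ignore_initial_segment)
  have i: "integrable haar (%t. cmod (G (n + N) t))" for n by (intro integrable_norm Gi)
  have si: "integrable haar (%t. \<Sum>n. cmod (G (n + N) t))"
   by (rule integrable_suminf[OF i ae']) (use s' in simp)
  have "(LI t. cmod (g' t - (\<Sum>n<N. G n t))) <= (LI t. (\<Sum>n. cmod (G (n + N) t)))"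
  proof (rule integral_mono_AE[OF _ si])
   show "integrable haar (%t. cmod (g' t - (\<Sum>n<N. G n t)))"
    by (intro integrable_norm BI_diff g'i BI_sum Gi)
   show "AE t in haar. cmod (g' t - (\<Sum>n<N. G n t)) <= (\<Sum>n. cmod (G (n + N) t))"
    using ae
   proof eventually_elim
    case (elim t)
    then have "g' t - (\<Sum>n<N. G n t) = (\<Sum>n. G (n + N) t)"
     using suminf_minus_initial_segment[OF summable_norm_cancel[OF elim], of N] by (simp add: g'_def)
    also have "cmod \<dots> <= (\<Sum>n. cmod (G (n + N) t))"
     by (rule summable_norm) (rule summable_ignore_initial_segment[OF elim])
    finally show ?case .
   qed
  qed
  also have "\<dots> = (\<Sum>n. LI t. cmod (G (n + N) t))"
   by (rule integral_suminf[OF i ae']) (use s' in simp)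
  finally show ?thesis .
 qed
 have "(LI t. cmod (g' t - g t)) <= 0"
 proof (rule LIMSEQ_le_const)
  show "(%N. (\<Sum>n. LI t. cmod (G (n + N) t)) + (LI t. cmod (g t - (\<Sum>n<N. G n t)))) \<longlonglongrightarrow> 0"
   using tendsto_add[OF tail lim] by simp
  have "(LI t. cmod (g' t - g t)) <= (\<Sum>n. LI t. cmod (G (n + N) t)) + (LI t. cmod (g t - (\<Sum>n<N. G n t)))" for N
  proof -
   have 1: "integrable haar (%t. g' t - (\<Sum>n<N. G n t))" "integrable haar (%t. g t - (\<Sum>n<N. G n t))"
    by (intro BI_diff g'i gi BI_sum Gi)+
   have "(LI t. cmod (g' t - g t)) <= (LI t. cmod (g' t - (\<Sum>n<N. G n t)) + cmod (g t - (\<Sum>n<N. G n t)))"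
   proof (rule integral_mono)
    show "integrable haar (%t. cmod (g' t - g t))" by (intro integrable_norm BI_diff g'i gi)
    show "integrable haar (%t. cmod (g' t - (\<Sum>n<N. G n t)) + cmod (g t - (\<Sum>n<N. G n t)))"
     by (intro BI_add integrable_norm 1)
    show "cmod (g' t - g t) <= cmod (g' t - (\<Sum>n<N. G n t)) + cmod (g t - (\<Sum>n<N. G n t))" for t
     using norm_triangle_ineq4[of "g' t - (\<Sum>n<N. G n t)" "g t - (\<Sum>n<N. G n t)"] by simp
   qed
   also have "\<dots> = (LI t. cmod (g' t - (\<Sum>n<N. G n t))) + (LI t. cmod (g t - (\<Sum>n<N. G n t)))"
    by (intro Bi_add integrable_norm 1)
   finally show ?thesis using g'lim[of N] by simp
  qed
  then show "EX N. ALL n>=N. (LI t. cmod (g' t - g t)) <= (\<Sum>k. LI t. cmod (G (k + n) t)) + (LI t. cmod (g t - (\<Sum>k<n. G k t)))"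
   by blast
 qed
 then have g'0: "(LI t. cmod (g' t - g t)) < ep" if "0 < ep" for ep using that by linarith
 have closed: "!!f. f : L1 ==> (!!ep. ep > 0 ==> EX g:J. (LI t. cmod (f t - g t)) < ep) ==> f : J"
  using J unfolding closed_left_ideal_def by blast
 have g'J: "g' : J" by (rule closed) (use g'i g'0 g in \<open>auto simp: L1_def\<close>)
 \<comment> \<open>\<open>H\<close> is the convolution of \<open>F\<close> with \<open>g'\<close>
   computed term by term. The functions \<open>P n\<close> majorise the terms and make the two agree
   almost everywhere, so \<open>H\<close> is in \<open>J\<close> by the ideal property.\<close>
 define H where "H t = (\<Sum>n. convolution F (G n) t)" for t
 define P where "P n t = (LI s. cmod (F s*G n (- s + t)))" for n t
 have Pi: "integrable haar (P n)" for n unfolding P_def[abs_def] by (rule convolution_cmod_le(2)[OF F G])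
 have Pint: "(LI t. P n t) = (LI t. cmod (F t))*(LI t. cmod (G n t))" for n
  unfolding P_def by (rule convolution_cmod_le(3)[OF F G])
 have P0: "0 <= P n t" for n t unfolding P_def by (rule integral_nonneg_AE) simp
 have Ps: "summable (%n. LI t. P n t)" unfolding Pint by (rule summable_mult[OF s])
 have Pae: "AE t in haar. summable (%n. P n t)"
  using AE_summable_norm[OF Pi] Ps P0 by simp
 have ci: "integrable haar (convolution F (G n))" for n by (rule Cc_integrable[OF convolution_Cc(1)[OF F G]])
 have cP: "cmod (convolution F (G n) t) <= P n t" for n t unfolding P_def by (rule convolution_cmod_le(1)[OF F G])
 have cae: "AE t in haar. summable (%n. norm (convolution F (G n) t))"
  using Pae by eventually_elim (rule summable_comparison_test'[where N=0], assumption, use cP in simp)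
 have cs: "summable (%n. LI t. norm (convolution F (G n) t))"
  by (rule summable_comparison_test'[OF Ps, where N=0])
   (use cP ci Pi in \<open>auto intro!: integral_mono simp: integral_nonneg_AE\<close>)
 have Hi: "integrable haar H" unfolding H_def[abs_def] by (rule integrable_suminf[OF ci cae cs])
 have "AE t in haar. H t = convolution F g' t"
  using Pae
 proof eventually_elim
  case (elim t)
  define f where "f n s = F s*G n (- s + t)" for n s
  have fi: "integrable haar (f n)" for n
   unfolding f_def[abs_def]
   by (intro Cc_integrable Cc_mult_right F cont_comp[OF Cc_continuous[OF G]] continuous_intros)
  have fs: "summable (%n. LI s. norm (f n s))" using elim by (simp add: P_def f_def)
  note fae = AE_summable_norm[OF fi fs]
  have "H t = (LI s. (\<Sum>n. f n s))"
   using integral_suminf[OF fi fae fs] by (simp add: H_def convolution_def f_def)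
  also have "\<dots> = (LI s. F s*g' (- s + t))"
  proof (rule integral_cong_AE)
   show "(%s. \<Sum>n. f n s) : borel_measurable haar" using borel_measurable_integrable[OF integrable_suminf[OF fi fae fs]] .
   have "(%s. - s + t) : borel_measurable borel" by (intro continuous_borel continuous_intros)
   from measurable_compose[OF this g'm]
   show "(%s. F s*g' (- s + t)) : borel_measurable haar"
    using Cc_measurable[OF F] by (simp add: measurable_haar_iff)
   show "AE s in haar. (\<Sum>n. f n s) = F s*g' (- s + t)"
    using fae
   proof eventually_elim
    case (elim s)
    show ?case
    proof (cases "F s = 0")
     case False
     have "summable (%n. cmod (G n (- s + t)))"
      using summable_mult[OF elim, of "1 / cmod (F s)"] False by (simp add: f_def norm_mult)
     then show ?thesis
      using suminf_mult[OF summable_norm_cancel, of "%n. G n (- s + t)" "F s"] by (simp add: f_def g'_def)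
    qed (simp add: f_def)
   qed
  qed
  finally show ?case by (simp add: convolution_def)
 qed
 then have HJ: "H : J"
  using J g'J Hi Cc_integrable[OF F] unfolding closed_left_ideal_def L1_def by blast
 have "(%n. LI t. convolution F (G n) t*h t) sums (LI t. (\<Sum>n. convolution F (G n) t*h t))"
 proof (rule sums_integral)
  show i: "integrable haar (%t. convolution F (G n) t*h t)" for n by (rule Linf_mult_L1(1)[OF ci h(1,2)])
  have le: "AE t in haar. cmod (convolution F (G n) t*h t) <= C*P n t" for n
   using loc_AE_support[OF h(2) ci[of n]]
  proof eventually_elim
   case (elim t)
   show ?case
   proof (cases "convolution F (G n) t = 0")
    case False
    then have "cmod (h t)*cmod (convolution F (G n) t) <= C*P n t"
     using elim cP h(3) by (intro mult_mono) auto
    then show ?thesis by (simp add: norm_mult mult.commute)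
   qed (use h(3) P0 in simp)
  qed
  have le': "(LI t. norm (convolution F (G n) t*h t)) <= (LI t. C*P n t)" for n
   by (intro integral_mono_AE integrable_norm i integrable_mult_right Pi le)
  have "summable (%n. LI t. C*P n t)" using summable_mult[OF Ps, of C] by simp
  then show s': "summable (%n. LI t. norm (convolution F (G n) t*h t))"
   by (rule summable_comparison_test'[where N=0]) (use le' in \<open>simp add: integral_nonneg_AE\<close>)
  show "AE t in haar. summable (%n. norm (convolution F (G n) t*h t))" by (rule AE_summable_norm[OF i s'])
 qed
 also have "(LI t. (\<Sum>n. convolution F (G n) t*h t)) = (LI t. H t*h t)"
 proof (rule integral_cong_AE)
  show "AE t in haar. (\<Sum>n. convolution F (G n) t*h t) = H t*h t"
   using cae by eventually_elim (simp add: H_def suminf_mult2[OF summable_norm_cancel])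
  have cm: "convolution F (G n) : borel_measurable borel" for n by (rule Cc_measurable[OF convolution_Cc(1)[OF F G]])
  show "(%t. \<Sum>n. convolution F (G n) t*h t) : borel_measurable haar"
   unfolding measurable_haar_iff using cm h(1) by measurable
  show "(%t. H t*h t) : borel_measurable haar"
   using borel_measurable_integrable[OF Hi] h(1) by (simp add: measurable_haar_iff)
 qed
 finally show ?thesis using HJ by blast
qed

subsection \<open>The inclusion of \<open>Bim\<close> in the annihilator of \<open>Ran\<close>\<close>

text \<open>With \<open>F\<close> the product of \<open>xi\<close> and the conjugate of
  \<open>eta\<close>, the coefficient \<open>q s\<close> integrates \<open>h\<close> against a
  normalised right translate of \<open>F\<close>. Integrating \<open>q\<close> against
  \<open>g\<close> therefore pairs \<open>h\<close> with the convolution of \<open>F\<close> and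
  \<open>g\<close>, an element of the left ideal.\<close>

lemma Theta_mult_op:
 fixes J :: "('g::locally_compact_group => complex) set"
 assumes J: "closed_left_ideal J" and g: "g : J" and h: "h : L1_annihilator J"
 shows "Theta g (mult_op h) = 0"
proof (rule op_eqI_dense[OF Cc_L2_dense])
 fix x y :: "'g L2" assume "x : Cc_L2" "y : Cc_L2"
 then obtain xi eta where xi: "xi : Cc" "x = abs_L2 xi" and eta: "eta : Cc" "y = abs_L2 eta" unfolding Cc_L2_def by blast
 have hL: "h : Linf" and hJ: "!!f. f : J ==> (LI t. f t*h t) = 0"
  using h by (auto simp: L1_annihilator_def)
 obtain C where hb: "h : borel_measurable borel" "loc_AE (%t. cmod (h t) <= C)" "0 <= C"
  using Linf_bound[OF hL] hL by (auto simp: Linf_def)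
 have gL: "g : L1" using J g by (auto simp: closed_left_ideal_def)
 then have gi: "integrable haar g" by (simp add: L1_def)
 define F where "F t = xi t*cnj (eta t)" for t
 have F: "F : Cc" unfolding F_def by (intro Cc_mult_right xi Cc_continuous Cc_cnj eta)
 define q where "q s = cinner (app (mult_op h) (app (right_reg (- s)) x)) (app (right_reg (- s)) y)" for s
 have q: "q s = (LI t. h t*(F (t + - s)*cor (modular (- s))))" for s
 proof -
  let ?c = "cor (sqrt (modular (- s)))"
  have cc: "?c*?c = cor (modular (- s))"
   by (simp only: of_real_mult[symmetric] real_sqrt_mult_self abs_of_nonneg[OF modular_nonneg])
  have sq: "square_integrable (%t. xi (t + - s)*?c)" "square_integrable (%t. eta (t + - s)*?c)"
   by (intro Cc_square_integrable Cc_right_translate_scaled xi eta)+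
  have "q s = cinner (abs_L2 (%t. h t*(xi (t + - s)*?c))) (abs_L2 (%t. eta (t + - s)*?c))"
   unfolding q_def xi(2) eta(2) right_reg_Cc[OF xi(1)] right_reg_Cc[OF eta(1)] mult_op_Linf(3)[OF hb sq(1)] ..
  also have "\<dots> = (LI t. h t*(xi (t + - s)*?c)*cnj (eta (t + - s)*?c))"
   by (rule cinner_abs_L2[OF mult_square_integrable(1)[OF sq(1) hb] sq(2)])
  also have "\<dots> = (LI t. h t*(F (t + - s)*cor (modular (- s))))"
   unfolding F_def cc[symmetric] by (simp add: mult_ac)
  finally show ?thesis .
 qed
 obtain G where "ALL n. G n : Cc" and G23: "summable (%n. LI t. cmod (G n t))"
  "(%N. LI t. cmod (g t - (\<Sum>n<N. G n t))) \<longlonglongrightarrow> 0"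
  using Cc_L1_series[OF gi] by (elim exE conjE)
 then have "G n : Cc" for n by simp
 note G = this G23
 obtain H where H: "H : J" "(%n. LI t. convolution F (G n) t*h t) sums (LI t. H t*h t)"
  using left_ideal_convolution[OF J g F G hb] by blast
 \<comment> \<open>The exchange needs an integrable factor, so \<open>h\<close> is cut off to the
   compact set \<open>B\<close>, outside of which the integrand vanishes for every
   \<open>s\<close>.\<close>
 have swap: "(LI s. G n s*q s) = (LI t. convolution F (G n) t*h t)" for n
 proof -
  obtain K where K: "cont F" "compact K" "!!x. x ~: K ==> F x = 0" using F by (rule CcE) blast
  obtain L where L: "cont (G n)" "compact L" "!!x. x ~: L ==> G n x = 0" using G(1)[of n] by (rule CcE) blast
  define B where "B = (%(x, y). x + y) ` (K \<times> L)"
  have B: "compact B" unfolding B_def by (rule compact_plus[OF K(2) L(2)])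
  define k where "k s t = F (t + - s)*cor (modular (- s))" for s t
  define hB where "hB t = indicator B t*h t" for t
  have hBi: "integrable haar hB" unfolding hB_def[abs_def]
   by (rule Linf_mult_L1(1)[OF integrable_indicator_compact[OF B] hb(1,2)])
  have hB0: "hB t = 0" if "t ~: B" for t using that by (simp add: hB_def)
  have tB: "t : B" if "k s t ~= 0" "s : L" for s t
  proof -
   have "t + - s : K" using that(1) K(3) by (auto simp: k_def)
   then have "(t + - s) + s : B" unfolding B_def using that(2) by (rule plus_image_mem)
   then show ?thesis by (simp add: add.assoc del: add_uminus_conv_diff)
  qed
  have kc: "cont (%(s, t). k s t)" unfolding k_def case_prod_unfold
   by (intro continuous_intros cont_comp[OF K(1)] cont_comp[OF modular_continuous])
  have eq: "G n s*(hB t*k s t) = G n s*(h t*k s t)" for s t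
   using tB[of s t] L(3)[of s] by (cases "s : L"; cases "k s t = 0") (auto simp: hB_def)
  have "(LI s. G n s*q s) = (LI s. G n s*(LI t. hB t*k s t))"
  proof (rule Bi_cong[OF refl])
   fix s
   have "G n s*q s = (LI t. G n s*(h t*k s t))" by (simp add: q k_def)
   then show "G n s*q s = G n s*(LI t. hB t*k s t)" unfolding eq[symmetric] by simp
  qed
  also have "\<dots> = (LI t. hB t*(LI s. G n s*k s t))"
   by (rule fubini_kernel[OF kc Cc_integrable[OF G(1)] L(2,3) hBi B hB0])
  also have "\<dots> = (LI t. convolution F (G n) t*h t)"
  proof (rule Bi_cong[OF refl])
   fix t
   have c: "(LI s. G n s*k s t) = convolution F (G n) t"
    unfolding convolution_Cc(3)[OF F G(1)] k_def ..
   have "convolution F (G n) t = 0" if "t ~: B"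
   proof -
    have z: "G n s*k s t = 0" for s using tB[of s t] L(3)[of s] that by (cases "s : L") auto
    show ?thesis unfolding c[symmetric] z by simp
   qed
   then show "hB t*(LI s. G n s*k s t) = convolution F (G n) t*h t"
    unfolding c by (cases "t : B") (simp_all add: hB_def mult.commute)
  qed
  finally show ?thesis .
 qed
 have qc: "cont q" unfolding q_def by (rule right_coeff_continuous)
 have qb: "cmod (q s) <= norm (mult_op h)*norm x*norm y" for s unfolding q_def by (rule right_coeff_bound)
 have "(%n. LI s. G n s*q s) sums (LI s. g s*q s)"
  by (rule integral_L1_limit[OF gi G(1,3) continuous_borel[OF qc] loc_AE_UNIV[OF qb]])
 then have "(LI s. g s*q s) = (LI t. H t*h t)"
  unfolding swap using H(2) by (rule sums_unique2)
 then show "cinner (app (Theta g (mult_op h)) x) y = cinner (app 0 x) y"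
  unfolding Theta(2)[OF gL mult_op_bounded_ops[OF hL]] q_def[symmetric] using hJ[OF H(1)] by simp
qed

lemma VN_bounded: "x : VN ==> x : bounded_ops"
 by (simp add: VN_def commutant_def)

lemma right_reg_commutant: "right_reg s : commutant (range left_reg)"
 unfolding commutant_def by (auto intro!: blinfun_eqI simp: left_right_reg_commute)

lemma VN_right_reg:
 assumes "x : VN"
 shows "app x (app (right_reg s) xi) = app (right_reg s) (app x xi)"
proof -
 have "x o\<^sub>L right_reg s = right_reg s o\<^sub>L x"
 proof -
  have "ALL A:commutant (range left_reg). x o\<^sub>L A = A o\<^sub>L x"
   using assms by (simp add: VN_def commutant_def[of "commutant _"])
  then show ?thesis using right_reg_commutant by (rule bspec)
 qed
 then show ?thesis by (metis blinfun_apply_blinfun_compose)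
qed

text \<open>Elements of VN(G) commute with right translations, so they pass through the conjugation
  by \<open>right_reg s\<close> under the integral.\<close>

lemma Theta_bimodule:
 assumes f: "f : L1" and x: "x : VN" and y: "y : VN" and T: "T : bounded_ops"
 shows "Theta f (x o\<^sub>L T o\<^sub>L y) = x o\<^sub>L Theta f T o\<^sub>L y"
proof (rule op_eqI)
 fix xi eta
 have b: "x o\<^sub>L T o\<^sub>L y : bounded_ops" by (intro bounded_ops_compose T VN_bounded x y)
 have eq: "cinner (app (x o\<^sub>L T o\<^sub>L y) (app (right_reg (- s)) xi)) (app (right_reg (- s)) eta)
  = cinner (app T (app (right_reg (- s)) (app y xi)))
    (app (right_reg (- s)) (app (adj_op x) eta))" for s
 proof -
  have "cinner (app x z) (app (right_reg (- s)) eta) = cinner z (app (right_reg (- s)) (app (adj_op x) eta))" for z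
   using right_reg_cinner[of s "app x z" eta] right_reg_cinner[of s z "app (adj_op x) eta"]
   by (simp add: VN_right_reg[OF x, symmetric] cinner_adj_right[OF VN_bounded[OF x]])
  then show ?thesis by (simp add: VN_right_reg[OF y])
 qed
 show "cinner (app (Theta f (x o\<^sub>L T o\<^sub>L y)) xi) eta = cinner (app (x o\<^sub>L Theta f T o\<^sub>L y) xi) eta"
  unfolding Theta(2)[OF f b] eq
  by (simp add: Theta(2)[OF f T, symmetric] cinner_adj_right[OF VN_bounded[OF x]])
qed

lemma trace_pairing_zero_left: "om : trace_class ==> trace_pairing 0 om = 0"
 using trace_pairing_scale_left[of om id_blinfun 0] by simp

lemma op_annihilator_subspace:
 assumes "S \<subseteq> trace_class" shows "cop.subspace (op_annihilator S)"
 using assms by (intro cop.subspaceI)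
  (auto simp: op_annihilator_def bounded_ops_add bounded_ops_scale trace_pairing_add_left trace_pairing_scale_left
   subset_iff trace_pairing_zero_left)

lemma cvec_span_generators:
 assumes "!!x. x : X ==> f x : S" "cvec.subspace S" "!!x y. f (x + y) = f x + f y" "!!c x. f (c *\<^sub>C x) = c *\<^sub>C f x"
  and "z : cvec.span X"
 shows "f z : S"
 using assms(5)
proof (induction rule: cvec.span_induct_alt)
 case base
 show ?case using assms(4)[of 0 0] cvec.subspace_0[OF assms(2)] by simp
qed (simp add: assms cvec.subspace_add cvec.subspace_scale)

subsection \<open>The duality between \<open>A(G)\<close> and \<open>VN(G)\<close>\<close>

instantiation prod :: (complex_inner, complex_inner) complex_inner
begin

definition scaleC_prod :: "complex => 'a \<times> 'b => 'a \<times> 'b"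
 where "c *\<^sub>C x = (c *\<^sub>C fst x, c *\<^sub>C snd x)"

definition cinner_prod :: "'a \<times> 'b => 'a \<times> 'b => complex"
 where "cinner x y = cinner (fst x) (fst y) + cinner (snd x) (snd y)"

instance
proof
 show "cinner x y = cnj (cinner y x)" for x y :: "'a \<times> 'b"
  using cinner_commute[of "fst x" "fst y"] cinner_commute[of "snd x" "snd y"] by (simp add: cinner_prod_def)
qed (simp_all add: scaleC_prod_def cinner_prod_def prod_eq_iff scaleC_add_right scaleC_add_left scaleC_scaleC
  scaleR_scaleC cinner_add_left cinner_scaleC_left inner_prod_def inner_cinner distrib_left)

end

instance prod :: (chilbert_space, chilbert_space) chilbert_space ..

lemma VN_commutes:
 fixes x :: "'g::locally_compact_group L2 \<Rightarrow>\<^sub>L 'g L2"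
 assumes x: "x : VN" and f: "!!u v. f (u + v) = f u + f v" "!!c u. f (c *\<^sub>C u) = c *\<^sub>C f u"
  and b: "!!u. norm (f u) <= C*norm u" and comm: "!!s u. f (left_reg s u) = left_reg s (f u)"
 shows "f (x u) = x (f u)"
proof -
 note F = op_of_linear[OF f b]
 have "Blinfun f : commutant (range left_reg)"
  unfolding commutant_def using F(2) by (auto intro!: blinfun_eqI simp: F(1) comm)
 moreover have "ALL A:commutant (range left_reg). x o\<^sub>L A = A o\<^sub>L x"
  using x by (simp add: VN_def commutant_def[of "commutant _"])
 ultimately have "x o\<^sub>L Blinfun f = Blinfun f o\<^sub>L x" by blast
 then have "app (x o\<^sub>L Blinfun f) u = app (Blinfun f o\<^sub>L x) u" by simp
 then show ?thesis by (simp add: F(1))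
qed

text \<open>The double commutant argument for the diagonal action of \<open>G\<close> on two copies of \<open>L\<^sup>2(G)\<close>: the
  projection onto the closed span of the orbit of \<open>(xi, xi')\<close> has entries commuting with \<open>\<lambda>(G)\<close>.\<close>

lemma VN_coeff_eq:
 fixes x :: "'g::locally_compact_group L2 \<Rightarrow>\<^sub>L 'g L2"
 assumes x: "x : VN" and eq: "fourier_coeff xi eta = fourier_coeff xi' eta'"
 shows "cinner (x xi) eta = cinner (x xi') eta'"
proof -
 define L where "L s z = (left_reg s (fst z), left_reg s (snd z))" for s :: 'g and z :: "'g L2 \<times> 'g L2"
 define D where "D = cvec.span (range (%s. L s (xi, xi')))"
 have D: "cvec.subspace D" unfolding D_def by (rule cvec.subspace_span)
 note lin = bounded_ops_scaleC[OF left_reg_bounded]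
 have Ladd: "L s (y + z) = L s y + L s z" and Lscale: "L s (c *\<^sub>C z) = c *\<^sub>C L s z" for s c y z
  by (simp_all add: L_def blinfun.add_right lin scaleC_prod_def)
 have Ladj: "cinner (L s y) z = cinner y (L (- s) z)" for s y z
  by (simp add: L_def cinner_prod_def left_reg_cinner)
 have LL: "L s (L r z) = L (s + r) z" for s r z by (simp add: L_def left_reg_add)
 have LD: "L s z : D" if "z : D" for s z
  by (rule cvec_span_generators[OF _ D Ladd Lscale that[unfolded D_def]])
   (auto simp: D_def LL intro!: cvec.span_base)
 have Lc: "cont (L s)" for s unfolding L_def by (intro continuous_intros)
 have LDc: "L s z : closure D" if "z : closure D" for s z
 proof -
  have "L s ` closure D \<subseteq> closure (L s ` D)" by (rule continuous_image_closure_subset[OF Lc]) simp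
  also have "\<dots> \<subseteq> closure D" by (rule closure_mono) (use LD in auto)
  finally show ?thesis using that by auto
 qed
 have "EX p:closure D. (ALL d:D. cinner d z = cinner d p) & norm p <= norm z" for z
 proof (rule riesz_subspace[OF D])
  show "cmod (cinner d z) <= norm z*norm d" for d using cinner_norm_le[of d z] by (simp add: mult.commute)
 qed (simp_all add: cinner_add_left cinner_scaleC_left)
 then obtain P where P: "!!z. P z : closure D" "!!z d. d : D ==> cinner d z = cinner d (P z)"
  "!!z. norm (P z) <= norm z" by metis
 have Dc: "cvec.subspace (closure D)" by (rule csubspace_closure[OF D])
 have Pu: "P z = w" if "w : closure D" "!!d. d : D ==> cinner d z = cinner d w" for z w
  by (rule riesz_closure_unique[OF D P(1) that(1)]) (simp add: that(2) P(2)[symmetric])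
 have Padd: "P (y + z) = P y + P z" for y z
  by (rule Pu) (auto simp: cinner_add_right P(2)[symmetric] intro: cvec.subspace_add[OF Dc] P(1))
 have Pscale: "P (c *\<^sub>C z) = c *\<^sub>C P z" for c z
  by (rule Pu) (auto simp: cinner_scaleC_right P(2)[symmetric] intro: cvec.subspace_scale[OF Dc] P(1))
 have PL: "P (L s z) = L s (P z)" for s z
 proof (rule Pu[OF LDc[OF P(1)]])
  show "cinner d (L s z) = cinner d (L s (P z))" if "d : D" for d
   using P(2)[OF LD[OF that, of "- s"], of z] by (simp add: Ladj)
 qed
 have x0: "(u, v) = (u, 0) + (0, v)" for u v :: "'g L2" by simp
 have nf: "norm (fst (P z)) <= norm z" and ns: "norm (snd (P z)) <= norm z" for z
  using order_trans[OF norm_fst_le[of "fst (P z)" "snd (P z)"]] order_trans[OF norm_snd_le[of "snd (P z)" "fst (P z)"]] P(3)[of z]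
  by simp_all
 have sp: "P (c *\<^sub>C u, 0) = c *\<^sub>C P (u, 0)" "P (0, c *\<^sub>C u) = c *\<^sub>C P (0, u)"
  "P (u + v, 0) = P (u, 0) + P (v, 0)" "P (0, u + v) = P (0, u) + P (0, v)" for c u v
  using Pscale[of c "(u, 0)"] Pscale[of c "(0, u)"] Padd[of "(u, 0)" "(v, 0)"] Padd[of "(0, u)" "(0, v)"]
  by (simp_all add: scaleC_prod_def)
 have sL: "P (left_reg s u, 0) = L s (P (u, 0))" "P (0, left_reg s u) = L s (P (0, u))" for s u
  using PL[of s "(u, 0)"] PL[of s "(0, u)"] by (simp_all add: L_def)
 have nz: "norm (fst (P (u, 0))) <= norm u" "norm (snd (P (u, 0))) <= norm u"
  "norm (fst (P (0, u))) <= norm u" "norm (snd (P (0, u))) <= norm u" for u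
  using nf[of "(u, 0)"] ns[of "(u, 0)"] nf[of "(0, u)"] ns[of "(0, u)"] by (simp_all add: norm_Pair)
 \<comment> \<open>\<open>P\<close> commutes with the diagonal action, so each of its four entries
   commutes with the left translations and hence with \<open>x\<close>.\<close>
 have c: "fst (P (x u, 0)) = x (fst (P (u, 0)))" "snd (P (x u, 0)) = x (snd (P (u, 0)))"
  "fst (P (0, x u)) = x (fst (P (0, u)))" "snd (P (0, x u)) = x (snd (P (0, u)))" for u
  by (rule VN_commutes[OF x, where C=1]; simp add: sp sL L_def scaleC_prod_def nz)+
 have Px: "P (x u, x v) = (x (fst (P (u, v))), x (snd (P (u, v))))" for u v
 proof -
  have "P (x u, x v) = P (x u, 0) + P (0, x v)" "P (u, v) = P (u, 0) + P (0, v)"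
   unfolding Padd[symmetric] by simp_all
  then show ?thesis using c by (simp add: prod_eq_iff blinfun.add_right)
 qed
 have "(xi, xi') : D" unfolding D_def by (rule cvec.span_base) (auto simp: L_def intro: range_eqI[of _ _ 0])
 then have "P (xi, xi') = (xi, xi')" by (intro Pu) (use closure_subset in auto)
 then have "(x xi, x xi') : closure D" using Px[of xi xi'] P(1)[of "(x xi, x xi')"] by simp
 \<comment> \<open>Equality of the two coefficient functions says exactly that
   \<open>(eta, - eta')\<close> is orthogonal to the orbit, hence to its closed span, which contains
   \<open>(x xi, x xi')\<close>.\<close>
 moreover have "cinner d (eta, - eta') = cinner d 0" if "d : D" for d
  using that unfolding D_def
 proof (induction rule: cvec.span_induct_alt)
  case (step c z y)
  then obtain s where "z = L s (xi, xi')" by auto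
  then have "cinner z (eta, - eta') = 0"
   using fun_cong[OF eq, of s] by (simp add: L_def cinner_prod_def fourier_coeff_def)
  then show ?case using step by (simp add: cinner_add_left cinner_scaleC_left)
 qed simp
 ultimately have "cinner (x xi, x xi') (eta, - eta') = cinner (x xi, x xi') 0" using cinner_closure_eq by blast
 then show ?thesis by (simp add: cinner_prod_def)
qed

text \<open>The definite description in the pairing is legitimate because an element of VN(G) takes
  the same value on all representations of a coefficient function.\<close>

lemma fourier_pairing_coeff:
 assumes "x : VN" shows "fourier_pairing x (fourier_coeff xi eta) = cinner (x xi) eta"
 unfolding fourier_pairing_def
proof (rule the_equality)
 fix c assume "EX xi' eta'. fourier_coeff xi eta = fourier_coeff xi' eta' & c = cinner (x xi') eta'"
 then obtain xi' eta' where h: "fourier_coeff xi eta = fourier_coeff xi' eta'" "c = cinner (x xi') eta'" by (elim exE conjE)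
 show "c = cinner (x xi) eta" unfolding h(2) by (rule VN_coeff_eq[OF assms h(1), symmetric])
qed (rule exI[of _ xi], rule exI[of _ eta], rule conjI[OF refl refl])

lemma left_reg_VN: "left_reg s : VN"
 unfolding VN_def commutant_def[of "commutant _"] by (auto simp: commutant_def)

lemma VN_id: "id_blinfun : VN"
 using left_reg_VN[of 0] by (metis blinfun_eqI id_blinfun.rep_eq id_apply left_reg_zero)

lemma fourier_coeff_continuous: "cont (fourier_coeff xi eta)"
 unfolding fourier_coeff_def by (intro continuous_on_cinner left_reg_continuous continuous_on_const)

lemma fourier_coeff_bound: "cmod (fourier_coeff xi eta s) <= norm xi*norm eta"
 unfolding fourier_coeff_def using cinner_norm_le[of "left_reg s xi" eta] by simp

text \<open>The operator $\lambda(w) = \int w(r)\lambda(r)\,dr$.\<close>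

definition lam :: "('g::locally_compact_group => complex) => 'g L2 \<Rightarrow>\<^sub>L 'g L2"
 where "lam w = (SOME S. S : bounded_ops & norm S <= (LI r. cmod (w r)) &
  (ALL xi eta. cinner (app S xi) eta = (LI r. w r*fourier_coeff xi eta r)))"

lemma lam:
 fixes w :: "'g::locally_compact_group => complex"
 assumes w: "integrable haar w"
 shows "lam w : bounded_ops" "norm (lam w) <= (LI r. cmod (w r))"
  "cinner (lam w xi) eta = (LI r. w r*fourier_coeff xi eta r)"
proof -
 note i = integrable_mult_bounded[OF w fourier_coeff_continuous fourier_coeff_bound]
 have "EX S:bounded_ops. norm S <= (LI r. cmod (w r)) &
  (ALL xi:UNIV. ALL eta:UNIV. cinner (app S xi) eta = (LI r. w r*fourier_coeff xi eta r))"
 proof (rule form_operator)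
  fix xi eta zt :: "'g L2" and c :: complex
  have "fourier_coeff (xi + eta) zt r = fourier_coeff xi zt r + fourier_coeff eta zt r"
   "fourier_coeff xi (eta + zt) r = fourier_coeff xi eta r + fourier_coeff xi zt r"
   "fourier_coeff (c *\<^sub>C xi) eta r = c*fourier_coeff xi eta r"
   "fourier_coeff xi (c *\<^sub>C eta) r = cnj c*fourier_coeff xi eta r" for r
   by (simp_all add: fourier_coeff_def blinfun.add_right cinner_add_left cinner_add_right
     bounded_ops_scaleC cinner_scaleC_left cinner_scaleC_right)
  then show "(LI r. w r*fourier_coeff (xi + eta) zt r) = (LI r. w r*fourier_coeff xi zt r) + (LI r. w r*fourier_coeff eta zt r)"
   "(LI r. w r*fourier_coeff xi (eta + zt) r) = (LI r. w r*fourier_coeff xi eta r) + (LI r. w r*fourier_coeff xi zt r)"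
   "(LI r. w r*fourier_coeff (c *\<^sub>C xi) eta r) = c*(LI r. w r*fourier_coeff xi eta r)"
   "(LI r. w r*fourier_coeff xi (c *\<^sub>C eta) r) = cnj c*(LI r. w r*fourier_coeff xi eta r)"
   using i(1) by (simp_all add: distrib_left mult.left_commute)
  show "cmod (LI r. w r*fourier_coeff xi eta r) <= (LI r. cmod (w r))*norm xi*norm eta"
   using i(2)[of xi eta] by (simp add: mult_ac)
 qed (auto simp: integral_nonneg_AE cvec.subspace_UNIV)
 then have "EX S. S : bounded_ops & norm S <= (LI r. cmod (w r)) &
  (ALL xi eta. cinner (app S xi) eta = (LI r. w r*fourier_coeff xi eta r))" by blast
 then have "lam w : bounded_ops & norm (lam w) <= (LI r. cmod (w r)) &
  (ALL xi eta. cinner (app (lam w) xi) eta = (LI r. w r*fourier_coeff xi eta r))"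
  unfolding lam_def by (rule someI_ex)
 then show "lam w : bounded_ops" "norm (lam w) <= (LI r. cmod (w r))"
  "cinner (lam w xi) eta = (LI r. w r*fourier_coeff xi eta r)" by simp_all
qed

lemma lam_VN:
 fixes w :: "'g::locally_compact_group => complex"
 assumes w: "integrable haar w"
 shows "lam w : VN"
proof -
 have "lam w o\<^sub>L A = A o\<^sub>L lam w" if A: "A : commutant (range left_reg)" for A
 proof (rule op_eqI)
  fix xi eta
  have Ab: "A : bounded_ops" using A by (simp add: commutant_def)
  have "left_reg s (A xi) = A (left_reg s xi)" for s
  proof -
   have "A o\<^sub>L left_reg s = left_reg s o\<^sub>L A" using A by (auto simp: commutant_def)
   then show ?thesis by (metis blinfun_apply_blinfun_compose)
  qed
  then have "fourier_coeff (A xi) eta = fourier_coeff xi (adj_op A eta)"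
   by (simp add: fourier_coeff_def fun_eq_iff cinner_adj_right[OF Ab])
  then show "cinner (app (lam w o\<^sub>L A) xi) eta = cinner (app (A o\<^sub>L lam w) xi) eta"
   by (simp add: lam(3)[OF w] cinner_adj_right[OF Ab, symmetric])
 qed
 then show ?thesis using lam(1)[OF w] by (simp add: VN_def commutant_def[of "commutant _"])
qed

lemma fourier_pairing_lam:
 assumes w: "integrable haar w" and u: "u : fourier_algebra"
 shows "fourier_pairing (lam w) u = (LI r. w r*u r)"
 using u fourier_pairing_coeff[OF lam_VN[OF w]] lam(3)[OF w] by (auto simp: fourier_algebra_def)

lemma loc_AE_continuous_eq:
 fixes f g :: "'g::locally_compact_group => complex"
 assumes f: "cont f" and g: "cont g" and ae: "loc_AE (%t. f t = g t)"
 shows "f = g"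
proof
 fix x :: 'g
 obtain U K where UK: "open U" "compact K" "x : U" "U \<subseteq> K" using locally_compact[of x] by blast
 obtain h :: "'g => real" where h: "cont h" "ALL y:{x}. h y = 1" "ALL y. y ~: U --> h y = 0"
  using bump_function[of "{x}" U] UK by auto
 have "AE t in haar. t : K --> f t = g t" using ae UK(2) by (simp add: loc_AE_def)
 then have ae: "AE t in haar. cor (h t)*(f t - g t) = 0"
  by eventually_elim (use h(3) UK(4) in auto)
 have "cor (h x)*(f x - g x) = 0"
  by (rule continuous_AE_eq_0[OF _ ae]) (intro continuous_intros f g h)
 then show "f x = g x" using h(2) by simp
qed

lemma fourier_mult:
 assumes ph: "ph : McbA" and v: "v : fourier_algebra"
 shows "fourier_mult ph v : fourier_algebra" "loc_AE (%t. fourier_mult ph v t = ph t * v t)"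
proof -
 obtain w where w: "w : fourier_algebra" "loc_AE (%t. w t = ph t * v t)"
  using ph v by (auto simp: McbA_def)
 have "w' = w" if "w' : fourier_algebra" "loc_AE (%t. w' t = ph t * v t)" for w'
 proof (rule loc_AE_continuous_eq)
  show "cont w'" "cont w"
   using that(1) w(1) fourier_coeff_continuous by (auto simp: fourier_algebra_def)
  show "loc_AE (%t. w' t = w t)"
   unfolding loc_AE_def
  proof (intro allI impI)
   fix K :: "'a set" assume "compact K"
   then have "AE t in haar. t : K --> w t = ph t * v t" "AE t in haar. t : K --> w' t = ph t * v t"
    using w(2) that(2) by (simp_all add: loc_AE_def)
   then show "AE t in haar. t : K --> w' t = w t" by eventually_elim simp
  qed
 qed
 note u = this
 have "fourier_mult ph v = w" unfolding fourier_mult_def 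
  by (rule the_equality, rule conjI[OF w]) (elim conjE, rule u)
 then show "fourier_mult ph v : fourier_algebra" "loc_AE (%t. fourier_mult ph v t = ph t * v t)"
  using w by simp_all
qed

subsection \<open>Matrix norms\<close>

lemma matrix_norm_leI:
 assumes "0 <= C" "!!xi. (\<Sum>j\<in>I. (norm (xi j))\<^sup>2) <= 1 ==> (\<Sum>i\<in>I. (norm (\<Sum>j\<in>I. a i j (xi j)))\<^sup>2) <= C\<^sup>2"
 shows "matrix_norm I a <= C"
 unfolding matrix_norm_def
proof (rule cSup_least)
 show "{sqrt (\<Sum>i\<in>I. (norm (\<Sum>j\<in>I. a i j (xi j)))\<^sup>2) |xi. (\<Sum>j\<in>I. (norm (xi j))\<^sup>2) <= 1} ~= {}"
  by (auto intro!: exI[of _ "%_. 0"])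
qed (auto intro!: real_le_lsqrt assms sum_nonneg)

text \<open>A real supremum is an upper bound only for a bounded set; here boundedness comes from
  the operator norms of the entries. Homogeneity then removes the normalisation of the
  vector.\<close>

lemma matrix_normD:
 fixes a :: "'i => 'i => 'h::real_normed_vector => 'h"
 assumes I: "finite I" and a: "!!i j. i : I ==> j : I ==> bounded_linear (a i j)"
  and C: "matrix_norm I a <= C"
 shows "(\<Sum>i\<in>I. (norm (\<Sum>j\<in>I. a i j (xi j)))\<^sup>2) <= C\<^sup>2*(\<Sum>j\<in>I. (norm (xi j))\<^sup>2)"
proof -
 let ?S = "{sqrt (\<Sum>i\<in>I. (norm (\<Sum>j\<in>I. a i j (xi j)))\<^sup>2) |xi. (\<Sum>j\<in>I. (norm (xi j))\<^sup>2) <= 1}"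
 have bdd: "bdd_above ?S"
 proof (rule bdd_aboveI)
  fix y assume "y : ?S"
  then obtain xi where xi: "y = sqrt (\<Sum>i\<in>I. (norm (\<Sum>j\<in>I. a i j (xi j)))\<^sup>2)" "(\<Sum>j\<in>I. (norm (xi j))\<^sup>2) <= 1" by blast
  have 1: "norm (xi j) <= 1" if "j : I" for j
  proof -
   have "(norm (xi j))\<^sup>2 <= (\<Sum>j\<in>I. (norm (xi j))\<^sup>2)" using I that by (intro member_le_sum) auto
   from order_trans[OF this xi(2)] have "(norm (xi j))\<^sup>2 <= 1\<^sup>2" unfolding one_power2 .
   then show ?thesis by (rule power2_le_imp_le) simp
  qed
  have "norm (\<Sum>j\<in>I. a i j (xi j)) <= (\<Sum>j\<in>I. onorm (a i j))" if "i : I" for i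
  proof (rule sum_norm_le)
   fix j assume j: "j : I"
   have "norm (a i j (xi j)) <= onorm (a i j)*norm (xi j)" by (rule onorm[OF a[OF that j]])
   also have "\<dots> <= onorm (a i j)" using mult_left_mono[OF 1[OF j] onorm_pos_le[OF a[OF that j]]] by simp
   finally show "norm (a i j (xi j)) <= onorm (a i j)" .
  qed
  then show "y <= sqrt (\<Sum>i\<in>I. (\<Sum>j\<in>I. onorm (a i j))\<^sup>2)"
   unfolding xi(1) by (intro real_sqrt_le_mono sum_mono power_mono) auto
 qed
 define r where "r = sqrt (\<Sum>j\<in>I. (norm (xi j))\<^sup>2)"
 have r2: "r\<^sup>2 = (\<Sum>j\<in>I. (norm (xi j))\<^sup>2)" and r0: "0 <= r" by (simp_all add: r_def sum_nonneg)
 show ?thesis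
 proof (cases "r = 0")
  case True
  then have "xi j = 0" if "j : I" for j using that r2 I by (simp add: sum_nonneg_eq_0_iff)
  then have "a i j (xi j) = 0" if "i : I" "j : I" for i j
   using that linear_simps(3)[OF a] by simp
  then show ?thesis by (simp add: r2[symmetric])
 next
  case False
  then have r: "0 < r" using r0 by simp
  define xi' where "xi' j = inverse r *\<^sub>R xi j" for j
  have "(\<Sum>j\<in>I. (norm (xi' j))\<^sup>2) = inverse r ^ 2*r\<^sup>2" unfolding r2 xi'_def
   using r by (simp add: power_mult_distrib sum_distrib_left)
  also have "\<dots> = 1" using r by (simp add: power_mult_distrib[symmetric])
  finally have "sqrt (\<Sum>i\<in>I. (norm (\<Sum>j\<in>I. a i j (xi' j)))\<^sup>2) : ?S" by (intro CollectI exI[of _ xi']) simp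
  from cSup_upper[OF this bdd] C have le: "sqrt (\<Sum>i\<in>I. (norm (\<Sum>j\<in>I. a i j (xi' j)))\<^sup>2) <= C"
   unfolding matrix_norm_def by simp
  have "(\<Sum>j\<in>I. a i j (xi j)) = r *\<^sub>R (\<Sum>j\<in>I. a i j (xi' j))" if "i : I" for i
   unfolding scaleR_sum_right
  proof (rule sum.cong[OF refl])
   fix j assume "j : I"
   from linear_simps(5)[OF a[OF that this], of r "xi' j"]
   show "a i j (xi j) = r *\<^sub>R a i j (xi' j)" using r r0 by (simp add: xi'_def)
  qed
  then have "(\<Sum>i\<in>I. (norm (\<Sum>j\<in>I. a i j (xi j)))\<^sup>2) = r\<^sup>2*(\<Sum>i\<in>I. (norm (\<Sum>j\<in>I. a i j (xi' j)))\<^sup>2)"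
   using r0 by (simp add: power_mult_distrib sum_distrib_left)
  also have "\<dots> <= r\<^sup>2*C\<^sup>2" by (rule mult_left_mono[OF sqrt_le_D[OF le]]) simp
  finally show ?thesis by (simp add: r2 mult.commute)
 qed
qed

lemma VN_matrix_bound:
 fixes x :: "nat => nat => 'h::chilbert_space \<Rightarrow>\<^sub>L 'h"
 assumes "matrix_norm {..<m} (%k l. app (x k l)) <= 1"
 shows "(\<Sum>k<m. (norm (\<Sum>l<m. x k l (xi l)))\<^sup>2) <= (\<Sum>l<m. (norm (xi l))\<^sup>2)"
 using matrix_normD[OF finite_lessThan _ assms, of xi] blinfun.bounded_linear_right by auto

lemma norm_sum_sq_le:
 fixes f :: "nat => 'a::real_normed_vector"
 shows "(norm (\<Sum>j<n. f j))\<^sup>2 <= real n*(\<Sum>j<n. (norm (f j))\<^sup>2)"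
proof -
 have "(norm (\<Sum>j<n. f j))\<^sup>2 <= (\<Sum>j<n. 1*norm (f j))\<^sup>2" by (intro power_mono) (auto intro: norm_sum)
 also have "\<dots> <= (\<Sum>j<n. 1\<^sup>2)*(\<Sum>j<n. (norm (f j))\<^sup>2)" by (rule Cauchy_Schwarz_ineq_sum)
 finally show ?thesis by simp
qed

abbreviation fourier_matrix_set where
 "fourier_matrix_set n u \<equiv> {matrix_norm ({..<n} \<times> {..<m})
     (%(i, k) (j, l) z. fourier_pairing (x k l) (u i j)*z) | (m::nat) x.
    (ALL k<m. ALL l<m. x k l : VN) &
    matrix_norm {..<m} (%k l. app (x k l)) <= 1}"

text \<open>\<open>fourier_matrix_norm\<close> is a real supremum, and using it as an upper bound
  requires this finiteness. The estimate is crude: it only has to be independent of \<open>m\<close>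
  and \<open>x\<close>.\<close>

lemma fourier_matrix_bdd:
 fixes u :: "nat => nat => 'g::locally_compact_group => complex"
 assumes u: "ALL i<n. ALL j<n. u i j : fourier_algebra"
 shows "bdd_above (fourier_matrix_set n u)"
proof -
 have "ALL i j. EX xi eta. i < n --> j < n --> u i j = fourier_coeff xi eta" using u by (auto simp: fourier_algebra_def)
 then obtain xi eta where uc: "!!i j. i < n ==> j < n ==> u i j = fourier_coeff (xi i j) (eta i j)" by metis
 define B where "B = (\<Sum>i<n. \<Sum>j<n. (norm (xi i j))\<^sup>2*(norm (eta i j))\<^sup>2)"
 have B: "0 <= B" by (simp add: B_def sum_nonneg)
 show ?thesis
 proof (rule bdd_aboveI)
  fix y assume "y : fourier_matrix_set n u"
  then obtain m and x :: "nat => nat => 'g L2 \<Rightarrow>\<^sub>L 'g L2" where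
   y: "y = matrix_norm ({..<n} \<times> {..<m}) (%(i, k) (j, l) z. fourier_pairing (x k l) (u i j)*z)"
   and VN: "!!k l. k < m ==> l < m ==> x k l : VN"
   and x1: "matrix_norm {..<m} (%k l. app (x k l)) <= 1" by blast
  note xb = VN_matrix_bound[OF x1]
  show "y <= sqrt (real n*B)"
   unfolding y
  proof (rule matrix_norm_leI)
   fix Z :: "nat \<times> nat => complex"
   assume "(\<Sum>j\<in>{..<n} \<times> {..<m}. (norm (Z j))\<^sup>2) <= 1"
   then have Z: "(\<Sum>j<n. \<Sum>l<m. (cmod (Z (j, l)))\<^sup>2) <= 1" by (simp add: sum.cartesian_product)
   have Zj: "(\<Sum>l<m. (cmod (Z (j, l)))\<^sup>2) <= 1" if "j < n" for j
    using member_le_sum[of j "{..<n}" "%j. \<Sum>l<m. (cmod (Z (j, l)))\<^sup>2"] that Z by (auto simp: sum_nonneg)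
   have ij: "(\<Sum>k<m. (cmod (\<Sum>l<m. fourier_pairing (x k l) (u i j)*Z (j, l)))\<^sup>2) <= (norm (xi i j))\<^sup>2*(norm (eta i j))\<^sup>2"
    if ij: "i < n" "j < n" for i j
   proof -
    have "(cmod (\<Sum>l<m. fourier_pairing (x k l) (u i j)*Z (j, l)))\<^sup>2
      <= (norm (eta i j))\<^sup>2*(norm (\<Sum>l<m. x k l (Z (j, l) *\<^sub>C xi i j)))\<^sup>2" if k: "k < m" for k
    proof -
     have "(\<Sum>l<m. fourier_pairing (x k l) (u i j)*Z (j, l)) = cinner (\<Sum>l<m. x k l (Z (j, l) *\<^sub>C xi i j)) (eta i j)"
      unfolding cinner_sum_left
      by (rule sum.cong) (use VN k in \<open>auto simp: uc[OF ij] fourier_pairing_coeff bounded_ops_scaleC[OF VN_bounded] cinner_scaleC_left\<close>)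
     then show ?thesis
      using power_mono[OF cinner_norm_le norm_ge_zero, of "\<Sum>l<m. x k l (Z (j, l) *\<^sub>C xi i j)" "eta i j" 2]
      by (simp add: power_mult_distrib mult.commute)
    qed
    then have "(\<Sum>k<m. (cmod (\<Sum>l<m. fourier_pairing (x k l) (u i j)*Z (j, l)))\<^sup>2)
      <= (norm (eta i j))\<^sup>2*(\<Sum>k<m. (norm (\<Sum>l<m. x k l (Z (j, l) *\<^sub>C xi i j)))\<^sup>2)"
     unfolding sum_distrib_left by (intro sum_mono) auto
    also have "\<dots> <= (norm (eta i j))\<^sup>2*(\<Sum>l<m. (norm (Z (j, l) *\<^sub>C xi i j))\<^sup>2)"
     by (intro mult_left_mono xb) simp
    also have "\<dots> = (norm (eta i j))\<^sup>2*((norm (xi i j))\<^sup>2*(\<Sum>l<m. (cmod (Z (j, l)))\<^sup>2))"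
     by (simp add: norm_scaleC power_mult_distrib sum_distrib_left mult_ac)
    also have "\<dots> <= (norm (eta i j))\<^sup>2*((norm (xi i j))\<^sup>2 * 1)"
     by (intro mult_left_mono Zj ij) simp_all
    finally show ?thesis by (simp add: mult.commute)
   qed
   have "(\<Sum>i\<in>{..<n} \<times> {..<m}. (norm (\<Sum>j\<in>{..<n} \<times> {..<m}.
     (%(i, k) (j, l) z. fourier_pairing (x k l) (u i j)*z) i j (Z j)))\<^sup>2)
    = (\<Sum>i<n. \<Sum>k<m. (cmod (\<Sum>j<n. \<Sum>l<m. fourier_pairing (x k l) (u i j)*Z (j, l)))\<^sup>2)"
    by (simp add: sum.cartesian_product split_beta)
   also have "\<dots> <= (\<Sum>i<n. \<Sum>k<m. real n*(\<Sum>j<n. (cmod (\<Sum>l<m. fourier_pairing (x k l) (u i j)*Z (j, l)))\<^sup>2))"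
    by (intro sum_mono norm_sum_sq_le)
   also have "\<dots> = real n*(\<Sum>i<n. \<Sum>j<n. \<Sum>k<m. (cmod (\<Sum>l<m. fourier_pairing (x k l) (u i j)*Z (j, l)))\<^sup>2)"
    by (simp add: sum_distrib_left[symmetric] sum.swap[of _ "{..<m}"])
   also have "\<dots> <= real n*B" unfolding B_def by (intro mult_left_mono sum_mono ij) auto
   finally show "(\<Sum>i\<in>{..<n} \<times> {..<m}. (norm (\<Sum>j\<in>{..<n} \<times> {..<m}.
     (%(i, k) (j, l) z. fourier_pairing (x k l) (u i j)*z) i j (Z j)))\<^sup>2) <= (sqrt (real n*B))\<^sup>2"
    using B by simp
  qed (use B in simp)
 qed
qed

lemma orthonormal_family:
 fixes e :: "nat => 'h::complex_inner"
 assumes e: "!!i j. i < n ==> j < n ==> cinner (e i) (e j) = (if i = j then 1 else 0)"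
 shows "(\<Sum>i<n. (cmod (cinner x (e i)))\<^sup>2) <= (norm x)\<^sup>2"
  "(norm (\<Sum>j<n. z j *\<^sub>C e j))\<^sup>2 = (\<Sum>j<n. (cmod (z j))\<^sup>2)"
proof -
 have inj: "inj_on e {..<n}"
 proof (rule inj_onI)
  fix i j assume ij: "i : {..<n}" "j : {..<n}" and eq: "e i = e j"
  show "i = j" using e[of i j] e[of i i] ij eq by (auto split: if_splits)
 qed
 have "orthonormal (e ` {..<n})" unfolding orthonormal_def using e inj by (auto simp: inj_on_def)
 from bessel[OF this] show "(\<Sum>i<n. (cmod (cinner x (e i)))\<^sup>2) <= (norm x)\<^sup>2"
  by (simp add: sum.reindex[OF inj] o_def)
 have "cinner (\<Sum>j<n. z j *\<^sub>C e j) (\<Sum>j<n. z j *\<^sub>C e j) = (\<Sum>j<n. \<Sum>i<n. if i = j then z j*cnj (z j) else 0)"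
  unfolding cinner_sum_left unfolding cinner_sum_right
  using e by (intro sum.cong refl) (auto simp: cinner_scaleC_left cinner_scaleC_right)
 also have "\<dots> = (\<Sum>j<n. z j*cnj (z j))" by (intro sum.cong refl) simp
 also have "\<dots> = cor (\<Sum>j<n. (cmod (z j))\<^sup>2)" by (simp only: complex_norm_square of_real_sum)
 finally show "(norm (\<Sum>j<n. z j *\<^sub>C e j))\<^sup>2 = (\<Sum>j<n. (cmod (z j))\<^sup>2)"
  unfolding cinner_self of_real_eq_iff .
qed

text \<open>This matrix of coefficients is the compression of VN(G) to the span of an orthonormal
  family, a complete contraction. It supplies matrices over A(G) of norm at most 1 on which a
  multiplier can act.\<close>

lemma fourier_matrix_norm_orthonormal:
 fixes e :: "nat => 'g::locally_compact_group L2"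
 assumes e: "!!i j. i < n ==> j < n ==> cinner (e i) (e j) = (if i = j then 1 else 0)"
 shows "fourier_matrix_norm n (%i j. fourier_coeff (e j) (e i)) <= 1"
 unfolding fourier_matrix_norm_def
proof (rule cSup_least)
 show "fourier_matrix_set n (%i j. fourier_coeff (e j) (e i)) ~= {}"
  using VN_id by (auto intro!: exI[of _ 0] matrix_norm_leI)
 fix y assume "y : fourier_matrix_set n (%i j. fourier_coeff (e j) (e i))"
 then obtain m and x :: "nat => nat => 'g L2 \<Rightarrow>\<^sub>L 'g L2" where
  y: "y = matrix_norm ({..<n} \<times> {..<m}) (%(i, k) (j, l) z. fourier_pairing (x k l) (fourier_coeff (e j) (e i))*z)"
  and VN: "!!k l. k < m ==> l < m ==> x k l : VN"
  and x1: "matrix_norm {..<m} (%k l. app (x k l)) <= 1" by blast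
 show "y <= 1"
  unfolding y
 proof (rule matrix_norm_leI)
  fix Z :: "nat \<times> nat => complex"
  assume "(\<Sum>j\<in>{..<n} \<times> {..<m}. (norm (Z j))\<^sup>2) <= 1"
  then have Z: "(\<Sum>j<n. \<Sum>l<m. (cmod (Z (j, l)))\<^sup>2) <= 1" by (simp add: sum.cartesian_product)
  define zt where "zt l = (\<Sum>j<n. Z (j, l) *\<^sub>C e j)" for l
  have eq: "(\<Sum>j<n. \<Sum>l<m. fourier_pairing (x k l) (fourier_coeff (e j) (e i))*Z (j, l)) = cinner (\<Sum>l<m. x k l (zt l)) (e i)"
   if k: "k < m" for i k
   unfolding zt_def cinner_sum_left blinfun.sum_right
   by (subst sum.swap, intro sum.cong refl)
    (use VN k in \<open>auto simp: fourier_pairing_coeff bounded_ops_scaleC[OF VN_bounded] cinner_scaleC_left\<close>)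
  have "(\<Sum>i\<in>{..<n} \<times> {..<m}. (norm (\<Sum>j\<in>{..<n} \<times> {..<m}.
     (%(i, k) (j, l) z. fourier_pairing (x k l) (fourier_coeff (e j) (e i))*z) i j (Z j)))\<^sup>2)
    = (\<Sum>i<n. \<Sum>k<m. (cmod (\<Sum>j<n. \<Sum>l<m. fourier_pairing (x k l) (fourier_coeff (e j) (e i))*Z (j, l)))\<^sup>2)"
   by (simp add: sum.cartesian_product split_beta)
  also have "\<dots> = (\<Sum>k<m. \<Sum>i<n. (cmod (cinner (\<Sum>l<m. x k l (zt l)) (e i)))\<^sup>2)"
   by (subst sum.swap, intro sum.cong refl) (simp add: eq)
  also have "\<dots> <= (\<Sum>k<m. (norm (\<Sum>l<m. x k l (zt l)))\<^sup>2)"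
   by (intro sum_mono orthonormal_family(1) e)
  also have "\<dots> <= (\<Sum>l<m. (norm (zt l))\<^sup>2)" by (rule VN_matrix_bound[OF x1])
  also have "\<dots> = (\<Sum>j<n. \<Sum>l<m. (cmod (Z (j, l)))\<^sup>2)"
   unfolding zt_def by (subst sum.swap, intro sum.cong refl orthonormal_family(2) e)
  also have "\<dots> <= 1" by (rule Z)
  finally show "(\<Sum>i\<in>{..<n} \<times> {..<m}. (norm (\<Sum>j\<in>{..<n} \<times> {..<m}.
     (%(i, k) (j, l) z. fourier_pairing (x k l) (fourier_coeff (e j) (e i))*z) i j (Z j)))\<^sup>2) <= 1\<^sup>2" by simp
 qed simp
qed

text \<open>The form in which complete boundedness enters: the multiplier is applied to the
  compression to an orthonormal family, evaluated at a contractive matrix over VN(G), and the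
  resulting scalar matrix is tested between two vectors \<open>Z\<close> and
  \<open>W\<close>.\<close>

lemma cb_apply:
 fixes e :: "nat => 'g::locally_compact_group L2" and x :: "nat => nat => 'g L2 \<Rightarrow>\<^sub>L 'g L2"
 assumes ph: "ph : McbA" and C: "cb_bound (fourier_mult ph) C"
  and e: "!!i j. i < n ==> j < n ==> cinner (e i) (e j) = (if i = j then 1 else 0)"
  and VN: "!!k l. k < m ==> l < m ==> x k l : VN"
  and x1: "!!zt. (\<Sum>k<m. (norm (\<Sum>l<m. x k l (zt l)))\<^sup>2) <= (\<Sum>l<m. (norm (zt l))\<^sup>2)"
 shows "cmod (\<Sum>i<n. \<Sum>k<m. (\<Sum>j<n. \<Sum>l<m. fourier_pairing (x k l) (fourier_mult ph (fourier_coeff (e j) (e i)))*Z j l)*W i k)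
  <= C * sqrt (\<Sum>j<n. \<Sum>l<m. (cmod (Z j l))\<^sup>2) * sqrt (\<Sum>i<n. \<Sum>k<m. (cmod (W i k))\<^sup>2)"
proof -
 define v where "v i j = fourier_coeff (e j) (e i)" for i j
 define A where "A = (%(i, k) (j, l) z. fourier_pairing (x k l) (fourier_mult ph (v i j))*z)"
 define I where "I = {..<n} \<times> {..<m}"
 have v: "v i j : fourier_algebra" for i j by (auto simp: v_def fourier_algebra_def)
 have C0: "0 <= C" using C by (simp add: cb_bound_def)
 have x1': "matrix_norm {..<m} (%k l. app (x k l)) <= 1"
  by (rule matrix_norm_leI) (use x1 order_trans in \<open>simp, fastforce\<close>)
 have "matrix_norm I A <= fourier_matrix_norm n (%i j. fourier_mult ph (v i j))"
  unfolding fourier_matrix_norm_def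
 proof (rule cSup_upper)
  show "bdd_above (fourier_matrix_set n (%i j. fourier_mult ph (v i j)))"
   by (rule fourier_matrix_bdd) (simp add: fourier_mult(1)[OF ph v])
  show "matrix_norm I A : fourier_matrix_set n (%i j. fourier_mult ph (v i j))"
   unfolding I_def A_def using VN x1' by blast
 qed
 also have "\<dots> <= C*fourier_matrix_norm n v" using C v by (simp add: cb_bound_def)
 also have "\<dots> <= C * 1"
  by (intro mult_left_mono C0) (simp add: v_def[abs_def] fourier_matrix_norm_orthonormal[OF e])
 finally have AC: "matrix_norm I A <= C" by simp
 have bl: "bounded_linear (A i j)" for i j
  by (cases i; cases j) (simp add: A_def bounded_linear_mult_right)
 define y where "y i = (\<Sum>j\<in>I. A i j ((%(j, l). Z j l) j))" for i
 have "(\<Sum>i\<in>I. (norm (y i))\<^sup>2) <= C\<^sup>2*(\<Sum>j\<in>I. (norm ((%(j, l). Z j l) j))\<^sup>2)"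
  unfolding y_def by (rule matrix_normD[OF _ bl AC]) (simp add: I_def)
 also have "\<dots> = C\<^sup>2*(\<Sum>j<n. \<Sum>l<m. (cmod (Z j l))\<^sup>2)" by (simp add: I_def sum.cartesian_product split_beta)
 finally have y2: "sqrt (\<Sum>i\<in>I. (cmod (y i))\<^sup>2) <= C * sqrt (\<Sum>j<n. \<Sum>l<m. (cmod (Z j l))\<^sup>2)"
  using C0 real_sqrt_le_mono by (fastforce simp: real_sqrt_mult)
 have "(\<Sum>i<n. \<Sum>k<m. (\<Sum>j<n. \<Sum>l<m. fourier_pairing (x k l) (fourier_mult ph (fourier_coeff (e j) (e i)))*Z j l)*W i k)
  = (\<Sum>i\<in>I. y i*(%(i, k). W i k) i)"
  by (simp add: y_def I_def A_def v_def sum.cartesian_product split_beta)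
 also have "cmod \<dots> <= (\<Sum>i\<in>I. \<bar>cmod (y i)\<bar>*\<bar>cmod ((%(i, k). W i k) i)\<bar>)"
  by (rule order_trans[OF norm_sum]) (simp add: norm_mult)
 also have "\<dots> <= L2_set (%i. cmod (y i)) I*L2_set (%i. cmod ((%(i, k). W i k) i)) I"
  by (rule L2_set_mult_ineq)
 also have "\<dots> <= (C * sqrt (\<Sum>j<n. \<Sum>l<m. (cmod (Z j l))\<^sup>2))*L2_set (%i. cmod ((%(i, k). W i k) i)) I"
  by (intro mult_right_mono L2_set_nonneg) (simp add: L2_set_def y2)
 also have "L2_set (%i. cmod ((%(i, k). W i k) i)) I = sqrt (\<Sum>i<n. \<Sum>k<m. (cmod (W i k))\<^sup>2)"
  by (simp add: L2_set_def I_def sum.cartesian_product split_beta)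
 finally show ?thesis by simp
qed

subsection \<open>Slices of an operator\<close>

text \<open>\<open>a\<close> and \<open>b\<close> stand for members of an approximate unit. The
  bounds on \<open>T\<close> and on their \<open>L\<^sup>1\<close> norms make the associated
  operator \<open>S\<close> a contraction.\<close>

locale operator_slices =
 fixes T :: "'g::locally_compact_group L2 \<Rightarrow>\<^sub>L 'g L2" and a b :: "'g => complex"
 assumes T: "T : bounded_ops" and T1: "norm T <= 1"
  and a: "a : Cc" and b: "b : Cc"
  and a1: "(LI t. cmod (a t)) <= 1" and b1: "(LI t. cmod (b t)) <= 1"
begin

definition h :: "'g => 'g => complex" where
 "h r s = cinner (T (right_reg (- s) (right_reg r (abs_L2 a)))) (right_reg (- s) (abs_L2 b))"

definition hbound :: real where "hbound = norm (abs_L2 a)*norm (abs_L2 b)"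

text \<open>Integrating \<open>slice\<close> against \<open>1\<close> gives back \<open>\<lambda>(b)\<^sup>* T \<lambda>(a)\<close>, see \<open>slice_integral\<close>.\<close>

definition slice :: "'g L2 => 'g L2 => 'g => complex" where
 "slice p q r = cor (sqrt (modular (- r)))*cinner (mult_op (h r) (left_reg r p)) q"

lemma h_eq: "h r s = cinner (T (right_reg (- s + r) (abs_L2 a))) (right_reg (- s) (abs_L2 b))"
 by (simp add: h_def right_reg_add)

lemma h_continuous: "cont (%z. h (f z) (g z))"
 if "cont f" "cont g" for f g :: "'x::topological_space => 'g"
 unfolding h_eq by (intro continuous_on_cinner continuous_blinfun_apply
   cont_comp[OF right_reg_continuous] continuous_intros that)

lemma hbound_nonneg: "0 <= hbound" by (simp add: hbound_def)

lemma h_bound: "cmod (h r s) <= hbound"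
proof -
 have "cmod (h r s) <= norm T*norm (abs_L2 a)*norm (abs_L2 b)"
  unfolding h_def using right_coeff_bound[of T "- s" "right_reg r (abs_L2 a)" "- s" "abs_L2 b"] by simp
 also have "\<dots> <= 1*norm (abs_L2 a)*norm (abs_L2 b)"
  by (intro mult_right_mono T1 norm_ge_zero)
 finally show ?thesis by (simp add: hbound_def)
qed

lemma h_Linf: "h r : borel_measurable borel" "loc_AE (%t. cmod (h r t) <= hbound)" "h r : Linf"
proof -
 show m: "h r : borel_measurable borel" by (rule continuous_borel[OF h_continuous]) (intro continuous_intros)+
 show l: "loc_AE (%t. cmod (h r t) <= hbound)" by (rule loc_AE_UNIV[OF h_bound])
 show "h r : Linf" using m l by (auto simp: Linf_def)
qed

lemma slice_Cc_eq:
 assumes P: "P : Cc" and Q: "Q : Cc"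
 shows "slice (abs_L2 P) (abs_L2 Q) r
  = (LI s. cor (sqrt (modular (- r)))*h r s*P (- r + s)*cnj (Q s))"
proof -
 have P': "(%t. P (- r + t)) : Cc" by (rule Cc_translate_left[OF P])
 have m: "mult_op (h r) (abs_L2 (%t. P (- r + t))) = abs_L2 (%t. h r t*P (- r + t))"
  by (rule mult_op_Linf(3)[OF h_Linf(1,2) hbound_nonneg Cc_square_integrable[OF P']])
 have "cinner (abs_L2 (%t. h r t*P (- r + t))) (abs_L2 Q) = (LI s. h r s*P (- r + s)*cnj (Q s))"
  by (rule cinner_abs_L2[OF mult_square_integrable(1)[OF Cc_square_integrable[OF P'] h_Linf(1,2) hbound_nonneg]
     Cc_square_integrable[OF Q]])
 then show ?thesis by (simp add: slice_def left_reg_Cc[OF P] m mult.assoc)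
qed

lemma slice_Cc:
 assumes p: "p : Cc_L2" and q: "q : Cc_L2"
 shows "slice p q : Cc"
proof -
 obtain P Q where P: "P : Cc" "p = abs_L2 P" and Q: "Q : Cc" "q = abs_L2 Q" using p q by (auto simp: Cc_L2_def)
 obtain K where K: "cont P" "compact K" "!!x. x ~: K ==> P x = 0" using P(1) by (rule CcE) blast
 obtain L where L: "cont Q" "compact L" "!!x. x ~: L ==> Q x = 0" using Q(1) by (rule CcE) blast
 define k where "k r s = cor (sqrt (modular (- r)))*h r s*P (- r + s)*cnj (Q s)" for r s
 define M where "M = (%(x, y). x + y) ` (L \<times> uminus ` K)"
 have M: "compact M" unfolding M_def by (intro compact_plus L compact_uminus K)
 have kc: "cont (%(r, s). k r s)" unfolding k_def case_prod_unfold
  by (intro continuous_intros h_continuous cont_comp[OF modular_continuous]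
    cont_comp[OF K(1)] cont_comp[OF L(1)])
 have eq: "slice p q = (%r. LI s. k r s)"
  unfolding P(2) Q(2) k_def using slice_Cc_eq[OF P(1) Q(1)] by (intro ext)
 have c: "cont (slice p q)" unfolding eq
  by (rule continuous_integral_compact_support[OF kc L(2)]) (simp add: k_def L(3))
 show ?thesis
 proof (rule CcI[OF c M])
  fix r assume r: "r ~: M"
  have "k r s = 0" for s
  proof (rule ccontr)
   assume "k r s ~= 0"
   then have "s : L" "- r + s : K" using K(3) L(3) by (auto simp: k_def)
   then have "s + - (- r + s) : M" unfolding M_def by (intro plus_image_mem imageI)
   then show False using r by (simp add: minus_add add.assoc[symmetric] del: add_uminus_conv_diff)
  qed
  then have "k r = (%_. 0)" by (intro ext)
  then show "slice p q r = 0" by (simp add: eq)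
 qed
qed

lemma slice_add: "slice (p + p') q r = slice p q r + slice p' q r" "slice p (q + q') r = slice p q r + slice p q' r"
 by (simp_all add: slice_def blinfun.add_right cinner_add_left cinner_add_right distrib_left)

lemma slice_scale: "slice (c *\<^sub>C p) q r = c * slice p q r" "slice p (c *\<^sub>C q) r = cnj c * slice p q r"
 using bounded_ops_scaleC[OF mult_op_bounded_ops[OF h_Linf(3)]]
 by (simp_all add: slice_def bounded_ops_scaleC cinner_scaleC_left cinner_scaleC_right)

lemma slice_sum: "slice (\<Sum>i\<in>I. p i) q r = (\<Sum>i\<in>I. slice (p i) q r)" "slice p' (\<Sum>i\<in>I. q' i) r = (\<Sum>i\<in>I. slice p' (q' i) r)"
 by (simp_all add: slice_def blinfun.sum_right cinner_sum_left cinner_sum_right sum_distrib_left)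

end

text \<open>$\lambda(a)p = \int p(w^{-1})\Delta(w)^{-1/2}\rho(w)a\,dw$\<close>

lemma lam_right_reg:
 fixes a P :: "'g::locally_compact_group => complex"
 assumes a: "a : Cc" and P: "P : Cc"
 shows "cinner (lam a (abs_L2 P)) th = (LI w. cor (sqrt (modular (- w)))*P (- w)*cinner (right_reg w (abs_L2 a)) th)"
  "cinner (lam a (abs_L2 P)) th = (LI s. cor (sqrt (modular (- s)))*P s*cinner (right_reg (- s) (abs_L2 a)) th)"
proof -
 obtain K where K: "cont P" "compact K" "!!x. x ~: K ==> P x = 0" using P by (rule CcE) blast
 obtain L where L: "cont a" "compact L" "!!x. x ~: L ==> a x = 0" using a by (rule CcE) blast
 define g where "g w = cor (sqrt (modular (- w)))*P (- w)" for w
 have g: "g : Cc" unfolding g_def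
  by (intro Cc_mult_left Cc_inverse P continuous_intros cont_comp[OF modular_continuous])
 obtain M where M: "cont g" "compact M" "!!x. x ~: M ==> g x = 0" using g by (rule CcE) blast
 have rc: "cont (%w. right_reg w (abs_L2 a))" by (rule right_reg_continuous)
 have dense: "cinner (lam a (abs_L2 P)) th = (LI w. g w*cinner (right_reg w (abs_L2 a)) th)" if th: "th : Cc_L2" for th
 proof -
  obtain \<Theta> where \<Theta>: "\<Theta> : Cc" "th = abs_L2 \<Theta>" using th by (auto simp: Cc_L2_def)
  obtain N where N: "cont \<Theta>" "compact N" "!!x. x ~: N ==> \<Theta> x = 0" using \<Theta>(1) by (rule CcE) blast
  note ci = continuous_intros cont_comp[OF K(1)] cont_comp[OF L(1)] cont_comp[OF N(1)]
  have "cinner (lam a (abs_L2 P)) th = (LI r. LI t. a r*P (- r + t)*cnj (\<Theta> t))"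
   unfolding lam(3)[OF Cc_integrable[OF a]] fourier_coeff_def \<Theta>(2) left_reg_Cc[OF P]
   by (simp add: cinner_Cc[OF Cc_translate_left[OF P] \<Theta>(1)] mult.assoc)
  also have "\<dots> = (LI t. LI r. a r*P (- r + t)*cnj (\<Theta> t))"
   by (rule fubini_compact_support[OF _ L(2) N(2)], unfold case_prod_unfold, intro ci) (use L(3) N(3) in auto)
  also have "\<dots> = (LI t. LI w. P (- w)*a (t + w)*cnj (\<Theta> t))"
  proof (rule Bi_cong[OF refl])
   fix t
   have "(LI w. a (t + w)*P (- (t + w) + t)*cnj (\<Theta> t)) = (LI r. a r*P (- r + t)*cnj (\<Theta> t))"
    by (rule integral_haar_left(1), rule continuous_borel) (intro ci)
   then show "(LI r. a r*P (- r + t)*cnj (\<Theta> t)) = (LI w. P (- w)*a (t + w)*cnj (\<Theta> t))"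
    by (simp add: minus_add add.assoc mult_ac)
  qed
  also have "\<dots> = (LI w. LI t. P (- w)*a (t + w)*cnj (\<Theta> t))"
  proof (rule fubini_compact_support[OF _ N(2) compact_uminus[OF K(2)]], unfold case_prod_unfold, intro ci)
   fix s t assume "s ~: N \<or> t ~: uminus ` K"
   moreover have "- t ~: K" if "t ~: uminus ` K" using that by (metis imageI minus_minus)
   ultimately show "P (- t)*a (s + t)*cnj (\<Theta> s) = 0" using K(3) N(3) by auto
  qed
  also have "\<dots> = (LI w. g w*cinner (right_reg w (abs_L2 a)) th)"
  proof (rule Bi_cong[OF refl])
   fix w :: 'g
   have m: "sqrt (modular (- w)) * sqrt (modular w) = 1" by (simp add: real_sqrt_mult[symmetric] modular_minus)
   have "g w*cinner (right_reg w (abs_L2 a)) th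
     = (LI t. g w*(a (t + w)*cor (sqrt (modular w))*cnj (\<Theta> t)))"
    unfolding \<Theta>(2) right_reg_Cc[OF a] cinner_Cc[OF Cc_right_translate_scaled[OF a] \<Theta>(1)] by simp
   also have "\<dots> = (LI t. cor (sqrt (modular (- w)) * sqrt (modular w))*(P (- w)*a (t + w)*cnj (\<Theta> t)))"
    by (rule Bi_cong[OF refl]) (simp add: g_def mult_ac)
   finally show "(LI t. P (- w)*a (t + w)*cnj (\<Theta> t)) = g w*cinner (right_reg w (abs_L2 a)) th"
    unfolding m by simp
  qed
  finally show ?thesis .
 qed
 have "cont (%th. LI w. g w*cinner (right_reg w (abs_L2 a)) th)"
  by (rule continuous_param_integral[OF _ Cc_integrable[OF g] M(2,3)], unfold case_prod_unfold)
   (intro continuous_on_cinner cont_comp[OF rc] continuous_intros)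
 then have c: "continuous_on (closure Cc_L2) (%th. cinner (lam a (abs_L2 P)) th - (LI w. g w*cinner (right_reg w (abs_L2 a)) th))"
  unfolding Cc_L2_dense by (intro continuous_intros continuous_on_cinner)
 have "cinner (lam a (abs_L2 P)) th - (LI w. g w*cinner (right_reg w (abs_L2 a)) th) = 0"
  by (rule continuous_constant_on_closure[OF c]) (simp_all add: dense Cc_L2_dense)
 then show 1: "cinner (lam a (abs_L2 P)) th = (LI w. cor (sqrt (modular (- w)))*P (- w)*cinner (right_reg w (abs_L2 a)) th)"
  by (simp add: g_def)
 have F: "(%w. g w*cinner (right_reg w (abs_L2 a)) th) : Cc"
  by (intro Cc_mult_right g continuous_on_cinner rc continuous_on_const)
 \<comment> \<open>Inverting the variable contributes the factor \<open>modular (- s)\<close>, which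
   turns \<open>sqrt (modular s)\<close> into \<open>sqrt (modular (- s))\<close>.\<close>
 have m: "sqrt (modular s)*modular (- s) = sqrt (modular (- s))" for s :: 'g
  using sqrt_divide_self_eq[OF modular_nonneg, of s] unfolding modular_minus real_sqrt_divide real_sqrt_one
  by (simp add: inverse_eq_divide)
 have "g (- s)*cinner (right_reg (- s) (abs_L2 a)) th*cor (modular (- s))
   = cor (sqrt (modular (- s)))*P s*cinner (right_reg (- s) (abs_L2 a)) th" for s
  unfolding m[symmetric] by (simp add: g_def mult_ac)
 then show "cinner (lam a (abs_L2 P)) th = (LI s. cor (sqrt (modular (- s)))*P s*cinner (right_reg (- s) (abs_L2 a)) th)"
  unfolding 1 g_def[symmetric] using integral_haar_inverse[OF F] by (simp only:)
qed

context operator_slices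
begin

definition S :: "'g L2 \<Rightarrow>\<^sub>L 'g L2" where "S = adj_op (lam b) o\<^sub>L T o\<^sub>L lam a"

lemma S_bounded: "S : bounded_ops"
 unfolding S_def by (intro bounded_ops_compose adj_op_bounded_ops T lam Cc_integrable a b)

lemma S_cinner: "cinner (S p) q = cinner (T (lam a p)) (lam b q)"
 by (simp add: S_def cinner_adj_left lam Cc_integrable b)

lemma S_bound: "cmod (cinner (S p) q) <= norm p*norm q"
proof -
 have c: "norm (lam a p) <= norm p" if "a : Cc" "(LI t. cmod (a t)) <= 1" for a :: "'g => complex" and p
 proof -
  have "norm (lam a p) <= norm (lam a)*norm p" by (rule norm_blinfun)
  also have "\<dots> <= 1*norm p"
   by (intro mult_right_mono norm_ge_zero order_trans[OF lam(2) that(2)] Cc_integrable that)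
  finally show ?thesis by simp
 qed
 have "norm (T (lam a p)) <= norm T*norm (lam a p)" by (rule norm_blinfun)
 also have "\<dots> <= 1*norm p" by (intro mult_mono T1 c a a1 norm_ge_zero zero_le_one)
 finally have "norm (T (lam a p)) <= norm p" by simp
 then have "norm (T (lam a p))*norm (lam b q) <= norm p*norm q"
  by (intro mult_mono c b b1 norm_ge_zero)
 then show ?thesis unfolding S_cinner by (rule order_trans[OF cinner_norm_le])
qed

text \<open>After the exchange, replacing \<open>r\<close> by \<open>s + w\<close> separates the
  kernel into a factor in \<open>s\<close> and a factor in \<open>w\<close>. The two remaining
  integrals are the two formulas of \<open>lam_right_reg\<close>, one producing
  \<open>lam a p\<close>, the other \<open>lam b q\<close>.\<close>

lemma slice_integral:
 assumes p: "p : Cc_L2" and q: "q : Cc_L2"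
 shows "(LI r. slice p q r) = cinner (S p) q"
proof -
 obtain P Q where P: "P : Cc" "p = abs_L2 P" and Q: "Q : Cc" "q = abs_L2 Q" using p q by (auto simp: Cc_L2_def)
 obtain K where K: "cont P" "compact K" "!!x. x ~: K ==> P x = 0" using P(1) by (rule CcE) blast
 obtain L where L: "cont Q" "compact L" "!!x. x ~: L ==> Q x = 0" using Q(1) by (rule CcE) blast
 define k where "k r s = cor (sqrt (modular (- r)))*h r s*P (- r + s)*cnj (Q s)" for r s
 define M where "M = (%(x, y). x + y) ` (L \<times> uminus ` K)"
 have M: "compact M" unfolding M_def by (intro compact_plus L compact_uminus K)
 note ci = continuous_intros h_continuous cont_comp[OF modular_continuous]
    cont_comp[OF K(1)] cont_comp[OF L(1)]
 have kc: "cont (%(r, s). k r s)" unfolding k_def case_prod_unfold by (intro ci)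
 have supp: "k r s = 0" if "r ~: M \<or> s ~: L" for r s
 proof (rule ccontr)
  assume "k r s ~= 0"
  then have "s : L" "- r + s : K" using K(3) L(3) by (auto simp: k_def)
  moreover then have "s + - (- r + s) : M" unfolding M_def by (intro plus_image_mem imageI)
  ultimately show False using that by (simp add: minus_add add.assoc[symmetric] del: add_uminus_conv_diff)
 qed
 have "(LI r. slice p q r) = (LI r. LI s. k r s)"
  unfolding P(2) Q(2) slice_Cc_eq[OF P(1) Q(1)] k_def ..
 also have "\<dots> = (LI s. LI r. k r s)"
  by (rule fubini_compact_support[OF kc M L(2) supp])
 also have "\<dots> = (LI s. cnj (cor (sqrt (modular (- s)))*Q s*cinner (right_reg (- s) (abs_L2 b)) (T (lam a p))))"
 proof (rule Bi_cong[OF refl])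
  fix s
  let ?B = "right_reg (- s) (abs_L2 b)"
  have "(LI r. k r s) = (LI w. k (s + w) s)"
   by (rule integral_haar_left(1)[symmetric], rule continuous_borel) (unfold k_def, intro ci)
  also have "\<dots> = (LI w. (cor (sqrt (modular (- s)))*cnj (Q s))*(cor (sqrt (modular (- w)))*P (- w)*cinner (right_reg w (abs_L2 a)) (adj_op T ?B)))"
  proof (rule Bi_cong[OF refl])
   fix w
   have 1: "- (s + w) + s = - w" "- s + (s + w) = w" by (simp_all add: minus_add add.assoc)
   have 2: "sqrt (modular (- (s + w))) = sqrt (modular (- w)) * sqrt (modular (- s))"
    by (simp only: minus_add modular_add real_sqrt_mult)
   show "k (s + w) s = (cor (sqrt (modular (- s)))*cnj (Q s))*(cor (sqrt (modular (- w)))*P (- w)*cinner (right_reg w (abs_L2 a)) (adj_op T ?B))"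
    unfolding k_def h_eq 1 2 cinner_adj_right[OF T] by (simp add: mult_ac)
  qed
  also have "\<dots> = cor (sqrt (modular (- s)))*cnj (Q s)*cinner (T (lam a p)) ?B"
   unfolding Bi_mult_right_zero lam_right_reg(1)[OF a P(1), symmetric] P(2)
   unfolding cinner_adj_right[OF T] ..
  finally show "(LI r. k r s) = cnj (cor (sqrt (modular (- s)))*Q s*cinner ?B (T (lam a p)))"
   by (simp add: cinner_commute[of "T (lam a p)"])
 qed
 also have "\<dots> = cnj (cinner (lam b q) (T (lam a p)))"
  unfolding Bi_cnj lam_right_reg(2)[OF b Q(1), symmetric] Q(2) ..
 also have "\<dots> = cinner (S p) q" by (simp add: S_cinner cinner_commute[of "T (lam a p)"])
 finally show ?thesis .
qed

end

section \<open>Absorption of a second copy of the regular representation\<close>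

definition twist :: "('g::locally_compact_group => complex) => ('g => complex) => 'g => 'g L2"
 where "twist P Z u = abs_L2 (%t. P t*Z (t + u))"

lemma twist_Cc:
 assumes P: "P : Cc" and Z: "Z : Cc"
 shows "(%t. P t*Z (t + u)) : Cc" "twist P Z u : Cc_L2"
 by (auto simp: twist_def Cc_L2_def intro!: imageI Cc_mult_right P cont_comp[OF Cc_continuous[OF Z]] continuous_intros)

text \<open>\<open>twist P Z u\<close> is the section at \<open>u\<close> of V applied to
  \<open>P \<otimes> Z\<close>, where V is the unitary \<open>(V k)(t, u) = k(t, t + u)\<close> on
  two variables. Left invariance in \<open>u\<close> makes V isometric, which is stated here through
  iterated integrals and without a product measure.\<close>

lemma twist_cinner:
 fixes P Q Z W :: "'g::locally_compact_group => complex"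
 assumes P: "P : Cc" and Q: "Q : Cc" and Z: "Z : Cc" and W: "W : Cc"
 shows "(%u. cinner (twist P Z u) (twist Q W u)) : Cc"
  "(LI u. cinner (twist P Z u) (twist Q W u)) = cinner (abs_L2 P) (abs_L2 Q)*cinner (abs_L2 Z) (abs_L2 W)"
proof -
 obtain K where K: "cont P" "compact K" "!!x. x ~: K ==> P x = 0" using P by (rule CcE) blast
 obtain L where L: "cont Z" "compact L" "!!x. x ~: L ==> Z x = 0" using Z by (rule CcE) blast
 define M where "M = (%(x, y). x + y) ` (uminus ` K \<times> L)"
 have M: "compact M" unfolding M_def by (intro compact_plus L compact_uminus K)
 define k where "k u t = P t*Z (t + u)*cnj (Q t*W (t + u))" for u t
 note ci = continuous_intros cont_comp[OF K(1)] cont_comp[OF L(1)]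
  cont_comp[OF Cc_continuous[OF Q]] cont_comp[OF Cc_continuous[OF W]]
 have kc: "cont (%(u, t). k u t)" unfolding k_def case_prod_unfold by (intro ci)
 have supp: "k u t = 0" if "u ~: M \<or> t ~: K" for u t
 proof (rule ccontr)
  assume "k u t ~= 0"
  then have "t : K" "t + u : L" using K(3) L(3) by (auto simp: k_def)
  moreover then have "- t + (t + u) : M" unfolding M_def by (intro plus_image_mem imageI)
  ultimately show False using that by (simp add: add.assoc[symmetric])
 qed
 have eq: "cinner (twist P Z u) (twist Q W u) = (LI t. k u t)" for u
  unfolding twist_def k_def by (rule cinner_Cc[OF twist_Cc(1)[OF P Z] twist_Cc(1)[OF Q W]])
 have "cont (%u. LI t. k u t)"
  by (rule continuous_integral_compact_support[OF kc K(2)]) (use supp in auto)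
 then show "(%u. cinner (twist P Z u) (twist Q W u)) : Cc"
  unfolding eq by (rule CcI[OF _ M]) (simp add: supp)
 have "(LI u. cinner (twist P Z u) (twist Q W u)) = (LI t. LI u. k u t)"
  unfolding eq by (rule fubini_compact_support[OF kc M K(2) supp])
 also have "\<dots> = (LI t. P t*cnj (Q t)*(LI u. Z u*cnj (W u)))"
 proof (rule Bi_cong[OF refl])
  fix t
  have "(LI u. Z (t + u)*cnj (W (t + u))) = (LI u. Z u*cnj (W u))"
   by (rule integral_haar_left(1), rule continuous_borel) (intro ci)
  moreover have "(LI u. k u t) = (LI u. P t*cnj (Q t)*(Z (t + u)*cnj (W (t + u))))"
   unfolding k_def by (simp add: mult_ac)
  ultimately show "(LI u. k u t) = P t*cnj (Q t)*(LI u. Z u*cnj (W u))" by simp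
 qed
 finally show "(LI u. cinner (twist P Z u) (twist Q W u)) = cinner (abs_L2 P) (abs_L2 Q)*cinner (abs_L2 Z) (abs_L2 W)"
  by (simp add: cinner_Cc P Q Z W)
qed

text \<open>The optimal \<open>t\<close> is \<open>B / A\<close>. Adding \<open>dl\<close> to both
  keeps it defined and positive when \<open>A\<close> or \<open>B\<close> is 0, at a cost of at most
  \<open>e\<close>.\<close>

lemma amgm_scale:
 fixes x A B :: real
 assumes "0 <= A" "0 <= B" and x: "!!t. 0 < t ==> x <= (t*A\<^sup>2 + B\<^sup>2 / t) / 2"
 shows "x <= A*B"
proof (rule field_le_epsilon)
 fix e :: real assume e: "0 < e"
 define dl where "dl = e / (A + B + 1)"
 have dl: "0 < dl" using e assms by (simp add: dl_def)
 have pos: "0 < A + dl" "0 < B + dl" using dl assms by auto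
 have "(B + dl) / (A + dl)*A\<^sup>2 <= (B + dl)*A"
 proof -
  have "(B + dl) / (A + dl)*A\<^sup>2 = (B + dl)*A*(A / (A + dl))" by (simp add: power2_eq_square)
  also have "\<dots> <= (B + dl)*A * 1" using pos assms dl by (intro mult_left_mono) auto
  finally show ?thesis by simp
 qed
 moreover have "B\<^sup>2 / ((B + dl) / (A + dl)) <= B*(A + dl)"
 proof -
  have "B\<^sup>2 / ((B + dl) / (A + dl)) = B*(A + dl)*(B / (B + dl))" by (simp add: power2_eq_square)
  also have "\<dots> <= B*(A + dl) * 1" using pos assms dl by (intro mult_left_mono) auto
  finally show ?thesis by simp
 qed
 ultimately have "x <= ((B + dl)*A + B*(A + dl)) / 2"
  using x[of "(B + dl) / (A + dl)"] pos by simp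
 also have "\<dots> = A*B + dl*(A + B) / 2" by (simp add: algebra_simps)
 also have "dl*(A + B) / 2 <= dl*(A + B + 1)" using dl assms by (simp add: field_simps)
 also have "dl*(A + B + 1) = e" using assms by (simp add: dl_def)
 finally show "x <= A*B + e" by simp
qed

context operator_slices
begin

text \<open>Matrix coefficients of \<open>\<lambda>\<close> decompose as an integral of rank one kernels, which turns a weighted
  integral of \<open>slice p q\<close> into an integral of matrix coefficients of the single contraction \<open>S\<close>.\<close>

lemma slice_coeff_integral:
 assumes P: "P : Cc" and Q: "Q : Cc" and Z: "Z : Cc" and W: "W : Cc"
 shows "(%u. cinner (S (twist P Z u)) (twist Q W u)) : Cc"
  "(LI r. slice (abs_L2 P) (abs_L2 Q) r*fourier_coeff (abs_L2 Z) (abs_L2 W) r)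
   = (LI u. cinner (S (twist P Z u)) (twist Q W u))"
proof -
 obtain K where K: "cont P" "compact K" "!!x. x ~: K ==> P x = 0" using P by (rule CcE) blast
 obtain L where L: "cont Q" "compact L" "!!x. x ~: L ==> Q x = 0" using Q by (rule CcE) blast
 obtain N where N: "cont W" "compact N" "!!x. x ~: N ==> W x = 0" using W by (rule CcE) blast
 define k where "k u r s = cor (sqrt (modular (- r)))*h r s*(P (- r + s)*Z (- r + s + u))*cnj (Q s*W (s + u))" for u r s
 define M where "M = (%(x, y). x + y) ` (L \<times> uminus ` K)"
 define M' where "M' = (%(x, y). x + y) ` (uminus ` L \<times> N)"
 have M: "compact M" "compact M'" unfolding M_def M'_def by (intro compact_plus L N compact_uminus K)+
 note ci = continuous_intros h_continuous cont_comp[OF modular_continuous]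
    cont_comp[OF K(1)] cont_comp[OF L(1)]
    cont_comp[OF N(1)] cont_comp[OF Cc_continuous[OF Z]]
 have kc: "cont (%z. k (f z) (g z) (l z))"
  if "cont f" "cont g" "cont l" for f g l :: "'x::topological_space => 'g"
  unfolding k_def by (intro ci that)
 have supp: "k u r s = 0" if "u ~: M' \<or> r ~: M \<or> s ~: L" for u r s
 proof (rule ccontr)
  assume "k u r s ~= 0"
  then have 1: "s : L" "- r + s : K" "s + u : N" using K(3) L(3) N(3) by (auto simp: k_def)
  have "s + - (- r + s) : M" unfolding M_def by (rule plus_image_mem[OF 1(1) imageI[OF 1(2)]])
  moreover have "- s + (s + u) : M'" unfolding M'_def by (rule plus_image_mem[OF imageI[OF 1(1)] 1(3)])
  ultimately show False using that 1 by (simp add: minus_add add.assoc[symmetric] del: add_uminus_conv_diff)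
 qed
 define G where "G u r = (LI s. k u r s)" for u r
 have Gc: "cont (%(u, r). G u r)" unfolding G_def case_prod_unfold
  by (rule continuous_integral_compact_support[OF _ L(2)], unfold case_prod_unfold)
   (intro kc continuous_intros, use supp in auto)
 have G0: "G u r = 0" if "u ~: M' \<or> r ~: M" for u r using supp that by (auto simp: G_def)
 have GS: "cinner (S (twist P Z u)) (twist Q W u) = (LI r. G u r)" for u
  unfolding slice_integral[OF twist_Cc(2)[OF P Z] twist_Cc(2)[OF Q W], symmetric]
  unfolding twist_def slice_Cc_eq[OF twist_Cc(1)[OF P Z] twist_Cc(1)[OF Q W]] G_def k_def ..
 have "cont (%u. LI r. G u r)"
  by (rule continuous_integral_compact_support[OF Gc M(1)]) (use G0 in auto)
 then show "(%u. cinner (S (twist P Z u)) (twist Q W u)) : Cc"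
  unfolding GS by (rule CcI[OF _ M(2)]) (simp add: G0)
 have "(LI u. cinner (S (twist P Z u)) (twist Q W u)) = (LI r. LI u. G u r)"
  unfolding GS by (rule fubini_compact_support[OF Gc M(2,1) G0])
 also have "\<dots> = (LI r. slice (abs_L2 P) (abs_L2 Q) r*fourier_coeff (abs_L2 Z) (abs_L2 W) r)"
 proof (rule Bi_cong[OF refl])
  fix r
  have "(LI u. G u r) = (LI s. LI u. k u r s)" unfolding G_def
   by (rule fubini_compact_support[OF _ M(2) L(2)], unfold case_prod_unfold)
    (intro kc continuous_intros, use supp in auto)
  also have "\<dots> = (LI s. cor (sqrt (modular (- r)))*h r s*P (- r + s)*cnj (Q s)*fourier_coeff (abs_L2 Z) (abs_L2 W) r)"
  proof (rule Bi_cong[OF refl])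
   fix s
   \<comment> \<open>Left invariance in \<open>u\<close> removes \<open>s\<close>, so the
     coefficient of \<open>\<lambda>(r)\<close> factors out of the integral over
     \<open>s\<close>.\<close>
   have "(LI u. Z (- r + (s + u))*cnj (W (s + u))) = (LI u. Z (- r + u)*cnj (W u))"
    by (rule integral_haar_left(1), rule continuous_borel) (intro ci)
   also have "\<dots> = fourier_coeff (abs_L2 Z) (abs_L2 W) r"
    unfolding fourier_coeff_def left_reg_Cc[OF Z] cinner_Cc[OF Cc_translate_left[OF Z] W] ..
   finally have c: "(LI u. Z (- r + (s + u))*cnj (W (s + u))) = fourier_coeff (abs_L2 Z) (abs_L2 W) r" .
   have "(LI u. k u r s) = (LI u. cor (sqrt (modular (- r)))*h r s*P (- r + s)*cnj (Q s)
     * (Z (- r + (s + u))*cnj (W (s + u))))"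
    unfolding k_def by (simp add: add.assoc mult_ac)
   then show "(LI u. k u r s) = cor (sqrt (modular (- r)))*h r s*P (- r + s)*cnj (Q s)*fourier_coeff (abs_L2 Z) (abs_L2 W) r"
    unfolding Bi_mult_right_zero c .
  qed
  finally show "(LI u. G u r) = slice (abs_L2 P) (abs_L2 Q) r*fourier_coeff (abs_L2 Z) (abs_L2 W) r"
   unfolding Bi_mult_left_zero slice_Cc_eq[OF P Q] .
 qed
 finally show "(LI r. slice (abs_L2 P) (abs_L2 Q) r*fourier_coeff (abs_L2 Z) (abs_L2 W) r)
   = (LI u. cinner (S (twist P Z u)) (twist Q W u))" ..
qed

text \<open>\<open>X u\<close> and \<open>Y u\<close> are the sections of the twisted tensors. Since
  \<open>S\<close> is a contraction, its coefficient between them is at most half the sum of their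
  squared norms, and integrating over \<open>u\<close> returns the Gram sums of the untwisted
  vectors. The arithmetic mean stands in for Cauchy-Schwarz in the integral over
  \<open>u\<close>.\<close>

lemma slice_gram_Cc:
 fixes p q zt th :: "nat => 'g L2"
 assumes p: "!!l. l < n ==> p l : Cc_L2" and q: "!!k. k < n ==> q k : Cc_L2"
  and zt: "!!l. l < n ==> zt l : Cc_L2" and th: "!!k. k < n ==> th k : Cc_L2"
 shows "cmod (\<Sum>k<n. \<Sum>l<n. cinner (lam (slice (p l) (q k)) (zt l)) (th k))
  <= (Re (\<Sum>l<n. \<Sum>l'<n. cinner (p l) (p l')*cinner (zt l) (zt l'))
   + Re (\<Sum>l<n. \<Sum>l'<n. cinner (q l) (q l')*cinner (th l) (th l'))) / 2"
proof -
 have "EX P. ALL l<n. P l : Cc & y l = abs_L2 (P l)" if "ALL l<n. y l : Cc_L2" for y :: "nat => 'g L2"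
  using that unfolding Cc_L2_def image_iff Bex_def by (intro choice) auto
 note rep = this
 have "EX P. ALL l<n. P l : Cc & p l = abs_L2 (P l)" "EX P. ALL l<n. P l : Cc & q l = abs_L2 (P l)"
  "EX P. ALL l<n. P l : Cc & zt l = abs_L2 (P l)" "EX P. ALL l<n. P l : Cc & th l = abs_L2 (P l)"
  by (rule rep; simp add: p q zt th)+
 then obtain P Q Z W where
  "ALL l<n. P l : Cc & p l = abs_L2 (P l)" "ALL l<n. Q l : Cc & q l = abs_L2 (Q l)"
  "ALL l<n. Z l : Cc & zt l = abs_L2 (Z l)" "ALL l<n. W l : Cc & th l = abs_L2 (W l)" by (elim exE)
 then have P: "P l : Cc" "p l = abs_L2 (P l)" and Q: "Q l : Cc" "q l = abs_L2 (Q l)"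
  and Z: "Z l : Cc" "zt l = abs_L2 (Z l)" and W: "W l : Cc" "th l = abs_L2 (W l)" if "l < n" for l
  using that by simp_all
 define X where "X u = (\<Sum>l<n. twist (P l) (Z l) u)" for u
 define Y where "Y u = (\<Sum>l<n. twist (Q l) (W l) u)" for u
 have gram: "(%u. \<Sum>l<n. \<Sum>l'<n. cinner (twist (P l) (Z l) u) (twist (P l') (Z l') u)) : Cc"
  "(LI u. (\<Sum>l<n. \<Sum>l'<n. cinner (twist (P l) (Z l) u) (twist (P l') (Z l') u)))
   = (\<Sum>l<n. \<Sum>l'<n. cinner (abs_L2 (P l)) (abs_L2 (P l'))*cinner (abs_L2 (Z l)) (abs_L2 (Z l')))"
  if "!!l. l < n ==> P l : Cc" "!!l. l < n ==> Z l : Cc" for P Z :: "nat => 'g => complex"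
 proof -
  show "(%u. \<Sum>l<n. \<Sum>l'<n. cinner (twist (P l) (Z l) u) (twist (P l') (Z l') u)) : Cc"
   using that by (intro Cc_sum twist_cinner(1)) auto
  have i: "integrable haar (%u. cinner (twist (P l) (Z l) u) (twist (P l') (Z l') u))" if "l < n" "l' < n" for l l'
   using that by (intro Cc_integrable twist_cinner(1) \<open>!!l. l < n ==> P l : Cc\<close> \<open>!!l. l < n ==> Z l : Cc\<close>)
  show "(LI u. (\<Sum>l<n. \<Sum>l'<n. cinner (twist (P l) (Z l) u) (twist (P l') (Z l') u)))
   = (\<Sum>l<n. \<Sum>l'<n. cinner (abs_L2 (P l)) (abs_L2 (P l'))*cinner (abs_L2 (Z l)) (abs_L2 (Z l')))"
   by (subst Bi_sum; intro sum.cong refl BI_sum i; simp?)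
    (subst Bi_sum; intro sum.cong refl twist_cinner(2) that i; simp)
 qed
 note gX = gram[of P Z] and gY = gram[of Q W]
 have XX: "(\<Sum>l<n. \<Sum>l'<n. cinner (twist (P l) (Z l) u) (twist (P l') (Z l') u)) = cinner (X u) (X u)"
  and YY: "(\<Sum>l<n. \<Sum>l'<n. cinner (twist (Q l) (W l) u) (twist (Q l') (W l') u)) = cinner (Y u) (Y u)" for u
  unfolding X_def Y_def cinner_sum_left by (simp_all only: cinner_sum_right)
 have Xi: "integrable haar (%u. cinner (X u) (X u))" and Yi: "integrable haar (%u. cinner (Y u) (Y u))"
  using Cc_integrable[OF gX(1)] Cc_integrable[OF gY(1)] P Z Q W unfolding XX YY by auto
 have SC: "(%u. cinner (S (twist (P l) (Z l) u)) (twist (Q k) (W k) u)) : Cc" if "l < n" "k < n" for k l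
  using that by (intro slice_coeff_integral(1) P Q Z W)
 have SXY: "(\<Sum>k<n. \<Sum>l<n. cinner (S (twist (P l) (Z l) u)) (twist (Q k) (W k) u)) = cinner (S (X u)) (Y u)" for u
  by (simp add: X_def Y_def blinfun.sum_right cinner_sum_left cinner_sum_right)
 have SCi: "integrable haar (%u. cinner (S (X u)) (Y u))"
  unfolding SXY[symmetric] using SC by (intro Cc_integrable Cc_sum) auto
 have eq: "cinner (lam (slice (p l) (q k)) (zt l)) (th k) = (LI u. cinner (S (twist (P l) (Z l) u)) (twist (Q k) (W k) u))"
  if "l < n" "k < n" for k l
 proof -
  have i: "integrable haar (slice (p l) (q k))" using that by (intro Cc_integrable slice_Cc p q)
  show ?thesis unfolding lam(3)[OF i] unfolding P(2)[OF that(1)] Q(2)[OF that(2)] Z(2)[OF that(1)] W(2)[OF that(2)]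
   by (rule slice_coeff_integral(2)) (use that P Q Z W in auto)
 qed
 have "(\<Sum>k<n. \<Sum>l<n. cinner (lam (slice (p l) (q k)) (zt l)) (th k)) = (LI u. cinner (S (X u)) (Y u))"
  unfolding SXY[symmetric] 
  by (subst Bi_sum; intro sum.cong refl BI_sum Cc_integrable SC; simp?)
   (subst Bi_sum; intro sum.cong refl eq Cc_integrable SC; simp)
 also have "cmod \<dots> <= (LI u. cmod (cinner (S (X u)) (Y u)))" by (rule integral_norm_bound)
 also have "\<dots> <= (LI u. (Re (cinner (X u) (X u)) + Re (cinner (Y u) (Y u))) / 2)"
 proof (rule integral_mono)
  show "integrable haar (%u. cmod (cinner (S (X u)) (Y u)))" by (rule integrable_norm[OF SCi])
  show "integrable haar (%u. (Re (cinner (X u) (X u)) + Re (cinner (Y u) (Y u))) / 2)"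
   using Xi Yi by (intro integrable_divide_zero BI_add integrable_Re)
  show "cmod (cinner (S (X u)) (Y u)) <= (Re (cinner (X u) (X u)) + Re (cinner (Y u) (Y u))) / 2" for u
   using S_bound[of "X u" "Y u"] sum_squares_bound[of "norm (X u)" "norm (Y u)"] by (simp add: cinner_self)
 qed
 also have "\<dots> = (Re (LI u. cinner (X u) (X u)) + Re (LI u. cinner (Y u) (Y u))) / 2"
  using Xi Yi by (simp add: integral_Re)
 finally show ?thesis
  unfolding XX[symmetric] YY[symmetric] using gX(2) gY(2) P Q Z W by simp
qed

text \<open>Both sides are continuous in the second legs \<open>zt\<close> and \<open>th\<close>,
  which may therefore be arbitrary; the first legs stay in \<open>Cc_L2\<close>, where slices are
  compactly supported.\<close>

lemma slice_gram:
 fixes p q zt th :: "nat => 'g L2"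
 assumes p: "!!l. l < n ==> p l : Cc_L2" and q: "!!k. k < n ==> q k : Cc_L2"
 shows "cmod (\<Sum>k<n. \<Sum>l<n. cinner (lam (slice (p l) (q k)) (zt l)) (th k))
  <= (Re (\<Sum>l<n. \<Sum>l'<n. cinner (p l) (p l')*cinner (zt l) (zt l'))
   + Re (\<Sum>l<n. \<Sum>l'<n. cinner (q l) (q l')*cinner (th l) (th l'))) / 2"
proof -
 have seq: "EX z. ALL l. (ALL m. z l m : Cc_L2) & z l \<longlonglongrightarrow> y l" for y :: "nat => 'g L2"
  by (rule choice) (use Cc_L2_dense closure_sequential[of _ "Cc_L2 :: 'g L2 set"] in auto)
 obtain z where z: "ALL l. (ALL m. z l m : Cc_L2) & z l \<longlonglongrightarrow> zt l" using seq[of zt] by (elim exE)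
 obtain w where w: "ALL l. (ALL m. w l m : Cc_L2) & w l \<longlonglongrightarrow> th l" using seq[of th] by (elim exE)
 have zl: "z l \<longlonglongrightarrow> zt l" and wl: "w l \<longlonglongrightarrow> th l" for l using z w by auto
 show ?thesis
 proof (rule LIMSEQ_le)
  show "(%m. cmod (\<Sum>k<n. \<Sum>l<n. cinner (lam (slice (p l) (q k)) (z l m)) (w k m)))
   \<longlonglongrightarrow> cmod (\<Sum>k<n. \<Sum>l<n. cinner (lam (slice (p l) (q k)) (zt l)) (th k))"
   by (intro tendsto_norm tendsto_sum tendsto_cinner blinfun.tendsto tendsto_const zl wl)
  show "(%m. (Re (\<Sum>l<n. \<Sum>l'<n. cinner (p l) (p l')*cinner (z l m) (z l' m))
   + Re (\<Sum>l<n. \<Sum>l'<n. cinner (q l) (q l')*cinner (w l m) (w l' m))) / 2)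
   \<longlonglongrightarrow> (Re (\<Sum>l<n. \<Sum>l'<n. cinner (p l) (p l')*cinner (zt l) (zt l'))
   + Re (\<Sum>l<n. \<Sum>l'<n. cinner (q l) (q l')*cinner (th l) (th l'))) / 2"
   by (intro tendsto_divide tendsto_add tendsto_Re tendsto_sum tendsto_mult tendsto_cinner tendsto_const zl wl) simp
  show "EX N. ALL m>=N. cmod (\<Sum>k<n. \<Sum>l<n. cinner (lam (slice (p l) (q k)) (z l m)) (w k m))
   <= (Re (\<Sum>l<n. \<Sum>l'<n. cinner (p l) (p l')*cinner (z l m) (z l' m))
   + Re (\<Sum>l<n. \<Sum>l'<n. cinner (q l) (q l')*cinner (w l m) (w l' m))) / 2"
   by (intro exI allI impI slice_gram_Cc p q) (use z w in auto)
 qed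
qed

text \<open>Tested against its own image \<open>th\<close>, the Gram estimate reads
  \<open>x \<le> (y + x) / 2\<close>, hence \<open>x \<le> y\<close>.\<close>

lemma slice_matrix_contraction:
 fixes c :: "nat => 'g L2"
 assumes c: "!!l. l < m ==> c l : Cc_L2"
  and on: "!!i j. i < m ==> j < m ==> cinner (c i) (c j) = (if i = j then 1 else 0)"
 shows "(\<Sum>k<m. (norm (\<Sum>l<m. lam (slice (c l) (c k)) (zt l)))\<^sup>2) <= (\<Sum>l<m. (norm (zt l))\<^sup>2)"
proof -
 define th where "th k = (\<Sum>l<m. lam (slice (c l) (c k)) (zt l))" for k
 have gram: "Re (\<Sum>l<m. \<Sum>l'<m. cinner (c l) (c l')*cinner (y l) (y l')) = (\<Sum>l<m. (norm (y l))\<^sup>2)" for y :: "nat => 'g L2"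
 proof -
  have "(\<Sum>l<m. \<Sum>l'<m. cinner (c l) (c l')*cinner (y l) (y l')) = (\<Sum>l<m. \<Sum>l'<m. if l' = l then cinner (y l) (y l) else 0)"
   by (intro sum.cong refl) (auto simp: on)
  also have "\<dots> = cor (\<Sum>l<m. (norm (y l))\<^sup>2)" by (simp add: cinner_self)
  finally show ?thesis by simp
 qed
 have "(\<Sum>k<m. \<Sum>l<m. cinner (lam (slice (c l) (c k)) (zt l)) (th k)) = cor (\<Sum>k<m. (norm (th k))\<^sup>2)"
  by (simp add: cinner_sum_left[symmetric] th_def[symmetric] cinner_self)
 then have "cmod (\<Sum>k<m. \<Sum>l<m. cinner (lam (slice (c l) (c k)) (zt l)) (th k)) = (\<Sum>k<m. (norm (th k))\<^sup>2)"
  by (simp only: norm_of_real) (simp add: sum_nonneg)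
 then show ?thesis using slice_gram[of m c c zt th] c unfolding gram th_def by simp
qed

text \<open>Scaling \<open>xi\<close> by \<open>sqrt t\<close> and \<open>eta\<close> by its inverse
  leaves the left side fixed, and optimising over \<open>t\<close> turns the arithmetic mean into a
  product.\<close>

lemma slice_coeff_bound:
 assumes p: "p : Cc_L2" and q: "q : Cc_L2"
 shows "cmod (LI r. slice p q r*fourier_coeff xi eta r) <= norm p*norm q*norm xi*norm eta"
proof -
 have lam_slice: "(LI r. slice p q r*fourier_coeff xi eta r) = cinner (lam (slice p q) xi) eta" for xi eta
  by (rule lam(3)[OF Cc_integrable[OF slice_Cc[OF p q]], symmetric])
 have "cmod (cinner (lam (slice p q) xi) eta) <= (norm p*norm xi)*(norm q*norm eta)"
 proof (rule amgm_scale)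
  fix t :: real assume t: "0 < t"
  have lb: "lam (slice p q) : bounded_ops" by (rule lam(1)[OF Cc_integrable[OF slice_Cc[OF p q]]])
  have 1: "cor (sqrt t)*cor (inverse (sqrt t)) = 1" using t by (simp flip: of_real_mult)
  have 2: "(cmod (cor (sqrt t)))\<^sup>2 = t" "(cmod (cor (inverse (sqrt t))))\<^sup>2 = 1 / t"
   using t by (simp_all only: norm_of_real power2_abs) (simp_all add: power_divide inverse_eq_divide)
  have "cinner (lam (slice p q) xi) eta = cinner (lam (slice p q) (cor (sqrt t) *\<^sub>C xi)) (cor (inverse (sqrt t)) *\<^sub>C eta)"
   using 1 by (simp add: bounded_ops_scaleC[OF lb] cinner_scaleC_left cinner_scaleC_right mult.assoc[symmetric] mult.commute del: of_real_inverse)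
  also have "cmod \<dots> <= (Re (cinner p p*cinner (cor (sqrt t) *\<^sub>C xi) (cor (sqrt t) *\<^sub>C xi))
    + Re (cinner q q*cinner (cor (inverse (sqrt t)) *\<^sub>C eta) (cor (inverse (sqrt t)) *\<^sub>C eta))) / 2"
   using slice_gram[of 1 "%_. p" "%_. q" "%_. cor (sqrt t) *\<^sub>C xi" "%_. cor (inverse (sqrt t)) *\<^sub>C eta"] p q
   by simp
  also have "\<dots> = (t*(norm p*norm xi)\<^sup>2 + (norm q*norm eta)\<^sup>2 / t) / 2"
   unfolding cinner_self norm_scaleC of_real_mult[symmetric] Re_complex_of_real power_mult_distrib 2
   by (simp add: mult_ac)
  finally show "cmod (cinner (lam (slice p q) xi) eta) <= (t*(norm p*norm xi)\<^sup>2 + (norm q*norm eta)\<^sup>2 / t) / 2" .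
 qed simp_all
 then show ?thesis unfolding lam_slice by (simp add: mult_ac)
qed

end

section \<open>The completely bounded estimate for weighted slices\<close>

lemma sum_swap4:
 fixes f :: "'a => 'b => 'c => 'd => 'e::comm_monoid_add"
 shows "(\<Sum>i\<in>A. \<Sum>j\<in>B. \<Sum>k\<in>C. \<Sum>l\<in>D. f i j k l) = (\<Sum>k\<in>C. \<Sum>l\<in>D. \<Sum>i\<in>A. \<Sum>j\<in>B. f i j k l)"
proof -
 have "(\<Sum>i\<in>A. \<Sum>j\<in>B. \<Sum>k\<in>C. \<Sum>l\<in>D. f i j k l) = (\<Sum>i\<in>A. \<Sum>k\<in>C. \<Sum>j\<in>B. \<Sum>l\<in>D. f i j k l)"
  by (rule sum.cong[OF refl], rule sum.swap)
 also have "\<dots> = (\<Sum>k\<in>C. \<Sum>i\<in>A. \<Sum>j\<in>B. \<Sum>l\<in>D. f i j k l)" by (rule sum.swap)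
 also have "\<dots> = (\<Sum>k\<in>C. \<Sum>i\<in>A. \<Sum>l\<in>D. \<Sum>j\<in>B. f i j k l)"
  by (rule sum.cong[OF refl], rule sum.cong[OF refl], rule sum.swap)
 also have "\<dots> = (\<Sum>k\<in>C. \<Sum>l\<in>D. \<Sum>i\<in>A. \<Sum>j\<in>B. f i j k l)"
  by (rule sum.cong[OF refl], rule sum.swap)
 finally show ?thesis .
qed

lemma integral_sum2:
 fixes f :: "'a => 'b => 'c => 'd::{banach, second_countable_topology}"
 assumes f: "!!i j. i : A ==> j : B ==> integrable M (f i j)"
 shows "(LINT x|M. (\<Sum>i\<in>A. \<Sum>j\<in>B. f i j x)) = (\<Sum>i\<in>A. \<Sum>j\<in>B. LINT x|M. f i j x)"
proof -
 have "(LINT x|M. (\<Sum>i\<in>A. \<Sum>j\<in>B. f i j x)) = (\<Sum>i\<in>A. LINT x|M. (\<Sum>j\<in>B. f i j x))"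
  by (rule Bi_sum, rule BI_sum, rule f)
 also have "\<dots> = (\<Sum>i\<in>A. \<Sum>j\<in>B. LINT x|M. f i j x)"
  by (rule sum.cong[OF refl], rule Bi_sum, rule f)
 finally show ?thesis .
qed

text \<open>Both sides are the squared norm of the tensor \<open>\<Sum> p l \<otimes> xi l\<close>,
  on the right in orthonormal coordinates.\<close>

lemma gram_expansion:
 fixes c e :: "nat => 'h::complex_inner"
 assumes c: "!!i j. i < m ==> j < m ==> cinner (c i) (c j) = (if i = j then 1 else 0)"
  and e: "!!i j. i < n ==> j < n ==> cinner (e i) (e j) = (if i = j then 1 else 0)"
  and p: "!!l. l : F ==> p l = (\<Sum>j<m. al l j *\<^sub>C c j)" and xi: "!!l. l : F ==> xi l = (\<Sum>j<n. ga l j *\<^sub>C e j)"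
 shows "Re (\<Sum>l\<in>F. \<Sum>l'\<in>F. cinner (p l) (p l')*cinner (xi l) (xi l'))
  = (\<Sum>j<n. \<Sum>j'<m. (cmod (\<Sum>l\<in>F. ga l j*al l j'))\<^sup>2)"
proof -
 have on: "cinner (\<Sum>j<n. z j *\<^sub>C c j) (\<Sum>j<n. w j *\<^sub>C c j) = (\<Sum>j<n. z j*cnj (w j))"
  if c: "!!i j. i < n ==> j < n ==> cinner (c i) (c j) = (if i = j then 1 else 0)"
  for c :: "nat => 'h" and n z w
 proof -
  have "cinner (\<Sum>j<n. z j *\<^sub>C c j) (\<Sum>j<n. w j *\<^sub>C c j) = (\<Sum>j<n. \<Sum>i<n. if i = j then z j*cnj (w j) else 0)"
   unfolding cinner_sum_left unfolding cinner_sum_right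
   using c by (intro sum.cong refl) (auto simp: cinner_scaleC_left cinner_scaleC_right)
  also have "\<dots> = (\<Sum>j<n. z j*cnj (w j))" by (intro sum.cong refl) simp
  finally show ?thesis .
 qed
 let ?g = "%l j j'. ga l j*al l j'"
 have "(\<Sum>l\<in>F. \<Sum>l'\<in>F. cinner (p l) (p l')*cinner (xi l) (xi l'))
   = (\<Sum>l\<in>F. \<Sum>l'\<in>F. \<Sum>j<n. \<Sum>j'<m. ?g l j j'*cnj (?g l' j j'))"
 proof (intro sum.cong refl)
  fix l l' assume "l : F" "l' : F"
  then have "cinner (p l) (p l')*cinner (xi l) (xi l') = (\<Sum>j<n. ga l j*cnj (ga l' j))*(\<Sum>j'<m. al l j'*cnj (al l' j'))"
   by (simp add: p xi on[OF c] on[OF e] mult.commute)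
  then show "cinner (p l) (p l')*cinner (xi l) (xi l') = (\<Sum>j<n. \<Sum>j'<m. ?g l j j'*cnj (?g l' j j'))"
   unfolding sum_product by (simp add: mult_ac)
 qed
 also have "\<dots> = (\<Sum>j<n. \<Sum>j'<m. \<Sum>l\<in>F. \<Sum>l'\<in>F. ?g l j j'*cnj (?g l' j j'))" by (rule sum_swap4)
 also have "\<dots> = (\<Sum>j<n. \<Sum>j'<m. cor ((cmod (\<Sum>l\<in>F. ?g l j j'))\<^sup>2))"
  unfolding complex_norm_square cnj_sum sum_product ..
 finally show ?thesis by (simp del: of_real_power)
qed

lemma fourier_coeff_Cc:
 fixes P Q :: "'g::locally_compact_group => complex"
 assumes P: "P : Cc" and Q: "Q : Cc"
 shows "fourier_coeff (abs_L2 P) (abs_L2 Q) : Cc"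
  "fourier_coeff (abs_L2 P) (abs_L2 Q) r = (LI s. P (- r + s)*cnj (Q s))"
proof -
 obtain K where K: "cont P" "compact K" "!!x. x ~: K ==> P x = 0" using P by (rule CcE) blast
 obtain L where L: "cont Q" "compact L" "!!x. x ~: L ==> Q x = 0" using Q by (rule CcE) blast
 show eq: "fourier_coeff (abs_L2 P) (abs_L2 Q) r = (LI s. P (- r + s)*cnj (Q s))" for r
  unfolding fourier_coeff_def left_reg_Cc[OF P] cinner_Cc[OF Cc_translate_left[OF P] Q] ..
 define M where "M = (%(x, y). x + y) ` (L \<times> uminus ` K)"
 have M: "compact M" unfolding M_def by (intro compact_plus L compact_uminus K)
 show "fourier_coeff (abs_L2 P) (abs_L2 Q) : Cc"
 proof (rule CcI[OF fourier_coeff_continuous M])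
  fix r assume r: "r ~: M"
  have "P (- r + s)*cnj (Q s) = 0" for s
  proof (rule ccontr)
   assume "P (- r + s)*cnj (Q s) ~= 0"
   then have "s : L" "- r + s : K" using K(3) L(3) by auto
   then have "s + - (- r + s) : M" unfolding M_def by (intro plus_image_mem imageI)
   then show False using r by (simp add: minus_add add.assoc[symmetric] del: add_uminus_conv_diff)
  qed
  then have "(%s. P (- r + s)*cnj (Q s)) = (%_. 0)" by (intro ext)
  then show "fourier_coeff (abs_L2 P) (abs_L2 Q) r = 0" unfolding eq by simp
 qed
qed

lemma translation_partition:
 fixes K W :: "'g::locally_compact_group set"
 assumes K: "compact K" and W: "open W" "0 : W"
 shows "EX (F :: 'g set) ka. finite F &
  (ALL t. cont (ka t) & (ALL x. 0 <= ka t x & (ka t x ~= 0 --> - t + x : W))) &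
  (ALL x:K. (\<Sum>t\<in>F. ka t x) = (1::real))"
proof (cases "K = {}")
 case True
 then show ?thesis by (intro exI[of _ "{}"] exI[of _ "%_ _. 0"]) simp
next
 case False
 have "EX g :: 'g => real. cont g & (ALL x. 0 <= g x & (g x ~= 0 --> - t + x : W)) & g t = 1" for t
 proof -
  have "open ((%x. - t + x) -` W)" by (rule open_vimage[OF W(1)]) (intro continuous_intros)
  moreover have "{t} \<subseteq> (%x. - t + x) -` W" using W(2) by simp
  ultimately have "EX h :: 'g => real. cont h & (ALL x. 0 <= h x & h x <= 1) &
   (ALL x:{t}. h x = 1) & (ALL x. x ~: (%x. - t + x) -` W --> h x = 0) & (EX L. compact L & (ALL x. x ~: L --> h x = 0))"
   by (intro bump_function) auto
  then show ?thesis by (elim exE) (rule exI, auto)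
 qed
 then obtain g :: "'g => 'g => real" where gg: "ALL t. cont (g t) & (ALL x. 0 <= g t x & (g t x ~= 0 --> - t + x : W)) & g t t = 1"
  by metis
 then have g: "cont (g t)" "0 <= g t x" "g t x ~= 0 ==> - t + x : W" "g t t = 1" for t x by auto
 have op: "open {x. 0 < g t x}" for t by (rule open_Collect_less[OF continuous_on_const g(1)])
 obtain F where F: "F \<subseteq> K" "finite F" "K \<subseteq> (\<Union>t\<in>F. {x. 0 < g t x})"
  by (rule compactE_image[OF K, of K "%t. {x. 0 < g t x}"]) (use op g(4) in auto)
 define G where "G x = (\<Sum>t\<in>F. g t x)" for x
 have Gc: "cont G" unfolding G_def by (intro continuous_intros g(1))
 have Gpos: "0 < G x" if x: "x : K" for x
 proof -
  obtain t where t: "t : F" "0 < g t x" using F(3) x by blast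
  have "g t x <= G x" unfolding G_def by (rule member_le_sum) (use t F g in auto)
  then show ?thesis using t by simp
 qed
 obtain x0 where x0: "x0 : K" "!!x. x : K ==> G x0 <= G x"
  using continuous_attains_inf[OF K False continuous_on_subset[OF Gc]] by auto
 \<comment> \<open>Taking the maximum with the least value of \<open>G\<close> on \<open>K\<close>
   changes nothing on \<open>K\<close> and gives a positive continuous denominator
   everywhere.\<close>
 define G' where "G' x = max (G x) (G x0)" for x
 have G'pos: "0 < G' x" for x using Gpos[OF x0(1)] by (simp add: G'_def)
 have G'c: "cont G'" unfolding G'_def by (intro continuous_intros Gc)
 define ka where "ka t x = g t x / G' x" for t x
 show ?thesis
 proof (intro exI conjI allI ballI impI)
  show "finite F" by (rule F)
  show "cont (ka t)" for t unfolding ka_def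
   by (intro continuous_on_divide g(1) G'c ballI) (use G'pos in \<open>simp add: less_imp_neq[symmetric]\<close>)
  show "0 <= ka t x" for t x using g(2) G'pos by (simp add: ka_def less_imp_le)
  show "- t + x : W" if "ka t x ~= 0" for t x using g(3) that by (auto simp: ka_def)
  show "(\<Sum>t\<in>F. ka t x) = 1" if "x : K" for x
  proof -
   have "(\<Sum>t\<in>F. ka t x) = G x / G' x" by (simp add: ka_def G_def sum_divide_distrib)
   also have "G' x = G x" using x0(2)[OF that] by (simp add: G'_def)
   finally show ?thesis using Gpos[OF that] by simp
  qed
 qed
qed

lemma unit_vector_exists: "EX zt :: 'g::locally_compact_group L2. norm zt = 1"
proof -
 define f where "f x = cor (haar_unit x)" for x :: 'g
 have f: "f : Cc" unfolding f_def by (rule haar_unit(1))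
 have "norm (abs_L2 f) ~= 0"
 proof
  assume "norm (abs_L2 f) = 0"
  then have "cinner (abs_L2 f) (abs_L2 f) = 0" by simp
  then have "f t = 0" for t unfolding cinner_Cc[OF f f] by (rule Cc_integral_sq_0[OF f])
  then have "haar_unit = (%_ :: 'g. 0 :: real)" by (simp add: fun_eq_iff f_def)
  then have "(LI t. haar_unit (t :: 'g)) = (LINT t|(haar :: 'g measure). 0)" by (simp only:)
  then show False unfolding haar_unit(3) by simp
 qed
 then have "norm (inverse (norm (abs_L2 f)) *\<^sub>R abs_L2 f) = 1" by simp
 then show ?thesis ..
qed

text \<open>Pulling back by \<open>left_reg s\<close> turns the coefficient into
  \<open>cinner x y\<close> with \<open>x\<close> and \<open>y\<close> both within \<open>ep\<close>
  of the unit vector \<open>zt\<close>. The point \<open>s\<close> only witnesses this; it does not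
  occur in the coefficient.\<close>

lemma coeff_close:
 fixes zt :: "'g::locally_compact_group L2"
 assumes zt: "norm zt = 1" and l: "norm (left_reg (- l + (- r + s)) zt - zt) <= ep"
  and k: "norm (left_reg (- k + s) zt - zt) <= ep"
 shows "cmod (1 - fourier_coeff (left_reg l zt) (left_reg k zt) r) <= 2*ep"
proof -
 have inv: "norm (left_reg (- w) zt - zt) = norm (left_reg w zt - zt)" for w
 proof -
  have "norm (left_reg (- w) zt - zt) = norm (left_reg w (left_reg (- w) zt - zt))" by simp
  also have "\<dots> = norm (zt - left_reg w zt)" by (simp add: blinfun.diff_right left_reg_add[symmetric])
  finally show ?thesis by (simp add: norm_minus_commute)
 qed
 define x where "x = left_reg (- (- l + (- r + s))) zt"
 define y where "y = left_reg (- (- k + s)) zt"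
 have x: "norm (x - zt) <= ep" and y: "norm (y - zt) <= ep" using l k by (simp_all only: x_def y_def inv)
 have sx: "left_reg r (left_reg l zt) = left_reg s x" and sy: "left_reg k zt = left_reg s y"
  by (simp_all add: x_def y_def left_reg_add[symmetric] minus_add add.assoc[symmetric] del: add_uminus_conv_diff)
 have "fourier_coeff (left_reg l zt) (left_reg k zt) r = cinner x y"
  unfolding fourier_coeff_def sx sy by (simp add: left_reg_cinner left_reg_add[symmetric])
 moreover have "cinner x y - 1 = cinner (x - zt) y + cinner zt (y - zt)"
  using cinner_self[of zt] zt by (simp add: cinner_diff_left cinner_diff_right)
 moreover have "cmod (cinner (x - zt) y) <= ep" "cmod (cinner zt (y - zt)) <= ep"
  using cinner_norm_le[of "x - zt" y] cinner_norm_le[of zt "y - zt"] x y zt by (simp_all add: y_def)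
 ultimately show ?thesis
  using norm_triangle_ineq[of "cinner (x - zt) y" "cinner zt (y - zt)"] by (simp add: norm_minus_commute[of 1])
qed

context operator_slices
begin

text \<open>The coefficient is kept apart from the weight because it is the element of A(G) on which
  the multiplier \<open>ph\<close> acts.\<close>

definition wint :: "('g => complex) => 'g L2 => 'g L2 => 'g L2 => 'g L2 => complex"
 where "wint ph p q xi eta = (LI r. slice p q r*fourier_coeff xi eta r*ph r)"

lemma Linf_Cc_integrable:
 assumes "ph : Linf" "f : Cc" shows "integrable haar (%r. f r*ph r)"
proof -
 obtain C where "loc_AE (%t. cmod (ph t) <= C)" using Linf_bound[OF assms(1)] by auto
 then show ?thesis using assms by (intro Linf_mult_L1(1)[OF Cc_integrable]) (auto simp: Linf_def)
qed

lemma wint_integrable: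
 assumes "ph : Linf" "p : Cc_L2" "q : Cc_L2"
 shows "integrable haar (%r. slice p q r*fourier_coeff xi eta r*ph r)"
 by (intro Linf_Cc_integrable Cc_mult_right slice_Cc assms fourier_coeff_continuous)

lemma wint_expand_left:
 assumes ph: "ph : Linf" and c: "!!j. j < m ==> c j : Cc_L2" and q: "q : Cc_L2"
 shows "wint ph (\<Sum>j<m. al j *\<^sub>C c j) q (\<Sum>j<n. ga j *\<^sub>C e j) eta
  = (\<Sum>j<n. \<Sum>j'<m. ga j*al j'*wint ph (c j') q (e j) eta)"
proof -
 have f: "fourier_coeff (\<Sum>j<n. ga j *\<^sub>C e j) eta r = (\<Sum>j<n. ga j*fourier_coeff (e j) eta r)" for r
  by (simp add: fourier_coeff_def blinfun.sum_right bounded_ops_scaleC cinner_sum_left cinner_scaleC_left)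
 have "slice (\<Sum>j<m. al j *\<^sub>C c j) q r*fourier_coeff (\<Sum>j<n. ga j *\<^sub>C e j) eta r*ph r
  = (\<Sum>j<n. \<Sum>j'<m. ga j*al j'*(slice (c j') q r*fourier_coeff (e j) eta r*ph r))" for r
 proof -
  have "slice (\<Sum>j<m. al j *\<^sub>C c j) q r*fourier_coeff (\<Sum>j<n. ga j *\<^sub>C e j) eta r*ph r
   = (\<Sum>j<n. ga j*fourier_coeff (e j) eta r)*(\<Sum>j'<m. al j' * slice (c j') q r)*ph r"
   unfolding slice_sum slice_scale f by (simp only: mult_ac)
  then show ?thesis unfolding sum_product unfolding sum_distrib_right by (simp only: mult_ac)
 qed
 then show ?thesis unfolding wint_def
  by (simp only:) (subst integral_sum2, intro integrable_mult_right wint_integrable ph c q, simp_all)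
qed

lemma wint_expand_right:
 assumes ph: "ph : Linf" and c: "!!j. j < m ==> c j : Cc_L2" and p: "p : Cc_L2"
 shows "wint ph p (\<Sum>j<m. al j *\<^sub>C c j) xi (\<Sum>j<n. ga j *\<^sub>C e j)
  = (\<Sum>j<n. \<Sum>j'<m. cnj (ga j*al j')*wint ph p (c j') xi (e j))"
proof -
 have f: "fourier_coeff xi (\<Sum>j<n. ga j *\<^sub>C e j) r = (\<Sum>j<n. cnj (ga j)*fourier_coeff xi (e j) r)" for r
  by (simp add: fourier_coeff_def cinner_sum_right cinner_scaleC_right)
 have "slice p (\<Sum>j<m. al j *\<^sub>C c j) r*fourier_coeff xi (\<Sum>j<n. ga j *\<^sub>C e j) r*ph r
  = (\<Sum>j<n. \<Sum>j'<m. cnj (ga j*al j')*(slice p (c j') r*fourier_coeff xi (e j) r*ph r))" for r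
 proof -
  have "slice p (\<Sum>j<m. al j *\<^sub>C c j) r*fourier_coeff xi (\<Sum>j<n. ga j *\<^sub>C e j) r*ph r
   = (\<Sum>j<n. cnj (ga j)*fourier_coeff xi (e j) r)*(\<Sum>j'<m. cnj (al j') * slice p (c j') r)*ph r"
   unfolding slice_sum slice_scale f by (simp only: mult_ac)
  then show ?thesis unfolding sum_product unfolding sum_distrib_right by (simp only: mult_ac complex_cnj_mult)
 qed
 then show ?thesis unfolding wint_def
  by (simp only:) (subst integral_sum2, intro integrable_mult_right wint_integrable ph c p, simp_all)
qed

text \<open>\<open>fourier_mult ph\<close> picks the element of A(G) that agrees with
  \<open>ph\<close> times the coefficient up to a locally null set, and the integral against an
  integrable slice does not see such a set. The weighted integral thus becomes a pairing governed by
  the cb-norm.\<close>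

lemma wint_pairing:
 assumes ph: "ph : McbA" and p: "p : Cc_L2" and q: "q : Cc_L2"
 shows "wint ph p q xi eta = fourier_pairing (lam (slice p q)) (fourier_mult ph (fourier_coeff xi eta))"
proof -
 have v: "fourier_coeff xi eta : fourier_algebra" by (auto simp: fourier_algebra_def)
 note w = fourier_mult[OF ph v]
 have i: "integrable haar (slice p q)" by (intro Cc_integrable slice_Cc p q)
 have phL: "ph : Linf" using ph by (simp add: McbA_def)
 have "wint ph p q xi eta = (LI r. slice p q r*fourier_mult ph (fourier_coeff xi eta) r)"
  unfolding wint_def
 proof (rule integral_cong_AE)
  show "(%r. slice p q r*fourier_coeff xi eta r*ph r) : borel_measurable haar"
   by (rule borel_measurable_integrable[OF wint_integrable[OF phL p q]])
  have "cont (fourier_mult ph (fourier_coeff xi eta))"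
   using w(1) fourier_coeff_continuous by (auto simp: fourier_algebra_def)
  then show "(%r. slice p q r*fourier_mult ph (fourier_coeff xi eta) r) : borel_measurable haar"
   by (intro borel_measurable_integrable Cc_integrable Cc_mult_right slice_Cc p q)
  show "AE r in haar. slice p q r*fourier_coeff xi eta r*ph r = slice p q r*fourier_mult ph (fourier_coeff xi eta) r"
   using loc_AE_support[OF w(2) i] by eventually_elim (auto simp: mult_ac)
 qed
 then show ?thesis by (simp add: fourier_pairing_lam[OF i w(1)])
qed

text \<open>Orthonormal coordinates turn the double sum into the bilinear form of a scalar matrix at
  \<open>Z\<close> and \<open>W\<close>. These are the coordinates of
  \<open>\<Sum> p l \<otimes> xi l\<close> and the conjugate coordinates of
  \<open>\<Sum> q k \<otimes> xi k\<close>, and the two roots are their norms.\<close>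

lemma multiplier_gram:
 assumes ph: "ph : McbA" and C: "cb_bound (fourier_mult ph) C" and F: "finite F"
  and p: "!!l. l : F ==> p l : Cc_L2" and q: "!!l. l : F ==> q l : Cc_L2"
 shows "cmod (\<Sum>k\<in>F. \<Sum>l\<in>F. wint ph (p l) (q k) (xi l) (xi k))
  <= C * sqrt (Re (\<Sum>l\<in>F. \<Sum>l'\<in>F. cinner (p l) (p l')*cinner (xi l) (xi l')))
    * sqrt (Re (\<Sum>l\<in>F. \<Sum>l'\<in>F. cinner (q l) (q l')*cinner (xi l) (xi l')))"
proof -
 have phL: "ph : Linf" using ph by (simp add: McbA_def)
 \<comment> \<open>A single orthonormal system for both families, indexed by their disjoint sum:
   rows and columns of the contractive matrix of slices refer to the same vectors.\<close>
 have "EX (m::nat) c al. (ALL j<m. c j : Cc_L2) & (ALL j<m. ALL k<m. cinner (c j) (c k) = (if j = k then 1 else 0)) &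
  (ALL i:F <+> F. case_sum p q i = (\<Sum>j<m. al i j *\<^sub>C c j))"
  by (rule gram_schmidt) (use F p q Cc_L2_subspace in auto)
 then obtain m :: nat and c al where c0: "ALL j<m. c j : Cc_L2" "ALL j<m. ALL k<m. cinner (c j) (c k) = (if j = k then 1 else 0)"
  "ALL i:F <+> F. case_sum p q i = (\<Sum>j<m. al i j *\<^sub>C c j)" by (elim exE conjE)
 have c1: "c j : Cc_L2" if "j < m" for j using c0(1) that by blast
 have c2: "cinner (c j) (c k) = (if j = k then 1 else 0)" if "j < m" "k < m" for j k using c0(2) that by blast
 have p': "p l = (\<Sum>j<m. al (Inl l) j *\<^sub>C c j)" and q': "q l = (\<Sum>j<m. al (Inr l) j *\<^sub>C c j)" if "l : F" for l
  using bspec[OF c0(3) InlI[OF that]] bspec[OF c0(3) InrI[OF that]] by simp_all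
 have "EX (n::nat) e ga. (ALL j<n. e j : (UNIV :: 'g L2 set)) & (ALL j<n. ALL k<n. cinner (e j) (e k) = (if j = k then 1 else 0)) &
  (ALL i:F. xi i = (\<Sum>j<n. ga i j *\<^sub>C e j))"
  by (rule gram_schmidt) (use F cvec.subspace_UNIV in auto)
 then obtain n :: nat and e ga where e0: "ALL j<n. ALL k<n. cinner (e j) (e k) = (if j = k then 1 else 0)"
  "ALL i:F. xi i = (\<Sum>j<n. ga i j *\<^sub>C e j)" by (elim exE conjE)
 have e: "cinner (e j) (e k) = (if j = k then 1 else 0)" if "j < n" "k < n" for j k using e0 that by auto
 have xi': "xi l = (\<Sum>j<n. ga l j *\<^sub>C e j)" if "l : F" for l using e0 that by auto
 define Z where "Z j j' = (\<Sum>l\<in>F. ga l j*al (Inl l) j')" for j j'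
 define W where "W i i' = (\<Sum>k\<in>F. cnj (ga k i*al (Inr k) i'))" for i i'
 have cW: "cmod (W i i') = cmod (\<Sum>k\<in>F. ga k i*al (Inr k) i')" for i i'
  unfolding W_def cnj_sum[symmetric] by (rule complex_mod_cnj)
 define f where "f j j' i i' = wint ph (c j') (c i') (e j) (e i)" for j j' i i'
 have right: "(\<Sum>k\<in>F. wint ph (c j') (q k) (e j) (xi k)) = (\<Sum>i<n. \<Sum>i'<m. W i i'*f j j' i i')" if j': "j' < m" for j j'
 proof -
  have "(\<Sum>k\<in>F. wint ph (c j') (q k) (e j) (xi k)) = (\<Sum>k\<in>F. \<Sum>i<n. \<Sum>i'<m. cnj (ga k i*al (Inr k) i')*f j j' i i')"
   unfolding f_def by (intro sum.cong refl) (simp only: q' xi' wint_expand_right[OF phL c1 c1[OF j']])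
  also have "\<dots> = (\<Sum>i<n. \<Sum>k\<in>F. \<Sum>i'<m. cnj (ga k i*al (Inr k) i')*f j j' i i')" by (rule sum.swap)
  also have "\<dots> = (\<Sum>i<n. \<Sum>i'<m. \<Sum>k\<in>F. cnj (ga k i*al (Inr k) i')*f j j' i i')"
   by (rule sum.cong[OF refl], rule sum.swap)
  finally show ?thesis by (simp only: W_def sum_distrib_right)
 qed
 have left: "(\<Sum>l\<in>F. wint ph (p l) y (xi l) eta) = (\<Sum>j<n. \<Sum>j'<m. Z j j'*wint ph (c j') y (e j) eta)" if y: "y : Cc_L2" for y eta
 proof -
  have "(\<Sum>l\<in>F. wint ph (p l) y (xi l) eta) = (\<Sum>l\<in>F. \<Sum>j<n. \<Sum>j'<m. ga l j*al (Inl l) j'*wint ph (c j') y (e j) eta)"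
   by (intro sum.cong refl) (simp only: p' xi' wint_expand_left[OF phL c1 y])
  also have "\<dots> = (\<Sum>j<n. \<Sum>l\<in>F. \<Sum>j'<m. ga l j*al (Inl l) j'*wint ph (c j') y (e j) eta)" by (rule sum.swap)
  also have "\<dots> = (\<Sum>j<n. \<Sum>j'<m. \<Sum>l\<in>F. ga l j*al (Inl l) j'*wint ph (c j') y (e j) eta)"
   by (rule sum.cong[OF refl], rule sum.swap)
  finally show ?thesis by (simp only: Z_def sum_distrib_right)
 qed
 have "(\<Sum>k\<in>F. \<Sum>l\<in>F. wint ph (p l) (q k) (xi l) (xi k)) = (\<Sum>k\<in>F. \<Sum>j<n. \<Sum>j'<m. Z j j'*wint ph (c j') (q k) (e j) (xi k))"
  by (intro sum.cong refl left q)
 also have "\<dots> = (\<Sum>j<n. \<Sum>k\<in>F. \<Sum>j'<m. Z j j'*wint ph (c j') (q k) (e j) (xi k))" by (rule sum.swap)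
 also have "\<dots> = (\<Sum>j<n. \<Sum>j'<m. \<Sum>k\<in>F. Z j j'*wint ph (c j') (q k) (e j) (xi k))"
  by (rule sum.cong[OF refl], rule sum.swap)
 also have "\<dots> = (\<Sum>j<n. \<Sum>j'<m. Z j j'*(\<Sum>i<n. \<Sum>i'<m. W i i'*f j j' i i'))"
  by (intro sum.cong refl) (simp add: sum_distrib_left[symmetric] right)
 also have "\<dots> = (\<Sum>j<n. \<Sum>j'<m. \<Sum>i<n. \<Sum>i'<m. Z j j'*(W i i'*f j j' i i'))" by (simp only: sum_distrib_left)
 also have "\<dots> = (\<Sum>i<n. \<Sum>i'<m. \<Sum>j<n. \<Sum>j'<m. Z j j'*(W i i'*f j j' i i'))" by (rule sum_swap4)
 also have "\<dots> = (\<Sum>i<n. \<Sum>i'<m. (\<Sum>j<n. \<Sum>j'<m. fourier_pairing (lam (slice (c j') (c i'))) (fourier_mult ph (fourier_coeff (e j) (e i)))*Z j j')*W i i')"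
  (is "_ = ?R") unfolding sum_distrib_right
  by (intro sum.cong refl) (use c1 in \<open>auto simp: f_def wint_pairing[OF ph] mult_ac\<close>)
 finally have eq: "(\<Sum>k\<in>F. \<Sum>l\<in>F. wint ph (p l) (q k) (xi l) (xi k)) = ?R" .
 have le: "cmod (\<Sum>k\<in>F. \<Sum>l\<in>F. wint ph (p l) (q k) (xi l) (xi k))
  <= C * sqrt (\<Sum>j<n. \<Sum>j'<m. (cmod (Z j j'))\<^sup>2) * sqrt (\<Sum>i<n. \<Sum>i'<m. (cmod (W i i'))\<^sup>2)"
  unfolding eq
  by (rule cb_apply[OF ph C]) (fact e, intro lam_VN Cc_integrable slice_Cc c1, assumption+, rule slice_matrix_contraction, (fact c1 c2)+)
 have "Re (\<Sum>l\<in>F. \<Sum>l'\<in>F. cinner (p l) (p l')*cinner (xi l) (xi l')) = (\<Sum>j<n. \<Sum>j'<m. (cmod (Z j j'))\<^sup>2)"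
  unfolding Z_def by (rule gram_expansion) (fact c2 e p' xi')+
 moreover have "Re (\<Sum>l\<in>F. \<Sum>l'\<in>F. cinner (q l) (q l')*cinner (xi l) (xi l')) = (\<Sum>j<n. \<Sum>j'<m. (cmod (W j j'))\<^sup>2)"
  unfolding cW by (rule gram_expansion) (fact c2 e q' xi')+
 ultimately show ?thesis using le by (simp only:)
qed

text \<open>The weights \<open>ka l x*ka l' x\<close> are nonnegative and the real parts of the
  inner products of unit vectors are at most 1. Replacing them by 1 leaves the square of the
  partition sum, which is 1 wherever \<open>P\<close> is nonzero.\<close>

lemma partition_gram:
 assumes F: "finite F" and P: "P : Cc" and ka: "!!t. cont (ka t)" "!!t x. 0 <= ka t x"
  and sum1: "!!x. P x ~= 0 ==> (\<Sum>t\<in>F. ka t x) = (1::real)" and xi: "!!t. norm (xi t) = 1"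
 shows "Re (\<Sum>l\<in>F. \<Sum>l'\<in>F. cinner (abs_L2 (%x. cor (ka l x)*P x)) (abs_L2 (%x. cor (ka l' x)*P x))
   * cinner (xi l) (xi l' :: 'h::complex_inner)) <= (norm (abs_L2 P))\<^sup>2"
proof -
 have Pt: "(%x. cor (ka l x)*P x) : Cc" for l
  by (intro Cc_mult_left P continuous_intros ka)
 have sq: "cor (ka l x)*P x*cnj (cor (ka l' x)*P x) = cor (ka l x*ka l' x*(cmod (P x))\<^sup>2)" for x l l'
  by (simp add: complex_norm_square mult_ac del: of_real_power)
 have c: "cinner (abs_L2 (%x. cor (ka l x)*P x)) (abs_L2 (%x. cor (ka l' x)*P x))
  = cor (LI x. ka l x*ka l' x*(cmod (P x))\<^sup>2)" for l l'
  unfolding cinner_Cc[OF Pt Pt] sq by (rule integral_complex_of_real)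
 have i: "integrable haar (%x. ka l x*ka l' x*(cmod (P x))\<^sup>2)" for l l'
 proof -
  have "(%x. cor (ka l x*ka l' x*(cmod (P x))\<^sup>2)) : Cc"
   unfolding sq[symmetric] by (intro Cc_mult_right Pt Cc_continuous[OF Cc_cnj[OF Pt]])
  from Cc_integrable[OF this] show ?thesis unfolding complex_of_real_integrable_eq .
 qed
 have "Re (\<Sum>l\<in>F. \<Sum>l'\<in>F. cinner (abs_L2 (%x. cor (ka l x)*P x)) (abs_L2 (%x. cor (ka l' x)*P x))
   * cinner (xi l) (xi l')) = (\<Sum>l\<in>F. \<Sum>l'\<in>F. (LI x. ka l x*ka l' x*(cmod (P x))\<^sup>2)*Re (cinner (xi l) (xi l')))"
  unfolding c by simp
 also have "\<dots> <= (\<Sum>l\<in>F. \<Sum>l'\<in>F. (LI x. ka l x*ka l' x*(cmod (P x))\<^sup>2) * 1)"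
  by (intro sum_mono mult_left_mono integral_nonneg_AE AE_I2 order_trans[OF Re_cinner_le]) (simp_all add: xi ka)
 also have "\<dots> = (LI x. (\<Sum>l\<in>F. \<Sum>l'\<in>F. ka l x*ka l' x*(cmod (P x))\<^sup>2))"
  using i by (simp add: integral_sum2)
 also have "\<dots> = (LI x. (cmod (P x))\<^sup>2)"
 proof (rule Bi_cong[OF refl])
  fix x
  have "(\<Sum>l\<in>F. \<Sum>l'\<in>F. ka l x*ka l' x*(cmod (P x))\<^sup>2) = (\<Sum>l\<in>F. ka l x)*(\<Sum>l'\<in>F. ka l' x)*(cmod (P x))\<^sup>2"
   unfolding sum_product by (simp only: sum_distrib_right)
  then show "(\<Sum>l\<in>F. \<Sum>l'\<in>F. ka l x*ka l' x*(cmod (P x))\<^sup>2) = (cmod (P x))\<^sup>2"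
   using sum1[of x] by (cases "P x = 0") auto
 qed
 also have "\<dots> = (norm (abs_L2 P))\<^sup>2" by (simp add: norm_L2_abs[OF Cc_square_integrable[OF P]])
 finally show ?thesis .
qed

text \<open>Wherever both \<open>P\<close> and \<open>Q\<close> contribute, the products of
  partition functions add up to 1, so the relative error is a convex combination of terms
  \<open>1 - v k l\<close>, each at most \<open>ep\<close>. The number of pieces does not enter the
  bound, and its dependence on \<open>r\<close> is integrable.\<close>

lemma slice_partition_error:
 assumes P: "P : Cc" and Q: "Q : Cc" and ka: "!!t. cont (ka t)" "!!t x. 0 <= ka t x"
  and F: "finite F" and sumP: "!!x. P x ~= 0 ==> (\<Sum>t\<in>F. ka t x) = (1::real)"
  and sumQ: "!!x. Q x ~= 0 ==> (\<Sum>t\<in>F. ka t x) = 1"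
  and close: "!!l k s. ka l (- r + s) ~= 0 ==> ka k s ~= 0 ==> cmod (1 - v k l) <= ep" and ep: "0 <= ep"
 shows "cmod (slice (abs_L2 P) (abs_L2 Q) r - (\<Sum>k\<in>F. \<Sum>l\<in>F.
   slice (abs_L2 (%x. cor (ka l x)*P x)) (abs_L2 (%x. cor (ka k x)*Q x)) r * v k l))
  <= ep*hbound * sqrt (modular (- r))*(LI s. cmod (P (- r + s))*cmod (Q s))"
proof -
 have Pt: "(%x. cor (ka l x)*P x) : Cc" and Qt: "(%x. cor (ka l x)*Q x) : Cc" for l
  by (intro Cc_mult_left P Q continuous_intros ka)+
 define A where "A s = cor (sqrt (modular (- r)))*h r s*P (- r + s)*cnj (Q s)" for s
 define w where "w s = (\<Sum>k\<in>F. \<Sum>l\<in>F. cor (ka l (- r + s))*cor (ka k s) * v k l)" for s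
 note ci = continuous_intros h_continuous cont_comp[OF ka(1)] cont_comp[OF Cc_continuous[OF P]]
 have A: "A : Cc" unfolding A_def by (intro Cc_mult_left Cc_cnj Q ci)
 have Aw: "(%s. A s*(cor (ka l (- r + s))*cor (ka k s) * v k l)) : Cc" for k l
  by (intro Cc_mult_right A ci)
 have "(\<Sum>k\<in>F. \<Sum>l\<in>F. slice (abs_L2 (%x. cor (ka l x)*P x)) (abs_L2 (%x. cor (ka k x)*Q x)) r * v k l)
   = (\<Sum>k\<in>F. \<Sum>l\<in>F. LI s. A s*(cor (ka l (- r + s))*cor (ka k s) * v k l))"
  unfolding slice_Cc_eq[OF Pt Qt] Bi_mult_left_zero[symmetric]
  by (intro sum.cong refl Bi_cong) (simp add: A_def mult_ac)
 also have "\<dots> = (LI s. A s*w s)"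
  unfolding w_def sum_distrib_left by (rule integral_sum2[symmetric], rule Cc_integrable[OF Aw])
 finally have e: "slice (abs_L2 P) (abs_L2 Q) r - (\<Sum>k\<in>F. \<Sum>l\<in>F.
   slice (abs_L2 (%x. cor (ka l x)*P x)) (abs_L2 (%x. cor (ka k x)*Q x)) r * v k l)
  = (LI s. A s) - (LI s. A s*w s)"
  unfolding slice_Cc_eq[OF P Q] A_def by simp
 have Awi: "(%s. A s*w s) : Cc" unfolding w_def by (intro Cc_mult_right A ci)
 have "(LI s. A s) - (LI s. A s*w s) = (LI s. A s*(1 - w s))"
  using Cc_integrable[OF A] Cc_integrable[OF Awi] by (simp add: right_diff_distrib)
 also have "cmod \<dots> <= (LI s. cmod (A s*(1 - w s)))" by (rule integral_norm_bound)
 also have "\<dots> <= (LI s. ep*hbound * sqrt (modular (- r))*(cmod (P (- r + s))*cmod (Q s)))"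
 proof (rule integral_mono)
  have "(%s. A s*(1 - w s)) : Cc" unfolding w_def by (intro Cc_mult_right A ci)
  then show "integrable haar (%s. cmod (A s*(1 - w s)))" by (intro integrable_norm Cc_integrable)
  have "(%s. P (- r + s)*Q s) : Cc" by (intro Cc_mult_left Q ci)
  from integrable_norm[OF Cc_integrable[OF this]]
  show "integrable haar (%s. ep*hbound * sqrt (modular (- r))*(cmod (P (- r + s))*cmod (Q s)))"
   by (intro integrable_mult_right) (simp add: norm_mult)
  show "cmod (A s*(1 - w s)) <= ep*hbound * sqrt (modular (- r))*(cmod (P (- r + s))*cmod (Q s))" for s
  proof (cases "P (- r + s) = 0 \<or> Q s = 0")
   case True
   then show ?thesis by (auto simp: A_def)
  next
   case False
   have one: "(\<Sum>k\<in>F. \<Sum>l\<in>F. ka l (- r + s)*ka k s) = 1"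
    using False sumP[of "- r + s"] sumQ[of s] by (simp add: sum_distrib_right[symmetric] sum_distrib_left[symmetric])
   then have "1 = cor (\<Sum>k\<in>F. \<Sum>l\<in>F. ka l (- r + s)*ka k s)" by simp
   then have "1 - w s = (\<Sum>k\<in>F. \<Sum>l\<in>F. cor (ka l (- r + s)*ka k s)*(1 - v k l))"
    unfolding w_def by (simp add: right_diff_distrib sum_subtractf)
   also have "cmod \<dots> <= (\<Sum>k\<in>F. \<Sum>l\<in>F. (ka l (- r + s)*ka k s)*ep)"
   proof (intro sum_norm_le)
    fix k l
    show "cmod (cor (ka l (- r + s)*ka k s)*(1 - v k l)) <= (ka l (- r + s)*ka k s)*ep"
    proof (cases "ka l (- r + s) = 0 \<or> ka k s = 0")
     case False
     then have "cmod (1 - v k l) <= ep" using close by blast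
     then show ?thesis unfolding norm_mult[of _ "1 - v k l"] norm_of_real
      using ka(2) by (simp add: abs_of_nonneg mult_left_mono)
    qed auto
   qed
   also have "\<dots> = ep" using one by (simp add: sum_distrib_right[symmetric])
   finally have w1: "cmod (1 - w s) <= ep" .
   have "cmod (A s*(1 - w s)) = sqrt (modular (- r))*cmod (P (- r + s))*cmod (Q s)*(cmod (h r s)*cmod (1 - w s))"
    by (simp add: A_def norm_mult)
   also have "\<dots> <= sqrt (modular (- r))*cmod (P (- r + s))*cmod (Q s)*(hbound*ep)"
    by (intro mult_left_mono mult_mono h_bound w1 hbound_nonneg mult_nonneg_nonneg) simp_all
   finally show ?thesis by (simp add: mult_ac)
  qed
 qed
 finally show ?thesis unfolding e by simp
qed

end

subsection \<open>Multipliers\<close>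

text \<open>Expanding both families in orthonormal systems exhibits the sum as a sum of squares.\<close>

lemma gram_nonneg:
 fixes p :: "'i => 'h::complex_inner" and xi :: "'i => 'h"
 assumes F: "finite F"
 shows "0 <= Re (\<Sum>l\<in>F. \<Sum>l'\<in>F. cinner (p l) (p l')*cinner (xi l) (xi l'))"
proof -
 have gs: "EX (m::nat) c al. (ALL j<m. c j : (UNIV :: 'h set)) & (ALL j<m. ALL k<m. cinner (c j) (c k) = (if j = k then 1 else 0)) &
  (ALL i:F. p i = (\<Sum>j<m. al i j *\<^sub>C c j))" for p :: "'i => 'h"
  by (rule gram_schmidt) (use F cvec.subspace_UNIV in auto)
 obtain m :: nat and c al where c: "ALL j<m. ALL k<m. cinner (c j) (c k) = (if j = k then 1 else 0)"
  "ALL i:F. p i = (\<Sum>j<m. al i j *\<^sub>C c j)" using gs[of p] by (elim exE conjE)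
 obtain n :: nat and e ga where e: "ALL j<n. ALL k<n. cinner (e j) (e k) = (if j = k then 1 else 0)"
  "ALL i:F. xi i = (\<Sum>j<n. ga i j *\<^sub>C e j)" using gs[of xi] by (elim exE conjE)
 have "Re (\<Sum>l\<in>F. \<Sum>l'\<in>F. cinner (p l) (p l')*cinner (xi l) (xi l')) = (\<Sum>j<n. \<Sum>j'<m. (cmod (\<Sum>l\<in>F. ga l j*al l j'))\<^sup>2)"
  by (rule gram_expansion[where c=c and e=e]) (use c e in blast)+
 then show ?thesis by (simp add: sum_nonneg)
qed

context operator_slices
begin

text \<open>The constant 1 need not be a coefficient, but the slice splits into pieces on which
  coefficients of translates of one unit vector are within \<open>2*ep\<close> of 1. The multiplier
  estimate does not deteriorate with the number of pieces, since the Gram sums stay below the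
  squared norms of \<open>p\<close> and \<open>q\<close>.\<close>

lemma multiplier_bound_cb:
 assumes ph: "ph : McbA" and C: "cb_bound (fourier_mult ph) C" and p: "p : Cc_L2" and q: "q : Cc_L2"
 shows "cmod (LI r. slice p q r*ph r) <= C*norm p*norm q"
proof -
 obtain P Q where P: "P : Cc" "p = abs_L2 P" and Q: "Q : Cc" "q = abs_L2 Q" using p q by (auto simp: Cc_L2_def)
 obtain K where K: "cont P" "compact K" "!!x. x ~: K ==> P x = 0" using P(1) by (rule CcE) blast
 obtain L where L: "cont Q" "compact L" "!!x. x ~: L ==> Q x = 0" using Q(1) by (rule CcE) blast
 have phL: "ph : Linf" using ph by (simp add: McbA_def)
 obtain B where "0 <= B & loc_AE (%t. cmod (ph t) <= B)" using Linf_bound[OF phL] by (elim exE)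
 then have B: "0 <= B" "loc_AE (%t. cmod (ph t) <= B)" by simp_all
 have phm: "ph : borel_measurable borel" using phL by (simp add: Linf_def)
 obtain zt :: "'g L2" where zt: "norm zt = 1" using unit_vector_exists by (elim exE)
 have C0: "0 <= C" using C by (simp add: cb_bound_def)
 \<comment> \<open>Up to the factor \<open>2*ep*hbound\<close> this dominates the pointwise error of
   the partition. It is integrable and chosen before \<open>ep\<close>, so the total error tends to
   0.\<close>
 define E where "E r = sqrt (modular (- r))*(LI s. cmod (P (- r + s))*cmod (Q s))" for r
 have E: "integrable haar E"
 proof -
  note PQ = fourier_coeff_Cc[OF Cc_cmod[OF P(1)] Cc_cmod[OF Q(1)]]
  have "cor (E r) = cor (sqrt (modular (- r)))
    * fourier_coeff (abs_L2 (%x. cor (cmod (P x)))) (abs_L2 (%x. cor (cmod (Q x)))) r" for r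
  proof -
   have i: "(LI s. cor (cmod (P (- r + s)))*cnj (cor (cmod (Q s))))
     = cor (LI s. cmod (P (- r + s))*cmod (Q s))"
    by (simp only: complex_cnj_complex_of_real of_real_mult[symmetric] integral_complex_of_real)
   show ?thesis unfolding E_def PQ(2) i of_real_mult ..
  qed
  then have "(%r. cor (E r)) : Cc"
   by (simp only:) (intro Cc_mult_left PQ(1) continuous_intros cont_comp[OF modular_continuous])
  from Cc_integrable[OF this] show ?thesis unfolding complex_of_real_integrable_eq .
 qed
 define M where "M = B*(2*hbound*(LI r. E r))"
 have M: "0 <= M" unfolding M_def E_def using B(1) hbound_nonneg
  by (intro mult_nonneg_nonneg integral_nonneg_AE AE_I2) simp_all
 have step: "cmod (LI r. slice p q r*ph r) <= C*norm p*norm q + ep*M" if ep: "0 < ep" for ep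
 proof -
  \<comment> \<open>A neighbourhood on which \<open>left_reg\<close> moves \<open>zt\<close> by less
    than \<open>ep\<close>; partition functions living on its translates make
    \<open>coeff_close\<close> applicable.\<close>
  define W where "W = {w. norm (left_reg w zt - zt) < ep}"
  have W: "open W" "0 : W" unfolding W_def
   using ep by (auto intro!: open_Collect_less continuous_intros left_reg_continuous)
  obtain F :: "'g set" and ka :: "'g => 'g => real" where F: "finite F" and ka0: "ALL t. cont (ka t) & (ALL x. 0 <= ka t x & (ka t x ~= 0 --> - t + x : W))"
   and ka1: "ALL x:K \<union> L. (\<Sum>t\<in>F. ka t x) = 1"
   using translation_partition[OF compact_Un[OF K(2) L(2)] W] by (elim exE conjE)
  have ka: "cont (ka t)" "0 <= ka t x" "ka t x ~= 0 ==> - t + x : W" for t x using ka0 by simp_all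
  have sum1: "(\<Sum>t\<in>F. ka t x) = 1" if "P x ~= 0 \<or> Q x ~= 0" for x
  proof -
   have "x : K \<union> L" using that K(3)[of x] L(3)[of x] by auto
   then show ?thesis using ka1 by blast
  qed
  have sumP: "P x ~= 0 ==> (\<Sum>t\<in>F. ka t x) = 1" and sumQ: "Q x ~= 0 ==> (\<Sum>t\<in>F. ka t x) = 1" for x by (simp_all add: sum1)
  define pt where "pt t = abs_L2 (%x. cor (ka t x)*P x)" for t
  define qt where "qt t = abs_L2 (%x. cor (ka t x)*Q x)" for t
  define xi where "xi t = left_reg t zt" for t
  have xi1: "norm (xi t) = 1" for t by (simp add: xi_def zt)
  have pt: "pt t : Cc_L2" and qt: "qt t : Cc_L2" for t
   unfolding pt_def qt_def Cc_L2_def by (intro imageI Cc_mult_left P Q continuous_intros ka)+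
  define v where "v k l r = fourier_coeff (xi l) (xi k) r" for k l r
  define D where "D r = slice p q r - (\<Sum>k\<in>F. \<Sum>l\<in>F. slice (pt l) (qt k) r * v k l r)" for r
  have close: "cmod (1 - v k l r) <= 2*ep" if "ka l (- r + s) ~= 0" "ka k s ~= 0" for k l s r
   unfolding v_def xi_def
   by (rule coeff_close[OF zt, where s=s]; rule less_imp_le) (use ka(3)[OF that(1)] ka(3)[OF that(2)] in \<open>simp_all add: W_def\<close>)
  have D: "cmod (D r) <= 2*ep*hbound*E r" for r
  proof -
   have "cmod (D r) <= 2*ep*hbound * sqrt (modular (- r))*(LI s. cmod (P (- r + s))*cmod (Q s))"
    unfolding D_def pt_def qt_def P(2) Q(2)
    by (rule slice_partition_error[OF P(1) Q(1) ka(1,2) F sumP sumQ close]) (use ep in auto)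
   then show ?thesis by (simp add: E_def mult.assoc)
  qed
  have s1: "(%r. slice (pt l) (qt k) r * v k l r) : Cc" for k l
   unfolding v_def by (intro Cc_mult_right slice_Cc pt qt fourier_coeff_continuous)
  have DC: "D : Cc" unfolding D_def[abs_def] by (intro Cc_diff Cc_sum s1 slice_Cc p q)
  have "(LI r. slice p q r*ph r) = (LI r. D r*ph r + (\<Sum>k\<in>F. \<Sum>l\<in>F. slice (pt l) (qt k) r * v k l r*ph r))"
   by (rule Bi_cong[OF refl]) (simp add: D_def left_diff_distrib sum_distrib_right)
  also have "\<dots> = (LI r. D r*ph r) + (LI r. (\<Sum>k\<in>F. \<Sum>l\<in>F. slice (pt l) (qt k) r * v k l r*ph r))"
   by (intro Bi_add BI_sum Linf_Cc_integrable phL DC s1)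
  also have "(LI r. (\<Sum>k\<in>F. \<Sum>l\<in>F. slice (pt l) (qt k) r * v k l r*ph r)) = (\<Sum>k\<in>F. \<Sum>l\<in>F. wint ph (pt l) (qt k) (xi l) (xi k))"
   unfolding wint_def v_def[symmetric] by (rule integral_sum2) (intro Linf_Cc_integrable phL s1)
  finally have eq: "(LI r. slice p q r*ph r) = (LI r. D r*ph r) + (\<Sum>k\<in>F. \<Sum>l\<in>F. wint ph (pt l) (qt k) (xi l) (xi k))" .
  have "cmod (LI r. D r*ph r) <= B*(LI r. cmod (D r))"
   by (rule Linf_mult_L1(2)[OF Cc_integrable[OF DC] phm B(2)])
  also have "\<dots> <= B*(LI r. 2*ep*hbound*E r)"
   by (intro mult_left_mono integral_mono integrable_norm Cc_integrable DC integrable_mult_right E D B)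
  also have "\<dots> = ep*M" by (simp add: M_def)
  finally have 1: "cmod (LI r. D r*ph r) <= ep*M" .
  have gp: "sqrt (Re (\<Sum>l\<in>F. \<Sum>l'\<in>F. cinner (pt l) (pt l')*cinner (xi l) (xi l'))) <= norm p"
   unfolding pt_def P(2) by (rule real_le_lsqrt[OF norm_ge_zero], rule partition_gram[OF F P(1) ka(1,2) sumP xi1])
  have gq: "sqrt (Re (\<Sum>l\<in>F. \<Sum>l'\<in>F. cinner (qt l) (qt l')*cinner (xi l) (xi l'))) <= norm q"
   unfolding qt_def Q(2) by (rule real_le_lsqrt[OF norm_ge_zero], rule partition_gram[OF F Q(1) ka(1,2) sumQ xi1])
  have gq0: "0 <= sqrt (Re (\<Sum>l\<in>F. \<Sum>l'\<in>F. cinner (qt l) (qt l')*cinner (xi l) (xi l')))"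
   unfolding real_sqrt_ge_0_iff by (rule gram_nonneg[OF F])
  have "cmod (\<Sum>k\<in>F. \<Sum>l\<in>F. wint ph (pt l) (qt k) (xi l) (xi k)) <= C*norm p*norm q"
   by (rule order_trans[OF multiplier_gram[OF ph C F pt qt]], intro mult_mono mult_left_mono gp gq C0 gq0 mult_nonneg_nonneg norm_ge_zero)
  then show ?thesis unfolding eq using 1 norm_triangle_ineq[of "LI r. D r*ph r" "\<Sum>k\<in>F. \<Sum>l\<in>F. wint ph (pt l) (qt k) (xi l) (xi k)"]
   by linarith
 qed
 show ?thesis
 proof (rule field_le_epsilon)
  fix e :: real assume e: "0 < e"
  have "e / (M + 1)*M <= e" using e M by (simp add: field_simps)
  then show "cmod (LI r. slice p q r*ph r) <= C*norm p*norm q + e"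
   using step[of "e / (M + 1)"] e M by (auto intro: order_trans)
 qed
qed

text \<open>The norm is an infimum whose attainment is not established, so an estimate valid for all
  admissible bounds has to be passed through it by division; this singles out
  \<open>k = 0\<close>.\<close>

lemma McbA_norm_mult_ge:
 assumes ph: "ph : McbA" and k: "0 <= k" and le: "!!C. cb_bound (fourier_mult ph) C ==> x <= C*k"
 shows "x <= McbA_norm ph*k" "0 <= McbA_norm ph"
proof -
 have ne: "{C. cb_bound (fourier_mult ph) C} ~= {}" using ph by (auto simp: McbA_def)
 show "0 <= McbA_norm ph" unfolding McbA_norm_def
  by (rule cInf_greatest[OF ne]) (simp add: cb_bound_def)
 show "x <= McbA_norm ph*k"
 proof (cases "k = 0")
  case True
  then show ?thesis using ne le by auto
 next
  case False
  then have k: "0 < k" using k by simp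
  have "x / k <= McbA_norm ph" unfolding McbA_norm_def
   by (rule cInf_greatest[OF ne]) (use le k in \<open>simp add: pos_divide_le_eq\<close>)
  then show ?thesis using k by (simp add: pos_divide_le_eq)
 qed
qed

lemma multiplier_bound:
 assumes ph: "ph : McbA" and p: "p : Cc_L2" and q: "q : Cc_L2"
 shows "cmod (LI r. slice p q r*ph r) <= McbA_norm ph*norm p*norm q"
 using McbA_norm_mult_ge(1)[OF ph, of "norm p*norm q"] multiplier_bound_cb[OF ph _ p q] by (simp add: mult.assoc)

section \<open>Weighted slices as operators\<close>

lemma slice_form_operator:
 assumes i: "!!p q. p : Cc_L2 ==> q : Cc_L2 ==> integrable haar (%r. slice p q r*ph r)"
  and b: "!!p q. p : Cc_L2 ==> q : Cc_L2 ==> cmod (LI r. slice p q r*ph r) <= C*norm p*norm q"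
  and C: "0 <= C"
 shows "EX R:bounded_ops. norm R <= C & (ALL p:Cc_L2. ALL q:Cc_L2. cinner (app R p) q = (LI r. slice p q r*ph r))"
 by (rule form_operator[OF Cc_L2_subspace Cc_L2_dense _ _ _ _ b C])
  (simp_all add: slice_add slice_scale i distrib_right mult.assoc)

text \<open>The weak integral of \<open>ph r\<close> times
  \<open>\<Delta>(r)^(-1/2) M_(h_r) \<lambda>(r)\<close>. Choosing it for any weight lets
  cb-multipliers, bounded through \<open>McbA_norm\<close>, and coefficients, bounded through the
  norms of their vectors, refer to one and the same operator.\<close>

definition mult_slice :: "('g => complex) => 'g L2 \<Rightarrow>\<^sub>L 'g L2" where
 "mult_slice ph = (SOME R. R : bounded_ops & (ALL p:Cc_L2. ALL q:Cc_L2. cinner (app R p) q = (LI r. slice p q r*ph r)))"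

lemma mult_slice_eqI:
 assumes "R : bounded_ops" "!!p q. p : Cc_L2 ==> q : Cc_L2 ==> cinner (R p) q = (LI r. slice p q r*ph r)"
 shows "mult_slice ph = R"
proof -
 have "mult_slice ph : bounded_ops & (ALL p:Cc_L2. ALL q:Cc_L2. cinner (app (mult_slice ph) p) q = (LI r. slice p q r*ph r))"
  unfolding mult_slice_def by (rule someI[of _ R]) (use assms in blast)
 then show ?thesis by (intro op_eqI_dense[OF Cc_L2_dense]) (simp add: assms)
qed

lemma mult_slice:
 assumes ph: "ph : McbA"
 shows "mult_slice ph : bounded_ops" "norm (mult_slice ph) <= McbA_norm ph"
  "p : Cc_L2 ==> q : Cc_L2 ==> cinner (mult_slice ph p) q = (LI r. slice p q r*ph r)"
proof -
 have phL: "ph : Linf" using ph by (simp add: McbA_def)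
 have "0 <= McbA_norm ph" by (rule McbA_norm_mult_ge(2)[OF ph, of 0 0]) simp_all
 then have "EX R:bounded_ops. norm R <= McbA_norm ph & (ALL p:Cc_L2. ALL q:Cc_L2. cinner (app R p) q = (LI r. slice p q r*ph r))"
  by (intro slice_form_operator Linf_Cc_integrable phL slice_Cc multiplier_bound[OF ph])
 then obtain R where R: "R : bounded_ops" "norm R <= McbA_norm ph"
  "ALL p:Cc_L2. ALL q:Cc_L2. cinner (app R p) q = (LI r. slice p q r*ph r)"
  by (elim bexE conjE)
 then have "mult_slice ph = R" by (intro mult_slice_eqI) simp_all
 then show "mult_slice ph : bounded_ops" "norm (mult_slice ph) <= McbA_norm ph"
  "p : Cc_L2 ==> q : Cc_L2 ==> cinner (mult_slice ph p) q = (LI r. slice p q r*ph r)"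
  using R by simp_all
qed

lemma mult_slice_one: "mult_slice (%_. 1) = S"
 by (rule mult_slice_eqI[OF S_bounded]) (simp add: slice_integral)

text \<open>A finite-rank approximation of \<open>om\<close>, uniform in the operator, replaces the
  functional by integration against a finite sum of slices, an \<open>L\<^sup>1\<close> function.
  The error is \<open>ep\<close> times the norm of the operator, hence at most \<open>ep\<close>
  times the cb-norm of the weight.\<close>

lemma mult_slice_Qcb:
 assumes om: "om : trace_class"
 shows "(%ph. trace_pairing (mult_slice ph) om) : Qcb"
 unfolding Qcb_def
proof (rule CollectI, intro allI impI)
 fix ep :: real assume ep: "0 < ep"
 obtain F :: "'g L2 set" and x y where F: "finite F" and xy: "ALL i:F. x i : Cc_L2 & y i : Cc_L2"
  and app: "ALL R:bounded_ops. cmod (trace_pairing R om - (\<Sum>i\<in>F. cinner (app R (x i)) (y i))) <= ep*norm R"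
  using trace_class_finite_approx[OF om Cc_L2_dense ep] by (elim exE conjE)
 define f where "f r = (\<Sum>i\<in>F. slice (x i) (y i) r)" for r
 show "EX f:L1. ALL ph:McbA. cmod (trace_pairing (mult_slice ph) om - (LI t. f t*ph t)) <= ep*McbA_norm ph"
 proof (intro bexI[of _ f] ballI)
  show "f : L1" unfolding L1_def f_def using xy by (intro CollectI Cc_integrable Cc_sum slice_Cc) auto
  fix ph :: "'g => complex" assume ph: "ph : McbA"
  have phL: "ph : Linf" using ph by (simp add: McbA_def)
  have "(LI t. f t*ph t) = (\<Sum>i\<in>F. LI t. slice (x i) (y i) t*ph t)"
   unfolding f_def sum_distrib_right
   by (rule Bi_sum) (use xy in \<open>auto intro!: Linf_Cc_integrable phL slice_Cc\<close>)
  also have "\<dots> = (\<Sum>i\<in>F. cinner (mult_slice ph (x i)) (y i))"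
   using xy by (intro sum.cong refl mult_slice(3)[OF ph, symmetric]) auto
  finally have "cmod (trace_pairing (mult_slice ph) om - (LI t. f t*ph t)) <= ep*norm (mult_slice ph)"
   using bspec[OF app mult_slice(1)[OF ph]] by (simp only:)
  also have "\<dots> <= ep*McbA_norm ph" using mult_slice(2)[OF ph] ep by (intro mult_left_mono) auto
  finally show "cmod (trace_pairing (mult_slice ph) om - (LI t. f t*ph t)) <= ep*McbA_norm ph" .
 qed
qed

subsection \<open>Functionals vanishing on the bimodule\<close>

lemma coeff_slice:
 "mult_slice (fourier_coeff xi eta) : bounded_ops" "norm (mult_slice (fourier_coeff xi eta)) <= norm xi*norm eta"
 "p : Cc_L2 ==> q : Cc_L2 ==> cinner (mult_slice (fourier_coeff xi eta) p) q = (LI r. slice p q r*fourier_coeff xi eta r)"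
proof -
 obtain R where R: "R : bounded_ops" "norm R <= norm xi*norm eta"
  "ALL p:Cc_L2. ALL q:Cc_L2. cinner (app R p) q = (LI r. slice p q r*fourier_coeff xi eta r)"
  using slice_form_operator[of "fourier_coeff xi eta" "norm xi*norm eta"] slice_coeff_bound[of _ _ xi eta]
   Cc_integrable[OF Cc_mult_right[OF slice_Cc fourier_coeff_continuous]] by (auto simp: mult_ac)
 then have "mult_slice (fourier_coeff xi eta) = R" by (intro mult_slice_eqI) simp_all
 then show "mult_slice (fourier_coeff xi eta) : bounded_ops" "norm (mult_slice (fourier_coeff xi eta)) <= norm xi*norm eta"
  "p : Cc_L2 ==> q : Cc_L2 ==> cinner (mult_slice (fourier_coeff xi eta) p) q = (LI r. slice p q r*fourier_coeff xi eta r)"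
  using R by simp_all
qed

text \<open>A compactly supported weight makes the operator integral converge, and each integrand
  pairs to 0 with \<open>om\<close>. To move the pairing inside, \<open>om\<close> is approximated
  by finitely many vectors; the resulting errors are small outside the integral by the bound on the
  operator and inside it by the integrable function \<open>g\<close>.\<close>

lemma coeff_slice_Cc_zero:
 assumes om: "om : trace_class" and 0: "!!r. trace_pairing (mult_op (h r) o\<^sub>L left_reg r) om = 0"
  and v: "fourier_coeff xi eta : Cc"
 shows "trace_pairing (mult_slice (fourier_coeff xi eta)) om = 0"
proof -
 let ?v = "fourier_coeff xi eta"
 define g where "g r = sqrt (modular (- r))*cmod (?v r)" for r
 have g0: "0 <= g r" for r by (simp add: g_def)
 have gi: "integrable haar g"
 proof -
  have "(%r. cor (sqrt (modular (- r)))*?v r) : Cc"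
   by (intro Cc_mult_left v continuous_intros cont_comp[OF modular_continuous])
  from integrable_norm[OF Cc_integrable[OF this]] show ?thesis by (simp add: g_def[abs_def] norm_mult)
 qed
 define N where "N = hbound*(LI r. g r) + norm xi*norm eta"
 have N: "0 <= N" unfolding N_def by (intro add_nonneg_nonneg mult_nonneg_nonneg hbound_nonneg integral_nonneg_AE) (simp_all add: g0)
 have step: "cmod (trace_pairing (mult_slice ?v) om) <= ep*N" if ep: "0 < ep" for ep
 proof -
  obtain F :: "'g L2 set" and x y where F: "finite F" and xy: "ALL i:F. x i : Cc_L2 & y i : Cc_L2"
   and app: "ALL R:bounded_ops. cmod (trace_pairing R om - (\<Sum>i\<in>F. cinner (app R (x i)) (y i))) <= ep*norm R"
   using trace_class_finite_approx[OF om Cc_L2_dense ep] by (elim exE conjE)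
  define A where "A r = (\<Sum>i\<in>F. slice (x i) (y i) r)*?v r" for r
  have AC: "A : Cc" unfolding A_def[abs_def] using xy by (intro Cc_mult_right Cc_sum slice_Cc fourier_coeff_continuous) auto
  have A: "cmod (A r) <= ep*hbound*g r" for r
  proof -
   let ?R = "mult_op (h r) o\<^sub>L left_reg r"
   have R: "?R : bounded_ops" by (intro bounded_ops_compose mult_op_bounded_ops h_Linf left_reg_bounded)
   have "norm ?R <= hbound"
   proof (rule norm_blinfun_bound[OF hbound_nonneg])
    fix xi
    have "norm (mult_op (h r) (left_reg r xi)) <= norm (mult_op (h r))*norm (left_reg r xi)" by (rule norm_blinfun)
    also have "\<dots> <= hbound*norm xi" unfolding left_reg_norm
     by (intro mult_right_mono mult_op_Linf(2)[OF h_Linf(1,2)] hbound_nonneg norm_ge_zero)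
    finally show "norm (app ?R xi) <= hbound*norm xi" by simp
   qed
   then have "ep*norm ?R <= ep*hbound" using ep by simp
   then have "cmod (\<Sum>i\<in>F. cinner (app ?R (x i)) (y i)) <= ep*hbound"
    using bspec[OF app R] by (simp add: 0)
   then have "cmod (\<Sum>i\<in>F. cinner (app ?R (x i)) (y i))*g r <= ep*hbound*g r"
    by (rule mult_right_mono[OF _ g0])
   moreover have "A r = (\<Sum>i\<in>F. cinner (app ?R (x i)) (y i))*(cor (sqrt (modular (- r)))*?v r)"
    by (simp add: A_def slice_def sum_distrib_left[symmetric] mult_ac)
   ultimately show ?thesis by (simp add: norm_mult g_def)
  qed
  have i: "integrable haar (%r. slice (x i) (y i) r*?v r)" if "i : F" for i
   using xy that by (intro Cc_integrable Cc_mult_right slice_Cc fourier_coeff_continuous) auto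
  have "(\<Sum>i\<in>F. cinner (mult_slice ?v (x i)) (y i)) = (\<Sum>i\<in>F. LI r. slice (x i) (y i) r*?v r)"
   using xy by (intro sum.cong refl coeff_slice(3)) auto
  also have "\<dots> = (LI r. A r)" unfolding A_def sum_distrib_right
   by (rule Bi_sum[symmetric]) (rule i)
  finally have s: "(\<Sum>i\<in>F. cinner (mult_slice ?v (x i)) (y i)) = (LI r. A r)" .
  have "cmod (LI r. A r) <= (LI r. cmod (A r))" by (rule integral_norm_bound)
  also have "\<dots> <= (LI r. ep*hbound*g r)"
   by (intro integral_mono integrable_norm Cc_integrable AC integrable_mult_right gi A)
  also have "\<dots> = ep*hbound*(LI r. g r)" by simp
  finally have 1: "cmod (LI r. A r) <= ep*hbound*(LI r. g r)" .
  have "cmod (trace_pairing (mult_slice ?v) om - (LI r. A r)) <= ep*norm (mult_slice ?v)"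
   using bspec[OF app coeff_slice(1)[of xi eta]] unfolding s .
  also have "\<dots> <= ep*(norm xi*norm eta)" using ep by (intro mult_left_mono coeff_slice) simp
  finally have 2: "cmod (trace_pairing (mult_slice ?v) om - (LI r. A r)) <= ep*(norm xi*norm eta)" .
  show ?thesis using norm_triangle_ineq[of "trace_pairing (mult_slice ?v) om - (LI r. A r)" "LI r. A r"] 1 2
   by (simp add: N_def distrib_left mult.assoc)
 qed
 have "cmod (trace_pairing (mult_slice ?v) om) <= 0"
 proof (rule field_le_epsilon)
  fix e :: real assume e: "0 < e"
  have "e / (N + 1)*N <= e" using e N by (simp add: field_simps)
  then show "cmod (trace_pairing (mult_slice ?v) om) <= 0 + e" using step[of "e / (N + 1)"] e N by (auto intro: order_trans)
 qed
 then show ?thesis by simp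
qed

text \<open>Vectors in \<open>Cc_L2\<close> are dense and have compactly supported coefficients. The
  bound of \<open>mult_slice\<close> by the norms of the two vectors does not involve supports, so
  the vanishing passes to the limit.\<close>

lemma coeff_slice_zero:
 assumes om: "om : trace_class" and 0: "!!r. trace_pairing (mult_op (h r) o\<^sub>L left_reg r) om = 0"
 shows "trace_pairing (mult_slice (fourier_coeff xi eta)) om = 0"
proof -
 have seq: "EX z. (ALL m. z m : Cc_L2) & z \<longlonglongrightarrow> y" for y :: "'g L2"
  using Cc_L2_dense closure_sequential[of y "Cc_L2 :: 'g L2 set"] by auto
 obtain x where x: "ALL m. x m : Cc_L2" "x \<longlonglongrightarrow> xi" using seq[of xi] by (elim exE conjE)
 obtain y where y: "ALL m. y m : Cc_L2" "y \<longlonglongrightarrow> eta" using seq[of eta] by (elim exE conjE)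
 have le: "cmod (trace_pairing (mult_slice (fourier_coeff xi eta)) om)
   <= (norm (xi - x m)*norm eta + norm (x m)*norm (eta - y m))*trace_norm om" for m
 proof -
  let ?c = "%xi eta. mult_slice (fourier_coeff xi eta)"
  let ?R = "?c (xi - x m) eta + ?c (x m) (eta - y m)"
  obtain X where X: "X : Cc" "x m = abs_L2 X" using spec[OF x(1), of m] by (auto simp: Cc_L2_def)
  obtain Y where Y: "Y : Cc" "y m = abs_L2 Y" using spec[OF y(1), of m] by (auto simp: Cc_L2_def)
  have z: "trace_pairing (?c (x m) (y m)) om = 0"
   by (rule coeff_slice_Cc_zero[OF om 0]) (simp add: X Y fourier_coeff_Cc)
  have eq: "?c xi eta = ?R + ?c (x m) (y m)"
  proof (rule mult_slice_eqI)
   show "?R + ?c (x m) (y m) : bounded_ops" by (intro bounded_ops_add coeff_slice)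
   fix p q :: "'g L2" assume pq: "p : Cc_L2" "q : Cc_L2"
   have i: "integrable haar (%r. slice p q r*fourier_coeff xi eta r)" for xi eta
    by (intro Cc_integrable Cc_mult_right slice_Cc pq fourier_coeff_continuous)
   have f: "slice p q r*fourier_coeff xi eta r = slice p q r*fourier_coeff (xi - x m) eta r
    + slice p q r*fourier_coeff (x m) (eta - y m) r + slice p q r*fourier_coeff (x m) (y m) r" for r
    by (simp add: fourier_coeff_def blinfun.diff_right cinner_diff_left cinner_diff_right algebra_simps)
   show "cinner (app (?R + ?c (x m) (y m)) p) q = (LI r. slice p q r*fourier_coeff xi eta r)"
    unfolding f by (simp add: blinfun.add_left cinner_add_left coeff_slice(3)[OF pq] i)
  qed
  have "norm ?R <= norm (?c (xi - x m) eta) + norm (?c (x m) (eta - y m))" by (rule norm_triangle_ineq)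
  also have "\<dots> <= norm (xi - x m)*norm eta + norm (x m)*norm (eta - y m)" by (intro add_mono coeff_slice(2))
  finally have nR: "norm ?R <= norm (xi - x m)*norm eta + norm (x m)*norm (eta - y m)" .
  have Rb: "?R : bounded_ops" by (intro bounded_ops_add coeff_slice)
  have "trace_pairing (?c xi eta) om = trace_pairing ?R om"
   unfolding eq by (simp add: trace_pairing_add_left[OF om Rb coeff_slice(1)] z)
  moreover have tn0: "0 <= trace_norm om" using om by (intro trace_norm_nonneg) (simp add: trace_class_def)
  ultimately have "cmod (trace_pairing (?c xi eta) om) <= norm ?R*trace_norm om"
   using trace_pairing_le[OF om Rb] by (simp only:)
  also have "\<dots> <= (norm (xi - x m)*norm eta + norm (x m)*norm (eta - y m))*trace_norm om"
   by (rule mult_right_mono[OF nR tn0])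
  finally show ?thesis .
 qed
 have "(%m. (norm (xi - x m)*norm eta + norm (x m)*norm (eta - y m))*trace_norm om)
   \<longlonglongrightarrow> (norm (xi - xi)*norm eta + norm xi*norm (eta - eta))*trace_norm om"
  by (intro tendsto_intros x y)
 then have "cmod (trace_pairing (mult_slice (fourier_coeff xi eta)) om) <= (norm (xi - xi)*norm eta + norm xi*norm (eta - eta))*trace_norm om"
  by (rule LIMSEQ_le_const) (use le in blast)
 then show ?thesis by simp
qed

lemma S_pairing_zero:
 assumes AP: "approximation_property TYPE('g)" and om: "om : trace_class"
  and 0: "!!r. trace_pairing (mult_op (h r) o\<^sub>L left_reg r) om = 0"
 shows "trace_pairing S om = 0"
proof (rule ccontr)
 assume nz: "trace_pairing S om ~= 0"
 define q where "q ph = trace_pairing (mult_slice ph) om" for ph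
 have q: "q : Qcb" unfolding q_def[abs_def] by (rule mult_slice_Qcb[OF om])
 obtain F :: "('g => complex) filter" where F: "F ~= bot" "\<forall>\<^sub>F v in F. v : fourier_algebra"
  "limitin weak_star_McbA (%v. v) (%_. 1) F"
  using AP unfolding approximation_property_def by (elim exE conjE)
 let ?P = "product_topology (%_. euclidean :: complex topology) (Qcb :: (('g => complex) => complex) set)"
 let ?e = "%ph :: 'g => complex. \<lambda>q\<in>Qcb. q ph"
 \<comment> \<open>The weak-star open set of multipliers where the functional \<open>q\<close> is
   nonzero contains 1, because weight 1 gives \<open>S\<close>. The filter then has an element of
   A(G) in this set, whereas \<open>q\<close> vanishes on A(G).\<close>
 define U where "U = {g : topspace ?P. g q : - {0}}"
 have "openin ?P U" unfolding U_def
  by (rule openin_continuous_map_preimage[OF continuous_map_product_projection[OF q]]) auto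
 then have op: "openin weak_star_McbA (?e -` U \<inter> McbA)"
  unfolding weak_star_McbA_def openin_pullback_topology by blast
 \<comment> \<open>That 1 is a cb-multiplier is contained in the assumed convergence, since a limit
   lies in the space.\<close>
 have "(%_. 1) : topspace (weak_star_McbA :: ('g => complex) topology)" using F(3) by (simp add: limitin_def)
 then have "(%_. 1) : (McbA :: ('g => complex) set)" unfolding weak_star_McbA_def topspace_pullback_topology by blast
 moreover have "q (%_. 1) ~= 0" using nz by (simp add: q_def mult_slice_one)
 ultimately have "(%_. 1) : ?e -` U \<inter> McbA" using q by (simp add: U_def PiE_UNIV_domain restrict_PiE_iff)
 then have "\<forall>\<^sub>F v in F. v : ?e -` U \<inter> McbA" using F(3) op unfolding limitin_def by blast
 from eventually_happens[OF eventually_conj[OF this F(2)]] F(1)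
 obtain v where v: "v : ?e -` U" "v : fourier_algebra" by auto
 have "q v ~= 0" using v(1) q by (simp add: U_def)
 moreover have "q v = 0" using v(2) coeff_slice_zero[OF om 0] by (auto simp: fourier_algebra_def q_def)
 ultimately show False by simp
qed

end

section \<open>Recovering an operator from its slices\<close>

lemma lam_approx:
 fixes k :: "'g::locally_compact_group => real"
 assumes k: "(%x. cor (k x)) : Cc" "!!x. 0 <= k x" "(LI t. k t) = 1"
  and U: "!!x. x ~: U ==> k x = 0" "!!r. r : U ==> norm (left_reg r xi - xi) <= dl" and dl: "0 <= dl"
 shows "norm (lam (%x. cor (k x)) xi - xi) <= dl"
proof (rule norm_eqI_cinner[OF dl])
 fix y :: "'g L2"
 let ?k = "%x. cor (k x)"
 have i: "integrable haar (%r. ?k r*fourier_coeff xi y r)"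
  by (intro Cc_integrable Cc_mult_right k fourier_coeff_continuous)
 have ki: "integrable haar ?k" by (rule Cc_integrable[OF k(1)])
 have kr: "integrable haar k" using ki unfolding complex_of_real_integrable_eq .
 have "cinner xi y = (LI r. ?k r*cinner xi y)" using k(3) by simp
 then have "cinner (lam ?k xi - xi) y = (LI r. ?k r*fourier_coeff xi y r) - (LI r. ?k r*cinner xi y)"
  unfolding cinner_diff_left lam(3)[OF ki] by (simp only:)
 also have "\<dots> = (LI r. ?k r*fourier_coeff xi y r - ?k r*cinner xi y)"
  by (intro Bi_diff[symmetric] i integrable_mult_left ki)
 also have "\<dots> = (LI r. ?k r*cinner (left_reg r xi - xi) y)"
  by (rule Bi_cong[OF refl]) (simp add: fourier_coeff_def cinner_diff_left right_diff_distrib)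
 also have "cmod \<dots> <= (LI r. cmod (?k r*cinner (left_reg r xi - xi) y))" by (rule integral_norm_bound)
 also have "\<dots> <= (LI r. k r*(dl*norm y))"
 proof (rule integral_mono)
  show "integrable haar (%r. cmod (?k r*cinner (left_reg r xi - xi) y))"
   by (intro integrable_norm Cc_integrable Cc_mult_right k continuous_on_cinner continuous_intros left_reg_continuous)
  show "integrable haar (%r. k r*(dl*norm y))" using kr by simp
  show "cmod (?k r*cinner (left_reg r xi - xi) y) <= k r*(dl*norm y)" for r
  proof (cases "r : U")
   case True
   have "cmod (cinner (left_reg r xi - xi) y) <= norm (left_reg r xi - xi)*norm y" by (rule cinner_norm_le)
   also have "\<dots> <= dl*norm y" by (rule mult_right_mono[OF U(2)[OF True] norm_ge_zero])
   finally show ?thesis using k(2)[of r] by (simp add: norm_mult mult_left_mono)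
  qed (simp add: U)
 qed
 also have "\<dots> = dl*norm y" using k(3) by simp
 finally show "cmod (cinner (lam ?k xi - xi) y) <= dl*norm y" .
qed

text \<open>One density \<open>k\<close> serves as both \<open>a\<close> and \<open>b\<close>; it is
  concentrated where the left translations nearly fix the finitely many vectors approximating
  \<open>om\<close>. The bound \<open>norm S \<le> 1\<close> holds for every such \<open>k\<close>,
  so the approximation fixed before \<open>k\<close> is chosen remains valid for
  \<open>S\<close>.\<close>

lemma pairing_zero_of_slices:
 fixes T :: "'g::locally_compact_group L2 \<Rightarrow>\<^sub>L 'g L2"
 assumes TT: "T : bounded_ops" "norm T <= 1" and om: "om : trace_class"
  and 0: "!!a b. operator_slices T a b ==> trace_pairing (operator_slices.S T a b) om = 0"
 shows "trace_pairing T om = 0"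
proof -
 have "cmod (trace_pairing T om) <= 0"
 proof (rule field_le_epsilon)
  fix e :: real assume e: "0 < e"
  \<comment> \<open>Three errors occur: replacing \<open>om\<close> by finitely many vectors, once
    for \<open>T\<close> and once for \<open>S\<close>, and replacing \<open>T\<close> by
    \<open>S\<close> between these vectors.\<close>
  define ep where "ep = e / 3"
  have ep: "0 < ep" using e by (simp add: ep_def)
  obtain F :: "'g L2 set" and x y where F: "finite F"
   and app: "ALL R:bounded_ops. cmod (trace_pairing R om - (\<Sum>i\<in>F. cinner (app R (x i)) (y i))) <= ep*norm R"
   using trace_class_finite_approx[OF om Cc_L2_dense ep] by (elim exE conjE)
  define N where "N = (\<Sum>i\<in>F. norm (y i) + norm (x i))"
  have N: "0 <= N" by (simp add: N_def sum_nonneg)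
  define dl where "dl = ep / (N + 1)"
  have dl: "0 < dl" using ep N by (simp add: dl_def)
  define U where "U = (\<Inter>i\<in>F. {r :: 'g. norm (left_reg r (x i) - x i) < dl} \<inter> {r. norm (left_reg r (y i) - y i) < dl})"
  have U: "open U" "0 : U" unfolding U_def
   using dl by (auto intro!: open_INT F open_Int open_Collect_less continuous_intros left_reg_continuous)
  obtain k :: "'g => real" where k: "(%x. cor (k x)) : Cc" "ALL x. 0 <= k x" "ALL x. x ~: U --> k x = 0"
   "(LI t. k t) = 1" using Cc_unit[OF U] by (elim exE conjE)
  let ?k = "%x. cor (k x)"
  have k1: "(LI t. cmod (?k t)) <= 1" using k(2,4) by simp
  interpret operator_slices T ?k ?k by unfold_locales (fact TT k k1)+
  have lx: "norm (lam ?k (x i) - x i) <= dl" and ly: "norm (lam ?k (y i) - y i) <= dl" if "i : F" for i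
   by (rule lam_approx[OF k(1) _ k(4), of U]; use k(2,3) dl that in \<open>auto simp: U_def less_imp_le\<close>)+
  have d: "cmod (cinner (T (x i)) (y i) - cinner (S (x i)) (y i)) <= dl*(norm (y i) + norm (x i))" if i: "i : F" for i
  proof -
   have ln: "norm (lam ?k z) <= norm z" for z
   proof -
    have "norm (lam ?k z) <= norm (lam ?k)*norm z" by (rule norm_blinfun)
    also have "\<dots> <= 1*norm z" by (intro mult_right_mono norm_ge_zero order_trans[OF lam(2) k1] Cc_integrable k)
    finally show ?thesis by simp
   qed
   have Tn: "norm (T z) <= norm z" for z
    using norm_blinfun[of T z] mult_right_mono[OF TT(2) norm_ge_zero[of z]] by simp
   have eq: "cinner (T (x i)) (y i) - cinner (S (x i)) (y i)
    = cinner (T (x i - lam ?k (x i))) (y i) + cinner (T (lam ?k (x i))) (y i - lam ?k (y i))"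
    by (simp add: S_cinner blinfun.diff_right cinner_diff_left cinner_diff_right)
   have "cmod (cinner (T (x i - lam ?k (x i))) (y i)) <= norm (T (x i - lam ?k (x i)))*norm (y i)" by (rule cinner_norm_le)
   also have "\<dots> <= dl*norm (y i)"
    by (rule mult_right_mono[OF order_trans[OF Tn] norm_ge_zero]) (use lx[OF i] in \<open>simp add: norm_minus_commute\<close>)
   finally have 1: "cmod (cinner (T (x i - lam ?k (x i))) (y i)) <= dl*norm (y i)" .
   have "cmod (cinner (T (lam ?k (x i))) (y i - lam ?k (y i))) <= norm (T (lam ?k (x i)))*norm (y i - lam ?k (y i))" by (rule cinner_norm_le)
   also have "\<dots> <= norm (x i)*dl"
    by (rule mult_mono[OF order_trans[OF Tn ln]]) (use ly[OF i] in \<open>simp_all add: norm_minus_commute\<close>)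
   finally have 2: "cmod (cinner (T (lam ?k (x i))) (y i - lam ?k (y i))) <= norm (x i)*dl" .
   have "cmod (cinner (T (x i)) (y i) - cinner (S (x i)) (y i)) <= dl*norm (y i) + norm (x i)*dl"
    unfolding eq by (rule order_trans[OF norm_triangle_ineq add_mono[OF 1 2]])
   then show ?thesis by (simp add: distrib_left mult.commute)
  qed
  have "norm S <= 1"
   by (rule norm_blinfun_bound) (use norm_eqI_cinner[of "norm z" "S z" for z] S_bound in \<open>auto simp: norm_ge_zero\<close>)
  then have "ep*norm S <= ep" "ep*norm T <= ep" using ep TT(2) by simp_all
  then have 1: "cmod (trace_pairing T om - (\<Sum>i\<in>F. cinner (T (x i)) (y i))) <= ep"
   and 2: "cmod (trace_pairing S om - (\<Sum>i\<in>F. cinner (S (x i)) (y i))) <= ep"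
   using bspec[OF app TT(1)] bspec[OF app S_bounded] by linarith+
  have z: "trace_pairing S om = 0" by (rule 0) unfold_locales
  have "cmod ((\<Sum>i\<in>F. cinner (T (x i)) (y i)) - (\<Sum>i\<in>F. cinner (S (x i)) (y i))) <= (\<Sum>i\<in>F. dl*(norm (y i) + norm (x i)))"
   unfolding sum_subtractf[symmetric] by (rule sum_norm_le) (rule d)
  also have "\<dots> = dl*N" by (simp add: N_def sum_distrib_left)
  also have "\<dots> <= ep" using ep N by (simp add: dl_def field_simps)
  finally have 3: "cmod ((\<Sum>i\<in>F. cinner (T (x i)) (y i)) - (\<Sum>i\<in>F. cinner (S (x i)) (y i))) <= ep" .
  have "cmod (trace_pairing T om) <= cmod (trace_pairing T om - (\<Sum>i\<in>F. cinner (T (x i)) (y i)))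
   + (cmod ((\<Sum>i\<in>F. cinner (T (x i)) (y i)) - (\<Sum>i\<in>F. cinner (S (x i)) (y i))) + cmod (\<Sum>i\<in>F. cinner (S (x i)) (y i)))"
   using norm_triangle_ineq[of "trace_pairing T om - (\<Sum>i\<in>F. cinner (T (x i)) (y i))" "\<Sum>i\<in>F. cinner (T (x i)) (y i)"]
    norm_triangle_ineq[of "(\<Sum>i\<in>F. cinner (T (x i)) (y i)) - (\<Sum>i\<in>F. cinner (S (x i)) (y i))" "\<Sum>i\<in>F. cinner (S (x i)) (y i)"]
   by simp
  also have "\<dots> <= ep + (ep + ep)" using 1 2 3 by (intro add_mono) (simp_all add: z)
  finally show "cmod (trace_pairing T om) <= 0 + e" by (simp add: ep_def)
 qed
 then show ?thesis by simp
qed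

lemma theorem5p5_contraction:
 fixes J :: "('g::locally_compact_group => complex) set"
 assumes AP: "approximation_property TYPE('g)" and J: "J \<subseteq> L1"
  and TT: "T : bounded_ops" "norm T <= 1" "!!g. g : J ==> Theta g T = 0"
  and om: "om : trace_class"
  and 0: "!!f x y. f : L1_annihilator J ==> x : VN ==> y : VN ==> trace_pairing (x o\<^sub>L mult_op f o\<^sub>L y) om = 0"
 shows "trace_pairing T om = 0"
proof (rule pairing_zero_of_slices[OF TT(1,2) om])
 fix a b :: "'g => complex" assume "operator_slices T a b"
 then interpret operator_slices T a b .
 show "trace_pairing S om = 0"
 proof (rule S_pairing_zero[OF AP om])
  fix r
  have "h r : L1_annihilator J"
   unfolding L1_annihilator_def
  proof (intro CollectI conjI ballI h_Linf)
   fix f assume f: "f : J"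
   then have "f : L1" using J by blast
   \<comment> \<open>The integral of \<open>f\<close> against \<open>h r\<close> is the coefficient
     of \<open>Theta f T\<close> at the vectors \<open>right_reg r (abs_L2 a)\<close> and
     \<open>abs_L2 b\<close>.\<close>
   from Theta(2)[OF this TT(1), of "right_reg r (abs_L2 a)" "abs_L2 b"] TT(3)[OF f]
   show "(LI t. f t*h r t) = 0" unfolding h_def by simp
  qed
  moreover have "id_blinfun o\<^sub>L mult_op (h r) = mult_op (h r)" by (rule blinfun_eqI) simp
  ultimately show "trace_pairing (mult_op (h r) o\<^sub>L left_reg r) om = 0"
   using 0[OF _ VN_id left_reg_VN[of r], of "h r"] by simp
 qed
qed

theorem theorem5p5:
  fixes J :: "('g::locally_compact_group \<Rightarrow> complex) set"
  assumes "approximation_property TYPE('g)"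
    and "closed_left_ideal J"
  shows "Bim (L1_annihilator J) = op_annihilator (Ran J)"
proof -
 let ?G = "{x o\<^sub>L mult_op f o\<^sub>L y | x f y. f : L1_annihilator J & x : VN & y : VN}"
 have J: "J \<subseteq> L1" using assms(2) by (simp add: closed_left_ideal_def)
 have ann: "op_annihilator (Ran J) = {T:bounded_ops. ALL g:J. Theta g T = 0}" by (rule op_annihilator_Ran[OF J])
 have Ran: "Ran J \<subseteq> trace_class" by (auto simp: Ran_def trace_norm_closure_def)
 have fL: "f : Linf" if "f : L1_annihilator J" for f using that by (simp add: L1_annihilator_def)
 have G: "?G \<subseteq> op_annihilator (Ran J)"
 proof
  fix z assume "z : ?G"
  then obtain x f y where z: "z = x o\<^sub>L mult_op f o\<^sub>L y" "f : L1_annihilator J" "x : VN" "y : VN" by blast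
  have b: "mult_op f : bounded_ops" by (rule mult_op_bounded_ops[OF fL[OF z(2)]])
  have "Theta g z = 0" if "g : J" for g
   using Theta_bimodule[OF _ z(3,4) b, of g] Theta_mult_op[OF assms(2) that z(2)] that J z(1)
   by (auto intro!: blinfun_eqI)
  moreover have "z : bounded_ops" unfolding z(1)
   by (rule bounded_ops_compose[OF bounded_ops_compose[OF VN_bounded[OF z(3)] b] VN_bounded[OF z(4)]])
  ultimately show "z : op_annihilator (Ran J)" unfolding ann by simp
 qed
 have sub: "op_cspan ?G \<subseteq> op_annihilator (Ran J)" by (rule cop.span_minimal[OF G op_annihilator_subspace[OF Ran]])
 have sb: "op_cspan ?G \<subseteq> bounded_ops" using sub ann by auto
 have Bim: "Bim (L1_annihilator J) = {T:bounded_ops. ALL om:trace_class. (ALL s:op_cspan ?G. trace_pairing s om = 0) --> trace_pairing T om = 0}"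
  unfolding Bim_def by (rule weak_star_closure_subspace[OF cop.subspace_span sb])
 show ?thesis
 proof (rule subset_antisym)
  show "Bim (L1_annihilator J) \<subseteq> op_annihilator (Ran J)"
  proof
   fix T assume "T : Bim (L1_annihilator J)"
   then have T: "T : bounded_ops" "ALL om:trace_class. (ALL s:op_cspan ?G. trace_pairing s om = 0) --> trace_pairing T om = 0"
    unfolding Bim by simp_all
   have "trace_pairing T om = 0" if om: "om : Ran J" for om
   proof -
    have "ALL s:op_cspan ?G. trace_pairing s om = 0"
    proof
     fix s assume "s : op_cspan ?G"
     then have "s : op_annihilator (Ran J)" using sub by (rule subsetD[rotated])
     then show "trace_pairing s om = 0" using om by (simp add: op_annihilator_def)
    qed
    moreover have "om : trace_class" using Ran om by (rule subsetD)
    ultimately show ?thesis using T(2) by simp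
   qed
   then show "T : op_annihilator (Ran J)" using T(1) by (simp add: op_annihilator_def)
  qed
  show "op_annihilator (Ran J) \<subseteq> Bim (L1_annihilator J)"
  proof
   fix T assume Tann: "T : op_annihilator (Ran J)"
   then have T: "T : bounded_ops" unfolding ann by simp
   have "trace_pairing T om = 0" if om: "om : trace_class" and s: "ALL s:op_cspan ?G. trace_pairing s om = 0" for om
   proof -
    \<comment> \<open>Slices are set up for contractions, so \<open>T\<close> is rescaled; the
      summand 1 keeps the factor nonzero when \<open>T = 0\<close>.\<close>
    define c where "c = cor (inverse (norm T + 1))"
    define T1 where "T1 = scale_op c T"
    have "0 < norm T + 1" by (rule add_nonneg_pos) simp_all
    then have "inverse (norm T + 1) ~= 0" by simp
    then have c0: "c ~= 0" unfolding c_def of_real_eq_0_iff .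
    have T1b: "T1 : bounded_ops" unfolding T1_def by (rule bounded_ops_scale[OF T])
    have "norm T1 <= 1"
    proof (rule norm_blinfun_bound)
     fix z :: "'g L2"
     have "norm (T1 z) = inverse (norm T + 1)*norm (T z)"
      unfolding T1_def scale_op_apply norm_scaleC c_def norm_of_real by simp
     also have "\<dots> <= inverse (norm T + 1)*(norm T*norm z)" by (intro mult_left_mono norm_blinfun) simp
     also have "\<dots> <= 1*norm z" unfolding mult.assoc[symmetric]
      by (intro mult_right_mono norm_ge_zero) (use \<open>0 < norm T + 1\<close> in \<open>simp add: inverse_eq_divide pos_divide_le_eq\<close>)
     finally show "norm (T1 z) <= 1*norm z" .
    qed simp
    moreover have "T1 : op_annihilator (Ran J)"
     unfolding T1_def using Tann by (rule cop.subspace_scale[OF op_annihilator_subspace[OF Ran]])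
    then have "Theta g T1 = 0" if "g : J" for g using that ann by simp
    ultimately have "trace_pairing T1 om = 0"
    proof (intro theorem5p5_contraction[OF assms(1) J T1b _ _ om])
     fix f :: "'g => complex" and x y :: "'g L2 \<Rightarrow>\<^sub>L 'g L2"
     assume "f : L1_annihilator J" "x : VN" "y : VN"
     then have "x o\<^sub>L mult_op f o\<^sub>L y : ?G" by blast
     then show "trace_pairing (x o\<^sub>L mult_op f o\<^sub>L y) om = 0" by (intro bspec[OF s] cop.span_base)
    qed
    then have "c*trace_pairing T om = 0" unfolding T1_def trace_pairing_scale_left[OF om T] .
    then show ?thesis using c0 by simp
   qed
   then show "T : Bim (L1_annihilator J)" unfolding Bim using T by blast
  qed
 qed
qed

end
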